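(* Fix $A_*>0$. There exists $\delta>0$ such that, for any $(a,b)$ with $\|(a,b)\|_6<\delta$, the operator $\mathrm dS(a,b)$ admits a right inverse $R(a,b)$ (that is, $\mathrm dS(a,b)\circ R(a,b)=\mathrm{Id}$) satisfying the tame estimates: for any $s\ge\tfrac52$, $$\|R(a,b)\gamma\|_s\le C(s)\|\gamma\|_{s+\frac12}+C(s)\,\|(a,b)\|_{s+\frac72}\,\|\gamma\|_3\qquad\forall\gamma\in H^{s+\frac12}_0(\mathbb T),$$ where $C(s)$ are positive constants.
   Context: $\mathbb T:=\mathbb R/2\pi\mathbb Z$. $e_j(x)=e^{ijx}$, $\widehat u(j)=\frac1{2\pi}\int_{\mathbb T}u\,e^{-ijx}\,\mathrm dx$, $\langle y\rangle=\max\{1,|y|\}$, $\|u\|_s^2=\sum_{j\in\mathbb Z}\langle j\rangle^{2s}|\widehat u(j)|^2$; $H^s(\mathbb T)$ is the Sobolev space of real-valued $2\pi$-periodic functions with $\|u\|_s<\infty$, $H^s_0(\mathbb T)$ its subspace of zero-mean functions, and $\|(a,b)\|_s$ denotes the product norm on $H^s(\mathbb T)\times H^s(\mathbb T)$. An estimate is void when its right-hand side is infinite. The constants $C(s)$ do not depend on $(a,b)$ or $\gamma$. For real periodic $(a,b)$ small, set $A(x)=A_*+a(x)$, $B(x)=x+b(x)$, $I_{A,B}(x,\varphi)=A(x)\sin\varphi+B(x)$ (a map $\mathbb T\times\mathbb T\to\mathbb T$), let $x_{A,B}(I,\varphi)$ be defined by $I_{A,B}(x_{A,B}(I,\varphi),\varphi)=I$,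 let $A_0=\frac1{2\pi}\int_{\mathbb T}A\,\mathrm dx$, and define the zero-mean function $$S(a,b)(I)=\int_{\mathbb T}(\cos^2\varphi)\,A(x_{A,B}(I,\varphi))\,\frac{\partial x_{A,B}}{\partial I}(I,\varphi)\,\mathrm d\varphi-\pi A_0 .$$ With $J_1(\theta)=\frac1{2\pi}\int_{\mathbb T}e^{i\theta\sin\varphi}e^{-i\varphi}\,\mathrm d\varphi$ the first Bessel function, the differential of $S$ at $(a,b)$ is $$\mathrm dS(a,b)[\alpha,\beta]=\sum_{k\ne0}\Big(\int_{\mathbb T}\big[J_1'(kA(x))\alpha(x)-iJ_1(kA(x))\beta(x)\big]e^{-ikB(x)}\,\mathrm dx\Big)e_k .$$ *)

theory Defs
  imports "HOL-Analysis.Analysis"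
begin

text \<open>Functions on the circle are represented by their \<open>2 * pi\<close>-periodic lifts to the reals.\<close>

definition fourier_coeff :: "(real \<Rightarrow> real) \<Rightarrow> int \<Rightarrow> complex" where
  "fourier_coeff u j =
     (1 / (2 * of_real pi)) *
     integral {0..2*pi} (\<lambda>x. of_real (u x) * exp (- \<i> * of_int j * of_real x))"

definition jap :: "real \<Rightarrow> real" where
  "jap y = max 1 \<bar>y\<bar>"

definition sobolev_term :: "real \<Rightarrow> (real \<Rightarrow> real) \<Rightarrow> int \<Rightarrow> real" where
  "sobolev_term s u j = jap (of_int j) powr (2 * s) * (cmod (fourier_coeff u j))\<^sup>2"

text \<open>The sum is meaningful only for \<open>u \<in> Hs s\<close>: \<open>infsum\<close> is 0 on non-summable families.\<close>

definition sobolev_norm :: "real \<Rightarrow> (real \<Rightarrow> real) \<Rightarrow> real" where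
  "sobolev_norm s u = sqrt (\<Sum>\<^sub>\<infinity>j\<in>UNIV. sobolev_term s u j)"

definition sobolev_norm2 :: "real \<Rightarrow> (real \<Rightarrow> real) \<times> (real \<Rightarrow> real) \<Rightarrow> real" where
  "sobolev_norm2 s p = sqrt ((sobolev_norm s (fst p))\<^sup>2 + (sobolev_norm s (snd p))\<^sup>2)"

text \<open>For \<open>s > 1/2\<close> every class in the Sobolev space has exactly one continuous
  representative; elements are these representatives, so that equality in the space is
  equality of functions. The definition is meant to be used for \<open>s > 1/2\<close> only.\<close>

definition Hs :: "real \<Rightarrow> (real \<Rightarrow> real) set" where
  "Hs s = {u. continuous_on UNIV u \<and> (\<forall>x. u (x + 2*pi) = u x) \<and>
              sobolev_term s u summable_on UNIV}"

definition Hs0 :: "real \<Rightarrow> (real \<Rightarrow> real) set" where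
  "Hs0 s = {u \<in> Hs s. integral {0..2*pi} u = 0}"

definition I_map :: "real \<Rightarrow> (real \<Rightarrow> real) \<Rightarrow> (real \<Rightarrow> real) \<Rightarrow> real \<Rightarrow> real \<Rightarrow> real" where
  "I_map Astar a b x \<phi> = (Astar + a x) * sin \<phi> + (x + b x)"

text \<open>On lifts, \<open>x \<mapsto> I_map Astar a b x \<phi>\<close> commutes with translation by \<open>2 * pi\<close>, and
  for \<open>a\<close>, \<open>b\<close> small in C1 it is an increasing diffeomorphism of the reals, so the solution
  below exists and is unique.\<close>

definition x_sol :: "real \<Rightarrow> (real \<Rightarrow> real) \<Rightarrow> (real \<Rightarrow> real) \<Rightarrow> real \<Rightarrow> real \<Rightarrow> real" where
  "x_sol Astar a b I \<phi> = (THE x. I_map Astar a b x \<phi> = I)"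

definition S_map :: "real \<Rightarrow> (real \<Rightarrow> real) \<times> (real \<Rightarrow> real) \<Rightarrow> real \<Rightarrow> real" where
  "S_map Astar = (\<lambda>(a, b) I.
     integral {0..2*pi} (\<lambda>\<phi>. (cos \<phi>)\<^sup>2 * (Astar + a (x_sol Astar a b I \<phi>)) *
                             deriv (\<lambda>J. x_sol Astar a b J \<phi>) I)
     - pi * (1 / (2*pi) * integral {0..2*pi} (\<lambda>x. Astar + a x)))"

definition lincomb :: "real \<Rightarrow> (real \<Rightarrow> real) \<Rightarrow> real \<Rightarrow> (real \<Rightarrow> real) \<Rightarrow> real \<Rightarrow> real" where
  "lincomb c u d v = (\<lambda>x. c * u x + d * v x)"

definition lincomb2 ::
  "real \<Rightarrow> (real \<Rightarrow> real) \<times> (real \<Rightarrow> real) \<Rightarrow> real \<Rightarrow> (real \<Rightarrow> real) \<times> (real \<Rightarrow> real)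
   \<Rightarrow> (real \<Rightarrow> real) \<times> (real \<Rightarrow> real)" where
  "lincomb2 c p d q = (lincomb c (fst p) d (fst q), lincomb c (snd p) d (snd q))"

text \<open>The differential of \<open>S_map\<close> at \<open>p = (a, b)\<close> in the direction \<open>h = (\<alpha>, \<beta>)\<close>,
  evaluated at the point \<open>I\<close>.\<close>

definition dS ::
  "real \<Rightarrow> (real \<Rightarrow> real) \<times> (real \<Rightarrow> real) \<Rightarrow> (real \<Rightarrow> real) \<times> (real \<Rightarrow> real)
   \<Rightarrow> real \<Rightarrow> real" where
  "dS Astar p h = (\<lambda>I. deriv (\<lambda>t. S_map Astar (lincomb2 1 p t h) I) 0)"

end

theory Submission
  imports Defs "HOL-Complex_Analysis.Complex_Analysis"
begin

text \<open>
  Write \<open>A = Astar + a(x)\<close> and \<open>B = x + b(x)\<close>. Substituting \<open>I = A(x) sin \<phi> + B(x)\<close> in the Fourier integrals shows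
  that the \<open>k\<close>-th coefficient of \<open>dS(a, b)[\<alpha>, \<beta>]\<close> is
  \<open>\<integral> (J'(kA) \<alpha> - i J(kA) \<beta>) e\<^sub>-\<^sub>k(B) dx\<close>, where \<open>J\<close> is the Bessel function of order one (lemmas \<open>dS_eq_T\<close>
  and \<open>fc_T\<close>). The modes \<open>V = J(kA) e\<^sub>-\<^sub>k(B)\<close>, regarded as functions of two variables \<open>A > 0\<close> and \<open>B\<close>, all solve one wave
  equation, \<open>\<partial>\<^sub>A(A \<partial>\<^sub>A V) - V/A = A \<partial>\<^sub>B\<^sup>2 V\<close>, and this makes the right inverse explicit.

  For two solutions \<open>P\<close> and \<open>V\<close> the Green form \<open>A(P V\<^sub>A - V P\<^sub>A) dB + A(P V\<^sub>B - V P\<^sub>B) dA\<close> is closed. Its integral over the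
  curve \<open>x \<mapsto> (A(x), B(x))\<close>, the flux, is therefore the same as over a straight line \<open>A = const\<close>, however the curve is bent.
  Let \<open>P\<close> be a superposition of the waves \<open>H(jA) e\<^sub>j(B)\<close>, \<open>j \<ge> 1\<close>, with \<open>H\<close> a Hankel function of order one. Against the mode \<open>k\<close>
  only the wave \<open>j = k\<close> has a flux, and this flux is the Wronskian of \<open>J\<close> and \<open>H\<close>, a nonzero constant (lemmas \<open>flux_mode\<close>,
  \<open>wronskian\<close>). So the weights of \<open>P\<close> can be chosen such that its flux against every mode \<open>k \<ge> 1\<close> is a prescribed
  multiple of the coefficient \<open>\<gamma>\<^sub>k\<close>. With an antiderivative \<open>Q\<close> of \<open>A(B' P\<^sub>A + a' P\<^sub>B)\<close>, an integration by parts along the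
  curve turns the flux into \<open>k\<close> times the pairing of the mode with the direction \<open>(A B' P + a' Q, A a' P + B' Q)\<close>
  (lemma \<open>pairing\<close>). For \<open>Q\<close> to be periodic one first subtracts from \<open>P\<close> a multiple of the solution \<open>A\<close>, which has no
  flux (lemma \<open>flux_zero_mode\<close>). The real part of the resulting direction is \<open>R \<gamma>\<close>: it has the required coefficients of both
  signs, and it is linear in \<open>\<gamma>\<close> (lemmas \<open>dS_R\<close>, \<open>R_linear\<close>).

  For the estimates, \<open>H(t) = e\<^sup>i\<^sup>t \<eta>(t)\<close> with an amplitude \<open>\<eta>\<close> that is holomorphic and \<open>O(|z|^(-1/2))\<close> in a sector. Its Taylor
  expansion at \<open>k Astar\<close> has coefficients that decay geometrically, uniformly in \<open>k\<close> (lemma \<open>amplitude_expansion\<close>), and it turns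
  \<open>P\<close> into \<open>\<Sum>\<^sub>l a\<^sup>l (v\<^sub>l \<circ> \<psi>)\<close>, where \<open>\<psi> = id + a + b\<close> and the \<open>v\<^sub>l\<close> are Fourier multipliers of order \<open>1/2\<close> applied
  to \<open>\<gamma>\<close>; this is the loss of \<open>1/2\<close> in the theorem. Two tools make the bounds tame. Powers of \<open>a\<close> are estimated in the Banach
  algebra with weight \<open>(1 + \<theta>|k|)^s\<close>, where \<open>\<theta>\<close> is adapted to the high norm of \<open>a\<close> (lemma \<open>weight_choice\<close>). Composition with
  \<open>\<psi>\<close> is estimated in theorem \<open>l2le_compose\<close>: near the diagonal the frequencies are grouped into dyadic blocks, for which a
  change of variables in \<open>L\<^sup>2\<close> suffices, and far from the diagonal one integrates by parts more than \<open>s + 1/2\<close> times; this requires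
  up to \<open>s + 7/2\<close> derivatives of \<open>(a, b)\<close>. The derivatives \<open>P\<^sub>A\<close> and \<open>P\<^sub>B\<close> cost one order, which the antiderivative \<open>Q\<close> gains
  back, and multiplications by \<open>A\<close>, \<open>a'\<close>, \<open>B'\<close> preserve tame bounds (lemma \<open>h_tame\<close>).
\<close>

section \<open>Periodic functions and their Fourier coefficients\<close>

definition ek :: "int \<Rightarrow> real \<Rightarrow> complex" where
  "ek k x = exp (\<i> * of_int k * of_real x)"

definition cper :: "(real \<Rightarrow> 'a::real_normed_vector) \<Rightarrow> bool" where
  "cper f \<longleftrightarrow> continuous_on UNIV f \<and> (\<forall>x. f (x + 2*pi) = f x)"

definition fc :: "(real \<Rightarrow> complex) \<Rightarrow> int \<Rightarrow> complex" where
  "fc f j = (1 / (2 * of_real pi)) * integral {0..2*pi} (\<lambda>x. f x * ek (-j) x)"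

lemma fourier_coeff_eq_fc: "fourier_coeff u j = fc (\<lambda>x. of_real (u x)) j"
  by (simp add: fourier_coeff_def fc_def ek_def)

lemma ek_0 [simp]: "ek 0 x = 1"
  and ek_at_0 [simp]: "ek k 0 = 1"
  and norm_ek [simp]: "cmod (ek k x) = 1"
  and ek_nonzero [simp]: "ek k x \<noteq> 0"
  by (simp_all add: ek_def)

lemma ek_add: "ek (j + k) x = ek j x * ek k x"
  by (simp add: ek_def exp_add [symmetric] algebra_simps)

lemma ek_add_arg: "ek k (x + y) = ek k x * ek k y"
  by (simp add: ek_def exp_add [symmetric] algebra_simps)

lemma cnj_ek: "cnj (ek k x) = ek (-k) x"
  by (simp add: ek_def exp_cnj)

lemma ek_2pi [simp]: "ek k (2*pi) = 1"
proof -
  have "\<i> * of_int k * of_real (2*pi) = (2 * of_int k * of_real pi) * \<i>"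
    by simp
  moreover have "exp ((2 * of_int k * of_real pi) * \<i>) = (1::complex)"
    using exp_integer_2pi[of "of_int k"] by (simp add: mult_ac)
  ultimately show ?thesis by (simp only: ek_def)
qed

lemma ek_periodic [simp]: "ek k (x + 2*pi) = ek k x"
  by (simp add: ek_add_arg)

lemma continuous_ek [continuous_intros]:
  "continuous_on S g \<Longrightarrow> continuous_on S (\<lambda>x. ek k (g x))"
  unfolding ek_def by (intro continuous_intros)

lemma ek_has_vector_derivative:
  assumes "(g has_real_derivative g') (at x within S)"
  shows "((\<lambda>x. ek k (g x)) has_vector_derivative (\<i> * of_int k * of_real g' * ek k (g x))) (at x within S)"
proof -
  have "(ek k has_vector_derivative (\<i> * of_int k * ek k y)) (at y within T)" for y T
  proof -
    have "((\<lambda>z. exp (\<i> * of_int k * z)) has_field_derivative (\<i> * of_int k * exp (\<i> * of_int k * of_real y))) (at (of_real y))"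
      by (auto intro!: derivative_eq_intros)
    from has_vector_derivative_real_field[OF this] show ?thesis
      unfolding ek_def .
  qed
  then have "((ek k \<circ> g) has_vector_derivative (g' *\<^sub>R (\<i> * of_int k * ek k (g x)))) (at x within S)"
    using assms by (intro vector_diff_chain_within)
      (auto simp: has_real_derivative_iff_has_vector_derivative)
  then show ?thesis by (simp add: o_def scaleR_conv_of_real mult_ac)
qed

lemma cper_continuous: "cper f \<Longrightarrow> continuous_on S f"
  using continuous_on_subset by (auto simp: cper_def)

lemma cperD: "cper f \<Longrightarrow> f (x + 2*pi) = f x"
  by (simp add: cper_def)

lemma cper_at_2pi: "cper f \<Longrightarrow> f (2*pi) = f 0"
  using cperD[of f 0] by simp

lemma cper_integrable:
  fixes f :: "real \<Rightarrow> 'a::euclidean_space"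
  shows "cper f \<Longrightarrow> f integrable_on {a..b}"
  by (auto intro: integrable_continuous_real cper_continuous)

lemma cper_ek [simp]: "cper (ek k)"
  by (auto simp: cper_def intro!: continuous_intros)

lemma cper_const [simp]: "cper (\<lambda>x. c)"
  by (auto simp: cper_def)

lemma cper_add: "cper f \<Longrightarrow> cper g \<Longrightarrow> cper (\<lambda>x. f x + g x)"
  by (auto simp: cper_def intro!: continuous_intros)

lemma cper_diff: "cper f \<Longrightarrow> cper g \<Longrightarrow> cper (\<lambda>x. f x - g x)"
  by (auto simp: cper_def intro!: continuous_intros)

lemma cper_mult:
  fixes f g :: "real \<Rightarrow> 'a::real_normed_algebra"
  shows "cper f \<Longrightarrow> cper g \<Longrightarrow> cper (\<lambda>x. f x * g x)"
  by (auto simp: cper_def intro!: continuous_intros)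

lemma cper_power:
  fixes f :: "real \<Rightarrow> 'a::{real_normed_algebra_1,power}"
  shows "cper f \<Longrightarrow> cper (\<lambda>x. f x ^ n)"
  by (auto simp: cper_def intro!: continuous_intros)

lemma cper_of_real: "cper f \<Longrightarrow> cper (\<lambda>x. of_real (f x) :: complex)"
  by (auto simp: cper_def intro!: continuous_intros)

lemma cper_cnj: "cper f \<Longrightarrow> cper (\<lambda>x. cnj (f x))"
  by (auto simp: cper_def intro!: continuous_intros)

lemma cper_Re: "cper f \<Longrightarrow> cper (\<lambda>x. Re (f x))"
  by (auto simp: cper_def intro!: continuous_intros)

lemma cper_Im: "cper f \<Longrightarrow> cper (\<lambda>x. Im (f x))"
  by (auto simp: cper_def intro!: continuous_intros)

lemma cper_sum: "(\<And>i. i \<in> I \<Longrightarrow> cper (f i)) \<Longrightarrow> cper (\<lambda>x. \<Sum>i\<in>I. f i x)"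
  by (auto simp: cper_def intro!: continuous_intros)

lemma cper_compose:
  assumes "cper f" "continuous_on UNIV \<psi>" "\<And>x. \<psi> (x + 2*pi) = \<psi> x + 2*pi"
  shows "cper (\<lambda>x. f (\<psi> x))"
  using assms continuous_on_compose2[of UNIV f UNIV \<psi>] by (auto simp: cper_def)

lemmas cper_intros = cper_add cper_diff cper_mult cper_power cper_of_real cper_cnj cper_sum
  cper_ek cper_const

lemma cper_shift_int:
  assumes "\<And>x. f (x + 2*pi) = f x"
  shows "f (x + 2 * pi * of_int n) = f x"
proof (induction n rule: int_induct[where k = 0])
  case base
  then show ?case by simp
next
  case (step1 i)
  then show ?case using assms[of "x + 2 * pi * of_int i"] by (simp add: algebra_simps)
next
  case (step2 i)
  then show ?case using assms[of "x + 2 * pi * of_int (i-1)"] by (simp add: algebra_simps)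
qed

lemma cper_bounded:
  fixes f :: "real \<Rightarrow> 'a::real_normed_vector"
  assumes "cper f"
  obtains B where "B > 0" "\<And>x. norm (f x) \<le> B"
proof -
  have "compact (f ` {0..2*pi})"
    by (intro compact_continuous_image cper_continuous assms) auto
  then obtain B where B: "B > 0" "\<forall>y\<in>f ` {0..2*pi}. norm y \<le> B"
    using compact_imp_bounded bounded_pos by metis
  have "norm (f x) \<le> B" for x
  proof -
    define n where "n = \<lfloor>x / (2*pi)\<rfloor>"
    have 1: "of_int n \<le> x / (2*pi)" "x / (2*pi) < of_int n + 1"
      unfolding n_def by linarith+
    have "x - 2 * pi * of_int n \<in> {0..2*pi}"
      using 1 pi_gt_zero by (auto simp: field_simps)
    then have "norm (f (x - 2 * pi * of_int n)) \<le> B" using B by blast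
    then show ?thesis
      using cper_shift_int[of f "x - 2 * pi * of_int n" n] assms by (simp add: cper_def)
  qed
  with B that show ?thesis by blast
qed

subsection \<open>Antiderivatives and changes of variable over one period\<close>

definition antid :: "(real \<Rightarrow> 'a::banach) \<Rightarrow> real \<Rightarrow> 'a" where
  "antid f x = (if 0 \<le> x then integral {0..x} f else - integral {x..0} f)"

lemma antid_derivative:
  fixes f :: "real \<Rightarrow> 'a::banach"
  assumes "continuous_on UNIV f"
  shows "(antid f has_vector_derivative f x) (at x)"
proof -
  have int: "f integrable_on {a..b}" for a b
    using assms continuous_on_subset by (blast intro: integrable_continuous_real)
  define N where "N = \<bar>x\<bar> + 1"
  have eq: "antid f y = integral {-N..y} f - integral {-N..0} f" if "y \<in> {-N<..<N}" for y
  proof (cases "0 \<le> y")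
    case True
    then have "integral {-N..0} f + integral {0..y} f = integral {-N..y} f"
      by (intro Henstock_Kurzweil_Integration.integral_combine int) (auto simp: N_def)
    then show ?thesis using True by (simp add: antid_def algebra_simps)
  next
    case False
    then have "integral {-N..y} f + integral {y..0} f = integral {-N..0} f"
      using that by (intro Henstock_Kurzweil_Integration.integral_combine int) (auto simp: N_def)
    then show ?thesis using False by (simp add: antid_def algebra_simps)
  qed
  have "((\<lambda>u. integral {-N..u} f) has_vector_derivative f x) (at x within {-N..N})"
    by (rule integral_has_vector_derivative)
      (use assms continuous_on_subset in \<open>auto simp: N_def\<close>)
  then have "((\<lambda>u. integral {-N..u} f) has_vector_derivative f x) (at x)"
    by (subst (asm) at_within_interior) (auto simp: N_def)
  then have "((\<lambda>u. integral {-N..u} f - integral {-N..0} f) has_vector_derivative f x - 0) (at x)"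
    by (intro has_vector_derivative_diff has_vector_derivative_const)
  then have "((\<lambda>u. integral {-N..u} f - integral {-N..0} f) has_vector_derivative f x) (at x)"
    by simp
  then show ?thesis
    by (rule has_vector_derivative_transform_within_open[where S = "{-N<..<N}"])
      (auto simp: N_def eq)
qed

lemma antid_0 [simp]: "antid f 0 = 0"
  by (simp add: antid_def)

lemma ex_antiderivative:
  fixes f :: "real \<Rightarrow> 'a::banach"
  assumes "continuous_on UNIV f"
  obtains G where "\<And>x. (G has_vector_derivative f x) (at x)"
  using antid_derivative[OF assms] that by blast

lemma integral_derivative:
  fixes f :: "real \<Rightarrow> 'a::banach"
  assumes "\<And>x. (f has_vector_derivative f' x) (at x)" "a \<le> b"
  shows "(f' has_integral (f b - f a)) {a..b}"
  using assms by (intro fundamental_theorem_of_calculus) (auto intro: has_vector_derivative_at_within)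

lemma integral_complex_of_real:
  fixes f :: "real \<Rightarrow> real"
  assumes "continuous_on {a..b} f"
  shows "integral {a..b} (\<lambda>x. of_real (f x) :: complex) = of_real (integral {a..b} f)"
  using has_integral_of_real[OF integrable_integral[OF integrable_continuous_real[OF assms]], where 'b = complex]
  by (simp add: o_def integral_unique)

lemma integral_period_shift:
  fixes f :: "real \<Rightarrow> 'a::euclidean_space"
  assumes "cper f" and G: "\<And>x. (G has_vector_derivative f x) (at x)"
  shows "G (c + 2*pi) - G c = integral {0..2*pi} f"
proof -
  have D: "((\<lambda>c. G (c + 2*pi) - G c) has_vector_derivative 0) (at x)" for x
  proof -
    have "((\<lambda>c. c + 2*pi) has_vector_derivative 1) (at x)"
      by (auto intro!: derivative_eq_intros)
    from has_vector_derivative_diff[OF vector_diff_chain_at[OF this G] G]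
    show ?thesis using assms(1) by (simp add: cper_def o_def)
  qed
  obtain k where "\<forall>x\<in>UNIV. G (x + 2*pi) - G x = k"
    using has_vector_derivative_zero_constant[of UNIV "\<lambda>c. G (c + 2*pi) - G c", OF convex_UNIV] D
    by auto
  then have "G (c + 2*pi) - G c = G (0 + 2*pi) - G 0" by (metis UNIV_I)
  also have "\<dots> = integral {0..2*pi} f"
    using integral_derivative[OF G, of 0 "2*pi"] by (simp add: integral_unique)
  finally show ?thesis .
qed

lemma has_integral_substitution_period:
  fixes v :: "real \<Rightarrow> 'a::euclidean_space"
  assumes v: "cper v" and \<psi>: "\<And>x. (\<psi> has_real_derivative \<psi>' x) (at x)"
    and per: "\<psi> (2*pi) = \<psi> 0 + 2*pi"
  shows "((\<lambda>x. \<psi>' x *\<^sub>R v (\<psi> x)) has_integral integral {0..2*pi} v) {0..2*pi}"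
proof -
  obtain G where G: "\<And>x. (G has_vector_derivative v x) (at x)"
    using ex_antiderivative[OF cper_continuous[OF v]] by metis
  have "((\<lambda>x. \<psi>' x *\<^sub>R v (\<psi> x)) has_integral (G (\<psi> (2*pi)) - G (\<psi> 0))) {0..2*pi}"
  proof (rule integral_derivative[where f = "\<lambda>x. G (\<psi> x)"])
    fix x
    have "(\<psi> has_vector_derivative \<psi>' x) (at x)"
      using \<psi>[of x] by (simp add: has_real_derivative_iff_has_vector_derivative)
    from vector_diff_chain_at[OF this G]
    show "((\<lambda>x. G (\<psi> x)) has_vector_derivative \<psi>' x *\<^sub>R v (\<psi> x)) (at x)"
      by (simp add: o_def)
  qed simp
  moreover have "G (\<psi> (2*pi)) - G (\<psi> 0) = integral {0..2*pi} v"
    unfolding per by (rule integral_period_shift[OF v G])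
  ultimately show ?thesis by (simp only:)
qed

subsection \<open>Fourier coefficients\<close>

lemma integral_ek: "integral {0..2*pi} (ek k) = (if k = 0 then 2 * of_real pi else 0)"
proof (cases "k = 0")
  case True
  then have "ek k = (\<lambda>_. 1)" by auto
  then show ?thesis using True by (simp add: scaleR_conv_of_real)
next
  case False
  have "((\<lambda>x. ek k x / (\<i> * of_int k)) has_vector_derivative ek k x) (at x)" for x
    using has_vector_derivative_divide[OF ek_has_vector_derivative[OF DERIV_ident, of k x UNIV], of "\<i> * of_int k"] False
    by simp
  from integral_derivative[OF this, of 0 "2*pi"] False show ?thesis
    by (simp add: integral_unique)
qed

lemma fc_add:
  assumes "cper f" "cper g"
  shows "fc (\<lambda>x. f x + g x) n = fc f n + fc g n"
proof -
  have "(\<lambda>x. f x * ek (-n) x) integrable_on {0..2*pi}" "(\<lambda>x. g x * ek (-n) x) integrable_on {0..2*pi}"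
    by (intro cper_integrable cper_mult assms cper_ek)+
  from Henstock_Kurzweil_Integration.integral_add[OF this]
  show ?thesis by (simp add: fc_def ring_distribs)
qed

lemma fc_diff:
  assumes "cper f" "cper g"
  shows "fc (\<lambda>x. f x - g x) n = fc f n - fc g n"
proof -
  have "(\<lambda>x. f x * ek (-n) x) integrable_on {0..2*pi}" "(\<lambda>x. g x * ek (-n) x) integrable_on {0..2*pi}"
    by (intro cper_integrable cper_mult assms cper_ek)+
  from Henstock_Kurzweil_Integration.integral_diff[OF this]
  show ?thesis by (simp add: fc_def ring_distribs diff_divide_distrib)
qed

lemma fc_cmult: "fc (\<lambda>x. c * f x) n = c * fc f n"
  unfolding fc_def by (simp add: mult.assoc)

lemma fc_zero [simp]: "fc (\<lambda>x. 0) n = 0"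
  by (simp add: fc_def)

lemma fc_sum:
  assumes "finite I" "\<And>i. i \<in> I \<Longrightarrow> cper (f i)"
  shows "fc (\<lambda>x. \<Sum>i\<in>I. f i x) n = (\<Sum>i\<in>I. fc (f i) n)"
  using assms by (induction I) (auto simp: fc_add cper_sum)

lemma fc_shift: "fc (\<lambda>x. ek k x * f x) n = fc f (n - k)"
proof -
  have "ek k x * f x * ek (-n) x = f x * ek (-(n-k)) x" for x
    using ek_add[of k "-n" x] by (simp add: mult_ac)
  then have eq: "(\<lambda>x. ek k x * f x * ek (-n) x) = (\<lambda>x. f x * ek (-(n-k)) x)" by (rule ext)
  show ?thesis unfolding fc_def eq ..
qed

lemma fc_ek: "fc (ek k) n = (if n = k then 1 else 0)"
proof -
  have "ek k x * ek (-n) x = ek (k-n) x" for x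
    using ek_add[of k "-n" x] by simp
  then show ?thesis by (simp add: fc_def integral_ek)
qed

lemma fc_cnj: "fc (\<lambda>x. cnj (f x)) n = cnj (fc f (-n))"
proof -
  have "cnj (integral {0..2*pi} (\<lambda>x. f x * ek n x)) = integral {0..2*pi} (\<lambda>x. cnj (f x * ek n x))"
    by (rule Henstock_Kurzweil_Integration.integral_cnj)
  then show ?thesis by (simp add: fc_def cnj_ek)
qed

lemma norm_fc_le:
  assumes "cper f" "\<And>x. cmod (f x) \<le> B"
  shows "cmod (fc f n) \<le> B"
proof -
  have "norm (integral {0..2*pi} (\<lambda>x. f x * ek (-n) x)) \<le> B * (2*pi - 0)"
    by (rule integral_bound) (auto intro!: cper_continuous cper_intros assms simp: norm_mult)
  then show ?thesis by (simp add: fc_def norm_mult norm_divide field_simps)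
qed

text \<open>Weierstrass' test, for the unordered sums in which Fourier series are written.\<close>

lemma dominated_series:
  fixes g :: "'i \<Rightarrow> real \<Rightarrow> complex"
  assumes g: "\<And>i. cper (g i)" "\<And>i x. cmod (g i x) \<le> b i" and b: "b summable_on UNIV"
    and f: "\<And>x. ((\<lambda>i. g i x) has_sum f x) UNIV"
  shows cper_series: "cper f"
    and integral_series: "((\<lambda>i. integral {0..2*pi} (g i)) has_sum integral {0..2*pi} f) UNIV"
proof -
  have u: "uniform_limit S (\<lambda>X x. \<Sum>i\<in>X. g i x) f (finite_subsets_at_top UNIV)" for S
    by (rule Weierstrass_m_test_general') (use assms in auto)
  have c: "continuous_on S (\<lambda>x. \<Sum>i\<in>X. g i x)" for X S
    by (intro continuous_on_sum cper_continuous g)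
  have "continuous_on UNIV f"
    by (rule uniform_limit_theorem[OF _ u])
      (auto intro!: always_eventually c)
  moreover have "f (x + 2*pi) = f x" for x
    using f[of x] f[of "x + 2*pi"] g(1) by (auto simp: cper_def dest: has_sum_unique)
  ultimately show "cper f" by (simp add: cper_def)
  obtain I J where IJ: "\<And>X. ((\<lambda>x. \<Sum>i\<in>X. g i x) has_integral I X) {0..2*pi}"
      "(f has_integral J) {0..2*pi}" "(I \<longlongrightarrow> J) (finite_subsets_at_top UNIV)"
    using uniform_limit_integral[OF u c finite_subsets_at_top_neq_bot] by blast
  have "I X = (\<Sum>i\<in>X. integral {0..2*pi} (g i))" if "finite X" for X
    using integral_unique[OF IJ(1)[of X]]
      Henstock_Kurzweil_Integration.integral_sum[OF that, of g "{0..2*pi}"] cper_integrable[OF g(1)]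
    by simp
  then have "eventually (\<lambda>X. I X = (\<Sum>i\<in>X. integral {0..2*pi} (g i))) (finite_subsets_at_top UNIV)"
    by (auto intro: eventually_finite_subsets_at_top_weakI)
  from Lim_transform_eventually[OF IJ(3) this]
  show "((\<lambda>i. integral {0..2*pi} (g i)) has_sum integral {0..2*pi} f) UNIV"
    unfolding has_sum_def integral_unique[OF IJ(2)] .
qed

lemma fc_series:
  fixes g :: "'i \<Rightarrow> real \<Rightarrow> complex"
  assumes g: "\<And>i. cper (g i)" "\<And>i x. cmod (g i x) \<le> b i" and b: "b summable_on UNIV"
    and f: "\<And>x. ((\<lambda>i. g i x) has_sum f x) UNIV"
  shows "((\<lambda>i. fc (g i) n) has_sum fc f n) UNIV"
  unfolding fc_def
proof (intro has_sum_cmult_right integral_series[where b = b])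
  show "((\<lambda>i. g i x * ek (-n) x) has_sum f x * ek (-n) x) UNIV" for x
    by (intro has_sum_cmult_left f)
qed (auto intro!: cper_intros g b simp: norm_mult)

subsection \<open>Uniqueness of Fourier coefficients\<close>

definition nofreq :: "(real \<Rightarrow> complex) \<Rightarrow> bool" where
  "nofreq v \<longleftrightarrow> cper v \<and> (\<forall>n. fc v n = 0)"

text \<open>The functions without frequencies form a module over the polynomials in
  \<open>cos x\<close> and \<open>sin x\<close>, because multiplication by \<open>e\<^sub>1\<close> only shifts coefficients.\<close>

lemma nofreq_polynomial:
  assumes "real_polynomial_function g" "nofreq v"
  shows "nofreq (\<lambda>x. v x * of_real (g (cis x)))"
  using assms
proof (induction arbitrary: v rule: real_polynomial_function.induct)
  case (linear f)
  have e1: "ek 1 x = cis x" "ek (-1) x = cnj (cis x)" for x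
    by (simp_all add: ek_def cis_conv_exp exp_cnj)
  define p where "p = (complex_of_real (f 1) - \<i> * of_real (f \<i>)) / 2"
  define q where "q = (complex_of_real (f 1) + \<i> * of_real (f \<i>)) / 2"
  have fc: "f (cis x) = cos x * f 1 + sin x * f \<i>" for x
  proof -
    have "cis x = cos x *\<^sub>R 1 + sin x *\<^sub>R \<i>"
      by (simp add: complex_eq_iff)
    then have "f (cis x) = f (cos x *\<^sub>R 1 + sin x *\<^sub>R \<i>)" by (rule arg_cong)
    then show ?thesis using linear by (simp add: linear_simps)
  qed
  have "of_real (f (cis x)) = p * ek 1 x + q * ek (-1) x" for x
    unfolding fc e1 p_def q_def by (simp add: complex_eq_iff field_simps)
  then have eq: "v x * of_real (f (cis x)) = p * (ek 1 x * v x) + q * (ek (-1) x * v x)" for x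
    by (simp add: algebra_simps)
  have cv: "cper v" and nv: "\<And>n. fc v n = 0" using linear(2) by (auto simp: nofreq_def)
  have c: "cper (\<lambda>x. p * (ek 1 x * v x))" "cper (\<lambda>x. q * (ek (-1) x * v x))"
    by (intro cper_mult cper_const cper_ek cv)+
  show ?case unfolding eq nofreq_def
    using cper_add[OF c] by (simp add: fc_add[OF c] fc_cmult fc_shift nv)
next
  case (const c)
  have "fc (\<lambda>x. v x * of_real c) n = of_real c * fc v n" for n
    using fc_cmult[of "of_real c" v n] by (simp add: mult.commute)
  with const show ?case by (auto simp: nofreq_def intro!: cper_intros)
next
  case (add f g)
  from add.IH(1)[OF add.prems] add.IH(2)[OF add.prems] show ?case
    by (auto simp: nofreq_def distrib_left fc_add intro!: cper_add)
next
  case (mult f g)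
  from mult.IH(2)[OF mult.IH(1)[OF mult.prems]] show ?case
    by (simp add: mult.assoc)
qed

lemma cis_eq_periodic:
  assumes "\<And>x. f (x + 2*pi) = f x" "cis x = cis y"
  shows "f x = f y"
proof -
  have "exp (\<i> * of_real x) = exp (\<i> * of_real y)" using assms(2) by (simp add: cis_conv_exp)
  then obtain n :: int where "\<i> * of_real x = \<i> * of_real y + (of_int (2 * n) * pi) * \<i>"
    unfolding exp_eq by auto
  then have "x = y + 2 * pi * of_int n"
    by (auto simp: complex_eq_iff)
  then show ?thesis using cper_shift_int[of f y n, OF assms(1)] by simp
qed

lemma cis_Arg_sphere: "cmod z = 1 \<Longrightarrow> cis (Arg z) = z"
  using cis_Arg[of z] by (cases "z = 0") (auto simp: sgn_div_norm)

text \<open>A continuous periodic function as a continuous function on the circle, where polynomials are dense. At the point \<open>-1\<close>,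
  where \<open>Arg\<close> jumps, one uses \<open>Arg (-z) + pi\<close> instead.\<close>

lemma periodic_lift_to_circle:
  fixes u :: "real \<Rightarrow> real"
  assumes u: "cper u"
  shows "continuous_on (sphere 0 1) (\<lambda>z. u (Arg z))"
proof -
  have per: "\<And>x. u (x + 2*pi) = u x" using u by (simp add: cper_def)
  have iso: "isCont u x" for x using u by (auto simp: cper_def continuous_on_eq_continuous_at)
  have "continuous (at z within sphere 0 1) (\<lambda>z. u (Arg z))" if z: "z \<in> sphere 0 1" for z
  proof (cases "z \<in> \<real>\<^sub>\<le>\<^sub>0")
    case False
    have "isCont (\<lambda>z. u (Arg z)) z"
      by (rule isCont_o2[OF continuous_at_Arg[OF False]]) (rule iso)
    then show ?thesis by (rule continuous_at_imp_continuous_at_within)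
  next
    case True
    moreover have "z \<noteq> 0" using z by auto
    ultimately have "- z \<notin> \<real>\<^sub>\<le>\<^sub>0"
      by (auto simp: complex_nonpos_Reals_iff complex_eq_iff)
    then have "isCont (\<lambda>w. Arg (- w)) z"
      by (intro isCont_o2[of z uminus Arg]) (auto intro: continuous_at_Arg)
    then have "isCont (\<lambda>w. u (Arg (- w) + pi)) z"
      by (intro isCont_o2[of z "\<lambda>w. Arg (- w) + pi" u] continuous_intros iso)
    then have "continuous (at z within sphere 0 1) (\<lambda>w. u (Arg (- w) + pi))"
      by (rule continuous_at_imp_continuous_at_within)
    then show ?thesis
    proof (rule continuous_transform_within[where \<delta> = 1])
      fix w :: complex assume "w \<in> sphere 0 1"
      then have "cis (Arg (- w) + pi) = cis (Arg w)"
        using cis_Arg_sphere[of w] cis_Arg_sphere[of "-w"] by (simp add: cis_mult [symmetric])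
      then show "u (Arg (- w) + pi) = u (Arg w)" using cis_eq_periodic[of u, OF per] by blast
    qed (use z in auto)
  qed
  then show ?thesis by (simp add: continuous_on_eq_continuous_within)
qed

lemma nofreq_orthogonal:
  fixes u :: "real \<Rightarrow> real"
  assumes v: "nofreq v" and u: "cper u"
  shows "integral {0..2*pi} (\<lambda>x. v x * of_real (u x)) = 0"
proof -
  have cv: "cper v" using v by (simp add: nofreq_def)
  obtain B where B: "B > 0" "\<And>x. cmod (v x) \<le> B" using cper_bounded[OF cv] by blast
  let ?J = "integral {0..2*pi} (\<lambda>x. v x * of_real (u x))"
  have "cmod ?J \<le> e" if "e > 0" for e
  proof -
    define d where "d = e / (B * (2*pi))"
    have d: "d > 0" using that B(1) by (simp add: d_def)
    have "\<exists>g. real_polynomial_function g \<and> (\<forall>z\<in>sphere 0 1. \<bar>u (Arg z) - g z\<bar> < d)"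
      by (rule Stone_Weierstrass_real_polynomial_function[OF compact_sphere periodic_lift_to_circle[OF u] d])
        (intro exI conjI ballI, assumption)
    then obtain g where g: "real_polynomial_function g"
      "\<And>z. z \<in> sphere 0 1 \<Longrightarrow> \<bar>u (Arg z) - g z\<bar> < d"
      by metis
    have close: "\<bar>u x - g (cis x)\<bar> \<le> d" for x
    proof -
      have "u (Arg (cis x)) = u x"
        using cis_eq_periodic[of u "Arg (cis x)" x] cperD[OF u] cis_Arg_sphere[of "cis x"] by simp
      then show ?thesis using g(2)[of "cis x"] by auto
    qed
    have nf: "nofreq (\<lambda>x. v x * of_real (g (cis x)))" by (rule nofreq_polynomial[OF g(1) v])
    then have "fc (\<lambda>x. v x * of_real (g (cis x))) 0 = 0" by (simp add: nofreq_def)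
    then have 0: "integral {0..2*pi} (\<lambda>x. v x * of_real (g (cis x))) = 0" by (simp add: fc_def)
    have ig: "(\<lambda>x. v x * of_real (g (cis x))) integrable_on {0..2*pi}"
      using nf by (auto simp: nofreq_def intro: cper_integrable)
    have iu: "(\<lambda>x. v x * of_real (u x)) integrable_on {0..2*pi}"
      by (intro cper_integrable cper_intros cv u)
    have cont: "continuous_on {0..2*pi} (\<lambda>x. v x * of_real (u x) - v x * of_real (g (cis x)))"
      using nf by (intro continuous_on_diff cper_continuous) (auto simp: nofreq_def intro!: cper_intros cv u)
    have "?J = integral {0..2*pi} (\<lambda>x. v x * of_real (u x) - v x * of_real (g (cis x)))"
      using 0 by (subst Henstock_Kurzweil_Integration.integral_diff[OF iu ig]) simp
    also have "cmod \<dots> \<le> (B * d) * (2*pi - 0)"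
    proof (rule integral_bound)
      show "cmod (v x * of_real (u x) - v x * of_real (g (cis x))) \<le> B * d" for x
      proof -
        have "v x * of_real (u x) - v x * of_real (g (cis x)) = v x * of_real (u x - g (cis x))"
          by (simp add: algebra_simps)
        then show ?thesis using B(2)[of x] close[of x] B(1)
          by (simp only: norm_mult norm_of_real) (intro mult_mono, auto)
      qed
    qed (use cont in auto)
    also have "\<dots> = e" using B(1) by (simp add: d_def)
    finally show ?thesis .
  qed
  then have "cmod ?J \<le> 0" by (rule field_le_epsilon[of _ 0, simplified])
  then show ?thesis by simp
qed

text \<open>By Weierstrass' approximation theorem a function without frequencies is orthogonal to every continuous function, hence
  to itself.\<close>

theorem fc_unique:
  assumes f: "cper f" and g: "cper g" and eq: "\<And>n. fc f n = fc g n"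
  shows "f x = g x"
proof -
  define v where "v x = f x - g x" for x
  have v: "nofreq v" using assms by (auto simp: nofreq_def v_def [abs_def] fc_diff intro!: cper_intros)
  then have cv: "cper v" by (simp add: nofreq_def)
  have "integral {0..2*pi} (\<lambda>x. v x * cnj (v x)) = 0"
  proof -
    have "(\<lambda>x. v x * cnj (v x)) = (\<lambda>x. v x * of_real (Re (v x)) - \<i> * (v x * of_real (Im (v x))))"
      by (auto simp: complex_eq_iff)
    moreover have "integral {0..2*pi} (\<lambda>x. v x * of_real (Re (v x)) - \<i> * (v x * of_real (Im (v x)))) =
      integral {0..2*pi} (\<lambda>x. v x * of_real (Re (v x))) - \<i> * integral {0..2*pi} (\<lambda>x. v x * of_real (Im (v x)))"
      by (subst Henstock_Kurzweil_Integration.integral_diff)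
        (auto intro!: cper_integrable cper_intros cv cper_Re cper_Im)
    ultimately show ?thesis
      using nofreq_orthogonal[OF v cper_Re[OF cv]] nofreq_orthogonal[OF v cper_Im[OF cv]] by simp
  qed
  moreover have "(\<lambda>x. v x * cnj (v x)) = (\<lambda>x. of_real ((cmod (v x))\<^sup>2))"
    by (intro ext) (rule complex_norm_square [symmetric])
  ultimately have "integral {0..2*pi} (\<lambda>x. of_real ((cmod (v x))\<^sup>2) :: complex) = 0" by simp
  moreover have c: "continuous_on {0..2*pi} (\<lambda>x. (cmod (v x))\<^sup>2)"
    by (intro continuous_intros cper_continuous cv)
  ultimately have "integral {0..2*pi} (\<lambda>x. (cmod (v x))\<^sup>2) = 0"
    by (simp only: integral_complex_of_real[OF c] of_real_eq_0_iff)
  then have "((\<lambda>x. (cmod (v x))\<^sup>2) has_integral 0) (cbox 0 (2*pi))"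
    using integrable_continuous_real[OF c] by (simp add: has_integral_integrable_integral)
  then have "v x = 0" if "x \<in> {0..2*pi}" for x
    using has_integral_0_cbox_imp_0[of 0 "2*pi" "\<lambda>x. (cmod (v x))\<^sup>2" x] c that
    by (auto simp: not_le)
  moreover define n where "n = \<lfloor>x / (2*pi)\<rfloor>"
  moreover have "of_int n \<le> x / (2*pi)" "x / (2*pi) < of_int n + 1"
    unfolding n_def by linarith+
  then have "x - 2 * pi * of_int n \<in> {0..2*pi}"
    using pi_gt_zero by (auto simp: field_simps)
  ultimately have "v (x - 2 * pi * of_int n) = 0" by blast
  then have "v x = 0"
    using cper_shift_int[of v "x - 2 * pi * of_int n" n] cv by (simp add: cper_def)
  then show ?thesis by (simp add: v_def)
qed

section \<open>Weighted norms of Fourier coefficients\<close>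

text \<open>A bound for all finite partial sums contains the summability of the series, so that no separate summability hypotheses
  have to accompany the estimates.\<close>

definition l1le :: "(int \<Rightarrow> real) \<Rightarrow> (int \<Rightarrow> complex) \<Rightarrow> real \<Rightarrow> bool" where
  "l1le \<omega> w M \<longleftrightarrow> (\<forall>F. finite F \<longrightarrow> (\<Sum>k\<in>F. \<omega> k * cmod (w k)) \<le> M)"

definition l2le :: "(int \<Rightarrow> real) \<Rightarrow> (int \<Rightarrow> complex) \<Rightarrow> real \<Rightarrow> bool" where
  "l2le \<omega> w M \<longleftrightarrow> (\<forall>F. finite F \<longrightarrow> L2_set (\<lambda>k. \<omega> k * cmod (w k)) F \<le> M)"

definition jw :: "real \<Rightarrow> int \<Rightarrow> real" where
  "jw s k = jap (of_int k) powr s"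

definition gw :: "real \<Rightarrow> real \<Rightarrow> int \<Rightarrow> real" where
  "gw \<theta> s k = (1 + \<theta> * \<bar>of_int k\<bar>) powr s"

lemma l1leD: "l1le \<omega> w M \<Longrightarrow> finite F \<Longrightarrow> (\<Sum>k\<in>F. \<omega> k * cmod (w k)) \<le> M"
  by (simp add: l1le_def)

lemma l2leD: "l2le \<omega> w M \<Longrightarrow> finite F \<Longrightarrow> L2_set (\<lambda>k. \<omega> k * cmod (w k)) F \<le> M"
  by (simp add: l2le_def)

lemma l1le_nonneg: "l1le \<omega> w M \<Longrightarrow> 0 \<le> M"
  using l1leD[of \<omega> w M "{}"] by simp

lemma l2le_nonneg: "l2le \<omega> w M \<Longrightarrow> 0 \<le> M"
  using l2leD[of \<omega> w M "{}"] by simp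

lemma l1le_mono: "l1le \<omega> w M \<Longrightarrow> M \<le> M' \<Longrightarrow> l1le \<omega> w M'"
  by (force simp: l1le_def)

lemma l2le_mono: "l2le \<omega> w M \<Longrightarrow> M \<le> M' \<Longrightarrow> l2le \<omega> w M'"
  by (force simp: l2le_def)

lemma l1le_weaken:
  assumes "l1le \<omega> w M" "\<And>k. \<omega>' k * cmod (v k) \<le> c * (\<omega> k * cmod (w k))" "c \<ge> 0"
  shows "l1le \<omega>' v (c * M)"
  unfolding l1le_def
proof safe
  fix F :: "int set" assume F: "finite F"
  have "(\<Sum>k\<in>F. \<omega>' k * cmod (v k)) \<le> (\<Sum>k\<in>F. c * (\<omega> k * cmod (w k)))"
    by (intro sum_mono assms)
  also have "\<dots> \<le> c * M"
    using l1leD[OF assms(1) F] assms(3) by (simp add: sum_distrib_left [symmetric] mult_left_mono)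
  finally show "(\<Sum>k\<in>F. \<omega>' k * cmod (v k)) \<le> c * M" .
qed

lemma l2le_weaken:
  assumes "l2le \<omega> w M" "\<And>k. \<omega>' k * cmod (v k) \<le> c * (\<omega> k * cmod (w k))" "c \<ge> 0" "\<And>k. \<omega>' k \<ge> 0"
  shows "l2le \<omega>' v (c * M)"
  unfolding l2le_def
proof safe
  fix F :: "int set" assume F: "finite F"
  have "L2_set (\<lambda>k. \<omega>' k * cmod (v k)) F \<le> L2_set (\<lambda>k. c * (\<omega> k * cmod (w k))) F"
    by (intro L2_set_mono assms) (simp add: assms)
  also have "\<dots> \<le> c * M"
    using l2leD[OF assms(1) F] assms(3) by (simp add: L2_set_right_distrib [symmetric] mult_left_mono)
  finally show "L2_set (\<lambda>k. \<omega>' k * cmod (v k)) F \<le> c * M" .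
qed

lemma l2le_add:
  assumes "l2le \<omega> v M" "l2le \<omega> w N" "\<And>k. \<omega> k \<ge> 0" "\<And>k. cmod (u k) \<le> cmod (v k) + cmod (w k)"
  shows "l2le \<omega> u (M + N)"
  unfolding l2le_def
proof safe
  fix F :: "int set" assume F: "finite F"
  have "\<omega> k * cmod (u k) \<le> \<omega> k * cmod (v k) + \<omega> k * cmod (w k)" for k
    using mult_left_mono[OF assms(4) assms(3)] by (simp add: distrib_left)
  then have "L2_set (\<lambda>k. \<omega> k * cmod (u k)) F \<le> L2_set (\<lambda>k. \<omega> k * cmod (v k) + \<omega> k * cmod (w k)) F"
    by (intro L2_set_mono) (auto simp: assms)
  also have "\<dots> \<le> M + N"
    by (intro order_trans[OF L2_set_triangle_ineq] add_mono l2leD[OF assms(1) F] l2leD[OF assms(2) F])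
  finally show "L2_set (\<lambda>k. \<omega> k * cmod (u k)) F \<le> M + N" .
qed

lemma l1le_summable:
  assumes "l1le \<omega> w M" "\<And>k. \<omega> k \<ge> 0"
  shows "(\<lambda>k. \<omega> k * cmod (w k)) summable_on UNIV" "infsum (\<lambda>k. \<omega> k * cmod (w k)) UNIV \<le> M"
proof -
  show *: "(\<lambda>k. \<omega> k * cmod (w k)) summable_on UNIV"
    by (rule nonneg_bdd_above_summable_on) (use assms in \<open>auto intro!: bdd_aboveI2[where M = M] simp: l1le_def\<close>)
  show "infsum (\<lambda>k. \<omega> k * cmod (w k)) UNIV \<le> M"
    by (rule infsum_le_finite_sums[OF *]) (use assms in \<open>auto simp: l1le_def\<close>)
qed

lemma l1le_1_summable:
  assumes "l1le (\<lambda>_. 1) w M"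
  shows "(\<lambda>k. cmod (w k)) summable_on UNIV" "infsum (\<lambda>k. cmod (w k)) UNIV \<le> M"
  using l1le_summable[OF assms] by simp_all

lemma jap_ge_1: "jap y \<ge> 1"
  by (simp add: jap_def)

lemma jw_ge_1: "s \<ge> 0 \<Longrightarrow> jw s k \<ge> 1"
  unfolding jw_def using jap_ge_1 by (intro ge_one_powr_ge_zero) auto

lemma jw_pos [simp]: "jw s k > 0"
  unfolding jw_def using jap_ge_1[of "of_int k"] by simp

lemma jw_nonneg [simp]: "jw s k \<ge> 0"
  using jw_pos[of s k] by linarith

lemma jw_0 [simp]: "jw 0 k = 1"
  unfolding jw_def using jap_ge_1[of "of_int k"] by simp

lemma jw_mono: "s \<le> t \<Longrightarrow> jw s k \<le> jw t k"
  unfolding jw_def using jap_ge_1 by (intro powr_mono) auto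

lemma jw_add: "jw (s + t) k = jw s k * jw t k"
  by (simp add: jw_def powr_add)

lemma jw_1: "jw 1 k = jap (of_int k)"
  unfolding jw_def using jap_ge_1[of "of_int k"] by simp

lemma jap_add_le: "jap (x + y) \<le> jap x + jap y"
  by (auto simp: jap_def)

lemma jw_add_le:
  assumes "s \<ge> 0"
  shows "jw s (i + j) \<le> 2 powr s * (jw s i + jw s j)"
proof -
  define m where "m = max (jap (of_int i)) (jap (of_int j))"
  have m: "m \<ge> 1" using jap_ge_1[of "of_int i"] by (simp add: m_def)
  have "jap (of_int (i + j)) \<le> 2 * m"
    using jap_add_le[of "of_int i" "of_int j"] by (simp add: m_def)
  then have "jw s (i + j) \<le> (2 * m) powr s"
    unfolding jw_def using assms jap_ge_1[of "of_int (i+j)"] by (intro powr_mono2) auto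
  also have "\<dots> = 2 powr s * m powr s" using m by (simp add: powr_mult)
  also have "m powr s \<le> jw s i + jw s j"
    by (auto simp: m_def jw_def max_def)
  finally show ?thesis by simp
qed

lemma gw_ge_1: "\<theta> \<ge> 0 \<Longrightarrow> s \<ge> 0 \<Longrightarrow> gw \<theta> s k \<ge> 1"
  unfolding gw_def by (intro ge_one_powr_ge_zero) auto

lemma gw_at_0 [simp]: "gw \<theta> s 0 = 1"
  by (simp add: gw_def)

lemma gw_submult:
  assumes "\<theta> \<ge> 0" "s \<ge> 0"
  shows "gw \<theta> s (i + j) \<le> gw \<theta> s i * gw \<theta> s j"
proof -
  have "\<theta> * \<bar>real_of_int (i + j)\<bar> \<le> \<theta> * (\<bar>of_int i\<bar> + \<bar>of_int j\<bar>)"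
    using assms by (intro mult_left_mono) auto
  moreover have "0 \<le> \<theta> * \<bar>of_int i\<bar> * (\<theta> * \<bar>of_int j\<bar>)" using assms by simp
  ultimately have "1 + \<theta> * \<bar>real_of_int (i + j)\<bar> \<le> (1 + \<theta> * \<bar>of_int i\<bar>) * (1 + \<theta> * \<bar>of_int j\<bar>)"
    by (simp add: algebra_simps)
  then show ?thesis unfolding gw_def using assms
    by (subst powr_mult [symmetric]) (auto intro!: powr_mono2)
qed

text \<open>The weight \<open>(1 + \<theta>|k|)^s\<close> is submultiplicative with constant 1. Rescaling \<open>\<theta>\<close> makes the
  high part of the weight as small as one likes, at the price of a factor \<open>\<theta>^-s\<close> when one
  returns to \<open>\<langle>k\<rangle>^s\<close>. With \<open>\<theta>\<close> chosen as below this factor is affine in the high norm, so that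
  Banach algebra estimates in the rescaled norm turn into tame estimates.\<close>

lemma gw_le_jw:
  assumes "\<theta> \<ge> 0" "s \<ge> 0"
  shows "gw \<theta> s k \<le> 3 + ((s + 2) * \<theta>) powr s * jw s k"
proof -
  define y where "y = \<theta> * \<bar>of_int k\<bar>"
  have y: "y \<ge> 0" using assms by (simp add: y_def)
  show ?thesis
  proof (cases "(s + 1) * y \<le> 1")
    case True
    then have "s * y \<le> 1" using y assms by (simp add: algebra_simps)
    have "(1 + y) powr s \<le> exp y powr s"
      using y assms by (intro powr_mono2) (auto simp: exp_ge_add_one_self)
    also have "\<dots> = exp (s * y)" by (simp add: powr_def)
    also have "\<dots> \<le> exp 1" using \<open>s * y \<le> 1\<close> by simp
    also have "\<dots> \<le> 3" using exp_le by simp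
    finally have "(1 + y) powr s \<le> 3" .
    moreover have "0 \<le> ((s + 2) * \<theta>) powr s * jw s k" by simp
    ultimately show ?thesis unfolding gw_def y_def by linarith
  next
    case False
    have "y \<le> \<theta> * jap (of_int k)" using assms by (auto simp: y_def jap_def intro!: mult_left_mono)
    have "1 + y \<le> (s + 2) * y" using False by (simp add: algebra_simps)
    also have "\<dots> \<le> (s + 2) * (\<theta> * jap (of_int k))"
      using assms \<open>y \<le> _\<close> by (intro mult_left_mono) auto
    finally have "(1 + y) powr s \<le> ((s + 2) * \<theta> * jap (of_int k)) powr s"
      using y assms by (intro powr_mono2) (auto simp: mult.assoc)
    also have "\<dots> = ((s + 2) * \<theta>) powr s * jw s k"
      unfolding jw_def using assms jap_ge_1[of "of_int k"] by (simp add: powr_mult)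
    finally show ?thesis unfolding gw_def y_def by linarith
  qed
qed

lemma jw_le_gw:
  assumes "0 < \<theta>" "\<theta> \<le> 1" "s \<ge> 0"
  shows "jw s k \<le> \<theta> powr (-s) * gw \<theta> s k"
proof -
  have "\<theta> * jap (of_int k) \<le> \<theta> * (1 + \<bar>of_int k\<bar>)"
    using assms by (intro mult_left_mono) (auto simp: jap_def)
  then have "\<theta> * jap (of_int k) \<le> 1 + \<theta> * \<bar>of_int k\<bar>"
    using assms by (simp add: algebra_simps)
  then have "(\<theta> * jap (of_int k)) powr s \<le> gw \<theta> s k"
    unfolding gw_def using assms jap_ge_1[of "of_int k"] by (intro powr_mono2) auto
  then have "\<theta> powr s * jw s k \<le> gw \<theta> s k"
    unfolding jw_def using assms jap_ge_1[of "of_int k"] by (simp add: powr_mult)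
  then show ?thesis using assms by (simp add: powr_minus field_simps)
qed

lemma weight_choice:
  fixes s \<epsilon> N :: real
  assumes "s > 0" "\<epsilon> > 0" "N \<ge> 0"
  obtains \<theta> where "0 < \<theta>" "\<theta> \<le> 1" "((s + 2) * \<theta>) powr s * N \<le> \<epsilon>"
    "\<theta> powr (-s) = (s + 2) powr s * (1 + N / \<epsilon>)"
proof
  define t where "t = \<epsilon> / (\<epsilon> + N)"
  have t: "0 < t" "t \<le> 1" using assms by (simp_all add: t_def add_pos_nonneg)
  define \<theta> where "\<theta> = t powr (1/s) / (s + 2)"
  show "0 < \<theta>" using t assms by (simp add: \<theta>_def)
  have "t powr (1/s) \<le> 1" using t assms by (simp add: powr_le1)
  then show "\<theta> \<le> 1" using assms by (simp add: \<theta>_def)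
  have p: "((s + 2) * \<theta>) powr s = t" using t assms by (simp add: \<theta>_def powr_powr)
  show "((s + 2) * \<theta>) powr s * N \<le> \<epsilon>"
    unfolding p using assms by (simp add: t_def field_simps)
  have "\<theta> powr s = t / (s + 2) powr s"
    using t assms by (simp add: \<theta>_def powr_powr powr_divide)
  then show "\<theta> powr (-s) = (s + 2) powr s * (1 + N / \<epsilon>)"
    using assms by (simp add: powr_minus t_def field_simps)
qed

subsection \<open>Absolutely convergent Fourier series\<close>

text \<open>Absolute convergence allows the series to be integrated term by term.\<close>

lemma synthesis:
  assumes w: "l1le (\<lambda>_. 1) w M"
  obtains f where "cper f" "fc f = w" "\<And>x. ((\<lambda>k. w k * ek k x) has_sum f x) UNIV"
    "\<And>x. cmod (f x) \<le> M"
proof -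
  note s = l1le_1_summable[OF w]
  have "(\<lambda>k. cmod (w k * ek k x)) summable_on UNIV" for x
    using s(1) by (simp add: norm_mult)
  then have sum: "((\<lambda>k. w k * ek k x) has_sum (\<Sum>\<^sub>\<infinity>k. w k * ek k x)) UNIV" for x
    by (rule has_sum_infsum[OF abs_summable_summable])
  define f where "f x = (\<Sum>\<^sub>\<infinity>k. w k * ek k x)" for x
  have f: "((\<lambda>k. w k * ek k x) has_sum f x) UNIV" for x using sum by (simp add: f_def)
  have g: "cper (\<lambda>x. w k * ek k x)" for k by (intro cper_intros)
  have cper: "cper f"
    by (rule cper_series[OF g _ s(1) f]) (simp add: norm_mult)
  have "((\<lambda>k. fc (\<lambda>x. w k * ek k x) n) has_sum fc f n) UNIV" for n
    by (rule fc_series[OF g _ s(1) f]) (simp add: norm_mult)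
  then have "((\<lambda>k. w k * (if n = k then 1 else 0)) has_sum fc f n) UNIV" for n
    by (simp add: fc_cmult fc_ek)
  moreover have "((\<lambda>k. w k * (if n = k then 1 else 0)) has_sum w n) UNIV" for n
    by (rule has_sum_finite_neutralI[of "{n}"]) auto
  ultimately have "fc f = w" by (auto dest: has_sum_unique)
  moreover have "cmod (f x) \<le> M" for x
    using norm_infsum_bound[of "\<lambda>k. w k * ek k x" UNIV] s by (simp add: f_def norm_mult)
  ultimately show ?thesis using that cper f by blast
qed

lemma fourier_inversion:
  assumes f: "cper f" and w: "l1le (\<lambda>_. 1) (fc f) M"
  shows "((\<lambda>k. fc f k * ek k x) has_sum f x) UNIV" "cmod (f x) \<le> M"
proof -
  obtain g where g: "cper g" "fc g = fc f" "\<And>x. ((\<lambda>k. fc f k * ek k x) has_sum g x) UNIV"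
    "\<And>x. cmod (g x) \<le> M" using synthesis[OF w] by metis
  have "g x = f x" by (rule fc_unique) (use f g in auto)
  then show "((\<lambda>k. fc f k * ek k x) has_sum f x) UNIV" "cmod (f x) \<le> M"
    using g(3)[of x] g(4)[of x] by simp_all
qed

lemma tendsto_L2_set [tendsto_intros]:
  assumes "\<And>i. i \<in> I \<Longrightarrow> ((\<lambda>x. f x i) \<longlongrightarrow> l i) F"
  shows "((\<lambda>x. L2_set (f x) I) \<longlongrightarrow> L2_set l I) F"
  unfolding L2_set_def by (intro tendsto_intros assms)

lemma L2_set_sum_le:
  "finite X \<Longrightarrow> L2_set (\<lambda>n. \<Sum>i\<in>X. g i n) F \<le> (\<Sum>i\<in>X. L2_set (g i) F)"
proof (induction X rule: finite_induct)
  case empty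
  then show ?case by (simp add: L2_set_def)
next
  case (insert a X)
  have "L2_set (\<lambda>n. \<Sum>i\<in>insert a X. g i n) F = L2_set (\<lambda>n. g a n + (\<Sum>i\<in>X. g i n)) F"
    using insert by simp
  also have "\<dots> \<le> L2_set (g a) F + L2_set (\<lambda>n. \<Sum>i\<in>X. g i n) F"
    by (rule L2_set_triangle_ineq)
  finally show ?case using insert by simp
qed

text \<open>Minkowski's inequality for series, in the weighted \<open>l\<^sup>2\<close> and \<open>l\<^sup>1\<close> norms.\<close>

lemma L2_set_series:
  fixes G :: "'i \<Rightarrow> int \<Rightarrow> complex"
  assumes F: "finite F" and \<omega>: "\<And>n. \<omega> n \<ge> 0"
    and H: "\<And>n. n \<in> F \<Longrightarrow> ((\<lambda>i. G i n) has_sum H n) UNIV"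
    and M: "\<And>i. L2_set (\<lambda>n. \<omega> n * cmod (G i n)) F \<le> M i"
    and S: "\<And>X. finite X \<Longrightarrow> sum M X \<le> S"
  shows "L2_set (\<lambda>n. \<omega> n * cmod (H n)) F \<le> S"
proof (rule tendsto_upperbound)
  show "((\<lambda>X. L2_set (\<lambda>n. \<omega> n * cmod (\<Sum>i\<in>X. G i n)) F) \<longlongrightarrow> L2_set (\<lambda>n. \<omega> n * cmod (H n)) F)
      (finite_subsets_at_top UNIV)"
    by (intro tendsto_intros) (use H in \<open>simp add: has_sum_def\<close>)
  have "L2_set (\<lambda>n. \<omega> n * cmod (\<Sum>i\<in>X. G i n)) F \<le> S" if X: "finite X" for X
  proof -
    have "\<omega> n * cmod (\<Sum>i\<in>X. G i n) \<le> (\<Sum>i\<in>X. \<omega> n * cmod (G i n))" for n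
      unfolding sum_distrib_left [symmetric] by (intro mult_left_mono norm_sum \<omega>)
    then have "L2_set (\<lambda>n. \<omega> n * cmod (\<Sum>i\<in>X. G i n)) F \<le> L2_set (\<lambda>n. \<Sum>i\<in>X. \<omega> n * cmod (G i n)) F"
      by (intro L2_set_mono) (auto simp: \<omega>)
    also have "\<dots> \<le> (\<Sum>i\<in>X. M i)"
      by (rule order_trans[OF L2_set_sum_le[OF X]]) (intro sum_mono M)
    finally show ?thesis using S[OF X] by linarith
  qed
  then show "eventually (\<lambda>X. L2_set (\<lambda>n. \<omega> n * cmod (\<Sum>i\<in>X. G i n)) F \<le> S) (finite_subsets_at_top UNIV)"
    by (auto intro: eventually_finite_subsets_at_top_weakI)
qed auto

lemma L1_series:
  fixes G :: "'i \<Rightarrow> int \<Rightarrow> complex"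
  assumes F: "finite F" and \<omega>: "\<And>n. \<omega> n \<ge> 0"
    and H: "\<And>n. n \<in> F \<Longrightarrow> ((\<lambda>i. G i n) has_sum H n) UNIV"
    and M: "\<And>i. (\<Sum>n\<in>F. \<omega> n * cmod (G i n)) \<le> M i"
    and S: "\<And>X. finite X \<Longrightarrow> sum M X \<le> S"
  shows "(\<Sum>n\<in>F. \<omega> n * cmod (H n)) \<le> S"
proof (rule tendsto_upperbound)
  show "((\<lambda>X. \<Sum>n\<in>F. \<omega> n * cmod (\<Sum>i\<in>X. G i n)) \<longlongrightarrow> (\<Sum>n\<in>F. \<omega> n * cmod (H n)))
      (finite_subsets_at_top UNIV)"
    by (intro tendsto_intros) (use H in \<open>simp add: has_sum_def\<close>)
  have "(\<Sum>n\<in>F. \<omega> n * cmod (\<Sum>i\<in>X. G i n)) \<le> S" if X: "finite X" for X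
  proof -
    have "(\<Sum>n\<in>F. \<omega> n * cmod (\<Sum>i\<in>X. G i n)) \<le> (\<Sum>n\<in>F. \<Sum>i\<in>X. \<omega> n * cmod (G i n))"
      unfolding sum_distrib_left [symmetric] by (intro sum_mono mult_left_mono norm_sum \<omega>)
    also have "\<dots> = (\<Sum>i\<in>X. \<Sum>n\<in>F. \<omega> n * cmod (G i n))" by (rule sum.swap)
    also have "\<dots> \<le> (\<Sum>i\<in>X. M i)" by (intro sum_mono M)
    finally show ?thesis using S[OF X] by linarith
  qed
  then show "eventually (\<lambda>X. (\<Sum>n\<in>F. \<omega> n * cmod (\<Sum>i\<in>X. G i n)) \<le> S) (finite_subsets_at_top UNIV)"
    by (auto intro: eventually_finite_subsets_at_top_weakI)
qed auto

subsection \<open>Products\<close>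

lemma fc_mult:
  assumes f: "cper f" and w: "l1le (\<lambda>_. 1) (fc f) M" and g: "cper g"
  shows "((\<lambda>i. fc f i * fc g (n - i)) has_sum fc (\<lambda>x. f x * g x) n) UNIV"
proof -
  obtain B where B: "B > 0" "\<And>x. cmod (g x) \<le> B" using cper_bounded[OF g] by metis
  have "((\<lambda>i. fc (\<lambda>x. fc f i * (ek i x * g x)) n) has_sum fc (\<lambda>x. f x * g x) n) UNIV"
  proof (rule fc_series[where b = "\<lambda>i. cmod (fc f i) * B"])
    show "cper (\<lambda>x. fc f i * (ek i x * g x))" for i by (intro cper_intros g)
    show "cmod (fc f i * (ek i x * g x)) \<le> cmod (fc f i) * B" for i x
      using B by (simp add: norm_mult mult_left_mono)
    show "(\<lambda>i. cmod (fc f i) * B) summable_on UNIV"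
      using l1le_1_summable(1)[OF w] by (rule summable_on_cmult_left)
    show "((\<lambda>i. fc f i * (ek i x * g x)) has_sum f x * g x) UNIV" for x
      using has_sum_cmult_left[OF fourier_inversion(1)[OF f w], of x "g x"] by (simp add: mult.assoc)
  qed
  then show ?thesis by (simp add: fc_cmult fc_shift)
qed

lemma l1le_imp_1:
  assumes "l1le \<omega> w M" "\<And>k. \<omega> k \<ge> 1"
  shows "l1le (\<lambda>_. 1) w M"
proof -
  have "1 * cmod (w k) \<le> 1 * (\<omega> k * cmod (w k))" for k
    using mult_right_mono[OF assms(2), of "cmod (w k)" k] by simp
  from l1le_weaken[OF assms(1) this] show ?thesis by simp
qed

text \<open>Submultiplicative weights make the coefficient sequences a Banach algebra under convolution.\<close>

lemma l1le_mult:
  assumes f: "cper f" "l1le \<omega> (fc f) M" and g: "cper g" "l1le \<omega> (fc g) N"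
    and \<omega>: "\<And>k. \<omega> k \<ge> 1" "\<And>i j. \<omega> (i + j) \<le> \<omega> i * \<omega> j"
  shows "l1le \<omega> (fc (\<lambda>x. f x * g x)) (M * N)"
  unfolding l1le_def
proof safe
  fix F :: "int set" assume F: "finite F"
  have w0: "\<omega> k \<ge> 0" for k using \<omega>(1)[of k] by linarith
  show "(\<Sum>n\<in>F. \<omega> n * cmod (fc (\<lambda>x. f x * g x) n)) \<le> M * N"
  proof (rule L1_series[OF F w0 fc_mult[OF f(1) l1le_imp_1[OF f(2) \<omega>(1)] g(1)]])
    fix i
    have "(\<Sum>n\<in>F. \<omega> n * cmod (fc f i * fc g (n - i))) \<le> (\<Sum>n\<in>F. \<omega> i * cmod (fc f i) * (\<omega> (n - i) * cmod (fc g (n - i))))"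
    proof (rule sum_mono)
      fix n
      show "\<omega> n * cmod (fc f i * fc g (n - i)) \<le> \<omega> i * cmod (fc f i) * (\<omega> (n - i) * cmod (fc g (n - i)))"
        using mult_right_mono[OF \<omega>(2)[of i "n - i"], of "cmod (fc f i) * cmod (fc g (n - i))"]
        by (simp add: norm_mult mult_ac)
    qed
    also have "\<dots> = \<omega> i * cmod (fc f i) * (\<Sum>n\<in>F. \<omega> (n - i) * cmod (fc g (n - i)))"
      by (simp add: sum_distrib_left)
    also have "(\<Sum>n\<in>F. \<omega> (n - i) * cmod (fc g (n - i))) = (\<Sum>m\<in>(\<lambda>n. n - i) ` F. \<omega> m * cmod (fc g m))"
      by (subst sum.reindex) (auto simp: inj_on_def)
    also have "\<omega> i * cmod (fc f i) * \<dots> \<le> \<omega> i * cmod (fc f i) * N"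
      using F by (intro mult_left_mono l1leD[OF g(2)]) (auto simp: w0)
    finally show "(\<Sum>n\<in>F. \<omega> n * cmod (fc f i * fc g (n - i))) \<le> \<omega> i * cmod (fc f i) * N" .
  next
    fix X :: "int set" assume X: "finite X"
    show "(\<Sum>i\<in>X. \<omega> i * cmod (fc f i) * N) \<le> M * N"
      unfolding sum_distrib_right [symmetric]
      by (intro mult_right_mono l1leD[OF f(2) X] l1le_nonneg[OF g(2)])
  qed
qed

lemma l1le_const:
  assumes "\<omega> 0 = 1" shows "l1le \<omega> (fc (\<lambda>x. c)) (cmod c)"
  unfolding l1le_def
proof safe
  fix F :: "int set" assume F: "finite F"
  have e: "fc (\<lambda>x. c) k = c * (if k = 0 then 1 else 0)" for k
    using fc_cmult[of c "ek 0" k] by (simp add: fc_ek)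
  have "(\<Sum>k\<in>F. \<omega> k * cmod (fc (\<lambda>x. c) k)) = (\<Sum>k\<in>F. if k = 0 then cmod c else 0)"
    by (intro sum.cong refl) (auto simp: e norm_mult assms)
  also have "\<dots> \<le> cmod c" using F by (simp add: sum.delta)
  finally show "(\<Sum>k\<in>F. \<omega> k * cmod (fc (\<lambda>x. c) k)) \<le> cmod c" .
qed

lemma l1le_power:
  assumes f: "cper f" "l1le \<omega> (fc f) r"
    and \<omega>: "\<And>k. \<omega> k \<ge> 1" "\<And>i j. \<omega> (i + j) \<le> \<omega> i * \<omega> j" "\<omega> 0 = 1"
  shows "l1le \<omega> (fc (\<lambda>x. f x ^ l)) (r ^ l)"
proof (induction l)
  case 0
  then show ?case using l1le_const[of \<omega> 1] \<omega>(3) by simp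
next
  case (Suc l)
  show ?case using l1le_mult[OF f cper_power[OF f(1)] Suc \<omega>(1,2)] by simp
qed

text \<open>The product estimate that is linear in the high norms: in \<open>\<langle>i + j\<rangle>\<^sup>s \<le> 2\<^sup>s (\<langle>i\<rangle>\<^sup>s + \<langle>j\<rangle>\<^sup>s)\<close> the weight falls on one factor
  only, and Minkowski's inequality needs the other one merely in a low norm.\<close>

lemma l2le_mult:
  assumes f: "cper f" "l1le (jw s) (fc f) Ms" "l1le (\<lambda>_. 1) (fc f) M0" and s: "s \<ge> 0"
    and g: "cper g" "l2le (jw s) (fc g) Ns" "l2le (\<lambda>_. 1) (fc g) N0"
  shows "l2le (jw s) (fc (\<lambda>x. f x * g x)) (2 powr s * (Ms * N0 + M0 * Ns))"
  unfolding l2le_def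
proof safe
  fix F :: "int set" assume F: "finite F"
  note N = l2le_nonneg[OF g(2)] l2le_nonneg[OF g(3)]
  show "L2_set (\<lambda>n. jw s n * cmod (fc (\<lambda>x. f x * g x) n)) F \<le> 2 powr s * (Ms * N0 + M0 * Ns)"
  proof (rule L2_set_series[OF F jw_nonneg fc_mult[OF f(1,3) g(1)]])
    fix i
    define F' where "F' = (\<lambda>n. n - i) ` F"
    have F': "finite F'" using F by (simp add: F'_def)
    have shift: "L2_set (\<lambda>n. h (n - i)) F = L2_set h F'" for h
      unfolding L2_set_def F'_def by (subst sum.reindex) (auto simp: inj_on_def)
    define h where "h m = 2 powr s * cmod (fc f i) * (jw s i * (1 * cmod (fc g m)) + jw s m * cmod (fc g m))" for m
    have "L2_set (\<lambda>n. jw s n * cmod (fc f i * fc g (n - i))) F \<le> L2_set (\<lambda>n. h (n - i)) F"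
    proof (rule L2_set_mono)
      fix n
      show "jw s n * cmod (fc f i * fc g (n - i)) \<le> h (n - i)"
        using mult_right_mono[OF jw_add_le[OF s, of i "n - i"], of "cmod (fc f i) * cmod (fc g (n - i))"]
        by (simp add: h_def norm_mult algebra_simps)
    qed simp
    also have "\<dots> = 2 powr s * cmod (fc f i) * L2_set (\<lambda>m. jw s i * (1 * cmod (fc g m)) + jw s m * cmod (fc g m)) F'"
      unfolding shift[of h] by (subst L2_set_right_distrib) (auto simp: h_def [abs_def])
    also have "\<dots> \<le> 2 powr s * cmod (fc f i) * (jw s i * N0 + Ns)"
    proof (intro mult_left_mono)
      have "L2_set (\<lambda>m. jw s i * (1 * cmod (fc g m)) + jw s m * cmod (fc g m)) F' \<le>
        jw s i * L2_set (\<lambda>m. 1 * cmod (fc g m)) F' + L2_set (\<lambda>m. jw s m * cmod (fc g m)) F'"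
        by (rule order_trans[OF L2_set_triangle_ineq]) (simp add: L2_set_right_distrib)
      also have "\<dots> \<le> jw s i * N0 + Ns"
        by (intro add_mono mult_left_mono l2leD[OF g(2) F'] l2leD[OF g(3) F']) auto
      finally show "L2_set (\<lambda>m. jw s i * (1 * cmod (fc g m)) + jw s m * cmod (fc g m)) F' \<le> jw s i * N0 + Ns" .
    qed auto
    finally show "L2_set (\<lambda>n. jw s n * cmod (fc f i * fc g (n - i))) F \<le> 2 powr s * cmod (fc f i) * (jw s i * N0 + Ns)" .
  next
    fix X :: "int set" assume X: "finite X"
    have "(\<Sum>i\<in>X. 2 powr s * cmod (fc f i) * (jw s i * N0 + Ns)) =
      2 powr s * ((\<Sum>i\<in>X. jw s i * cmod (fc f i)) * N0 + (\<Sum>i\<in>X. 1 * cmod (fc f i)) * Ns)"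
      by (simp add: sum_distrib_left sum_distrib_right sum.distrib [symmetric] algebra_simps)
    also have "\<dots> \<le> 2 powr s * (Ms * N0 + M0 * Ns)"
      by (intro mult_left_mono add_mono mult_right_mono l1leD[OF f(2) X] l1leD[OF f(3) X] N) auto
    finally show "(\<Sum>i\<in>X. 2 powr s * cmod (fc f i) * (jw s i * N0 + Ns)) \<le> 2 powr s * (Ms * N0 + M0 * Ns)" .
  qed
qed

subsection \<open>Bessel's inequality and Parseval's identity for trigonometric polynomials\<close>

lemma cper_cmod_square: "cper f \<Longrightarrow> cper (\<lambda>x. (cmod (f x))\<^sup>2)"
  by (auto simp: cper_def intro!: continuous_intros)

lemma bessel_parseval:
  fixes c :: "int \<Rightarrow> complex"
  assumes g: "cper g" and F: "finite F"
  defines "p \<equiv> (\<lambda>x. \<Sum>n\<in>F. c n * ek n x)"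
  shows bessel: "(\<Sum>n\<in>F. (cmod (fc g n))\<^sup>2) \<le> 1 / (2*pi) * integral {0..2*pi} (\<lambda>x. (cmod (g x))\<^sup>2)"
    and parseval: "1 / (2*pi) * integral {0..2*pi} (\<lambda>x. (cmod (p x))\<^sup>2) = (\<Sum>n\<in>F. (cmod (c n))\<^sup>2)"
proof -
  have msq: "fc (\<lambda>x. h x * cnj (h x)) 0 = of_real (1 / (2*pi) * integral {0..2*pi} (\<lambda>x. (cmod (h x))\<^sup>2))"
    if h: "cper h" for h
  proof -
    have "continuous_on {0..2*pi} (\<lambda>x. (cmod (h x))\<^sup>2)"
      by (intro continuous_intros cper_continuous h)
    from integral_complex_of_real[OF this]
    show ?thesis by (simp add: fc_def complex_norm_square [symmetric])
  qed
  have pairing: "fc (\<lambda>x. (\<Sum>n\<in>F. d n * ek n x) * cnj (h x)) 0 = (\<Sum>n\<in>F. d n * cnj (fc h n))"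
    if h: "cper h" for h d
  proof -
    have "fc (\<lambda>x. (\<Sum>n\<in>F. d n * ek n x) * cnj (h x)) 0 = fc (\<lambda>x. \<Sum>n\<in>F. d n * (ek n x * cnj (h x))) 0"
      by (simp add: sum_distrib_right mult.assoc)
    also have "\<dots> = (\<Sum>n\<in>F. fc (\<lambda>x. d n * (ek n x * cnj (h x))) 0)"
      by (intro fc_sum F cper_mult cper_const cper_ek cper_cnj h)
    finally show ?thesis by (simp add: fc_cmult fc_shift fc_cnj)
  qed
  have cp: "cper (\<lambda>x. \<Sum>n\<in>F. d n * ek n x)" for d by (intro cper_sum cper_mult cper_const cper_ek)
  have fcp: "fc (\<lambda>x. \<Sum>n\<in>F. d n * ek n x) m = (if m \<in> F then d m else 0)" for d m
  proof -
    have "fc (\<lambda>x. \<Sum>n\<in>F. d n * ek n x) m = (\<Sum>n\<in>F. fc (\<lambda>x. d n * ek n x) m)"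
      by (intro fc_sum F cper_mult cper_const cper_ek)
    then show ?thesis using F by (simp add: fc_cmult fc_ek if_distrib[of "\<lambda>x. _ * x"] sum.delta' cong: if_cong)
  qed
  have "complex_of_real (1 / (2*pi) * integral {0..2*pi} (\<lambda>x. (cmod (p x))\<^sup>2)) = (\<Sum>n\<in>F. c n * cnj (c n))"
    unfolding p_def using msq[OF cp] pairing[OF cp] by (simp add: fcp)
  also have "\<dots> = of_real (\<Sum>n\<in>F. (cmod (c n))\<^sup>2)"
    by (simp only: complex_norm_square of_real_sum)
  finally show "1 / (2*pi) * integral {0..2*pi} (\<lambda>x. (cmod (p x))\<^sup>2) = (\<Sum>n\<in>F. (cmod (c n))\<^sup>2)"
    by (simp only: of_real_eq_iff)
  define q where "q x = (\<Sum>n\<in>F. fc g n * ek n x)" for x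
  define S where "S = (\<Sum>n\<in>F. (cmod (fc g n))\<^sup>2)"
  have cq: "cper q" unfolding q_def [abs_def] by (rule cp)
  have S: "(\<Sum>n\<in>F. fc g n * cnj (fc g n)) = of_real S"
    unfolding S_def by (simp only: complex_norm_square of_real_sum)
  have qg: "fc (\<lambda>x. q x * cnj (g x)) 0 = of_real S"
    unfolding q_def pairing[OF g] S ..
  have qq: "fc (\<lambda>x. q x * cnj (q x)) 0 = of_real S"
  proof -
    have "fc q n = fc g n" if "n \<in> F" for n
      using that by (simp add: q_def [abs_def] fcp)
    then have "(\<Sum>n\<in>F. fc g n * cnj (fc q n)) = of_real S"
      unfolding S [symmetric] by (intro sum.cong) auto
    then show ?thesis using pairing[OF cq, of "fc g"] unfolding q_def [symmetric] by simp
  qed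
  have gq: "fc (\<lambda>x. g x * cnj (q x)) 0 = of_real S"
    using fc_cnj[of "\<lambda>x. q x * cnj (g x)" 0] qg by (simp add: mult.commute)
  have c: "cper (\<lambda>x. g x * cnj (g x))" "cper (\<lambda>x. q x * cnj (g x))" "cper (\<lambda>x. g x * cnj (q x))" "cper (\<lambda>x. q x * cnj (q x))"
    by (intro cper_mult cper_cnj g cq)+
  have "fc (\<lambda>x. (g x - q x) * cnj (g x - q x)) 0 =
    fc (\<lambda>x. (g x * cnj (g x) - q x * cnj (g x)) - (g x * cnj (q x) - q x * cnj (q x))) 0"
    by (simp add: algebra_simps)
  also have "\<dots> = fc (\<lambda>x. g x * cnj (g x)) 0 - of_real S"
    by (simp add: fc_diff c cper_diff qg qq gq)
  finally have "complex_of_real (1 / (2*pi) * integral {0..2*pi} (\<lambda>x. (cmod (g x - q x))\<^sup>2)) =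
    of_real (1 / (2*pi) * integral {0..2*pi} (\<lambda>x. (cmod (g x))\<^sup>2) - S)"
    using msq[OF g] msq[OF cper_diff[OF g cq]] by simp
  then have "1 / (2*pi) * integral {0..2*pi} (\<lambda>x. (cmod (g x - q x))\<^sup>2) =
    1 / (2*pi) * integral {0..2*pi} (\<lambda>x. (cmod (g x))\<^sup>2) - S"
    by (simp only: of_real_eq_iff)
  moreover have "integral {0..2*pi} (\<lambda>x. (cmod (g x - q x))\<^sup>2) \<ge> 0"
    by (rule Henstock_Kurzweil_Integration.integral_nonneg)
      (auto intro!: cper_integrable cper_cmod_square cper_diff g cq)
  then have "1 / (2*pi) * integral {0..2*pi} (\<lambda>x. (cmod (g x - q x))\<^sup>2) \<ge> 0" by simp
  ultimately show "(\<Sum>n\<in>F. (cmod (fc g n))\<^sup>2) \<le> 1 / (2*pi) * integral {0..2*pi} (\<lambda>x. (cmod (g x))\<^sup>2)"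
    unfolding S_def by linarith
qed

lemma l2le_of_bounded:
  assumes g: "cper g" "\<And>x. cmod (g x) \<le> B"
  shows "l2le (\<lambda>_. 1) (fc g) B"
  unfolding l2le_def
proof safe
  fix F :: "int set" assume F: "finite F"
  have B: "B \<ge> 0" using g(2)[of 0] norm_ge_zero order_trans by blast
  have "norm (integral {0..2*pi} (\<lambda>x. (cmod (g x))\<^sup>2)) \<le> B\<^sup>2 * (2*pi - 0)"
    by (rule integral_bound) (auto intro!: cper_continuous cper_cmod_square power_mono g)
  then have "1 / (2*pi) * integral {0..2*pi} (\<lambda>x. (cmod (g x))\<^sup>2) \<le> B\<^sup>2"
    by (auto simp: field_simps)
  then have "(\<Sum>n\<in>F. (cmod (fc g n))\<^sup>2) \<le> B\<^sup>2"
    using bessel[OF g(1) F] by linarith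
  then show "L2_set (\<lambda>k. 1 * cmod (fc g k)) F \<le> B"
    unfolding L2_set_def using B by (simp add: real_le_lsqrt sum_nonneg)
qed

subsection \<open>Differentiation and antidifferentiation\<close>

lemma fc_derivative:
  assumes f: "cper f" "cper f'" "\<And>x. (f has_vector_derivative f' x) (at x)"
  shows "fc f' k = \<i> * of_int k * fc f k"
proof -
  have D: "((\<lambda>x. f x * ek (-k) x) has_vector_derivative (f x * (\<i> * of_int (-k) * of_real 1 * ek (-k) x) + f' x * ek (-k) x)) (at x)" for x
    by (intro has_vector_derivative_mult f ek_has_vector_derivative[OF DERIV_ident])
  have "((\<lambda>x. f x * (\<i> * of_int (-k) * of_real 1 * ek (-k) x) + f' x * ek (-k) x) has_integral 0) {0..2*pi}"
    using integral_derivative[OF D, of 0 "2*pi"] cper_at_2pi[OF f(1)] by simp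
  then have 0: "integral {0..2*pi} (\<lambda>x. (- \<i> * of_int k) * (f x * ek (-k) x) + f' x * ek (-k) x) = 0"
    by (intro integral_unique) (simp add: mult_ac)
  have "(\<lambda>x. (- \<i> * of_int k) * (f x * ek (-k) x)) integrable_on {0..2*pi}" "(\<lambda>x. f' x * ek (-k) x) integrable_on {0..2*pi}"
    by (intro cper_integrable cper_mult cper_const cper_ek f)+
  from Henstock_Kurzweil_Integration.integral_add[OF this] 0
  have "integral {0..2*pi} (\<lambda>x. f' x * ek (-k) x) = \<i> * of_int k * integral {0..2*pi} (\<lambda>x. f x * ek (-k) x)"
    by (simp add: algebra_simps)
  then show ?thesis by (simp add: fc_def)
qed

lemma periodic_antiderivative:
  fixes q :: "real \<Rightarrow> complex"
  assumes q: "cper q" "integral {0..2*pi} q = 0" and Q: "\<And>x. (Q has_vector_derivative q x) (at x)"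
  shows "cper Q"
proof -
  have "Q (x + 2*pi) = Q x" for x using integral_period_shift[OF q(1) Q, of x] q(2) by simp
  moreover have "continuous_on UNIV Q"
    using Q by (intro continuous_at_imp_continuous_on) (auto intro: has_vector_derivative_continuous)
  ultimately show ?thesis by (simp add: cper_def)
qed

lemma series_derivative:
  assumes f: "cper f" and w: "l1le (\<lambda>_. 1) (\<lambda>k. \<i> * of_int k * fc f k) M"
  obtains f' where "cper f'" "\<And>x. (f has_vector_derivative f' x) (at x)"
    "\<And>k. fc f' k = \<i> * of_int k * fc f k" "\<And>x. cmod (f' x) \<le> M"
proof -
  obtain g where g: "cper g" "fc g = (\<lambda>k. \<i> * of_int k * fc f k)" "\<And>x. cmod (g x) \<le> M"
    using synthesis[OF w] by metis
  obtain G where G: "\<And>x. (G has_vector_derivative g x) (at x)"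
    using ex_antiderivative[OF cper_continuous[OF g(1)]] by metis
  have "fc g 0 = 0" by (simp add: g)
  then have "integral {0..2*pi} g = 0" by (simp add: fc_def)
  from periodic_antiderivative[OF g(1) this G] have cG: "cper G" .
  define c where "c = fc f 0 - fc G 0"
  have fcc: "fc (\<lambda>x. c) k = (if k = 0 then c else 0)" for k
    using fc_cmult[of c "ek 0" k] by (simp add: fc_ek)
  have "fc f k = fc (\<lambda>x. G x + c) k" for k
  proof (cases "k = 0")
    case True
    then show ?thesis using fcc[of 0] by (simp add: fc_add[OF cG cper_const]) (simp add: c_def)
  next
    case False
    then show ?thesis using fc_derivative[OF cG g(1) G, of k] g(2) fcc[of k]
      by (simp add: fc_add[OF cG cper_const])
  qed
  then have "f x = G x + c" for x
    by (rule fc_unique[OF f cper_add[OF cG cper_const]])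
  then have eq: "f = (\<lambda>x. G x + c)" by (rule ext)
  have "((\<lambda>x. G x + c) has_vector_derivative g x + 0) (at x)" for x
    by (intro has_vector_derivative_add G has_vector_derivative_const)
  then have D: "(f has_vector_derivative g x) (at x)" for x unfolding eq by simp
  show ?thesis by (rule that[OF g(1) D fun_cong[OF g(2)] g(3)])
qed

section \<open>Composition with a diffeomorphism of the circle\<close>

text \<open>Neumann's series in the Banach algebra of coefficient sequences.\<close>

lemma l1le_reciprocal:
  assumes g: "cper g" "l1le \<omega> (fc g) (1/2)"
    and \<omega>: "\<And>k. \<omega> k \<ge> 1" "\<And>i j. \<omega> (i + j) \<le> \<omega> i * \<omega> j" "\<omega> 0 = 1"
  shows "g x \<noteq> 1" "cper (\<lambda>x. 1 / (1 - g x))" "l1le \<omega> (fc (\<lambda>x. 1 / (1 - g x))) 2"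
proof -
  have bd: "cmod (g x) \<le> 1/2" for x
    using fourier_inversion(2)[OF g(1) l1le_imp_1[OF g(2) \<omega>(1)]] .
  show "g x \<noteq> 1" for x using bd[of x] by auto
  have pw: "cmod (g x ^ l) \<le> (1/2) ^ l" for x l
    unfolding norm_power by (intro power_mono bd) auto
  have sm: "(\<lambda>l. (1/2::real) ^ l) summable_on UNIV"
    by (intro summable_on_UNIV_nonneg_real_iff[THEN iffD2]) (auto simp: summable_geometric)
  have "(\<lambda>l. g x ^ l) sums (1 / (1 - g x))" for x
    using bd[of x] by (intro geometric_sums) auto
  then have hs: "((\<lambda>l. g x ^ l) has_sum (1 / (1 - g x))) UNIV" for x
  proof (rule norm_summable_imp_has_sum[rotated])
    show "summable (\<lambda>l. norm (g x ^ l))"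
      using bd[of x] by (simp add: norm_power summable_geometric)
  qed
  show "cper (\<lambda>x. 1 / (1 - g x))"
    by (rule cper_series[OF cper_power[OF g(1)] pw sm hs])
  show "l1le \<omega> (fc (\<lambda>x. 1 / (1 - g x))) 2"
    unfolding l1le_def
  proof safe
    fix F :: "int set" assume F: "finite F"
    have w0: "\<omega> k \<ge> 0" for k using \<omega>(1)[of k] by linarith
    show "(\<Sum>k\<in>F. \<omega> k * cmod (fc (\<lambda>x. 1 / (1 - g x)) k)) \<le> 2"
    proof (rule L1_series[OF F w0 fc_series[OF cper_power[OF g(1)] pw sm hs]])
      show "(\<Sum>n\<in>F. \<omega> n * cmod (fc (\<lambda>x. g x ^ i) n)) \<le> (1/2) ^ i" for i
        by (rule l1leD[OF l1le_power[OF g \<omega>] F])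
      fix X :: "nat set" assume X: "finite X"
      have "sum (\<lambda>l. (1/2::real) ^ l) X \<le> (\<Sum>l. (1/2::real) ^ l)"
        by (intro sum_le_suminf X) (auto simp: summable_geometric)
      also have "\<dots> = 2" by (simp add: suminf_geometric)
      finally show "sum (\<lambda>l. (1/2::real) ^ l) X \<le> 2" .
    qed
  qed
qed

lemma gw_mono: "\<theta> \<ge> 0 \<Longrightarrow> s \<le> t \<Longrightarrow> gw \<theta> s k \<le> gw \<theta> t k"
  unfolding gw_def by (intro powr_mono) auto

lemma gw_nonneg [simp]: "gw \<theta> s k \<ge> 0"
  by (simp add: gw_def)

lemma gw_derivative:
  assumes f: "cper f" "l1le (gw \<theta> (s + 1)) (fc f) M" and "\<theta> > 0" "s \<ge> 0"
  obtains f' where "cper f'" "\<And>x. (f has_vector_derivative f' x) (at x)"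
    "l1le (gw \<theta> s) (fc f') (M / \<theta>)"
proof -
  have le: "gw \<theta> s k * cmod (\<i> * of_int k * fc f k) \<le> (1/\<theta>) * (gw \<theta> (s + 1) k * cmod (fc f k))" for k
  proof -
    have "gw \<theta> (s + 1) k = gw \<theta> s k * (1 + \<theta> * \<bar>of_int k\<bar>)"
      unfolding gw_def using assms(3) by (simp add: powr_add add_pos_nonneg)
    then have "gw \<theta> s k * (\<theta> * \<bar>of_int k\<bar>) \<le> gw \<theta> (s + 1) k"
      by (simp add: distrib_left)
    then have "gw \<theta> s k * \<bar>of_int k\<bar> \<le> gw \<theta> (s + 1) k / \<theta>"
      using assms(3) by (simp add: field_simps)
    from mult_right_mono[OF this, of "cmod (fc f k)"] show ?thesis
      by (simp add: norm_mult mult_ac)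
  qed
  have w: "l1le (gw \<theta> s) (\<lambda>k. \<i> * of_int k * fc f k) (1/\<theta> * M)"
    by (rule l1le_weaken[OF f(2) le]) (use assms in auto)
  obtain f' where f': "cper f'" "\<And>x. (f has_vector_derivative f' x) (at x)"
    "\<And>k. fc f' k = \<i> * of_int k * fc f k"
    using series_derivative[OF f(1) l1le_imp_1[OF w gw_ge_1]] assms by (metis less_eq_real_def)
  have "fc f' = (\<lambda>k. \<i> * of_int k * fc f k)" using f'(3) by (rule ext)
  then have "l1le (gw \<theta> s) (fc f') (M / \<theta>)" using w by simp
  then show ?thesis using that f' by metis
qed

text \<open>The Fourier coefficients of \<open>e\<^sub>k \<circ> \<psi>\<close>, \<open>\<psi> = id + c\<close>, far from the diagonal: the phase
  \<open>-(n-k)x + k c(x)\<close> has derivative at least \<open>|n-k|/2\<close> in modulus, so \<open>m\<close> integrations by parts gain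
  \<open>|n-k|^-m\<close>. Each of them divides by \<open>1 - \<kappa>c'\<close>, \<open>\<kappa> = k/(n-k)\<close>, and differentiates; in the norm with weight
  \<open>(1 + \<theta>|k|)^j\<close> this costs the factor \<open>2/\<theta>\<close> and one unit of \<open>j\<close>.\<close>

lemma fc_ek_compose_far:
  fixes c c' :: "real \<Rightarrow> real"
  assumes c: "\<And>x. (c has_real_derivative c' x) (at x)" "\<And>x. c (x + 2*pi) = c x"
    and c': "cper c'" "l1le (\<lambda>_. 1) (fc (\<lambda>x. of_real (c' x))) (1/16)"
      "l1le (jw m) (fc (\<lambda>x. of_real (c' x))) N"
    and m: "m > 0" and far: "3 * \<bar>k\<bar> \<le> 4 * \<bar>n - k\<bar>" "n \<noteq> k"
  shows "cmod (fc (\<lambda>x. ek k (x + c x)) n) \<le> (2 * (real m + 2)) ^ m * (1 + 16 * N / 3) / \<bar>of_int (n - k)\<bar> ^ m"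
proof -
  have N: "N \<ge> 0" by (rule l1le_nonneg[OF c'(3)])
  obtain \<theta> where \<theta>: "0 < \<theta>" "\<theta> \<le> 1" "((real m + 2) * \<theta>) powr real m * N \<le> 3/16"
    "\<theta> powr (- real m) = (real m + 2) powr real m * (1 + N / (3/16))"
    using weight_choice[of "real m" "3/16" N] m N by auto
  define \<rho> where "\<rho> = n - k"
  define \<kappa> where "\<kappa> = of_int k / (of_int \<rho> :: real)"
  have \<rho>: "\<rho> \<noteq> 0" using far by (simp add: \<rho>_def)
  have \<kappa>: "\<bar>\<kappa>\<bar> \<le> 4/3"
  proof -
    have "3 * \<bar>real_of_int k\<bar> \<le> 4 * \<bar>of_int \<rho>\<bar>" using far(1) unfolding \<rho>_def by linarith
    then show ?thesis using \<rho> by (simp add: \<kappa>_def field_simps)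
  qed
  define g where "g x = of_real \<kappa> * (of_real (c' x) :: complex)" for x
  have cg: "cper g" unfolding g_def [abs_def] by (intro cper_mult cper_const cper_of_real c')
  note \<omega> = gw_ge_1[of \<theta>] gw_submult[of \<theta>]
  have "l1le (gw \<theta> m) (fc (\<lambda>x. of_real (c' x))) (3/8)"
    unfolding l1le_def
  proof safe
    fix F :: "int set" assume F: "finite F"
    let ?w = "fc (\<lambda>x. of_real (c' x))"
    let ?q = "((real m + 2) * \<theta>) powr real m"
    have "(\<Sum>k\<in>F. gw \<theta> m k * cmod (?w k)) \<le> (\<Sum>k\<in>F. 3 * (1 * cmod (?w k)) + ?q * (jw m k * cmod (?w k)))"
    proof (rule sum_mono)
      fix k
      show "gw \<theta> m k * cmod (?w k) \<le> 3 * (1 * cmod (?w k)) + ?q * (jw m k * cmod (?w k))"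
        using mult_right_mono[OF gw_le_jw[of \<theta> m k], of "cmod (?w k)"] \<theta> by (simp add: algebra_simps)
    qed
    also have "\<dots> = 3 * (\<Sum>k\<in>F. 1 * cmod (?w k)) + ?q * (\<Sum>k\<in>F. jw m k * cmod (?w k))"
      by (simp add: sum.distrib sum_distrib_left)
    also have "\<dots> \<le> 3 * (1/16) + ?q * N"
      by (intro add_mono mult_left_mono l1leD[OF c'(2) F] l1leD[OF c'(3) F]) auto
    also have "\<dots> \<le> 3/8" using \<theta>(3) by simp
    finally show "(\<Sum>k\<in>F. gw \<theta> m k * cmod (?w k)) \<le> 3/8" .
  qed
  then have "l1le (gw \<theta> m) (fc g) (4/3 * (3/8))"
  proof (rule l1le_weaken)
    fix k
    have "gw \<theta> m k * cmod (fc g k) = \<bar>\<kappa>\<bar> * (gw \<theta> m k * cmod (fc (\<lambda>x. of_real (c' x)) k))"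
      unfolding g_def [abs_def] by (simp add: fc_cmult norm_mult)
    also have "\<dots> \<le> 4/3 * (gw \<theta> m k * cmod (fc (\<lambda>x. of_real (c' x)) k))"
      by (intro mult_right_mono \<kappa>) auto
    finally show "gw \<theta> m k * cmod (fc g k) \<le> \<dots>" .
  qed simp
  then have g: "l1le (gw \<theta> m) (fc g) (1/2)" by simp
  define M where "M x = 1 / (1 - g x)" for x
  have M: "g x \<noteq> 1" "cper M" "l1le (gw \<theta> m) (fc M) 2" for x
    using l1le_reciprocal[OF cg g] \<omega> \<theta> by (auto simp: M_def [abs_def])
  define E where "E x = ek k (x + c x) * ek (-n) x" for x
  have cont_c: "continuous_on UNIV c"
    using c(1) by (intro continuous_at_imp_continuous_on) (auto intro: DERIV_isCont)
  have cE: "cper E" unfolding E_def [abs_def]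
    by (intro cper_mult cper_ek cper_compose[OF cper_ek] continuous_intros cont_c)
      (auto simp: c(2))
  have dE: "(E has_vector_derivative - \<i> * of_int \<rho> * (1 - g x) * E x) (at x)" for x
  proof -
    have "((\<lambda>x. x + c x) has_real_derivative 1 + c' x) (at x)"
      by (auto intro!: derivative_eq_intros c(1))
    from has_vector_derivative_mult[OF ek_has_vector_derivative[OF this, of k]
        ek_has_vector_derivative[OF DERIV_ident, of "-n"]]
    have "(E has_vector_derivative ek k (x + c x) * (\<i> * of_int (-n) * of_real 1 * ek (-n) x) +
        \<i> * of_int k * of_real (1 + c' x) * ek k (x + c x) * ek (-n) x) (at x)"
      unfolding E_def [abs_def] .
    moreover have "of_int \<rho> * g x = of_int k * of_real (c' x)"
      using \<rho> by (simp add: g_def \<kappa>_def)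
    then have "- \<i> * of_int \<rho> * (1 - g x) * E x = - \<i> * (of_int \<rho> - of_int k * of_real (c' x)) * E x"
      by (simp add: algebra_simps)
    ultimately show ?thesis by (simp add: E_def \<rho>_def algebra_simps)
  qed
  define J where "J f = integral {0..2*pi} (\<lambda>x. E x * f x)" for f
  have step: "\<exists>f. cper f \<and> l1le (gw \<theta> (real m - real j)) (fc f) ((2/\<theta>) ^ j) \<and>
      cmod (J (\<lambda>x. 1)) = cmod (J f) / \<bar>of_int \<rho>\<bar> ^ j" if "j \<le> m" for j
    using that
  proof (induction j)
    case 0
    have "l1le (gw \<theta> m) (fc (\<lambda>x. 1)) (cmod 1)" by (rule l1le_const) simp
    then show ?case by (intro exI[of _ "\<lambda>x. 1"]) simp
  next
    case (Suc j)
    then obtain f where f: "cper f" "l1le (gw \<theta> (real m - real j)) (fc f) ((2/\<theta>) ^ j)"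
      "cmod (J (\<lambda>x. 1)) = cmod (J f) / \<bar>of_int \<rho>\<bar> ^ j" by auto
    have "l1le (gw \<theta> (real m - real j)) (fc M) (1 * 2)"
      by (rule l1le_weaken[OF M(3)]) (use \<theta> in \<open>auto intro!: mult_right_mono gw_mono\<close>)
    then have "l1le (gw \<theta> (real m - real j)) (fc (\<lambda>x. f x * M x)) ((2/\<theta>)^j * (1 * 2))"
      using Suc.prems \<theta> by (intro l1le_mult f M gw_ge_1 gw_submult) auto
    then have fM: "l1le (gw \<theta> (real m - real (Suc j) + 1)) (fc (\<lambda>x. f x * M x)) ((2/\<theta>)^j * 2)"
      by (simp add: algebra_simps)
    have cfM: "cper (\<lambda>x. f x * M x)" by (intro cper_mult f M)
    obtain h where h: "cper h" "\<And>x. ((\<lambda>x. f x * M x) has_vector_derivative h x) (at x)"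
      "l1le (gw \<theta> (real m - real (Suc j))) (fc h) ((2/\<theta>)^j * 2 / \<theta>)"
      using gw_derivative[OF cfM fM] \<theta> Suc.prems by (metis of_nat_le_iff diff_ge_0_iff_ge)
    have D: "((\<lambda>x. E x * (f x * M x)) has_vector_derivative
        (E x * h x + (- \<i> * of_int \<rho> * (1 - g x) * E x) * (f x * M x))) (at x)" for x
      by (intro has_vector_derivative_mult dE h)
    have eqd: "(- \<i> * of_int \<rho> * (1 - g x) * E x) * (f x * M x) = (- \<i> * of_int \<rho>) * (E x * f x)" for x
    proof -
      have "(1 - g x) * M x = 1" using M(1)[of x] by (simp add: M_def)
      then show ?thesis by (metis (no_types, lifting) mult.assoc mult.commute mult.right_neutral)
    qed
    have D: "((\<lambda>x. E x * (f x * M x)) has_vector_derivative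
        (E x * h x + (- \<i> * of_int \<rho>) * (E x * f x))) (at x)" for x using D[of x] unfolding eqd .
    have "((\<lambda>x. E x * h x + (- \<i> * of_int \<rho>) * (E x * f x)) has_integral 0) {0..2*pi}"
      using integral_derivative[OF D, of 0 "2*pi"] cper_at_2pi[OF cper_mult[OF cE cfM]] by simp
    then have "integral {0..2*pi} (\<lambda>x. E x * h x + (- \<i> * of_int \<rho>) * (E x * f x)) = 0"
      by (rule integral_unique)
    moreover have "(\<lambda>x. E x * h x) integrable_on {0..2*pi}" "(\<lambda>x. (- \<i> * of_int \<rho>) * (E x * f x)) integrable_on {0..2*pi}"
      by (intro cper_integrable cper_mult cper_const cE h f)+
    ultimately have "J h = \<i> * of_int \<rho> * J f"
      using Henstock_Kurzweil_Integration.integral_add[of "\<lambda>x. E x * h x" "{0..2*pi}" "\<lambda>x. (- \<i> * of_int \<rho>) * (E x * f x)"]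
      by (simp add: J_def)
    then have "cmod (J f) = cmod (J h) / \<bar>of_int \<rho>\<bar>" using \<rho> by (simp add: norm_mult)
    with f(3) h show ?case by (intro exI[of _ h]) (auto simp: field_simps)
  qed
  obtain f where f: "cper f" "l1le (gw \<theta> (real m - real m)) (fc f) ((2/\<theta>) ^ m)"
      "cmod (J (\<lambda>x. 1)) = cmod (J f) / \<bar>of_int \<rho>\<bar> ^ m" using step[of m] by auto
  have fb: "cmod (f x) \<le> (2/\<theta>) ^ m" for x
    by (rule fourier_inversion(2)[OF f(1) l1le_imp_1[OF f(2) gw_ge_1]]) (use \<theta> in auto)
  have nE: "cmod (E x) = 1" for x by (simp add: E_def norm_mult)
  have "cmod (J f) \<le> (2/\<theta>) ^ m * (2*pi - 0)"
    unfolding J_def by (rule integral_bound)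
      (auto intro!: cper_continuous cper_mult cE f fb simp: norm_mult nE)
  then have "cmod (J f) / (2*pi) \<le> (2/\<theta>) ^ m" by (simp add: pos_divide_le_eq)
  then have "cmod (J f) / (2*pi) / \<bar>of_int \<rho>\<bar> ^ m \<le> (2/\<theta>) ^ m / \<bar>of_int \<rho>\<bar> ^ m"
    by (rule divide_right_mono) simp
  then have "cmod (J (\<lambda>x. 1)) / (2*pi) \<le> (2/\<theta>) ^ m / \<bar>of_int \<rho>\<bar> ^ m"
    unfolding f(3) by (simp add: mult.commute)
  moreover have "fc (\<lambda>x. ek k (x + c x)) n = (1 / (2 * of_real pi)) * J (\<lambda>x. 1)"
    unfolding fc_def J_def E_def by simp
  then have "cmod (fc (\<lambda>x. ek k (x + c x)) n) = cmod (J (\<lambda>x. 1)) / (2*pi)"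
    by (simp add: norm_mult norm_divide)
  moreover have "(2/\<theta>) ^ m = (2 * (real m + 2)) ^ m * (1 + 16 * N / 3)"
  proof -
    have "(1/\<theta>) ^ m = \<theta> powr (- real m)"
      using \<theta>(1) by (simp add: powr_minus powr_realpow power_one_over divide_inverse power_inverse)
    then have "(1/\<theta>) ^ m = (real m + 2) ^ m * (1 + 16 * N / 3)"
      unfolding \<theta>(4) by (simp add: powr_realpow)
    then have "2 ^ m * (1/\<theta>) ^ m = (2 ^ m * (real m + 2) ^ m) * (1 + 16 * N / 3)" by simp
    then show ?thesis by (simp only: power_mult_distrib [symmetric]) (simp add: field_simps)
  qed
  ultimately show ?thesis by (simp add: \<rho>_def)
qed

lemma summable_jw:
  assumes "p > 1/2"
  obtains D where "D \<ge> 0" "\<And>F. finite F \<Longrightarrow> L2_set (jw (-p)) F \<le> D"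
proof -
  have "summable (\<lambda>n. real n powr (-(2*p)))"
    using assms by (subst summable_real_powr_iff) auto
  then have s: "summable (\<lambda>n. real (Suc n) powr (-(2*p)))"
    by (subst summable_Suc_iff)
  define T where "T = (\<Sum>n. real (Suc n) powr (-(2*p)))"
  have part: "(\<Sum>n\<in>A. real (Suc n) powr (-(2*p))) \<le> T" if "finite A" for A
    unfolding T_def by (intro sum_le_suminf s that) auto
  have jw: "(jw (-p) k)\<^sup>2 = jap (of_int k) powr (-(2*p))" for k
    using jap_ge_1[of "of_int k"] unfolding jw_def power2_eq_square by (simp add: powr_add [symmetric])
  have half: "(\<Sum>k\<in>B. (jw (-p) k)\<^sup>2) \<le> T"
    if B: "finite B" "\<And>k. k \<in> B \<Longrightarrow> k \<noteq> 0" "inj_on (\<lambda>k. \<bar>k\<bar>) B" for B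
  proof -
    define \<nu> where "\<nu> k = nat \<bar>k\<bar> - 1" for k :: int
    have inj: "inj_on \<nu> B"
    proof (rule inj_onI)
      fix x y assume xy: "x \<in> B" "y \<in> B" "\<nu> x = \<nu> y"
      then have "x \<noteq> 0" "y \<noteq> 0" using B(2) by metis+
      then have "\<bar>x\<bar> = \<bar>y\<bar>" using xy(3) unfolding \<nu>_def by linarith
      then show "x = y" using inj_onD[OF B(3)] xy by metis
    qed
    have "(\<Sum>k\<in>B. (jw (-p) k)\<^sup>2) = (\<Sum>k\<in>B. real (Suc (\<nu> k)) powr (-(2*p)))"
    proof (rule sum.cong)
      fix k assume "k \<in> B"
      then have "k \<noteq> 0" using B by auto
      then have "jap (of_int k) = real (Suc (\<nu> k))"
        by (auto simp: jap_def \<nu>_def max_def)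
      then show "(jw (-p) k)\<^sup>2 = real (Suc (\<nu> k)) powr (-(2*p))" by (simp add: jw)
    qed auto
    also have "\<dots> = (\<Sum>n\<in>\<nu> ` B. real (Suc n) powr (-(2*p)))"
      using inj by (simp add: sum.reindex)
    also have "\<dots> \<le> T" using B by (intro part) auto
    finally show ?thesis .
  qed
  have T: "T \<ge> 0" using part[of "{}"] by simp
  have "L2_set (jw (-p)) F \<le> sqrt (1 + T + T)" if F: "finite F" for F
  proof -
    have "(\<Sum>k\<in>F. (jw (-p) k)\<^sup>2) \<le> (\<Sum>k\<in>{0} \<union> {k\<in>F. k > 0} \<union> {k\<in>F. k < 0}. (jw (-p) k)\<^sup>2)"
      using F by (intro sum_mono2) auto
    also have "\<dots> = (jw (-p) 0)\<^sup>2 + (\<Sum>k\<in>{k\<in>F. k > 0}. (jw (-p) k)\<^sup>2) + (\<Sum>k\<in>{k\<in>F. k < 0}. (jw (-p) k)\<^sup>2)"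
      using F by (subst sum.union_disjoint; (subst sum.union_disjoint)?) auto
    also have "\<dots> \<le> 1 + T + T"
      by (intro add_mono half) (auto simp: F jw_def jap_def inj_on_def)
    finally show ?thesis unfolding L2_set_def by (rule real_sqrt_le_mono)
  qed
  then show ?thesis using that[of "sqrt (1 + T + T)"] T by auto
qed

lemma has_sum_norm_le:
  fixes f :: "'i \<Rightarrow> 'a::real_normed_vector"
  assumes "(f has_sum S) A" "\<And>X. finite X \<Longrightarrow> X \<subseteq> A \<Longrightarrow> (\<Sum>i\<in>X. norm (f i)) \<le> B"
  shows "norm S \<le> B"
proof (rule tendsto_upperbound)
  show "((\<lambda>X. norm (sum f X)) \<longlongrightarrow> norm S) (finite_subsets_at_top A)"
    using assms(1) by (intro tendsto_intros) (simp add: has_sum_def)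
  show "eventually (\<lambda>X. norm (sum f X) \<le> B) (finite_subsets_at_top A)"
    by (rule eventually_finite_subsets_at_top_weakI) (rule order_trans[OF norm_sum assms(2)])
qed auto

definition blk :: "int \<Rightarrow> nat" where
  "blk k = nat \<lfloor>log 2 (jap (of_int k))\<rfloor>"

lemma blk_bounds: "2 ^ blk k \<le> jap (of_int k)" "jap (of_int k) < 2 ^ Suc (blk k)"
proof -
  have 1: "jap (of_int k) \<ge> 1" by (rule jap_ge_1)
  then have "0 \<le> log 2 (jap (of_int k))" by simp
  then have b: "of_nat (blk k) \<le> log 2 (jap (of_int k))" "log 2 (jap (of_int k)) < of_nat (blk k) + 1"
    unfolding blk_def by (simp_all add: of_nat_nat)
  show "2 ^ blk k \<le> jap (of_int k)"
    using b(1) 1 by (simp add: le_log_iff powr_realpow)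
  have "jap (of_int k) < 2 powr real (Suc (blk k))"
    using b(2) 1 by (subst log_less_iff [symmetric]) auto
  then show "jap (of_int k) < 2 ^ Suc (blk k)"
    by (subst (asm) powr_realpow) auto
qed

text \<open>If \<open>k\<close> and \<open>n\<close> lie in dyadic blocks that are at least three apart, then \<open>|n - k|\<close> is comparable with the larger
  of \<open>\<langle>k\<rangle>\<close> and \<open>\<langle>n\<rangle>\<close>.\<close>

lemma blk_far:
  assumes "\<not> (blk k \<le> blk n + 2 \<and> blk n \<le> blk k + 2)"
  shows "3 * \<bar>k\<bar> \<le> 4 * \<bar>n - k\<bar>" "n \<noteq> k" "3 * jap (of_int n) \<le> 4 * \<bar>of_int (n - k)\<bar>"
proof -
  consider "blk k + 3 \<le> blk n" | "blk n + 3 \<le> blk k" using assms by linarith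
  then have "4 * jap (of_int k) \<le> jap (of_int n) \<or> 4 * jap (of_int n) \<le> jap (of_int k)"
  proof cases
    case 1
    then have "(2::real) ^ (blk k + 3) \<le> 2 ^ blk n" by (intro power_increasing) auto
    then show ?thesis using blk_bounds[of k] blk_bounds[of n] by (simp add: power_add)
  next
    case 2
    then have "(2::real) ^ (blk n + 3) \<le> 2 ^ blk k" by (intro power_increasing) auto
    then show ?thesis using blk_bounds[of k] blk_bounds[of n] by (simp add: power_add)
  qed
  then have "3 * \<bar>real_of_int k\<bar> \<le> 4 * \<bar>real_of_int (n - k)\<bar> \<and> 3 * jap (of_int n) \<le> 4 * \<bar>real_of_int (n - k)\<bar>"
  proof -
    define d where "d = \<bar>real_of_int (n - k)\<bar>"
    have "\<bar>real_of_int n\<bar> \<le> \<bar>real_of_int k\<bar> + d" "\<bar>real_of_int k\<bar> \<le> \<bar>real_of_int n\<bar> + d"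
      unfolding d_def by auto
    moreover assume "4 * jap (of_int k) \<le> jap (of_int n) \<or> 4 * jap (of_int n) \<le> jap (of_int k)"
    ultimately have "3 * \<bar>real_of_int k\<bar> \<le> 4 * d \<and> 3 * jap (of_int n) \<le> 4 * d"
      unfolding jap_def by linarith
    then show ?thesis by (simp add: d_def)
  qed
  then show "3 * \<bar>k\<bar> \<le> 4 * \<bar>n - k\<bar>" "3 * jap (of_int n) \<le> 4 * \<bar>of_int (n - k)\<bar>" by linarith+
  then show "n \<noteq> k" using jap_ge_1[of "of_int n"] by auto
qed

lemma finite_blk_le: "finite {k. blk k \<le> q}"
proof (rule finite_subset)
  show "{k. blk k \<le> q} \<subseteq> {- (2 ^ Suc q) .. 2 ^ Suc q}"
  proof
    fix k assume "k \<in> {k. blk k \<le> q}"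
    then have "(2::real) ^ Suc (blk k) \<le> 2 ^ Suc q" by (intro power_increasing) auto
    then have "\<bar>real_of_int k\<bar> \<le> 2 ^ Suc q"
      using blk_bounds(2)[of k] unfolding jap_def by linarith
    then have "real_of_int \<bar>k\<bar> \<le> real_of_int (2 ^ Suc q)" by simp
    then have "\<bar>k\<bar> \<le> 2 ^ Suc q" by (simp only: of_int_le_iff)
    then show "k \<in> {- (2 ^ Suc q) .. 2 ^ Suc q}" by (auto simp: abs_le_iff)
  qed
qed simp

lemma compose_L2_bound:
  fixes c c' :: "real \<Rightarrow> real"
  assumes c: "\<And>x. (c has_real_derivative c' x) (at x)" "\<And>x. c (x + 2*pi) = c x"
    and c': "cper c'" "\<And>x. \<bar>c' x\<bar> \<le> 1/2" and v: "cper v"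
  shows "integral {0..2*pi} (\<lambda>x. (cmod (v (x + c x)))\<^sup>2) \<le> 2 * integral {0..2*pi} (\<lambda>x. (cmod (v x))\<^sup>2)"
proof -
  have cv: "cper (\<lambda>x. (cmod (v x))\<^sup>2)" by (rule cper_cmod_square[OF v])
  have cont_c: "continuous_on UNIV c"
    using c(1) by (intro continuous_at_imp_continuous_on) (auto intro: DERIV_isCont)
  have cvc: "cper (\<lambda>x. (cmod (v (x + c x)))\<^sup>2)"
    by (intro cper_cmod_square cper_compose[OF v] continuous_intros cont_c) (simp add: c(2))
  have "((\<lambda>x. x + c x) has_real_derivative 1 + c' x) (at x)" for x
    by (auto intro!: derivative_eq_intros c(1))
  from has_integral_substitution_period[OF cv this] c(2)[of 0]
  have "((\<lambda>x. (1 + c' x) * (cmod (v (x + c x)))\<^sup>2) has_integral integral {0..2*pi} (\<lambda>x. (cmod (v x))\<^sup>2)) {0..2*pi}"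
    by simp
  from has_integral_mult_right[OF this, of 2]
  have 1: "((\<lambda>x. 2 * ((1 + c' x) * (cmod (v (x + c x)))\<^sup>2)) has_integral 2 * integral {0..2*pi} (\<lambda>x. (cmod (v x))\<^sup>2)) {0..2*pi}" .
  show ?thesis
  proof (rule has_integral_le[OF integrable_integral[OF cper_integrable[OF cvc]] 1])
    fix x
    have "1 \<le> 2 * (1 + c' x)" using c'(2)[of x] by (simp add: abs_le_iff)
    from mult_right_mono[OF this zero_le_power2[of "cmod (v (x + c x))"]]
    show "(cmod (v (x + c x)))\<^sup>2 \<le> 2 * ((1 + c' x) * (cmod (v (x + c x)))\<^sup>2)"
      by (simp only: mult.assoc mult_1)
  qed
qed

text \<open>Composition with \<open>id + c\<close> in \<open>H\<^sup>s\<close>, any real \<open>s \<ge> 0\<close>. Frequencies are grouped into dyadic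
  blocks. The blocks adjacent to that of \<open>n\<close> are treated together as one trigonometric polynomial, for which
  the change of variables bounds the \<open>L\<^sup>2\<close> norm and \<open>\<langle>n\<rangle>\<^sup>s\<close> is comparable with \<open>\<langle>k\<rangle>\<^sup>s\<close>; all other
  frequencies fall under the far estimate, which is tame.\<close>

theorem l2le_compose:
  fixes c c' :: "real \<Rightarrow> real"
  assumes c: "\<And>x. (c has_real_derivative c' x) (at x)" "\<And>x. c (x + 2*pi) = c x"
    and c': "cper c'" "l1le (\<lambda>_. 1) (fc (\<lambda>x. of_real (c' x))) (1/16)"
      "l1le (jw m) (fc (\<lambda>x. of_real (c' x))) N"
    and s: "s \<ge> 0" and D: "\<And>F. finite F \<Longrightarrow> L2_set (jw (s - real m)) F \<le> D" and m: "m > 0"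
    and u: "l1le (\<lambda>_. 1) u U1" "l2le (jw s) u Us"
    and f: "\<And>x. ((\<lambda>k. u k * ek k (x + c x)) has_sum f x) UNIV"
  shows "l2le (jw s) (fc f) (4 * 8 powr s * Us + (4 * (real m + 2)) ^ m * D * (1 + 16 * N / 3) * U1)"
  unfolding l2le_def
proof safe
  fix F :: "int set" assume F: "finite F"
  define Z where "Z = (2 * (real m + 2)) ^ m * (1 + 16 * N / 3)"
  have Z: "Z \<ge> 0" using l1le_nonneg[OF c'(3)] by (simp add: Z_def)
  have U1: "U1 \<ge> 0" by (rule l1le_nonneg[OF u(1)])
  have Us: "Us \<ge> 0" by (rule l2le_nonneg[OF u(2)])
  have cb: "\<bar>c' x\<bar> \<le> 1/2" for x
    using fourier_inversion(2)[OF cper_of_real[OF c'(1)] c'(2), of x] by simp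
  have cont_c: "continuous_on UNIV c"
    using c(1) by (intro continuous_at_imp_continuous_on) (auto intro: DERIV_isCont)
  have cek: "cper (\<lambda>x. u k * ek k (x + c x))" for k
    by (intro cper_mult cper_const cper_compose[OF cper_ek] continuous_intros cont_c) (simp add: c(2))
  define K where "K n k = fc (\<lambda>x. u k * ek k (x + c x)) n" for n k
  have hs: "((\<lambda>k. K n k) has_sum fc f n) UNIV" for n
    unfolding K_def by (rule fc_series[OF cek _ l1le_1_summable(1)[OF u(1)] f]) (simp add: norm_mult)
  define Nr where "Nr r = {k. blk k \<le> r + 2 \<and> r \<le> blk k + 2}" for r
  have fin: "finite (Nr r)" for r
    by (rule finite_subset[OF _ finite_blk_le[of "r + 2"]]) (auto simp: Nr_def)
  define v where "v r x = (\<Sum>k\<in>Nr r. u k * ek k x)" for r x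
  have cv: "cper (v r)" for r unfolding v_def [abs_def] by (intro cper_sum cper_mult cper_const cper_ek)
  define near where "near n = (\<Sum>k\<in>Nr (blk n). K n k)" for n
  have nearv: "near n = fc (\<lambda>x. v (blk n) (x + c x)) n" for n
    unfolding near_def K_def v_def by (rule fc_sum[OF fin cek, symmetric])
  \<comment> \<open>the far part, pointwise in \<open>n\<close>\<close>
  have far: "cmod (fc f n - near n) \<le> 2 ^ m * Z * U1 * jw (- real m) n" for n
  proof (rule has_sum_norm_le)
    have "((\<lambda>k. if k \<in> Nr (blk n) then K n k else 0) has_sum near n) UNIV"
      unfolding near_def by (rule has_sum_finite_neutralI[OF fin]) auto
    from has_sum_add[OF hs has_sum_cmult_right[OF this, of "-1"]]
    show "((\<lambda>k. K n k - (if k \<in> Nr (blk n) then K n k else 0)) has_sum (fc f n - near n)) UNIV"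
      by simp
    fix X :: "int set" assume X: "finite X"
    have "cmod (K n k - (if k \<in> Nr (blk n) then K n k else 0)) \<le> 2 ^ m * Z * jw (- real m) n * (1 * cmod (u k))" for k
    proof (cases "k \<in> Nr (blk n)")
      case True
      then show ?thesis using Z by simp
    next
      case False
      then have nb: "\<not> (blk k \<le> blk n + 2 \<and> blk n \<le> blk k + 2)" by (simp add: Nr_def)
      define \<rho> where "\<rho> = \<bar>real_of_int (n - k)\<bar>"
      have j: "jap (of_int n) \<le> 2 * \<rho>" "1 \<le> jap (of_int n)"
        using blk_far(3)[OF nb] jap_ge_1[of "of_int n"] by (auto simp: \<rho>_def)
      have "jap (of_int n) ^ m \<le> (2 * \<rho>) ^ m" using j by (intro power_mono) auto
      then have "jw m n \<le> 2 ^ m * \<rho> ^ m"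
        unfolding jw_def using j by (simp add: powr_realpow power_mult_distrib)
      then have "1 / \<rho> ^ m \<le> 2 ^ m * (1 / jw m n)"
        using j by (simp add: field_simps)
      also have "1 / jw m n = jw (- real m) n" by (simp add: jw_def powr_minus_divide)
      finally have "Z * (1 / \<rho> ^ m) \<le> Z * (2 ^ m * jw (- real m) n)" using Z by (intro mult_left_mono)
      moreover have "cmod (fc (\<lambda>x. ek k (x + c x)) n) \<le> Z / \<rho> ^ m"
        unfolding Z_def \<rho>_def by (rule fc_ek_compose_far[OF c c' m blk_far(1,2)[OF nb]])
      ultimately have "cmod (fc (\<lambda>x. ek k (x + c x)) n) \<le> Z * (2 ^ m * jw (- real m) n)" by simp
      then have "cmod (u k) * cmod (fc (\<lambda>x. ek k (x + c x)) n) \<le> cmod (u k) * (Z * (2 ^ m * jw (- real m) n))"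
        by (intro mult_left_mono) auto
      then show ?thesis using False by (simp add: K_def fc_cmult norm_mult mult_ac)
    qed
    then have "(\<Sum>k\<in>X. cmod (K n k - (if k \<in> Nr (blk n) then K n k else 0))) \<le> (\<Sum>k\<in>X. 2 ^ m * Z * jw (- real m) n * (1 * cmod (u k)))"
      by (intro sum_mono)
    also have "\<dots> \<le> 2 ^ m * Z * jw (- real m) n * U1"
      unfolding sum_distrib_left [symmetric] using Z l1leD[OF u(1) X] by (intro mult_left_mono) auto
    finally show "(\<Sum>k\<in>X. cmod (K n k - (if k \<in> Nr (blk n) then K n k else 0))) \<le> 2 ^ m * Z * U1 * jw (- real m) n"
      by (simp add: mult_ac)
  qed
  have "L2_set (\<lambda>n. jw s n * cmod (fc f n - near n)) F \<le> L2_set (\<lambda>n. 2 ^ m * Z * U1 * jw (s - real m) n) F"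
  proof (rule L2_set_mono)
    fix n
    have "jw s n * cmod (fc f n - near n) \<le> jw s n * (2 ^ m * Z * U1 * jw (- real m) n)"
      by (intro mult_left_mono far) auto
    then show "jw s n * cmod (fc f n - near n) \<le> 2 ^ m * Z * U1 * jw (s - real m) n"
      using jw_add[of s "- real m" n] by (simp add: mult_ac)
  qed auto
  also have "\<dots> = 2 ^ m * Z * U1 * L2_set (jw (s - real m)) F"
    using Z U1 by (subst L2_set_right_distrib) auto
  also have "\<dots> \<le> 2 ^ m * Z * U1 * D" using Z U1 by (intro mult_left_mono D F) auto
  finally have farF: "L2_set (\<lambda>n. jw s n * cmod (fc f n - near n)) F \<le> 2 ^ m * Z * U1 * D" .
  \<comment> \<open>the near part, block by block\<close>
  have block: "(\<Sum>n\<in>{n\<in>F. blk n = r}. (jw s n * cmod (near n))\<^sup>2) \<le> 2 * 64 powr s * (\<Sum>k\<in>Nr r. (jw s k * cmod (u k))\<^sup>2)" for r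
  proof -
    define w where "w = (2 powr (s * (real r + 1)))\<^sup>2"
    have "(\<Sum>n\<in>{n\<in>F. blk n = r}. (jw s n * cmod (near n))\<^sup>2) \<le> (\<Sum>n\<in>{n\<in>F. blk n = r}. w * (cmod (fc (\<lambda>x. v r (x + c x)) n))\<^sup>2)"
    proof (rule sum_mono)
      fix n assume n: "n \<in> {n\<in>F. blk n = r}"
      have "jap (of_int n) \<le> 2 powr (real r + 1)"
        using blk_bounds(2)[of n] n powr_realpow[of 2 "Suc r"] by (simp add: add.commute)
      then have "jw s n \<le> (2 powr (real r + 1)) powr s"
        unfolding jw_def using s jap_ge_1[of "of_int n"] by (intro powr_mono2) auto
      then have "jw s n \<le> 2 powr (s * (real r + 1))" by (simp add: powr_powr mult.commute)
      then have "(jw s n)\<^sup>2 \<le> w" unfolding w_def by (intro power_mono) auto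
      then show "(jw s n * cmod (near n))\<^sup>2 \<le> w * (cmod (fc (\<lambda>x. v r (x + c x)) n))\<^sup>2"
        using n by (simp add: nearv power_mult_distrib mult_right_mono)
    qed
    also have "\<dots> = w * (\<Sum>n\<in>{n\<in>F. blk n = r}. (cmod (fc (\<lambda>x. v r (x + c x)) n))\<^sup>2)"
      by (simp add: sum_distrib_left)
    also have "\<dots> \<le> w * (1 / (2*pi) * integral {0..2*pi} (\<lambda>x. (cmod (v r (x + c x)))\<^sup>2))"
    proof (intro mult_left_mono bessel)
      show "cper (\<lambda>x. v r (x + c x))"
        by (intro cper_compose[OF cv] continuous_intros cont_c) (simp add: c(2))
    qed (auto simp: F w_def)
    also have "\<dots> \<le> w * (1 / (2*pi) * (2 * integral {0..2*pi} (\<lambda>x. (cmod (v r x))\<^sup>2)))"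
      by (intro mult_left_mono compose_L2_bound[OF c c'(1) cb cv]) (auto simp: w_def)
    also have "\<dots> = w * (2 * (1 / (2*pi) * integral {0..2*pi} (\<lambda>x. (cmod (v r x))\<^sup>2)))" by simp
    also have "1 / (2*pi) * integral {0..2*pi} (\<lambda>x. (cmod (v r x))\<^sup>2) = (\<Sum>k\<in>Nr r. (cmod (u k))\<^sup>2)"
      unfolding v_def by (rule parseval[OF cv[of r] fin])
    also have "w * (2 * (\<Sum>k\<in>Nr r. (cmod (u k))\<^sup>2)) = (\<Sum>k\<in>Nr r. 2 * (w * (cmod (u k))\<^sup>2))"
      by (simp add: sum_distrib_left mult_ac)
    also have "\<dots> \<le> (\<Sum>k\<in>Nr r. 2 * (64 powr s * (jw s k * cmod (u k))\<^sup>2))"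
    proof (intro sum_mono mult_left_mono)
      fix k assume k: "k \<in> Nr r"
      have "2 powr (real r + 1) \<le> 2 powr (real (blk k + 3))" using k by (auto simp: Nr_def)
      also have "\<dots> = 8 * 2 ^ blk k" by (subst powr_realpow) (auto simp: power_add)
      also have "\<dots> \<le> 8 * jap (of_int k)" using blk_bounds(1)[of k] by simp
      finally have "(2 powr (real r + 1)) powr s \<le> (8 * jap (of_int k)) powr s"
        using s by (intro powr_mono2) auto
      then have "2 powr (s * (real r + 1)) \<le> 8 powr s * jw s k"
        unfolding jw_def using jap_ge_1[of "of_int k"] by (simp add: powr_mult powr_powr mult.commute)
      then have "w \<le> (8 powr s * jw s k)\<^sup>2" unfolding w_def by (intro power_mono) auto
      also have "\<dots> = 64 powr s * (jw s k)\<^sup>2"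
        by (simp add: power_mult_distrib power2_eq_square powr_mult [symmetric])
      finally have "w * (cmod (u k))\<^sup>2 \<le> 64 powr s * (jw s k)\<^sup>2 * (cmod (u k))\<^sup>2"
        by (intro mult_right_mono) auto
      then show "w * (cmod (u k))\<^sup>2 \<le> 64 powr s * (jw s k * cmod (u k))\<^sup>2"
        by (simp add: power_mult_distrib mult_ac)
    qed auto
    finally show ?thesis by (simp add: sum_distrib_left mult_ac)
  qed
  define h where "h k = (jw s k * cmod (u k))\<^sup>2" for k
  define R where "R = blk ` F"
  define Y where "Y = (\<Union>r\<in>R. Nr r)"
  have finR: "finite R" and finY: "finite Y" using F fin by (auto simp: R_def Y_def)
  have "(\<Sum>n\<in>F. (jw s n * cmod (near n))\<^sup>2) = (\<Sum>r\<in>R. \<Sum>n\<in>{n\<in>F. blk n = r}. (jw s n * cmod (near n))\<^sup>2)"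
    unfolding R_def by (rule sum.image_gen[OF F])
  also have "\<dots> \<le> (\<Sum>r\<in>R. 2 * 64 powr s * (\<Sum>k\<in>Nr r. h k))"
    unfolding h_def by (intro sum_mono block)
  also have "\<dots> = 2 * 64 powr s * (\<Sum>r\<in>R. \<Sum>k\<in>Nr r. h k)" by (simp add: sum_distrib_left)
  also have "(\<Sum>r\<in>R. \<Sum>k\<in>Nr r. h k) = (\<Sum>r\<in>R. \<Sum>k | k \<in> Y \<and> k \<in> Nr r. h k)"
    by (intro sum.cong refl) (auto simp: Y_def)
  also have "\<dots> = (\<Sum>k\<in>Y. \<Sum>r | r \<in> R \<and> k \<in> Nr r. h k)"
    by (rule sum.swap_restrict[OF finR finY])
  also have "\<dots> \<le> (\<Sum>k\<in>Y. 5 * h k)"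
  proof (rule sum_mono)
    fix k
    have "{r. r \<in> R \<and> k \<in> Nr r} \<subseteq> {blk k - 2 .. blk k + 2}" by (auto simp: Nr_def)
    from card_mono[OF _ this] have "card {r. r \<in> R \<and> k \<in> Nr r} \<le> 5" by simp
    then have "real (card {r. r \<in> R \<and> k \<in> Nr r}) \<le> 5" by simp
    then show "(\<Sum>r | r \<in> R \<and> k \<in> Nr r. h k) \<le> 5 * h k"
      by (simp add: h_def mult_right_mono)
  qed
  also have "\<dots> = 5 * (\<Sum>k\<in>Y. h k)" by (simp add: sum_distrib_left)
  also have "(\<Sum>k\<in>Y. h k) \<le> Us\<^sup>2"
  proof -
    have "sqrt (\<Sum>k\<in>Y. h k) \<le> Us" using l2leD[OF u(2) finY] by (simp add: L2_set_def h_def)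
    then show ?thesis by (simp add: sqrt_le_D)
  qed
  finally have "(\<Sum>n\<in>F. (jw s n * cmod (near n))\<^sup>2) \<le> 10 * 64 powr s * Us\<^sup>2" by simp
  also have "\<dots> \<le> 16 * (8 powr s * Us)\<^sup>2"
  proof -
    have "(8 powr s)\<^sup>2 = (64 powr s :: real)" by (simp add: power2_eq_square powr_mult [symmetric])
    then show ?thesis by (simp add: power_mult_distrib mult_right_mono)
  qed
  also have "\<dots> = (4 * 8 powr s * Us)\<^sup>2" by (simp add: power_mult_distrib)
  finally have nearF: "L2_set (\<lambda>n. jw s n * cmod (near n)) F \<le> 4 * 8 powr s * Us"
    unfolding L2_set_def using Us by (intro real_le_lsqrt) (auto intro!: sum_nonneg)
  have "L2_set (\<lambda>n. jw s n * cmod (fc f n)) F \<le> L2_set (\<lambda>n. jw s n * cmod (near n) + jw s n * cmod (fc f n - near n)) F"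
  proof (rule L2_set_mono)
    fix n
    have "cmod (fc f n) \<le> cmod (near n) + cmod (fc f n - near n)"
      using norm_triangle_ineq[of "near n" "fc f n - near n"] by simp
    from mult_left_mono[OF this jw_nonneg[of s n]]
    show "jw s n * cmod (fc f n) \<le> jw s n * cmod (near n) + jw s n * cmod (fc f n - near n)"
      by (simp add: distrib_left)
  qed auto
  also have "\<dots> \<le> 4 * 8 powr s * Us + 2 ^ m * Z * U1 * D"
    by (intro order_trans[OF L2_set_triangle_ineq] add_mono nearF farF)
  also have "2 ^ m * Z * U1 * D = (4 * (real m + 2)) ^ m * D * (1 + 16 * N / 3) * U1"
  proof -
    have "(4 * (real m + 2)) ^ m = 2 ^ m * (2 * (real m + 2)) ^ m"
      by (subst power_mult_distrib [symmetric]) simp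
    then show ?thesis by (simp add: Z_def)
  qed
  finally show "L2_set (\<lambda>n. jw s n * cmod (fc f n)) F \<le> 4 * 8 powr s * Us + (4 * (real m + 2)) ^ m * D * (1 + 16 * N / 3) * U1" .
qed

section \<open>Two solutions of Bessel's equation of order one\<close>

subsection \<open>The Bessel function \<open>J\<^sub>1\<close>\<close>

text \<open>The real form of the integral for the Bessel function of order one, and its first two derivatives.\<close>

definition besJ :: "real \<Rightarrow> real" where
  "besJ t = 1 / (2*pi) * integral {0..2*pi} (\<lambda>\<phi>. sin (t * sin \<phi>) * sin \<phi>)"

definition besJ' :: "real \<Rightarrow> real" where
  "besJ' t = 1 / (2*pi) * integral {0..2*pi} (\<lambda>\<phi>. cos (t * sin \<phi>) * (sin \<phi>)\<^sup>2)"

definition besJ'' :: "real \<Rightarrow> real" where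
  "besJ'' t = - (1 / (2*pi)) * integral {0..2*pi} (\<lambda>\<phi>. sin (t * sin \<phi>) * (sin \<phi>) ^ 3)"

lemma integral_parameter_derivative:
  fixes f fx :: "real \<Rightarrow> real \<Rightarrow> real"
  assumes "\<And>x t. ((\<lambda>x. f x t) has_field_derivative fx x t) (at x)"
    "\<And>x. continuous_on UNIV (f x)" "continuous_on UNIV (\<lambda>(x, t). fx x t)"
  shows "((\<lambda>x. integral {0..2*pi} (f x)) has_field_derivative integral {0..2*pi} (fx x0)) (at x0)"
proof -
  have "f x integrable_on cbox 0 (2*pi)" for x
    using continuous_on_subset[OF assms(2)] by (intro integrable_continuous) auto
  moreover have "continuous_on (UNIV \<times> cbox 0 (2*pi)) (\<lambda>(x, t). fx x t)"
    by (rule continuous_on_subset[OF assms(3)]) auto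
  ultimately show ?thesis
    using leibniz_rule_field_derivative[of UNIV 0 "2*pi" f fx x0] assms(1) by simp
qed

lemma besJ_derivative: "(besJ has_field_derivative besJ' t) (at t)"
proof -
  have "((\<lambda>x. integral {0..2*pi} (\<lambda>\<phi>. sin (x * sin \<phi>) * sin \<phi>)) has_field_derivative
      integral {0..2*pi} (\<lambda>\<phi>. cos (t * sin \<phi>) * (sin \<phi>)\<^sup>2)) (at t)"
    by (rule integral_parameter_derivative)
      (auto intro!: derivative_eq_intros continuous_intros simp: case_prod_beta power2_eq_square)
  from DERIV_cmult[OF this, of "1 / (2*pi)"] show ?thesis
    unfolding besJ_def [abs_def] besJ'_def .
qed

lemma besJ'_derivative: "(besJ' has_field_derivative besJ'' t) (at t)"
proof -
  have "((\<lambda>x. integral {0..2*pi} (\<lambda>\<phi>. cos (x * sin \<phi>) * (sin \<phi>)\<^sup>2)) has_field_derivative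
      integral {0..2*pi} (\<lambda>\<phi>. - (sin (t * sin \<phi>) * (sin \<phi>) ^ 3))) (at t)"
    by (rule integral_parameter_derivative)
      (auto intro!: derivative_eq_intros continuous_intros simp: case_prod_beta power2_eq_square power3_eq_cube)
  from DERIV_cmult[OF this, of "1 / (2*pi)"] show ?thesis
    unfolding besJ'_def [abs_def] besJ''_def by simp
qed

text \<open>Bessel's equation: the combination under the integral is the derivative of
  \<open>cos \<phi> sin (t sin \<phi>) - t sin \<phi> cos \<phi> cos (t sin \<phi>)\<close>.\<close>

lemma J_ode: "t\<^sup>2 * besJ'' t + t * besJ' t + (t\<^sup>2 - 1) * besJ t = 0"
proof -
  define D where "D \<phi> = t\<^sup>2 * (- (sin (t * sin \<phi>) * (sin \<phi>) ^ 3)) + t * (cos (t * sin \<phi>) * (sin \<phi>)\<^sup>2)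
    + (t\<^sup>2 - 1) * (sin (t * sin \<phi>) * sin \<phi>)" for \<phi>
  have "((\<lambda>\<phi>. cos \<phi> * sin (t * sin \<phi>) - t * sin \<phi> * cos \<phi> * cos (t * sin \<phi>)) has_vector_derivative D \<phi>) (at \<phi>)" for \<phi>
  proof -
    have c: "cos \<phi> * cos \<phi> = 1 - sin \<phi> * sin \<phi>"
      using sin_cos_squared_add[of \<phi>] by (simp add: power2_eq_square)
    have c': "cos \<phi> * (cos \<phi> * y) = (1 - sin \<phi> * sin \<phi>) * y" for y
      by (simp add: c mult.assoc [symmetric])
    show ?thesis
      unfolding has_real_derivative_iff_has_vector_derivative [symmetric] D_def
      by (rule derivative_eq_intros refl)+
        (simp add: algebra_simps power2_eq_square power3_eq_cube c c')
  qed
  from integral_derivative[OF this, of 0 "2*pi"] have "(D has_integral 0) {0..2*pi}" by simp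
  then have "integral {0..2*pi} D = 0" by (rule integral_unique)
  moreover have "integral {0..2*pi} D = t\<^sup>2 * integral {0..2*pi} (\<lambda>\<phi>. - (sin (t * sin \<phi>) * (sin \<phi>) ^ 3))
     + t * integral {0..2*pi} (\<lambda>\<phi>. cos (t * sin \<phi>) * (sin \<phi>)\<^sup>2)
     + (t\<^sup>2 - 1) * integral {0..2*pi} (\<lambda>\<phi>. sin (t * sin \<phi>) * sin \<phi>)"
    unfolding D_def
    by (subst Henstock_Kurzweil_Integration.integral_add, (intro integrable_continuous_real continuous_intros)+)+
      (simp only: integral_mult_right)
  ultimately have *: "t\<^sup>2 * integral {0..2*pi} (\<lambda>\<phi>. - (sin (t * sin \<phi>) * (sin \<phi>) ^ 3))
     + t * integral {0..2*pi} (\<lambda>\<phi>. cos (t * sin \<phi>) * (sin \<phi>)\<^sup>2)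
     + (t\<^sup>2 - 1) * integral {0..2*pi} (\<lambda>\<phi>. sin (t * sin \<phi>) * sin \<phi>) = 0" by simp
  have J2eq: "besJ'' t = 1 / (2*pi) * integral {0..2*pi} (\<lambda>\<phi>. - (sin (t * sin \<phi>) * (sin \<phi>) ^ 3))"
    by (simp add: besJ''_def)
  have lin: "t\<^sup>2 * (k * x) + t * (k * y) + (t\<^sup>2 - 1) * (k * z) = k * (t\<^sup>2 * x + t * y + (t\<^sup>2 - 1) * z)" for k x y z
    by (simp add: algebra_simps)
  show ?thesis unfolding besJ_def besJ'_def J2eq lin * by simp
qed

lemma besJ_0 [simp]: "besJ 0 = 0"
  by (simp add: besJ_def)

lemma besJ'_0 [simp]: "besJ' 0 = 1/2"
proof -
  have "((\<lambda>\<phi>. \<phi> / 2 - sin \<phi> * cos \<phi> / 2) has_vector_derivative (sin \<phi>)\<^sup>2) (at \<phi>)" for \<phi>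
  proof -
    have "cos \<phi> * cos \<phi> = 1 - sin \<phi> * sin \<phi>"
      using sin_cos_squared_add[of \<phi>] by (simp add: power2_eq_square)
    then have "1/2 - (cos \<phi> * cos \<phi> - sin \<phi> * sin \<phi>) / 2 = (sin \<phi>)\<^sup>2"
      by (simp add: power2_eq_square field_simps)
    moreover have "((\<lambda>\<phi>. \<phi> / 2 - sin \<phi> * cos \<phi> / 2) has_real_derivative
        1/2 - (cos \<phi> * cos \<phi> - sin \<phi> * sin \<phi>) / 2) (at \<phi>)"
      by (auto intro!: derivative_eq_intros)
    ultimately show ?thesis by (simp add: has_real_derivative_iff_has_vector_derivative)
  qed
  from integral_derivative[OF this, of 0 "2*pi"] show ?thesis
    by (simp add: besJ'_def integral_unique)
qed

subsection \<open>A Gaussian integral transform\<close>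

text \<open>\<open>gtrans q z = \<integral>\<^sub>0\<^sup>\<infinity> 2v\<^sup>2 exp(-v\<^sup>2) q(2z + iv\<^sup>2) dv\<close>, written as a series of integrals over unit intervals.\<close>

definition gk :: "real \<Rightarrow> real" where
  "gk v = 2 * v\<^sup>2 * exp (- v\<^sup>2)"

definition garg :: "complex \<Rightarrow> real \<Rightarrow> complex" where
  "garg z v = 2 * z + \<i> * (of_real v)\<^sup>2"

definition gtrans :: "(complex \<Rightarrow> complex) \<Rightarrow> complex \<Rightarrow> complex" where
  "gtrans q z = (\<Sum>n. integral {real n..real n + 1} (\<lambda>v. of_real (gk v) * q (garg z v)))"

definition gpart :: "(complex \<Rightarrow> complex) \<Rightarrow> nat \<Rightarrow> complex \<Rightarrow> complex" where
  "gpart q N z = integral {0..real N} (\<lambda>v. of_real (gk v) * q (garg z v))"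

definition rhp :: "complex set" where
  "rhp = {z. Re z > 0}"

text \<open>A growth condition under which the partial integrals of \<open>gtrans q\<close> converge locally uniformly in the right half-plane.\<close>

definition tempered :: "(complex \<Rightarrow> complex) \<Rightarrow> bool" where
  "tempered q \<longleftrightarrow> (\<forall>e>0. \<exists>K\<ge>0. \<forall>s. Re s \<ge> e \<longrightarrow> cmod (q s) \<le> K * (1 + cmod s))"

lemma open_rhp: "open rhp" and convex_rhp: "convex rhp"
  unfolding rhp_def by (auto intro: open_halfspace_Re_gt convex_halfspace_Re_gt)

lemma Re_garg [simp]: "Re (garg z v) = 2 * Re z"
  by (simp add: garg_def flip: of_real_power)

lemma norm_garg_le: "cmod (garg z v) \<le> 2 * cmod z + v\<^sup>2"
proof -
  have "cmod (garg z v) \<le> cmod (2 * z) + cmod (\<i> * (of_real v)\<^sup>2)"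
    unfolding garg_def by (rule norm_triangle_ineq)
  then show ?thesis by (simp add: norm_mult norm_power)
qed

lemma gk_nonneg [simp]: "gk v \<ge> 0"
  by (simp add: gk_def)

lemma gk_decay:
  assumes "B \<ge> 0"
  shows "gk v * (1 + B + v\<^sup>2) \<le> (40 + 8 * B) * exp (- v)"
proof -
  define y where "y = v\<^sup>2"
  have y: "y \<ge> 0" by (simp add: y_def)
  define e where "e = exp (y / 2)"
  have e: "e > 0" "1 + y/2 + (y/2)\<^sup>2/2 \<le> e"
    using exp_lower_Taylor_quadratic[of "y/2"] y by (auto simp: e_def)
  have "(y/2)\<^sup>2/2 = y\<^sup>2/8" "0 \<le> y\<^sup>2" by (simp_all add: power_divide)
  then have y2: "y\<^sup>2 \<le> 8 * e" "y \<le> 2 * e" using e y by linarith+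
  have "v - y \<le> 1/2 - y/2"
    using zero_le_power2[of "v - 1"] by (simp add: y_def power2_eq_square algebra_simps)
  then have "exp (v - y) \<le> exp (1/2 - y/2)" by simp
  also have "\<dots> = exp (1/2) / e" by (simp add: e_def exp_diff)
  also have "\<dots> \<le> 2 / e"
  proof -
    have "exp (1/2 :: real) \<le> 2" using exp_bound_half[of "1/2::real"] by simp
    then show ?thesis using e by (intro divide_right_mono) auto
  qed
  finally have "2 * y * (1 + B + y) * exp (v - y) \<le> 2 * y * (1 + B + y) * (2 / e)"
    using y assms by (intro mult_left_mono) auto
  also have "\<dots> = (4 * (1 + B) * y + 4 * y\<^sup>2) / e" by (simp add: power2_eq_square algebra_simps add_divide_distrib)
  also have "\<dots> \<le> (4 * (1 + B) * (2 * e) + 4 * (8 * e)) / e"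
    using y2 e assms by (intro divide_right_mono add_mono mult_left_mono) auto
  also have "\<dots> = 40 + 8 * B" using e by (simp add: field_simps)
  finally have "2 * y * (1 + B + y) * exp (v - y) \<le> 40 + 8 * B" .
  have "exp (v - y) * exp (- v) = exp (- y)" by (simp add: exp_add [symmetric])
  with mult_right_mono[OF \<open>2 * y * (1 + B + y) * exp (v - y) \<le> 40 + 8 * B\<close>, of "exp (-v)"]
  have "2 * y * (1 + B + y) * exp (- y) \<le> (40 + 8 * B) * exp (- v)" by (simp add: mult.assoc)
  then show ?thesis by (simp add: gk_def y_def mult_ac)
qed

lemma continuous_gk [continuous_intros]: "continuous_on S f \<Longrightarrow> continuous_on S (\<lambda>x. gk (f x))"
  unfolding gk_def by (intro continuous_intros)

lemma continuous_garg [continuous_intros]: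
  "continuous_on S f \<Longrightarrow> continuous_on S g \<Longrightarrow> continuous_on S (\<lambda>x. garg (f x) (g x))"
  unfolding garg_def by (intro continuous_intros)

lemma continuous_garg_compose:
  assumes "q holomorphic_on rhp" "continuous_on S f" "continuous_on S g" "\<And>x. x \<in> S \<Longrightarrow> f x \<in> rhp"
  shows "continuous_on S (\<lambda>x. of_real (gk (g x)) * q (garg (f x) (g x)))"
proof -
  have "continuous_on S (\<lambda>x. q (garg (f x) (g x)))"
    by (rule continuous_on_compose2[OF holomorphic_on_imp_continuous_on[OF assms(1)]])
      (use assms in \<open>auto intro!: continuous_intros simp: rhp_def\<close>)
  then show ?thesis by (intro continuous_intros assms)
qed

lemma gpart_sum:
  assumes q: "q holomorphic_on rhp" "z \<in> rhp"
  shows "(\<Sum>n<N. integral {real n..real n + 1} (\<lambda>v. of_real (gk v) * q (garg z v))) = gpart q N z"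
proof (induction N)
  case 0
  then show ?case by (simp add: gpart_def)
next
  case (Suc N)
  have "integral {0..real N} (\<lambda>v. of_real (gk v) * q (garg z v)) +
      integral {real N..real N + 1} (\<lambda>v. of_real (gk v) * q (garg z v)) =
      integral {0..real N + 1} (\<lambda>v. of_real (gk v) * q (garg z v))"
    by (intro Henstock_Kurzweil_Integration.integral_combine integrable_continuous_real continuous_garg_compose[OF q(1)]
        continuous_on_const continuous_on_id q(2)) auto
  then show ?case using Suc by (simp add: gpart_def add.commute)
qed

lemma gpart_uniform_limit:
  assumes q: "q holomorphic_on rhp" "tempered q" and S: "\<And>z. z \<in> S \<Longrightarrow> Re z \<ge> e \<and> cmod z \<le> B" "e > 0"
  shows "uniform_limit S (gpart q) (gtrans q) sequentially"
proof (cases "S = {}")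
  case False
  then have B: "B \<ge> 0" using S(1) norm_ge_zero order_trans by blast
  obtain K where K: "K \<ge> 0" "\<And>s. Re s \<ge> 2 * e \<Longrightarrow> cmod (q s) \<le> K * (1 + cmod s)"
    using q(2) S(2) unfolding tempered_def by (metis mult_pos_pos zero_less_numeral)
  define C where "C = K * (40 + 8 * (2 * B))"
  have C: "C \<ge> 0" using K B by (simp add: C_def)
  have Srhp: "S \<subseteq> rhp" using S by (force simp: rhp_def)
  have "uniform_limit S (\<lambda>N z. \<Sum>n<N. integral {real n..real n + 1} (\<lambda>v. of_real (gk v) * q (garg z v)))
      (\<lambda>z. \<Sum>n. integral {real n..real n + 1} (\<lambda>v. of_real (gk v) * q (garg z v))) sequentially"
  proof (rule Weierstrass_m_test)
    fix n z assume z: "z \<in> S"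
    have "norm (integral {real n..real n + 1} (\<lambda>v. of_real (gk v) * q (garg z v))) \<le> C * exp (-1) ^ n * ((real n + 1) - real n)"
    proof (rule integral_bound)
      show "continuous_on {real n..real n + 1} (\<lambda>v. of_real (gk v) * q (garg z v))"
        by (intro continuous_garg_compose q continuous_intros) (use z Srhp in auto)
      fix v assume v: "v \<in> {real n..real n + 1}"
      have "cmod (q (garg z v)) \<le> K * (1 + cmod (garg z v))"
        by (rule K) (use S(1)[OF z] in auto)
      also have "\<dots> \<le> K * (1 + 2 * B + v\<^sup>2)"
        using norm_garg_le[of z v] S(1)[OF z] K(1) by (intro mult_left_mono) auto
      finally have "gk v * cmod (q (garg z v)) \<le> gk v * (K * (1 + 2 * B + v\<^sup>2))"
        by (intro mult_left_mono) auto
      also have "\<dots> = K * (gk v * (1 + 2 * B + v\<^sup>2))" by simp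
      also have "\<dots> \<le> K * ((40 + 8 * (2 * B)) * exp (- v))"
        using B K(1) by (intro mult_left_mono gk_decay) auto
      also have "\<dots> \<le> C * exp (- real n)"
        using v C unfolding C_def by (simp add: mult.assoc [symmetric] mult_left_mono)
      also have "exp (- real n) = exp (-1) ^ n" by (simp add: exp_of_nat_mult [symmetric])
      finally show "norm (of_real (gk v) * q (garg z v)) \<le> C * exp (-1) ^ n" by (simp add: norm_mult)
    qed auto
    then show "norm (integral {real n..real n + 1} (\<lambda>v. of_real (gk v) * q (garg z v))) \<le> C * exp (-1) ^ n"
      by simp
  next
    show "summable (\<lambda>n. C * exp (-1) ^ n :: real)"
      by (intro summable_mult summable_geometric) auto
  qed
  then show ?thesis
    by (subst (asm) uniform_limit_cong'[where g = "gpart q" and i = "gtrans q"])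
      (use gpart_sum[OF q(1)] Srhp in \<open>auto simp: gtrans_def\<close>)
qed auto

lemma gpart_tendsto:
  assumes "q holomorphic_on rhp" "tempered q" "z \<in> rhp"
  shows "(\<lambda>N. gpart q N z) \<longlonglongrightarrow> gtrans q z"
  by (rule tendsto_uniform_limitI[OF gpart_uniform_limit[where S = "{z}" and e = "Re z" and B = "cmod z"]])
    (use assms in \<open>auto simp: rhp_def\<close>)

text \<open>Differentiation under the integral, on finite intervals; the derivatives of locally uniform limits of holomorphic
  functions converge, too.\<close>

lemma gtrans_derivative:
  assumes q: "\<And>s. s \<in> rhp \<Longrightarrow> (q has_field_derivative q' s) (at s)" "q' holomorphic_on rhp"
    and t: "tempered q" "tempered q'" and z: "z \<in> rhp"
  shows "(gtrans q has_field_derivative 2 * gtrans q' z) (at z)"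
proof -
  have hq: "q holomorphic_on rhp"
    using q(1) by (auto simp: holomorphic_on_open[OF open_rhp])
  have D: "(gpart q N has_field_derivative 2 * gpart q' N z) (at z)" if z: "z \<in> rhp" for N z
  proof -
    have "((\<lambda>z. integral (cbox 0 (real N)) (\<lambda>v. of_real (gk v) * q (garg z v))) has_field_derivative
        integral (cbox 0 (real N)) (\<lambda>v. of_real (gk v) * (2 * q' (garg z v)))) (at z within rhp)"
    proof (rule leibniz_rule_field_derivative[OF _ _ _ z convex_rhp])
      fix x t assume x: "x \<in> rhp"
      have "(q has_field_derivative q' (garg x t)) (at (garg x t))" using x by (intro q) (simp add: rhp_def)
      moreover have "((\<lambda>z. garg z t) has_field_derivative 2) (at x within rhp)"
        unfolding garg_def by (auto intro!: derivative_eq_intros)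
      ultimately have "((\<lambda>z. q (garg z t)) has_field_derivative q' (garg x t) * 2) (at x within rhp)"
        by (rule DERIV_chain2)
      then show "((\<lambda>z. of_real (gk t) * q (garg z t)) has_field_derivative of_real (gk t) * (2 * q' (garg x t))) (at x within rhp)"
        by (auto intro!: derivative_eq_intros)
    next
      fix x assume "x \<in> rhp"
      then have "continuous_on (cbox 0 (real N)) (\<lambda>v. of_real (gk v) * q (garg x v))"
        by (intro continuous_garg_compose[OF hq] continuous_on_const continuous_on_id) auto
      then show "(\<lambda>v. of_real (gk v) * q (garg x v)) integrable_on cbox 0 (real N)"
        by (rule integrable_continuous)
    next
      have "continuous_on (rhp \<times> cbox 0 (real N)) (\<lambda>x. 2 * (of_real (gk (snd x)) * q' (garg (fst x) (snd x))))"
        by (intro continuous_on_mult_left continuous_garg_compose[OF q(2)] continuous_intros) auto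
      then show "continuous_on (rhp \<times> cbox 0 (real N)) (\<lambda>(x, t). of_real (gk t) * (2 * q' (garg x t)))"
        by (simp add: case_prod_beta mult_ac)
    qed
    moreover have "(\<lambda>v. of_real (gk v) * (2 * q' (garg z v))) = (\<lambda>v. 2 * (of_real (gk v) * q' (garg z v)))"
      by (simp add: mult_ac)
    ultimately show ?thesis
      using z by (simp add: gpart_def [abs_def] at_within_open[OF _ open_rhp])
  qed
  have "\<exists>g'. \<forall>x\<in>rhp. (gtrans q has_field_derivative g' x) (at x) \<and> ((\<lambda>N. 2 * gpart q' N x) \<longlonglongrightarrow> g' x)"
  proof (rule has_complex_derivative_uniform_sequence[OF open_rhp D])
    fix x assume x: "x \<in> rhp"
    define d where "d = Re x / 2"
    have d: "d > 0" using x by (simp add: d_def rhp_def)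
    have *: "Re z \<ge> d \<and> cmod z \<le> cmod x + d" if "z \<in> cball x d" for z
    proof -
      have n: "cmod (x - z) \<le> d" using that by (simp add: dist_norm)
      have "Re (x - z) \<le> d" using complex_Re_le_cmod[of "x - z"] n by linarith
      moreover have "cmod z \<le> cmod x + cmod (x - z)" using norm_triangle_ineq4[of x "x - z"] by simp
      ultimately show ?thesis using n by (simp add: d_def)
    qed
    have "cball x d \<subseteq> rhp" using * d by (force simp: rhp_def)
    moreover have "uniform_limit (cball x d) (gpart q) (gtrans q) sequentially"
      by (rule gpart_uniform_limit[OF hq t(1) *]) (use d in auto)
    ultimately show "\<exists>d>0. cball x d \<subseteq> rhp \<and> uniform_limit (cball x d) (gpart q) (gtrans q) sequentially"
      using d by blast
  qed
  then obtain g' where g': "(gtrans q has_field_derivative g' z) (at z)" "(\<lambda>N. 2 * gpart q' N z) \<longlonglongrightarrow> g' z"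
    using z by blast
  have "(\<lambda>N. 2 * gpart q' N z) \<longlonglongrightarrow> 2 * gtrans q' z"
    by (intro tendsto_mult_left gpart_tendsto q t z)
  from LIMSEQ_unique[OF g'(2) this] show ?thesis using g'(1) by simp
qed

subsection \<open>The Hankel function\<close>

text \<open>Up to a constant factor \<open>exp (iz) E0(z) / z\<close> is Hankel's integral for the Hankel function of order one, after the
  substitution \<open>t = v\<^sup>2\<close>, which removes the singularity of the integrand at \<open>0\<close>. \<open>E1\<close> and \<open>E2\<close> are the derivatives of \<open>E0\<close>.\<close>

definition E0 :: "complex \<Rightarrow> complex" where "E0 = gtrans csqrt"
definition E1 :: "complex \<Rightarrow> complex" where "E1 = gtrans (\<lambda>s. 1 / csqrt s)"
definition E2 :: "complex \<Rightarrow> complex" where "E2 = gtrans (\<lambda>s. - 1 / csqrt s ^ 3)"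

lemma rhp_not_nonpos: "s \<in> rhp \<Longrightarrow> s \<notin> \<real>\<^sub>\<le>\<^sub>0"
  by (auto simp: rhp_def complex_nonpos_Reals_iff)

lemma csqrt_nonzero: "s \<in> rhp \<Longrightarrow> csqrt s \<noteq> 0"
  by (auto simp: rhp_def)

lemma norm_csqrt: "cmod (csqrt s) = sqrt (cmod s)"
proof -
  have "(cmod (csqrt s))\<^sup>2 = cmod s" by (metis norm_power power2_csqrt)
  then show ?thesis by (metis norm_ge_zero real_sqrt_abs abs_of_nonneg)
qed

lemma csqrt_derivatives:
  assumes "s \<in> rhp"
  shows "(csqrt has_field_derivative 1 / (2 * csqrt s)) (at s)"
    "((\<lambda>s. 1 / csqrt s) has_field_derivative (-1 / csqrt s ^ 3) / 2) (at s)"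
proof -
  show 1: "(csqrt has_field_derivative 1 / (2 * csqrt s)) (at s)"
    using has_field_derivative_csqrt[OF rhp_not_nonpos[OF assms]] unfolding inverse_eq_divide .
  show "((\<lambda>s. 1 / csqrt s) has_field_derivative (-1 / csqrt s ^ 3) / 2) (at s)"
    using DERIV_divide[OF DERIV_const 1 csqrt_nonzero[OF assms], of 1] csqrt_nonzero[OF assms]
    by (simp add: power3_eq_cube mult_ac)
qed

lemma csqrt_holomorphic:
  "csqrt holomorphic_on rhp" "(\<lambda>s. 1 / csqrt s) holomorphic_on rhp" "(\<lambda>s. - 1 / csqrt s ^ 3) holomorphic_on rhp"
proof -
  show c: "csqrt holomorphic_on rhp"
    using csqrt_derivatives(1) by (auto simp: holomorphic_on_open[OF open_rhp])
  show "(\<lambda>s. 1 / csqrt s) holomorphic_on rhp" "(\<lambda>s. - 1 / csqrt s ^ 3) holomorphic_on rhp"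
    using csqrt_nonzero by (auto intro!: holomorphic_intros c)
qed

lemma csqrt_tempered:
  "tempered csqrt" "tempered (\<lambda>s. 1 / csqrt s)" "tempered (\<lambda>s. - 1 / csqrt s ^ 3)"
proof -
  have "sqrt (cmod s) \<le> 1 * (1 + cmod s)" for s
  proof -
    have "cmod s * 1 \<le> (1 + cmod s)\<^sup>2" by (simp add: power2_eq_square algebra_simps)
    then have "sqrt (cmod s) \<le> 1 + cmod s" by (intro real_le_lsqrt) auto
    then show ?thesis by simp
  qed
  then show "tempered csqrt" unfolding tempered_def norm_csqrt by (intro allI impI exI[of _ 1]) auto
  have lb: "sqrt e \<le> cmod (csqrt s)" if "e > 0" "Re s \<ge> e" for e s
    using complex_Re_le_cmod[of s] that by (simp add: norm_csqrt)
  show "tempered (\<lambda>s. 1 / csqrt s)" unfolding tempered_def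
  proof (intro allI impI)
    fix e :: real assume e: "e > 0"
    have "cmod (1 / csqrt s) \<le> (1 / sqrt e) * (1 + cmod s)" if "Re s \<ge> e" for s
    proof -
      have "cmod (1 / csqrt s) \<le> 1 / sqrt e"
        using lb[OF e that] e by (simp add: norm_divide frac_le)
      also have "\<dots> \<le> (1 / sqrt e) * (1 + cmod s)" using e by (simp add: field_simps)
      finally show ?thesis .
    qed
    then show "\<exists>K\<ge>0. \<forall>s. e \<le> Re s \<longrightarrow> cmod (1 / csqrt s) \<le> K * (1 + cmod s)"
      using e by (intro exI[of _ "1 / sqrt e"]) auto
  qed
  show "tempered (\<lambda>s. - 1 / csqrt s ^ 3)" unfolding tempered_def
  proof (intro allI impI)
    fix e :: real assume e: "e > 0"
    have "cmod (- 1 / csqrt s ^ 3) \<le> (1 / sqrt e ^ 3) * (1 + cmod s)" if "Re s \<ge> e" for s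
    proof -
      have "sqrt e ^ 3 \<le> cmod (csqrt s) ^ 3" using lb[OF e that] e by (intro power_mono) auto
      then have "cmod (- 1 / csqrt s ^ 3) \<le> 1 / sqrt e ^ 3"
        using e by (simp add: norm_divide norm_power frac_le)
      also have "\<dots> \<le> (1 / sqrt e ^ 3) * (1 + cmod s)" using e by (simp add: field_simps)
      finally show ?thesis .
    qed
    then show "\<exists>K\<ge>0. \<forall>s. e \<le> Re s \<longrightarrow> cmod (- 1 / csqrt s ^ 3) \<le> K * (1 + cmod s)"
      using e by (intro exI[of _ "1 / sqrt e ^ 3"]) auto
  qed
qed

lemma gpart_cmult:
  "gpart (\<lambda>s. c * q s) N z = c * gpart q N z"
proof -
  have "(\<lambda>v. of_real (gk v) * (c * q (garg z v))) = (\<lambda>v. c * (of_real (gk v) * q (garg z v)))"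
    by (simp add: mult_ac)
  then show ?thesis by (simp add: gpart_def)
qed

lemma tempered_cmult: "tempered q \<Longrightarrow> tempered (\<lambda>s. c * q s)"
  unfolding tempered_def
proof (intro allI impI)
  fix e :: real assume "\<forall>e>0. \<exists>K\<ge>0. \<forall>s. e \<le> Re s \<longrightarrow> cmod (q s) \<le> K * (1 + cmod s)" "e > 0"
  then obtain K where K: "K \<ge> 0" "\<forall>s. e \<le> Re s \<longrightarrow> cmod (q s) \<le> K * (1 + cmod s)" by blast
  then show "\<exists>K\<ge>0. \<forall>s. e \<le> Re s \<longrightarrow> cmod (c * q s) \<le> K * (1 + cmod s)"
    by (intro exI[of _ "cmod c * K"]) (auto simp: norm_mult mult.assoc intro!: mult_left_mono)
qed

lemma gtrans_cmult:
  assumes "q holomorphic_on rhp" "tempered q" "z \<in> rhp"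
  shows "gtrans (\<lambda>s. c * q s) z = c * gtrans q z"
proof -
  have "(\<lambda>N. gpart (\<lambda>s. c * q s) N z) \<longlonglongrightarrow> gtrans (\<lambda>s. c * q s) z"
    by (intro gpart_tendsto holomorphic_intros assms tempered_cmult)
  moreover have "(\<lambda>N. gpart (\<lambda>s. c * q s) N z) \<longlonglongrightarrow> c * gtrans q z"
    unfolding gpart_cmult by (intro tendsto_mult_left gpart_tendsto assms)
  ultimately show ?thesis by (rule LIMSEQ_unique)
qed

lemma E_derivatives:
  assumes "z \<in> rhp"
  shows "(E0 has_field_derivative E1 z) (at z)" "(E1 has_field_derivative E2 z) (at z)"
proof -
  have "(E0 has_field_derivative 2 * gtrans (\<lambda>s. (1/2) * (1 / csqrt s)) z) (at z)"
    unfolding E0_def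
    by (rule gtrans_derivative[OF _ holomorphic_on_mult[OF holomorphic_on_const csqrt_holomorphic(2)]
        csqrt_tempered(1) tempered_cmult[OF csqrt_tempered(2)] assms])
      (use csqrt_derivatives(1) in simp)
  then show "(E0 has_field_derivative E1 z) (at z)"
    unfolding gtrans_cmult[OF csqrt_holomorphic(2) csqrt_tempered(2) assms] E1_def by simp
  have "(E1 has_field_derivative 2 * gtrans (\<lambda>s. (1/2) * (- 1 / csqrt s ^ 3)) z) (at z)"
    unfolding E1_def
    by (rule gtrans_derivative[OF _ holomorphic_on_mult[OF holomorphic_on_const csqrt_holomorphic(3)]
        csqrt_tempered(2) tempered_cmult[OF csqrt_tempered(3)] assms])
      (use csqrt_derivatives(2) in \<open>simp add: mult.commute\<close>)
  then show "(E1 has_field_derivative E2 z) (at z)"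
    unfolding gtrans_cmult[OF csqrt_holomorphic(3) csqrt_tempered(3) assms] E2_def by simp
qed

text \<open>The integrand of the left-hand side is the \<open>v\<close>-derivative of \<open>-v\<^sup>3 exp(-v\<^sup>2) / csqrt(2z + iv\<^sup>2)\<close>.\<close>

lemma E_ode:
  assumes z: "z \<in> rhp"
  shows "z * E2 z + (2 * \<i> * z - 1) * E1 z - \<i> * E0 z = 0"
proof -
  define b where "b v = - (complex_of_real (v ^ 3 * exp (- v\<^sup>2)) / csqrt (garg z v))" for v
  have garg: "garg z v \<in> rhp" for v using z by (simp add: rhp_def)
  have db: "(b has_vector_derivative (z * (of_real (gk v) * (- 1 / csqrt (garg z v) ^ 3))
      + (2 * \<i> * z - 1) * (of_real (gk v) * (1 / csqrt (garg z v))) + (- \<i>) * (of_real (gk v) * csqrt (garg z v)))) (at v)" for v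
  proof -
    define q where "q = csqrt (garg z v)"
    have q0: "q \<noteq> 0" unfolding q_def by (rule csqrt_nonzero[OF garg])
    have q2: "q\<^sup>2 = 2 * z + \<i> * (of_real v)\<^sup>2" by (simp add: q_def garg_def)
    define h where "h w = - (w ^ 3 * exp (- w\<^sup>2) / csqrt (2 * z + \<i> * w\<^sup>2))" for w :: complex
    have nn: "2 * z + \<i> * (of_real v)\<^sup>2 \<notin> \<real>\<^sub>\<le>\<^sub>0"
      using rhp_not_nonpos[OF garg[of v]] by (simp add: garg_def)
    let ?v = "complex_of_real v"
    have "(h has_field_derivative - ((((3 * ?v\<^sup>2) * exp (- ?v\<^sup>2) + ?v ^ 3 * (exp (- ?v\<^sup>2) * (- (2 * ?v)))) * q
        - ?v ^ 3 * exp (- ?v\<^sup>2) * ((\<i> * (2 * ?v)) / (2 * q))) / (q * q))) (at ?v)"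
    proof -
      have d1: "((\<lambda>w. w ^ 3 * exp (- w\<^sup>2)) has_field_derivative
          ((3 * ?v\<^sup>2) * exp (- ?v\<^sup>2) + ?v ^ 3 * (exp (- ?v\<^sup>2) * (- (2 * ?v))))) (at ?v)"
        by (auto intro!: derivative_eq_intros)
      have "((\<lambda>w. 2 * z + \<i> * w\<^sup>2) has_field_derivative \<i> * (2 * ?v)) (at ?v)"
        by (auto intro!: derivative_eq_intros)
      from has_field_derivative_csqrt'[OF this nn]
      have d2: "((\<lambda>w. csqrt (2 * z + \<i> * w\<^sup>2)) has_field_derivative (\<i> * (2 * ?v)) / (2 * q)) (at ?v)"
        unfolding q_def garg_def .
      have qv: "csqrt (2 * z + \<i> * ?v\<^sup>2) = q" by (simp only: q_def garg_def)
      show ?thesis unfolding h_def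
        using DERIV_minus[OF DERIV_divide[OF d1 d2]] q0 unfolding qv by blast
    qed
    from has_vector_derivative_real_field[OF this]
    have "((\<lambda>x. h (of_real x)) has_vector_derivative - ((((3 * ?v\<^sup>2) * exp (- ?v\<^sup>2) + ?v ^ 3 * (exp (- ?v\<^sup>2) * (- (2 * ?v)))) * q
        - ?v ^ 3 * exp (- ?v\<^sup>2) * ((\<i> * (2 * ?v)) / (2 * q))) / (q * q))) (at v)" .
    moreover have "(\<lambda>x. h (of_real x)) = b"
      by (rule ext) (simp add: h_def b_def garg_def exp_of_real [symmetric])
    moreover have "- ((((3 * ?v\<^sup>2) * exp (- ?v\<^sup>2) + ?v ^ 3 * (exp (- ?v\<^sup>2) * (- (2 * ?v)))) * q
        - ?v ^ 3 * exp (- ?v\<^sup>2) * ((\<i> * (2 * ?v)) / (2 * q))) / (q * q)) =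
      z * (of_real (gk v) * (- 1 / q ^ 3)) + (2 * \<i> * z - 1) * (of_real (gk v) * (1 / q)) + (- \<i>) * (of_real (gk v) * q)"
    proof -
      define e where "e = exp (- ?v\<^sup>2)"
      have ge: "of_real (gk v) = 2 * ?v\<^sup>2 * e" by (simp add: gk_def e_def exp_of_real [symmetric])
      have z': "z = (q\<^sup>2 - \<i> * ?v\<^sup>2) / 2" using q2 by simp
      show ?thesis unfolding ge e_def [symmetric] z' using q0
        by (simp add: field_simps power2_eq_square power3_eq_cube)
    qed
    ultimately show ?thesis by (simp add: q_def)
  qed
  have eq: "z * gpart (\<lambda>s. - 1 / csqrt s ^ 3) N z + (2 * \<i> * z - 1) * gpart (\<lambda>s. 1 / csqrt s) N z + (- \<i>) * gpart csqrt N z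
      = b (real N)" for N
  proof -
    have i: "(\<lambda>v. of_real (gk v) * q (garg z v)) integrable_on {0..real N}" if "q holomorphic_on rhp" for q
      by (intro integrable_continuous_real continuous_garg_compose that continuous_intros z)
    have I: "((\<lambda>v. z * (of_real (gk v) * (- 1 / csqrt (garg z v) ^ 3))
      + (2 * \<i> * z - 1) * (of_real (gk v) * (1 / csqrt (garg z v))) + (- \<i>) * (of_real (gk v) * csqrt (garg z v))) has_integral
      z * gpart (\<lambda>s. - 1 / csqrt s ^ 3) N z + (2 * \<i> * z - 1) * gpart (\<lambda>s. 1 / csqrt s) N z + (- \<i>) * gpart csqrt N z) {0..real N}"
      unfolding gpart_def
      by (intro has_integral_add has_integral_mult_right integrable_integral i[OF csqrt_holomorphic(1)] i[OF csqrt_holomorphic(2)] i[OF csqrt_holomorphic(3)])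
    have "((\<lambda>v. z * (of_real (gk v) * (- 1 / csqrt (garg z v) ^ 3))
      + (2 * \<i> * z - 1) * (of_real (gk v) * (1 / csqrt (garg z v))) + (- \<i>) * (of_real (gk v) * csqrt (garg z v))) has_integral
      (b (real N) - b 0)) {0..real N}"
      by (rule integral_derivative[OF db]) simp
    from has_integral_unique[OF I this] show ?thesis by (simp add: b_def)
  qed
  have "(\<lambda>N. b (real N)) \<longlonglongrightarrow> 0"
  proof (rule tendsto_norm_zero_cancel, rule tendsto_sandwich[OF always_eventually always_eventually tendsto_const])
    define r where "r = 1 / sqrt (2 * Re z)"
    have r: "Re z > 0" using z by (simp add: rhp_def)
    show "(\<lambda>N. r * (real N ^ 3 * exp (- real N))) \<longlonglongrightarrow> 0"
    proof -
      have "((\<lambda>x::real. x ^ 3 / exp x) \<longlongrightarrow> 0) at_top" by (rule tendsto_power_div_exp_0)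
      then have "(\<lambda>N. real N ^ 3 / exp (real N)) \<longlonglongrightarrow> 0"
        by (rule filterlim_compose) (rule filterlim_real_sequentially)
      then have "(\<lambda>N. r * (real N ^ 3 / exp (real N))) \<longlonglongrightarrow> r * 0" by (rule tendsto_mult_left)
      then show ?thesis by (simp add: exp_minus divide_inverse)
    qed
    show "\<forall>N. 0 \<le> norm (b (real N))" by simp
    show "\<forall>N. norm (b (real N)) \<le> r * (real N ^ 3 * exp (- real N))"
    proof
      fix N
      have "sqrt (2 * Re z) \<le> cmod (csqrt (garg z (real N)))"
        using complex_Re_le_cmod[of "garg z (real N)"] by (simp add: norm_csqrt)
      then have 1: "1 / cmod (csqrt (garg z (real N))) \<le> r"
        unfolding r_def using r by (intro divide_left_mono) (auto intro!: mult_pos_pos simp: csqrt_nonzero[OF garg])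
      have "real N \<le> (real N)\<^sup>2" by (cases N) (auto simp: power2_eq_square)
      then have "exp (- (real N)\<^sup>2) \<le> exp (- real N)" by simp
      then have 2: "real N ^ 3 * exp (- (real N)\<^sup>2) \<le> real N ^ 3 * exp (- real N)" by (intro mult_left_mono) auto
      have "(1 / cmod (csqrt (garg z (real N)))) * (real N ^ 3 * exp (- (real N)\<^sup>2)) \<le> r * (real N ^ 3 * exp (- real N))"
        by (rule mult_mono[OF 1 2]) (use r in \<open>simp_all add: r_def\<close>)
      moreover have "norm (b (real N)) = (1 / cmod (csqrt (garg z (real N)))) * (real N ^ 3 * exp (- (real N)\<^sup>2))"
        unfolding b_def norm_minus_cancel norm_divide norm_of_real by (simp add: abs_mult)
      ultimately show "norm (b (real N)) \<le> r * (real N ^ 3 * exp (- real N))" by simp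
    qed
  qed
  moreover have L: "(\<lambda>N. z * gpart (\<lambda>s. - 1 / csqrt s ^ 3) N z + (2 * \<i> * z - 1) * gpart (\<lambda>s. 1 / csqrt s) N z + (- \<i>) * gpart csqrt N z)
      \<longlonglongrightarrow> z * E2 z + (2 * \<i> * z - 1) * E1 z + (- \<i>) * E0 z"
    unfolding E0_def E1_def E2_def
    by (intro tendsto_intros gpart_tendsto csqrt_holomorphic csqrt_tempered z)
  ultimately have "z * E2 z + (2 * \<i> * z - 1) * E1 z + (- \<i>) * E0 z = 0"
    unfolding eq by (metis LIMSEQ_unique)
  then show ?thesis by simp
qed

lemma gtrans_bound:
  assumes q: "q holomorphic_on rhp" "tempered q" and z: "z \<in> rhp"
    and K: "\<And>v. v \<ge> 0 \<Longrightarrow> cmod (q (garg z v)) \<le> K * (1 + v\<^sup>2)"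
  shows "cmod (gtrans q z) \<le> 40 * K"
proof -
  have K0: "K \<ge> 0" using order_trans[OF norm_ge_zero K[of 0]] by simp
  have "cmod (gpart q N z) \<le> 40 * K" for N
  proof -
    have ie: "((\<lambda>v. 40 * K * exp (- v)) has_integral (- (40 * K) * exp (- real N) - - (40 * K) * exp (- 0))) {0..real N}"
      by (rule integral_derivative[where f = "\<lambda>v. - (40 * K) * exp (- v)"])
        (auto intro!: derivative_eq_intros simp: has_real_derivative_iff_has_vector_derivative [symmetric])
    have "cmod (gpart q N z) \<le> integral {0..real N} (\<lambda>v. 40 * K * exp (- v))"
      unfolding gpart_def
    proof (rule integral_norm_bound_integral)
      have "continuous_on {0..real N} (\<lambda>v. of_real (gk v) * q (garg z v))"
        by (rule continuous_garg_compose[OF q(1)]) (auto intro!: continuous_intros z)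
      then show "(\<lambda>v. of_real (gk v) * q (garg z v)) integrable_on {0..real N}"
        by (rule integrable_continuous_real)
      show "(\<lambda>v. 40 * K * exp (- v)) integrable_on {0..real N}" using ie by blast
      fix v assume "v \<in> {0..real N}"
      then have "gk v * cmod (q (garg z v)) \<le> gk v * (K * (1 + v\<^sup>2))"
        by (intro mult_left_mono K) auto
      also have "\<dots> = K * (gk v * (1 + 0 + v\<^sup>2))" by simp
      also have "\<dots> \<le> K * ((40 + 8 * 0) * exp (- v))" by (intro mult_left_mono gk_decay K0) auto
      finally show "cmod (of_real (gk v) * q (garg z v)) \<le> 40 * K * exp (- v)"
        by (simp add: norm_mult mult_ac)
    qed
    also have "\<dots> = 40 * K - 40 * K * exp (- real N)" using integral_unique[OF ie] by simp
    also have "\<dots> \<le> 40 * K" using K0 by simp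
    finally show ?thesis .
  qed
  then show ?thesis
    by (intro tendsto_upperbound[OF tendsto_norm[OF gpart_tendsto[OF q z]]] always_eventually) auto
qed

lemma E0_bound:
  assumes "z \<in> rhp" shows "cmod (E0 z) \<le> 40 * (sqrt (2 * cmod z) + 1)"
  unfolding E0_def
proof (rule gtrans_bound[OF csqrt_holomorphic(1) csqrt_tempered(1) assms])
  fix v :: real assume v: "v \<ge> 0"
  define r where "r = sqrt (2 * cmod z)"
  have r: "r \<ge> 0" by (simp add: r_def)
  have "cmod (garg z v) \<le> (r + v)\<^sup>2"
    using norm_garg_le[of z v] v by (simp add: r_def power2_sum add_increasing2)
  then have "cmod (csqrt (garg z v)) \<le> r + v"
    unfolding norm_csqrt using r v by (intro real_le_lsqrt) auto
  also have "v \<le> 1 + v\<^sup>2 \<and> 0 \<le> r * v\<^sup>2" using r zero_le_power2[of "v - 1"] v by (simp add: power2_eq_square algebra_simps)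
  then have "r + v \<le> (r + 1) * (1 + v\<^sup>2)" by (simp add: algebra_simps)
  finally show "cmod (csqrt (garg z v)) \<le> (sqrt (2 * cmod z) + 1) * (1 + v\<^sup>2)" by (simp add: r_def)
qed

lemma E1_bound:
  assumes "z \<in> rhp" shows "cmod (E1 z) \<le> 40 * (1 / sqrt (2 * Re z))"
  unfolding E1_def
proof (rule gtrans_bound[OF csqrt_holomorphic(2) csqrt_tempered(2) assms])
  fix v :: real
  have z: "Re z > 0" using assms by (simp add: rhp_def)
  have "sqrt (2 * Re z) \<le> cmod (csqrt (garg z v))"
    using complex_Re_le_cmod[of "garg z v"] by (simp add: norm_csqrt)
  then have "cmod (1 / csqrt (garg z v)) \<le> 1 / sqrt (2 * Re z)"
    using z by (simp add: norm_divide frac_le)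
  also have "\<dots> \<le> 1 / sqrt (2 * Re z) * (1 + v\<^sup>2)" using z by (simp add: field_simps)
  finally show "cmod (1 / csqrt (garg z v)) \<le> 1 / sqrt (2 * Re z) * (1 + v\<^sup>2)" .
qed

text \<open>A bound from below down to \<open>t = 0\<close>, which shows that the second solution is singular there. The real part of the integrand
  is at least \<open>v\<^sup>3 exp (-v\<^sup>2)\<close>.\<close>

lemma E0_lower:
  assumes t: "t > 0" shows "cmod (E0 (of_real t)) \<ge> 1/10"
proof -
  have z: "complex_of_real t \<in> rhp" using t by (simp add: rhp_def)
  have re: "Re (csqrt (garg (of_real t) v)) \<ge> v / 2" if "v \<ge> 0" for v
  proof -
    have "Im (garg (of_real t) v) = v\<^sup>2" by (simp add: garg_def flip: of_real_power)
    then have "v\<^sup>2 \<le> cmod (garg (of_real t) v)" using abs_Im_le_cmod[of "garg (of_real t) v"] by simp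
    then have "(v/2)\<^sup>2 \<le> (cmod (garg (of_real t) v) + Re (garg (of_real t) v)) / 2"
    proof -
      have "(v/2)\<^sup>2 = v\<^sup>2 / 4" by (simp add: power_divide)
      moreover have "y / 4 \<le> (c + 2 * t) / 2" if "y \<le> c" "0 < t" "0 \<le> y" for y c t :: real
        using that by simp
      from this[OF \<open>v\<^sup>2 \<le> cmod (garg (of_real t) v)\<close> t zero_le_power2]
      have "v\<^sup>2 / 4 \<le> (cmod (garg (of_real t) v) + 2 * t) / 2" .
      ultimately show ?thesis by simp
    qed
    then have "v / 2 \<le> sqrt ((cmod (garg (of_real t) v) + Re (garg (of_real t) v)) / 2)"
      by (rule real_le_rsqrt)
    then show ?thesis by simp
  qed
  have part: "Re (gpart csqrt N (of_real t)) \<ge> 1/10" if N: "N \<ge> 1" for N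
  proof -
    have c: "continuous_on {a..b} (\<lambda>v. of_real (gk v) * csqrt (garg (of_real t) v))" for a b
      by (rule continuous_garg_compose[OF csqrt_holomorphic(1)]) (auto intro!: continuous_intros z)
    have hi: "((\<lambda>v. Re (of_real (gk v) * csqrt (garg (of_real t) v))) has_integral
        Re (integral {a..b} (\<lambda>v. of_real (gk v) * csqrt (garg (of_real t) v)))) {a..b}" for a b
      using has_integral_linear[OF integrable_integral[OF integrable_continuous_real[OF c]] bounded_linear_Re]
      by (simp add: o_def)
    have "gpart csqrt N (of_real t) = integral {0..1} (\<lambda>v. of_real (gk v) * csqrt (garg (of_real t) v)) +
        integral {1..real N} (\<lambda>v. of_real (gk v) * csqrt (garg (of_real t) v))"
      unfolding gpart_def using N
      by (intro Henstock_Kurzweil_Integration.integral_combine[symmetric] integrable_continuous_real c) auto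
    moreover have "Re (integral {1..real N} (\<lambda>v. of_real (gk v) * csqrt (garg (of_real t) v))) \<ge> 0"
    proof (rule has_integral_nonneg[OF hi])
      fix v :: real assume v: "v \<in> {1..real N}"
      then have "0 \<le> v" by simp
      then have "0 \<le> Re (csqrt (garg (of_real t) v))" using re[OF \<open>0 \<le> v\<close>] by linarith
      then show "0 \<le> Re (of_real (gk v) * csqrt (garg (of_real t) v))" by simp
    qed
    moreover have "Re (integral {0..1} (\<lambda>v. of_real (gk v) * csqrt (garg (of_real t) v))) \<ge> 1/10"
    proof -
      have "((\<lambda>v. - ((v\<^sup>2 + 1) * exp (- v\<^sup>2) / 2)) has_vector_derivative v ^ 3 * exp (- v\<^sup>2)) (at v)" for v :: real
        unfolding has_real_derivative_iff_has_vector_derivative [symmetric]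
        by (auto intro!: derivative_eq_intros simp: power2_eq_square power3_eq_cube algebra_simps)
      from integral_derivative[OF this, of 0 1]
      have i: "((\<lambda>v::real. v ^ 3 * exp (- v\<^sup>2)) has_integral (1/2 - exp (-1))) {0..1}" by simp
      have "1/2 - exp (-1) \<le> Re (integral {0..1} (\<lambda>v. of_real (gk v) * csqrt (garg (of_real t) v)))"
      proof (rule has_integral_le[OF i hi])
        fix v :: real assume v: "v \<in> {0..1}"
        have "v ^ 3 * exp (- v\<^sup>2) = gk v * (v / 2)" by (simp add: gk_def power2_eq_square power3_eq_cube)
        also have "\<dots> \<le> gk v * Re (csqrt (garg (of_real t) v))"
          using v by (intro mult_left_mono re) auto
        finally show "v ^ 3 * exp (- v\<^sup>2) \<le> Re (of_real (gk v) * csqrt (garg (of_real t) v))" by simp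
      qed
      moreover have "exp (-1) \<le> (2/5 :: real)"
        using exp_lower_Taylor_quadratic[of "1::real"] by (simp add: exp_minus field_simps)
      ultimately show ?thesis by simp
    qed
    ultimately show ?thesis by simp
  qed
  have "1/10 \<le> Re (E0 (of_real t))"
    unfolding E0_def
    by (rule tendsto_lowerbound[OF tendsto_Re[OF gpart_tendsto[OF csqrt_holomorphic(1) csqrt_tempered(1) z]]])
      (rule eventually_sequentiallyI[of 1], rule part, assumption, simp)
  then show ?thesis using complex_Re_le_cmod[of "E0 (of_real t)"] by linarith
qed

text \<open>\<open>exp (iz) * eta0 z\<close> is a multiple of the Hankel function of order one; \<open>eta0\<close> and \<open>eta1\<close>, the amplitude of
  its derivative, do not oscillate: they are holomorphic and \<open>O(|z|^(-1/2))\<close> in a sector around the real axis.\<close>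

definition eta0 :: "complex \<Rightarrow> complex" where
  "eta0 z = E0 z / z"

definition eta1 :: "complex \<Rightarrow> complex" where
  "eta1 z = \<i> * E0 z / z + E1 z / z - E0 z / z\<^sup>2"

definition eta2 :: "complex \<Rightarrow> complex" where
  "eta2 z = \<i> * eta1 z + (\<i> * E1 z / z - \<i> * E0 z / z\<^sup>2 + E2 z / z - 2 * E1 z / z\<^sup>2 + 2 * E0 z / z ^ 3)"

definition hank :: "real \<Rightarrow> complex" where "hank t = exp (\<i> * of_real t) * eta0 (of_real t)"
definition hank' :: "real \<Rightarrow> complex" where "hank' t = exp (\<i> * of_real t) * eta1 (of_real t)"
definition hank'' :: "real \<Rightarrow> complex" where "hank'' t = exp (\<i> * of_real t) * eta2 (of_real t)"

lemma rhp_nonzero: "z \<in> rhp \<Longrightarrow> z \<noteq> 0"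
  by (auto simp: rhp_def)

lemma eta_derivatives:
  assumes z: "z \<in> rhp"
  shows "(eta0 has_field_derivative (eta1 z - \<i> * eta0 z)) (at z)"
    "(eta1 has_field_derivative (eta2 z - \<i> * eta1 z)) (at z)"
proof -
  note z0 = rhp_nonzero[OF z]
  have "((\<lambda>z. E0 z / z) has_field_derivative (E1 z * z - E0 z * 1) / (z * z)) (at z)"
    by (rule DERIV_divide[OF E_derivatives(1)[OF z] DERIV_ident z0])
  moreover have "(E1 z * z - E0 z * 1) / (z * z) = eta1 z - \<i> * eta0 z"
    using z0 by (simp add: eta1_def eta0_def power2_eq_square field_simps)
  ultimately show "(eta0 has_field_derivative (eta1 z - \<i> * eta0 z)) (at z)"
    by (simp add: eta0_def [abs_def])
  have "((\<lambda>z. \<i> * E0 z / z + E1 z / z - E0 z / z\<^sup>2) has_field_derivative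
      (\<i> * E1 z * z - \<i> * E0 z * 1) / (z * z) + (E2 z * z - E1 z * 1) / (z * z) - (E1 z * z\<^sup>2 - E0 z * (2 * z)) / (z\<^sup>2 * z\<^sup>2)) (at z)"
    by (intro DERIV_diff DERIV_add DERIV_divide DERIV_cmult E_derivatives DERIV_ident z z0)
      (use z0 in \<open>auto intro!: derivative_eq_intros\<close>)
  moreover have "(\<i> * E1 z * z - \<i> * E0 z * 1) / (z * z) + (E2 z * z - E1 z * 1) / (z * z) - (E1 z * z\<^sup>2 - E0 z * (2 * z)) / (z\<^sup>2 * z\<^sup>2)
      = eta2 z - \<i> * eta1 z"
    using z0 by (simp add: eta2_def power2_eq_square power3_eq_cube field_simps)
  ultimately show "(eta1 has_field_derivative (eta2 z - \<i> * eta1 z)) (at z)"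
    by (simp add: eta1_def [abs_def])
qed

lemma eta_holomorphic: "eta0 holomorphic_on rhp" "eta1 holomorphic_on rhp"
  using eta_derivatives by (auto simp: holomorphic_on_open[OF open_rhp])

lemma H_derivatives:
  assumes t: "t > 0"
  shows "(hank has_vector_derivative hank' t) (at t)" "(hank' has_vector_derivative hank'' t) (at t)"
proof -
  have z: "complex_of_real t \<in> rhp" using t by (simp add: rhp_def)
  have e: "((\<lambda>z. exp (\<i> * z)) has_field_derivative (\<i> * exp (\<i> * of_real t))) (at (of_real t))"
    by (auto intro!: derivative_eq_intros)
  have "((\<lambda>z. exp (\<i> * z) * eta0 z) has_field_derivative
      (\<i> * exp (\<i> * of_real t) * eta0 (of_real t) + (eta1 (of_real t) - \<i> * eta0 (of_real t)) * exp (\<i> * of_real t))) (at (of_real t))"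
    by (rule DERIV_mult[OF e eta_derivatives(1)[OF z]])
  moreover have "\<i> * exp (\<i> * of_real t) * eta0 (of_real t) + (eta1 (of_real t) - \<i> * eta0 (of_real t)) * exp (\<i> * of_real t) = hank' t"
    by (simp add: hank'_def algebra_simps)
  ultimately have "((\<lambda>z. exp (\<i> * z) * eta0 z) has_field_derivative hank' t) (at (of_real t))" by simp
  from has_vector_derivative_real_field[OF this]
  show "(hank has_vector_derivative hank' t) (at t)" by (simp add: hank_def [abs_def])
  have "((\<lambda>z. exp (\<i> * z) * eta1 z) has_field_derivative
      (\<i> * exp (\<i> * of_real t) * eta1 (of_real t) + (eta2 (of_real t) - \<i> * eta1 (of_real t)) * exp (\<i> * of_real t))) (at (of_real t))"
    by (rule DERIV_mult[OF e eta_derivatives(2)[OF z]])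
  moreover have "\<i> * exp (\<i> * of_real t) * eta1 (of_real t) + (eta2 (of_real t) - \<i> * eta1 (of_real t)) * exp (\<i> * of_real t) = hank'' t"
    by (simp add: hank''_def algebra_simps)
  ultimately have "((\<lambda>z. exp (\<i> * z) * eta1 z) has_field_derivative hank'' t) (at (of_real t))" by simp
  from has_vector_derivative_real_field[OF this]
  show "(hank' has_vector_derivative hank'' t) (at t)" by (simp add: hank'_def [abs_def])
qed

lemma H_ode:
  assumes t: "t > 0"
  shows "(of_real t)\<^sup>2 * hank'' t + of_real t * hank' t + ((of_real t)\<^sup>2 - 1) * hank t = 0"
proof -
  define z where "z = complex_of_real t"
  have z: "z \<in> rhp" "z \<noteq> 0" using t by (auto simp: rhp_def z_def)
  have "z\<^sup>2 * eta2 z + z * eta1 z + (z\<^sup>2 - 1) * eta0 z = z * E2 z + (2 * \<i> * z - 1) * E1 z - \<i> * E0 z"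
    unfolding eta2_def eta1_def eta0_def using z(2)
    by (simp add: field_simps power2_eq_square power3_eq_cube)
  also have "\<dots> = 0" by (rule E_ode[OF z(1)])
  finally have "exp (\<i> * z) * (z\<^sup>2 * eta2 z + z * eta1 z + (z\<^sup>2 - 1) * eta0 z) = 0" by simp
  then show ?thesis unfolding hank_def hank'_def hank''_def z_def [symmetric] by (simp add: algebra_simps)
qed

lemma J_vector_derivatives:
  "((\<lambda>t. of_real (besJ t) :: complex) has_vector_derivative of_real (besJ' t)) (at t)"
  "((\<lambda>t. of_real (besJ' t) :: complex) has_vector_derivative of_real (besJ'' t)) (at t)"
  using besJ_derivative[of t] besJ'_derivative[of t]
  by (auto simp: has_real_derivative_iff_has_vector_derivative intro!: has_vector_derivative_of_real)

lemma J_ode_complex: "(of_real t)\<^sup>2 * of_real (besJ'' t) + of_real t * of_real (besJ' t) + ((of_real t)\<^sup>2 - 1) * of_real (besJ t) = (0 :: complex)"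
  using arg_cong[OF J_ode[of t], of complex_of_real] by simp

text \<open>The Wronskian of the two solutions is constant by Abel's identity, and it does not vanish because of
  the behaviour of both factors at \<open>0\<close>.\<close>

lemma wronskian:
  obtains c where "c \<noteq> 0" "\<And>t. t > 0 \<Longrightarrow> of_real t * (hank t * of_real (besJ' t) - of_real (besJ t) * hank' t) = c"
proof -
  define W where "W t = of_real t * (hank t * of_real (besJ' t) - of_real (besJ t) * hank' t)" for t
  have D: "(W has_vector_derivative 0) (at t)" if t: "t > 0" for t
  proof -
    have "((\<lambda>t. complex_of_real t) has_vector_derivative 1) (at t)"
      using has_vector_derivative_of_real[OF DERIV_ident[of "at t"], where 'a = complex] by simp
    from has_vector_derivative_mult[OF this has_vector_derivative_diff[OF
        has_vector_derivative_mult[OF H_derivatives(1)[OF t] J_vector_derivatives(2)]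
        has_vector_derivative_mult[OF J_vector_derivatives(1) H_derivatives(2)[OF t]]]]
    have "(W has_vector_derivative (of_real t * (hank t * of_real (besJ'' t) + hank' t * of_real (besJ' t) - (of_real (besJ t) * hank'' t + of_real (besJ' t) * hank' t))
       + 1 * (hank t * of_real (besJ' t) - of_real (besJ t) * hank' t))) (at t)" unfolding W_def [abs_def] .
    moreover have "of_real t * (of_real t * (hank t * of_real (besJ'' t) + hank' t * of_real (besJ' t) - (of_real (besJ t) * hank'' t + of_real (besJ' t) * hank' t))
       + 1 * (hank t * of_real (besJ' t) - of_real (besJ t) * hank' t)) =
       hank t * ((of_real t)\<^sup>2 * of_real (besJ'' t) + of_real t * of_real (besJ' t) + ((of_real t)\<^sup>2 - 1) * of_real (besJ t))
       - of_real (besJ t) * ((of_real t)\<^sup>2 * hank'' t + of_real t * hank' t + ((of_real t)\<^sup>2 - 1) * hank t)"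
      by (simp add: algebra_simps power2_eq_square)
    then have "of_real t * (hank t * of_real (besJ'' t) + hank' t * of_real (besJ' t) - (of_real (besJ t) * hank'' t + of_real (besJ' t) * hank' t))
       + 1 * (hank t * of_real (besJ' t) - of_real (besJ t) * hank' t) = 0"
      unfolding H_ode[OF t] J_ode_complex using t by simp
    ultimately show ?thesis by simp
  qed
  have "\<exists>c. \<forall>t\<in>{0<..}. W t = c"
  proof (rule has_vector_derivative_zero_constant)
    fix t :: real assume "t \<in> {0<..}"
    then show "(W has_vector_derivative 0) (at t within {0<..})"
      using has_vector_derivative_at_within[OF D[of t]] by simp
  qed (simp, blast)
  then obtain c where c: "\<And>t. t > 0 \<Longrightarrow> W t = c" by (metis greaterThan_iff)
  have "c \<noteq> 0"
  proof
    assume c0: "c = 0"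
    \<comment> \<open>If the Wronskian vanished, the left-hand side below, which tends to \<open>1/10\<close> as \<open>t \<rightarrow> 0\<close>, would be bounded by a
      function that tends to \<open>0\<close>.\<close>
    have lower: "cmod (of_real (besJ' t + besJ t / t) - \<i> * of_real (besJ t)) * (1/10) \<le> \<bar>besJ t / t\<bar> * (40 * sqrt (t / 2))" if t: "t > 0" for t
    proof -
      define z where "z = complex_of_real t"
      have z: "z \<in> rhp" "z \<noteq> 0" using t by (auto simp: rhp_def z_def)
      have eq: "W t = exp (\<i> * z) * (E0 z * (of_real (besJ' t + besJ t / t) - \<i> * of_real (besJ t)) - of_real (besJ t) * E1 z)"
        unfolding W_def hank_def hank'_def eta0_def eta1_def z_def [symmetric] using z(2) t
        by (simp add: field_simps power2_eq_square z_def)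
      then have "E0 z * (of_real (besJ' t + besJ t / t) - \<i> * of_real (besJ t)) = of_real (besJ t) * E1 z"
        using c[OF t] c0 by simp
      then have "cmod (E0 z) * cmod (of_real (besJ' t + besJ t / t) - \<i> * of_real (besJ t)) = \<bar>besJ t\<bar> * cmod (E1 z)"
        by (metis norm_mult norm_of_real)
      moreover have "(1/10) * cmod (of_real (besJ' t + besJ t / t) - \<i> * of_real (besJ t)) \<le> cmod (E0 z) * cmod (of_real (besJ' t + besJ t / t) - \<i> * of_real (besJ t))"
        unfolding z_def by (intro mult_right_mono E0_lower t) auto
      moreover have "\<bar>besJ t\<bar> * cmod (E1 z) \<le> \<bar>besJ t\<bar> * (40 * (1 / sqrt (2 * t)))"
        using E1_bound[OF z(1)] by (intro mult_left_mono) (auto simp: z_def)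
      moreover have "\<bar>besJ t\<bar> * (40 * (1 / sqrt (2 * t))) = \<bar>besJ t / t\<bar> * (40 * sqrt (t / 2))"
      proof -
        have "1 / sqrt (2 * t) = sqrt (t / 2) / t"
        proof -
          have "sqrt (t / 2) * sqrt (2 * t) = t" using t by (simp add: real_sqrt_mult [symmetric])
          then show ?thesis using t by (simp add: field_simps)
        qed
        then show ?thesis using t by (simp add: abs_divide)
      qed
      ultimately show ?thesis by linarith
    qed
    have J0t: "((\<lambda>t. besJ t / t) \<longlongrightarrow> 1/2) (at_right 0)"
      using besJ_derivative[of 0] unfolding has_field_derivative_iff
      by (auto intro: filterlim_mono[OF _ order_refl at_within_le_at])
    have J1t: "(besJ' \<longlongrightarrow> 1/2) (at_right 0)"
      using isContD[OF DERIV_isCont[OF besJ'_derivative[of 0]]] by (auto intro: filterlim_mono[OF _ order_refl at_within_le_at])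
    have J00: "(besJ \<longlongrightarrow> 0) (at_right 0)"
      using isContD[OF DERIV_isCont[OF besJ_derivative[of 0]]] by (auto intro: filterlim_mono[OF _ order_refl at_within_le_at])
    have L1: "((\<lambda>t. cmod (of_real (besJ' t + besJ t / t) - \<i> * of_real (besJ t)) * (1/10)) \<longlongrightarrow> cmod (of_real (1/2 + 1/2) - \<i> * of_real 0) * (1/10)) (at_right 0)"
      by (intro tendsto_intros J1t J0t J00)
    have L2: "((\<lambda>t. \<bar>besJ t / t\<bar> * (40 * sqrt (t / 2))) \<longlongrightarrow> \<bar>1/2\<bar> * (40 * sqrt (0 / 2))) (at_right 0)"
    proof (rule tendsto_mult[OF tendsto_rabs[OF J0t]])
      show "((\<lambda>t::real. 40 * sqrt (t / 2)) \<longlongrightarrow> 40 * sqrt (0 / 2)) (at_right 0)"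
        by (rule tendsto_intros | simp)+
    qed
    have "eventually (\<lambda>t. cmod (of_real (besJ' t + besJ t / t) - \<i> * of_real (besJ t)) * (1/10) \<le> \<bar>besJ t / t\<bar> * (40 * sqrt (t / 2))) (at_right 0)"
      by (rule eventually_at_rightI[of 0 1]) (rule lower, simp, simp)
    from tendsto_le[OF trivial_limit_at_right_real L2 L1 this]
    have "cmod (of_real (1/2 + 1/2) - \<i> * of_real 0) * (1/10) \<le> \<bar>1/2::real\<bar> * (40 * sqrt (0 / 2))" .
    then show False by simp
  qed
  then show ?thesis using that c unfolding W_def by blast
qed

subsection \<open>Taylor expansion of the amplitudes\<close>

text \<open>In the sector \<open>Re z\<close> is comparable with \<open>|z|\<close>, so that \<open>E0\<close> is \<open>O(|z|^(1/2))\<close> and \<open>E1\<close> is \<open>O(|z|^(-1/2))\<close>.\<close>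

lemma eta_bounds:
  assumes r: "r > 0"
  obtains C where "C > 0" "\<And>z. \<bar>Im z\<bar> \<le> Re z \<Longrightarrow> cmod z \<ge> r \<Longrightarrow> cmod (eta0 z) \<le> C / sqrt (cmod z)"
    "\<And>z. \<bar>Im z\<bar> \<le> Re z \<Longrightarrow> cmod z \<ge> r \<Longrightarrow> cmod (eta1 z) \<le> C / sqrt (cmod z)"
proof
  define C0 where "C0 = 40 * (sqrt 2 + 1 / sqrt r)"
  define C where "C = C0 * (1 + 1 / r) + 40 / r"
  have C0: "C0 > 0" using r by (simp add: C0_def add_pos_pos)
  show C: "C > 0" using C0 r by (simp add: C_def add_pos_pos)
  fix z assume z: "\<bar>Im z\<bar> \<le> Re z" "cmod z \<ge> r"
  have z0: "cmod z > 0" using z r by linarith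
  then have "Re z \<noteq> 0" using z(1) by (auto simp: complex_eq_iff)
  then have Re: "Re z > 0" using z(1) by linarith
  then have zr: "z \<in> rhp" by (simp add: rhp_def)
  define u where "u = sqrt (cmod z)"
  have u: "u > 0" "u * u = cmod z" "sqrt r \<le> u" using z0 z(2) by (auto simp: u_def)
  have E0: "cmod (E0 z) \<le> C0 * u"
  proof -
    have "1 \<le> u / sqrt r" using u r by simp
    then have "40 * (sqrt 2 * u + 1) \<le> 40 * (sqrt 2 * u + u / sqrt r)" by simp
    then show ?thesis using E0_bound[OF zr] by (simp add: C0_def u_def real_sqrt_mult algebra_simps)
  qed
  have e0: "cmod (E0 z / z) \<le> C0 / u"
  proof -
    have "cmod (E0 z) / cmod z \<le> C0 * u / cmod z" using E0 z0 by (simp add: divide_right_mono)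
    also have "\<dots> = C0 / u" unfolding u(2) [symmetric] using u(1) by simp
    finally show ?thesis by (simp add: norm_divide)
  qed
  have "C0 / u \<le> C / u"
    using u r C0 by (intro divide_right_mono) (auto simp: C_def algebra_simps)
  with e0 show "cmod (eta0 z) \<le> C / sqrt (cmod z)" by (simp add: eta0_def u_def)
  have "(cmod z)\<^sup>2 \<le> (2 * Re z)\<^sup>2"
  proof -
    have "(cmod z)\<^sup>2 = (Re z)\<^sup>2 + (Im z)\<^sup>2" by (rule cmod_power2)
    moreover have "(Im z)\<^sup>2 \<le> (Re z)\<^sup>2" using z(1) by (simp add: abs_le_square_iff [symmetric])
    moreover have "(2 * Re z)\<^sup>2 = 4 * (Re z)\<^sup>2" by (simp add: power_mult_distrib)
    ultimately show ?thesis using zero_le_power2[of "Re z"] by linarith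
  qed
  from power2_le_imp_le[OF this] have "cmod z \<le> 2 * Re z" using Re by linarith
  then have "u \<le> sqrt (2 * Re z)" by (simp add: u_def)
  then have "1 / sqrt (2 * Re z) \<le> 1 / u" using u by (simp add: frac_le)
  then have E1: "cmod (E1 z) \<le> 40 / u" using E1_bound[OF zr] by simp
  have i: "1 / cmod z \<le> 1 / r" using z(2) r by (simp add: frac_le)
  have "cmod (E1 z / z) \<le> 40 / u * (1 / r)"
    unfolding norm_divide using mult_mono[OF E1 i] u by simp
  moreover have "cmod (E0 z / z\<^sup>2) \<le> C0 / u * (1 / r)"
  proof -
    have "cmod (E0 z / z\<^sup>2) = cmod (E0 z / z) * (1 / cmod z)" by (simp add: norm_divide norm_mult power2_eq_square)
    then show ?thesis using mult_mono[OF e0 i] u C0 by simp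
  qed
  moreover have "cmod (\<i> * E0 z / z) \<le> C0 / u" using e0 by (simp add: norm_divide norm_mult)
  moreover have "cmod (eta1 z) \<le> cmod (\<i> * E0 z / z) + cmod (E1 z / z) + cmod (E0 z / z\<^sup>2)"
    unfolding eta1_def by (intro order_trans[OF norm_triangle_ineq4] add_mono norm_triangle_ineq order_refl)
  ultimately have "cmod (eta1 z) \<le> C0 / u + 40 / u * (1 / r) + C0 / u * (1 / r)" by linarith
  also have "\<dots> = C / u" by (simp add: C_def field_simps add_divide_distrib)
  finally show "cmod (eta1 z) \<le> C / sqrt (cmod z)" by (simp add: u_def)
qed

text \<open>Cauchy's inequalities on discs of radius \<open>a/2\<close> around \<open>a\<close>, uniformly in the frequency \<open>k\<close>.\<close>

lemma amplitude_expansion: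
  assumes a: "a > 0" and hol: "\<eta> holomorphic_on rhp"
    and C: "\<And>z. \<bar>Im z\<bar> \<le> Re z \<Longrightarrow> cmod z \<ge> a/2 \<Longrightarrow> cmod (\<eta> z) \<le> C / sqrt (cmod z)" and C0: "C > 0"
  obtains h :: "nat \<Rightarrow> nat \<Rightarrow> complex" where
    "\<And>k l. k \<ge> 1 \<Longrightarrow> cmod (h k l) \<le> C / sqrt (a/2) / sqrt (real k) * (2/a) ^ l"
    "\<And>k y. k \<ge> 1 \<Longrightarrow> \<bar>y\<bar> < a/2 \<Longrightarrow> (\<lambda>l. h k l * of_real y ^ l) sums \<eta> (of_real (real k * (a + y)))"
proof
  define f where "f k w = \<eta> (of_nat k * (of_real a + w))" for k :: nat and w
  define h where "h k l = (deriv ^^ l) (f k) 0 / fact l" for k l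
  fix k :: nat assume k: "k \<ge> 1"
  have hf: "f k holomorphic_on ball 0 a"
  proof -
    have "(\<lambda>w. of_nat k * (complex_of_real a + w)) ` ball 0 a \<subseteq> rhp"
    proof
      fix z assume "z \<in> (\<lambda>w. of_nat k * (complex_of_real a + w)) ` ball 0 a"
      then obtain w where "z = of_nat k * (of_real a + w)" "w \<in> ball 0 a" by (rule imageE)
      then have w: "z = of_nat k * (of_real a + w)" "cmod w < a" by simp_all
      have "a + Re w > 0" using w(2) abs_Re_le_cmod[of w] by linarith
      then show "z \<in> rhp" using k w(1) by (simp add: rhp_def)
    qed
    then have "(\<eta> \<circ> (\<lambda>w. of_nat k * (complex_of_real a + w))) holomorphic_on ball 0 a"
      by (intro holomorphic_on_compose_gen[OF _ hol] holomorphic_intros)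
    then show ?thesis unfolding f_def [abs_def] o_def .
  qed
  show "(\<lambda>l. h k l * of_real y ^ l) sums \<eta> (of_real (real k * (a + y)))" if "\<bar>y\<bar> < a/2" for y
    using holomorphic_power_series[OF hf, of "of_real y"] that a by (simp add: f_def h_def)
  have "norm ((deriv ^^ l) (f k) 0) \<le> fact l * (C / sqrt (a/2) / sqrt (real k)) / (a/2) ^ l" for l
  proof (rule Cauchy_inequality)
    show "f k holomorphic_on ball 0 (a/2)" using hf by (rule holomorphic_on_subset) (use a in auto)
    show "continuous_on (cball 0 (a/2)) (f k)"
      using holomorphic_on_imp_continuous_on[OF hf] by (rule continuous_on_subset) (use a in auto)
    show "0 < a/2" using a by simp
    fix w :: complex assume "norm (0 - w) = a/2"
    then have w: "cmod w = a/2" by simp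
    define z where "z = of_nat k * (complex_of_real a + w)"
    have rw: "\<bar>Re w\<bar> \<le> a/2" "\<bar>Im w\<bar> \<le> a/2" using abs_Re_le_cmod[of w] abs_Im_le_cmod[of w] w by auto
    have Re: "Re z \<ge> real k * (a/2)" "\<bar>Im z\<bar> \<le> real k * (a/2)"
      using k rw by (auto simp: z_def abs_mult intro!: mult_left_mono)
    have nz: "real k * (a/2) \<le> cmod z" using complex_Re_le_cmod[of z] Re by linarith
    have "a/2 \<le> real k * (a/2)" using k a by simp
    then have "cmod (\<eta> z) \<le> C / sqrt (cmod z)" using nz Re by (intro C) auto
    also have "\<dots> \<le> C / sqrt (real k * (a/2))"
    proof -
      have p: "0 < real k * (a/2)" using k a by simp
      then have "sqrt (real k * (a/2)) \<le> sqrt (cmod z)" "0 < sqrt (real k * (a/2))" using nz by simp_all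
      then show ?thesis using C0 by (intro frac_le) auto
    qed
    finally show "cmod (f k w) \<le> C / sqrt (a/2) / sqrt (real k)"
      by (simp add: f_def z_def real_sqrt_mult real_sqrt_divide mult.commute)
  qed
  then show "cmod (h k l) \<le> C / sqrt (a/2) / sqrt (real k) * (2/a) ^ l" for l
    using a by (simp add: h_def norm_divide field_simps power_divide)
qed

section \<open>The conserved flux\<close>

text \<open>A form \<open>d(f(A) e\<^sub>n(B))\<close> has no integral over a curve on which \<open>A\<close> and \<open>e\<^sub>n(B)\<close> return to their initial
  values.\<close>

lemma flux_exact:
  fixes A B A' B' :: "real \<Rightarrow> real" and f f' :: "real \<Rightarrow> complex"
  assumes A: "\<And>x. (A has_real_derivative A' x) (at x)" "\<And>x. A x > 0" "A (2*pi) = A 0"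
    and B: "\<And>x. (B has_real_derivative B' x) (at x)" "B (2*pi) = B 0 + 2*pi"
    and f: "\<And>r. r > 0 \<Longrightarrow> (f has_vector_derivative f' r) (at r)"
  shows "((\<lambda>x. (of_real (A' x) * f' (A x) + \<i> * of_int n * of_real (B' x) * f (A x)) * ek n (B x)) has_integral 0) {0..2*pi}"
proof -
  have "((\<lambda>x. f (A x) * ek n (B x)) has_vector_derivative
      (of_real (A' x) * f' (A x) + \<i> * of_int n * of_real (B' x) * f (A x)) * ek n (B x)) (at x)" for x
  proof -
    have "(A has_vector_derivative A' x) (at x)"
      using A(1) by (simp add: has_real_derivative_iff_has_vector_derivative)
    from vector_diff_chain_at[OF this f[OF A(2)]]
    have "((\<lambda>x. f (A x)) has_vector_derivative of_real (A' x) * f' (A x)) (at x)"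
      by (simp add: o_def scaleR_conv_of_real)
    from has_vector_derivative_mult[OF this ek_has_vector_derivative[OF B(1), of n x]]
    show ?thesis by (simp add: algebra_simps)
  qed
  from integral_derivative[OF this, of 0 "2*pi"] show ?thesis using A(3) B(2) by simp
qed

text \<open>For \<open>P = H(jA) e\<^sub>j(B)\<close> and \<open>V = J(kA) e\<^sub>-\<^sub>k(B)\<close>, both solutions of
  \<open>\<partial>\<^sub>A(A \<partial>\<^sub>A V) - V/A = A \<partial>\<^sub>B\<^sup>2 V\<close>, the Green form
  \<open>A(P V\<^sub>A - V P\<^sub>A) dB + A(P V\<^sub>B - V P\<^sub>B) dA\<close> is closed. Its integral over the curve is therefore that over a
  straight line \<open>A = const\<close>, where different modes decouple and equal ones produce the Wronskian.\<close>

lemma flux_mode: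
  fixes A B A' B' :: "real \<Rightarrow> real" and k :: int and j :: nat
  assumes A: "\<And>x. (A has_real_derivative A' x) (at x)" "\<And>x. A x > 0" "A (2*pi) = A 0"
    and B: "\<And>x. (B has_real_derivative B' x) (at x)" "B (2*pi) = B 0 + 2*pi"
    and k: "k \<noteq> 0" and j: "j \<ge> 1"
    and c: "\<And>t. t > 0 \<Longrightarrow> of_real t * (hank t * of_real (besJ' t) - of_real (besJ t) * hank' t) = c"
  defines "V \<equiv> \<lambda>x. of_real (besJ (of_int k * A x)) * ek (-k) (B x)"
    and "VA \<equiv> \<lambda>x. of_int k * of_real (besJ' (of_int k * A x)) * ek (-k) (B x)"
    and "P \<equiv> \<lambda>x. hank (real j * A x) * ek (int j) (B x)"
    and "PA \<equiv> \<lambda>x. of_nat j * hank' (real j * A x) * ek (int j) (B x)"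
  shows "((\<lambda>x. of_real (A x) * ((P x * VA x - V x * PA x) * of_real (B' x) +
      (P x * (- \<i> * of_int k * V x) - V x * (\<i> * of_nat j * P x)) * of_real (A' x)))
    has_integral (if int j = k then 2 * of_real pi * c else 0)) {0..2*pi}"
proof -
  have ekm: "ek (int j) y * ek (-k) y = ek (int j - k) y" for y
    using ek_add[of "int j" "-k" y] by simp
  define F where "F r = of_real r * (of_int k * hank (real j * r) * of_real (besJ' (of_int k * r))
      - of_nat j * of_real (besJ (of_int k * r)) * hank' (real j * r))" for r
  define G where "G r = of_real r * hank (real j * r) * of_real (besJ (of_int k * r))" for r
  have integrand: "of_real (A x) * ((P x * VA x - V x * PA x) * of_real (B' x) +
      (P x * (- \<i> * of_int k * V x) - V x * (\<i> * of_nat j * P x)) * of_real (A' x)) =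
      (of_real (A' x) * (- \<i> * (of_nat j + of_int k) * G (A x)) + of_real (B' x) * F (A x)) * ek (int j - k) (B x)" for x
    unfolding P_def PA_def V_def VA_def F_def G_def ekm [symmetric] by (simp add: algebra_simps)
  have dH: "((\<lambda>r. hank (real j * r)) has_vector_derivative of_nat j * hank' (real j * r)) (at r)"
    "((\<lambda>r. hank' (real j * r)) has_vector_derivative of_nat j * hank'' (real j * r)) (at r)" if r: "r > 0" for r
  proof -
    have jr: "real j * r > 0" using r j by simp
    have m: "((\<lambda>r. real j * r) has_vector_derivative real j) (at r)"
      by (auto intro!: derivative_eq_intros simp: has_real_derivative_iff_has_vector_derivative [symmetric])
    show "((\<lambda>r. hank (real j * r)) has_vector_derivative of_nat j * hank' (real j * r)) (at r)"
      using vector_diff_chain_at[OF m H_derivatives(1)[OF jr]] by (simp add: o_def scaleR_conv_of_real)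
    show "((\<lambda>r. hank' (real j * r)) has_vector_derivative of_nat j * hank'' (real j * r)) (at r)"
      using vector_diff_chain_at[OF m H_derivatives(2)[OF jr]] by (simp add: o_def scaleR_conv_of_real)
  qed
  have dJ: "((\<lambda>r. of_real (besJ (of_int k * r)) :: complex) has_vector_derivative of_int k * of_real (besJ' (of_int k * r))) (at r)"
    "((\<lambda>r. of_real (besJ' (of_int k * r)) :: complex) has_vector_derivative of_int k * of_real (besJ'' (of_int k * r))) (at r)" for r
  proof -
    have m: "((\<lambda>r. of_int k * r) has_vector_derivative of_int k) (at r)"
      by (auto intro!: derivative_eq_intros simp: has_real_derivative_iff_has_vector_derivative [symmetric])
    show "((\<lambda>r. of_real (besJ (of_int k * r)) :: complex) has_vector_derivative of_int k * of_real (besJ' (of_int k * r))) (at r)"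
      using vector_diff_chain_at[OF m J_vector_derivatives(1)] by (simp add: o_def scaleR_conv_of_real)
    show "((\<lambda>r. of_real (besJ' (of_int k * r)) :: complex) has_vector_derivative of_int k * of_real (besJ'' (of_int k * r))) (at r)"
      using vector_diff_chain_at[OF m J_vector_derivatives(2)] by (simp add: o_def scaleR_conv_of_real)
  qed
  have did: "((\<lambda>r. complex_of_real r) has_vector_derivative 1) (at r)" for r
    using has_vector_derivative_of_real[OF DERIV_ident[of "at r"], where 'a = complex] by simp
  note cm = has_vector_derivative_mult_right
  show ?thesis
  proof (cases "int j = k")
    case False
    define n where "n = int j - k"
    have n: "n \<noteq> 0" using False by (simp add: n_def)
    have dF: "(F has_vector_derivative of_int (n * (int j + k)) * G r) (at r)" if r: "r > 0" for r
    proof -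
      let ?z = "complex_of_real r" and ?j = "complex_of_nat j" and ?k = "complex_of_int k"
      let ?H0 = "hank (real j * r)" and ?H1 = "hank' (real j * r)" and ?H2 = "hank'' (real j * r)"
      let ?J0 = "complex_of_real (besJ (of_int k * r))" and ?J1 = "complex_of_real (besJ' (of_int k * r))"
        and ?J2 = "complex_of_real (besJ'' (of_int k * r))"
      have "(F has_vector_derivative ?z * ((?k * ?H0) * (?k * ?J2) + (?k * (?j * ?H1)) * ?J1
          - ((?j * ?J0) * (?j * ?H2) + (?j * (?k * ?J1)) * ?H1)) + 1 * (?k * ?H0 * ?J1 - ?j * ?J0 * ?H1)) (at r)"
        unfolding F_def [abs_def]
        by (intro has_vector_derivative_mult did has_vector_derivative_diff cm dH dJ r)
      moreover have "?z * ((?k * ?H0) * (?k * ?J2) + (?k * (?j * ?H1)) * ?J1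
          - ((?j * ?J0) * (?j * ?H2) + (?j * (?k * ?J1)) * ?H1)) + 1 * (?k * ?H0 * ?J1 - ?j * ?J0 * ?H1)
          = of_int (n * (int j + k)) * G r"
      proof -
        have jr: "real j * r > 0" using r j by simp
        have h: "(?j * ?z)\<^sup>2 * ?H2 + (?j * ?z) * ?H1 + ((?j * ?z)\<^sup>2 - 1) * ?H0 = 0"
          using H_ode[OF jr] by simp
        have q: "(?k * ?z)\<^sup>2 * ?J2 + (?k * ?z) * ?J1 + ((?k * ?z)\<^sup>2 - 1) * ?J0 = 0"
          using J_ode_complex[of "of_int k * r"] by simp
        have "?z * (?z * ((?k * ?H0) * (?k * ?J2) + (?k * (?j * ?H1)) * ?J1
          - ((?j * ?J0) * (?j * ?H2) + (?j * (?k * ?J1)) * ?H1)) + 1 * (?k * ?H0 * ?J1 - ?j * ?J0 * ?H1)) =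
          ?H0 * ((?k * ?z)\<^sup>2 * ?J2 + (?k * ?z) * ?J1 + ((?k * ?z)\<^sup>2 - 1) * ?J0)
          - ?J0 * ((?j * ?z)\<^sup>2 * ?H2 + (?j * ?z) * ?H1 + ((?j * ?z)\<^sup>2 - 1) * ?H0)
          + ?z * (of_int (n * (int j + k)) * G r)"
          by (simp add: n_def G_def algebra_simps power2_eq_square)
        then have "?z * (?z * ((?k * ?H0) * (?k * ?J2) + (?k * (?j * ?H1)) * ?J1
          - ((?j * ?J0) * (?j * ?H2) + (?j * (?k * ?J1)) * ?H1)) + 1 * (?k * ?H0 * ?J1 - ?j * ?J0 * ?H1)) =
          ?z * (of_int (n * (int j + k)) * G r)" unfolding h q by simp
        moreover have "?z \<noteq> 0" using r by simp
        ultimately show ?thesis by (simp only: mult_cancel_left) simp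
      qed
      ultimately show ?thesis by simp
    qed
    define f where "f r = (1 / (\<i> * of_int n)) * F r" for r
    have df: "(f has_vector_derivative (1 / (\<i> * of_int n)) * (of_int (n * (int j + k)) * G r)) (at r)" if "r > 0" for r
      unfolding f_def [abs_def] by (intro cm dF that)
    have e: "(of_real (A' x) * ((1 / (\<i> * of_int n)) * (of_int (n * (int j + k)) * G (A x))) + \<i> * of_int n * of_real (B' x) * f (A x)) * ek n (B x) =
      (of_real (A' x) * (- \<i> * (of_nat j + of_int k) * G (A x)) + of_real (B' x) * F (A x)) * ek n (B x)" for x
    proof -
      have 1: "(1 / (\<i> * of_int n)) * (of_int (n * (int j + k)) * y) = - \<i> * (of_nat j + of_int k) * y" for y
        using n by (simp add: field_simps)
      have 2: "\<i> * of_int n * of_real (B' x) * f (A x) = of_real (B' x) * F (A x)"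
        using n by (simp add: f_def)
      show ?thesis unfolding 1 2 ..
    qed
    show ?thesis using flux_exact[OF A B df, of n] False unfolding integrand e by (simp add: n_def)
  next
    case True
    have Fc: "F r = c" if r: "r > 0" for r
    proof -
      have "real j * r > 0" using r j by simp
      moreover have jk: "complex_of_int k = of_nat j" "real_of_int k = real j"
        using True by (metis of_int_of_nat_eq)+
      ultimately show ?thesis unfolding F_def jk using c[of "real j * r"] by (simp add: algebra_simps)
    qed
    define S where "S r = (1 / (2 * (of_nat j)\<^sup>2)) * ((of_nat j * of_real r)\<^sup>2 * (of_real (besJ' (of_int k * r)) * hank' (real j * r))
        + ((of_nat j * of_real r)\<^sup>2 - 1) * (of_real (besJ (of_int k * r)) * hank (real j * r)))" for r
    have dS: "(S has_vector_derivative G r) (at r)" if r: "r > 0" for r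
    proof -
      let ?z = "complex_of_real r" and ?j = "complex_of_nat j"
      let ?H0 = "hank (real j * r)" and ?H1 = "hank' (real j * r)" and ?H2 = "hank'' (real j * r)"
      let ?J0 = "complex_of_real (besJ (of_int k * r))" and ?J1 = "complex_of_real (besJ' (of_int k * r))"
        and ?J2 = "complex_of_real (besJ'' (of_int k * r))"
      have jk: "complex_of_int k = ?j" using True by (metis of_int_of_nat_eq)
      have dsq: "((\<lambda>r. (?j * complex_of_real r)\<^sup>2) has_vector_derivative 2 * ?j\<^sup>2 * ?z) (at r)"
      proof -
        have "((\<lambda>z. (?j * z)\<^sup>2) has_field_derivative 2 * ?j\<^sup>2 * ?z) (at ?z)"
          by (auto intro!: derivative_eq_intros simp: power2_eq_square)
        from has_vector_derivative_real_field[OF this] show ?thesis .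
      qed
      have "(S has_vector_derivative (1 / (2 * ?j\<^sup>2)) *
          (((?j * ?z)\<^sup>2 * (?J1 * (?j * ?H2) + (of_int k * ?J2) * ?H1) + 2 * ?j\<^sup>2 * ?z * (?J1 * ?H1))
          + (((?j * ?z)\<^sup>2 - 1) * (?J0 * (?j * ?H1) + (of_int k * ?J1) * ?H0) + (2 * ?j\<^sup>2 * ?z - 0) * (?J0 * ?H0)))) (at r)"
        unfolding S_def [abs_def]
        by (intro cm has_vector_derivative_add has_vector_derivative_mult dsq dH dJ r has_vector_derivative_diff has_vector_derivative_const)
      moreover have "(1 / (2 * ?j\<^sup>2)) *
          (((?j * ?z)\<^sup>2 * (?J1 * (?j * ?H2) + (of_int k * ?J2) * ?H1) + 2 * ?j\<^sup>2 * ?z * (?J1 * ?H1))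
          + (((?j * ?z)\<^sup>2 - 1) * (?J0 * (?j * ?H1) + (of_int k * ?J1) * ?H0) + (2 * ?j\<^sup>2 * ?z - 0) * (?J0 * ?H0))) = G r"
      proof -
        have jr: "real j * r > 0" using r j by simp
        have h: "(?j * ?z)\<^sup>2 * ?H2 + (?j * ?z) * ?H1 + ((?j * ?z)\<^sup>2 - 1) * ?H0 = 0"
          using H_ode[OF jr] by simp
        have q: "(?j * ?z)\<^sup>2 * ?J2 + (?j * ?z) * ?J1 + ((?j * ?z)\<^sup>2 - 1) * ?J0 = 0"
          using J_ode_complex[of "of_int k * r"] jk by simp
        have "((?j * ?z)\<^sup>2 * (?J1 * (?j * ?H2) + (of_int k * ?J2) * ?H1) + 2 * ?j\<^sup>2 * ?z * (?J1 * ?H1))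
          + (((?j * ?z)\<^sup>2 - 1) * (?J0 * (?j * ?H1) + (of_int k * ?J1) * ?H0) + (2 * ?j\<^sup>2 * ?z - 0) * (?J0 * ?H0)) =
          ?j * ?J1 * ((?j * ?z)\<^sup>2 * ?H2 + (?j * ?z) * ?H1 + ((?j * ?z)\<^sup>2 - 1) * ?H0)
          + ?j * ?H1 * ((?j * ?z)\<^sup>2 * ?J2 + (?j * ?z) * ?J1 + ((?j * ?z)\<^sup>2 - 1) * ?J0)
          + 2 * ?j\<^sup>2 * G r"
          unfolding jk by (simp add: G_def algebra_simps power2_eq_square)
        also have "\<dots> = 2 * ?j\<^sup>2 * G r" unfolding h q by simp
        finally show ?thesis using j by simp
      qed
      ultimately show ?thesis by simp
    qed
    have dS': "((\<lambda>r. (- 2 * \<i> * of_nat j) * S r) has_vector_derivative (- 2 * \<i> * of_nat j) * G r) (at r)" if "r > 0" for r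
      by (intro cm dS that)
    have dB: "((\<lambda>x. of_real (B x) * c) has_vector_derivative of_real (B' x) * c) (at x)" for x
      by (intro has_vector_derivative_mult_left has_vector_derivative_of_real B)
    have "((\<lambda>x. of_real (B' x) * c) has_integral (2 * of_real pi * c)) {0..2*pi}"
      using integral_derivative[OF dB, of 0 "2*pi"] B(2) by (simp add: algebra_simps)
    from has_integral_add[OF flux_exact[OF A B dS', of 0] this]
    have "((\<lambda>x. of_real (A' x) * ((- 2 * \<i> * of_nat j) * G (A x)) + of_real (B' x) * c) has_integral (2 * of_real pi * c)) {0..2*pi}"
      by simp
    moreover have "of_real (A' x) * ((- 2 * \<i> * of_nat j) * G (A x)) + of_real (B' x) * c =
      (of_real (A' x) * (- \<i> * (of_nat j + of_int k) * G (A x)) + of_real (B' x) * F (A x)) * ek (int j - k) (B x)" for x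
      using True Fc[OF A(2)[of x]] by (simp add: True [symmetric])
    ultimately show ?thesis unfolding integrand using True by simp
  qed
qed

text \<open>The solution \<open>P = A\<close> of the same equation carries no flux against any mode \<open>k \<noteq> 0\<close>.\<close>

lemma flux_zero_mode:
  fixes A B A' B' :: "real \<Rightarrow> real" and k :: int
  assumes A: "\<And>x. (A has_real_derivative A' x) (at x)" "\<And>x. A x > 0" "A (2*pi) = A 0"
    and B: "\<And>x. (B has_real_derivative B' x) (at x)" "B (2*pi) = B 0 + 2*pi"
    and k: "k \<noteq> 0"
  defines "V \<equiv> \<lambda>x. of_real (besJ (of_int k * A x)) * ek (-k) (B x)"
    and "VA \<equiv> \<lambda>x. of_int k * of_real (besJ' (of_int k * A x)) * ek (-k) (B x)"
  shows "((\<lambda>x. of_real (A x) * ((of_real (A x) * VA x - V x) * of_real (B' x) +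
      of_real (A x) * (- \<i> * of_int k * V x) * of_real (A' x))) has_integral 0) {0..2*pi}"
proof -
  define F :: "real \<Rightarrow> complex" where
    "F r = (of_real r)\<^sup>2 * (of_int k * of_real (besJ' (of_int k * r))) - of_real r * of_real (besJ (of_int k * r))" for r
  have dF: "(F has_vector_derivative - (of_int k)\<^sup>2 * (of_real r)\<^sup>2 * of_real (besJ (of_int k * r))) (at r)" if r: "r > 0" for r
  proof -
    let ?k = "complex_of_int k" and ?z = "complex_of_real r"
    let ?J0 = "complex_of_real (besJ (of_int k * r))" and ?J1 = "complex_of_real (besJ' (of_int k * r))"
        and ?J2 = "complex_of_real (besJ'' (of_int k * r))"
    have m: "((\<lambda>r. of_int k * r) has_vector_derivative of_int k) (at r)"
      by (auto intro!: derivative_eq_intros simp: has_real_derivative_iff_has_vector_derivative [symmetric])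
    have dJ: "((\<lambda>r. of_real (besJ (of_int k * r)) :: complex) has_vector_derivative ?k * ?J1) (at r)"
      using vector_diff_chain_at[OF m J_vector_derivatives(1)] by (simp add: o_def scaleR_conv_of_real)
    have dJ': "((\<lambda>r. of_real (besJ' (of_int k * r)) :: complex) has_vector_derivative ?k * ?J2) (at r)"
      using vector_diff_chain_at[OF m J_vector_derivatives(2)] by (simp add: o_def scaleR_conv_of_real)
    have did: "((\<lambda>r. complex_of_real r) has_vector_derivative 1) (at r)"
      using has_vector_derivative_of_real[OF DERIV_ident[of "at r"], where 'a = complex] by simp
    have dsq: "((\<lambda>r. (complex_of_real r)\<^sup>2) has_vector_derivative 2 * ?z) (at r)"
    proof -
      have "((\<lambda>z. z\<^sup>2) has_field_derivative 2 * ?z) (at ?z)"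
        by (auto intro!: derivative_eq_intros)
      from has_vector_derivative_real_field[OF this] show ?thesis .
    qed
    have "(F has_vector_derivative (?z\<^sup>2 * (?k * (?k * ?J2)) + 2 * ?z * (?k * ?J1)) - (?z * (?k * ?J1) + 1 * ?J0)) (at r)"
      unfolding F_def [abs_def]
      by (intro has_vector_derivative_diff has_vector_derivative_mult did dsq has_vector_derivative_mult_right dJ dJ')
    moreover have "(?z\<^sup>2 * (?k * (?k * ?J2)) + 2 * ?z * (?k * ?J1)) - (?z * (?k * ?J1) + 1 * ?J0) =
      ((?k * ?z)\<^sup>2 * ?J2 + (?k * ?z) * ?J1 + ((?k * ?z)\<^sup>2 - 1) * ?J0) - ?k\<^sup>2 * ?z\<^sup>2 * ?J0"
      by (simp add: algebra_simps power2_eq_square)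
    moreover have "(?k * ?z)\<^sup>2 * ?J2 + (?k * ?z) * ?J1 + ((?k * ?z)\<^sup>2 - 1) * ?J0 = 0"
      using J_ode_complex[of "of_int k * r"] by simp
    ultimately show ?thesis by simp
  qed
  define f where "f r = (1 / (- \<i> * of_int k)) * F r" for r
  have df: "(f has_vector_derivative (1 / (- \<i> * of_int k)) * (- (of_int k)\<^sup>2 * (of_real r)\<^sup>2 * of_real (besJ (of_int k * r)))) (at r)" if "r > 0" for r
    unfolding f_def [abs_def] by (intro has_vector_derivative_mult_right dF that)
  have e: "(of_real (A' x) * ((1 / (- \<i> * of_int k)) * (- (of_int k)\<^sup>2 * (of_real (A x))\<^sup>2 * of_real (besJ (of_int k * A x))))
       + \<i> * of_int (-k) * of_real (B' x) * f (A x)) * ek (-k) (B x) =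
      of_real (A x) * ((of_real (A x) * VA x - V x) * of_real (B' x) +
      of_real (A x) * (- \<i> * of_int k * V x) * of_real (A' x))" for x
  proof -
    have 1: "(1 / (- \<i> * of_int k)) * (- (of_int k)\<^sup>2 * (of_real (A x))\<^sup>2 * of_real (besJ (of_int k * A x)))
      = - \<i> * of_int k * (of_real (A x))\<^sup>2 * of_real (besJ (of_int k * A x))"
      using k by (simp add: power2_eq_square field_simps)
    have 2: "\<i> * of_int (-k) * of_real (B' x) * f (A x) = of_real (B' x) * F (A x)"
      using k by (simp add: f_def)
    show ?thesis unfolding 1 2 F_def V_def VA_def by (simp add: algebra_simps power2_eq_square)
  qed
  show ?thesis using flux_exact[OF A B df, of "-k"] unfolding e .
qed

section \<open>The differential of the action map\<close>

text \<open>The implicit function theorem in one variable, for a defining equation in which the parameter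
  enters through a factor \<open>\<sigma>(s)\<close>.\<close>

lemma implicit_derivative:
  fixes u r \<sigma> x :: "real \<Rightarrow> real"
  assumes eq: "eventually (\<lambda>s. u (x s) + r (x s) * \<sigma> s = C) (nhds s0)"
    and x: "isCont x s0" and r: "isCont r (x s0)" and \<sigma>: "(\<sigma> has_real_derivative \<sigma>') (at s0)"
    and w: "((\<lambda>y. u y + \<sigma> s0 * r y) has_real_derivative p) (at (x s0))" and p: "p \<noteq> 0"
  shows "(x has_real_derivative - (r (x s0) * \<sigma>' / p)) (at s0)"
proof -
  define w where "w y = u y + \<sigma> s0 * r y" for y
  obtain g where g: "\<And>y. w y - w (x s0) = g y * (y - x s0)" "isCont g (x s0)" "g (x s0) = p"
    using assms(5) unfolding w_def [symmetric] CARAT_DERIV by metis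
  obtain \<tau> where \<tau>: "\<And>s. \<sigma> s - \<sigma> s0 = \<tau> s * (s - s0)" "isCont \<tau> s0" "\<tau> s0 = \<sigma>'"
    using \<sigma> unfolding CARAT_DERIV by metis
  have gx: "isCont (\<lambda>s. g (x s)) s0" by (rule isCont_o2[OF x g(2)])
  have rx: "isCont (\<lambda>s. r (x s)) s0" by (rule isCont_o2[OF x r])
  have step: "g (x s) * (x s - x s0) = - (r (x s) * \<tau> s) * (s - s0)" if "u (x s) + r (x s) * \<sigma> s = C" for s
  proof -
    have "w (x s) - w (x s0) = - (r (x s) * (\<sigma> s - \<sigma> s0))"
      using that eventually_nhds_x_imp_x[OF eq] by (simp add: w_def algebra_simps)
    then show ?thesis unfolding g(1)[of "x s"] \<tau>(1) by (simp add: algebra_simps)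
  qed
  have nz: "eventually (\<lambda>s. g (x s) \<noteq> 0) (at s0)"
    using isContD[OF gx] p g(3) by (intro tendsto_imp_eventually_ne[of _ "g (x s0)"]) auto
  have "((\<lambda>s. - (r (x s) * \<tau> s) / g (x s)) \<longlongrightarrow> - (r (x s0) * \<tau> s0) / g (x s0)) (at s0)"
    using p g(3) by (intro tendsto_intros isContD[OF rx] isContD[OF gx] isContD[OF \<tau>(2)]) auto
  moreover have "eventually (\<lambda>s. - (r (x s) * \<tau> s) / g (x s) = (x s - x s0) / (s - s0)) (at s0)"
  proof (rule eventually_mono[OF eventually_conj[OF nz eventually_conj]])
    show "eventually (\<lambda>s. s \<noteq> s0) (at s0)" by (simp add: eventually_at_filter)
    show "eventually (\<lambda>s. u (x s) + r (x s) * \<sigma> s = C) (at s0)"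
      using eq by (auto simp: eventually_at_filter elim: eventually_mono)
    fix s assume "g (x s) \<noteq> 0 \<and> s \<noteq> s0 \<and> u (x s) + r (x s) * \<sigma> s = C"
    then show "- (r (x s) * \<tau> s) / g (x s) = (x s - x s0) / (s - s0)"
      using step[of s] by (simp add: field_simps)
  qed
  ultimately have "((\<lambda>s. (x s - x s0) / (s - s0)) \<longlongrightarrow> - (r (x s0) * \<tau> s0) / g (x s0)) (at s0)"
    by (rule Lim_transform_eventually)
  then show ?thesis unfolding has_field_derivative_iff g(3) \<tau>(3) by simp
qed

text \<open>The slope condition makes \<open>x \<mapsto> A(x) sin \<phi> + B(x)\<close> strictly increasing for every angle \<open>\<phi>\<close>.\<close>

locale phase_curve =
  fixes Astar :: real and a b a' b' :: "real \<Rightarrow> real" and \<kappa> :: real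
  assumes da: "\<And>x. (a has_real_derivative a' x) (at x)" and db: "\<And>x. (b has_real_derivative b' x) (at x)"
    and ca': "cper a'" and cb': "cper b'"
    and pa: "\<And>x. a (x + 2*pi) = a x" and pb: "\<And>x. b (x + 2*pi) = b x"
    and slope: "\<And>x. \<bar>a' x\<bar> + \<bar>b' x\<bar> \<le> \<kappa>" and \<kappa>: "\<kappa> < 1"
begin

abbreviation X :: "real \<Rightarrow> real \<Rightarrow> real" where
  "X I \<phi> \<equiv> x_sol Astar a b I \<phi>"

definition g' :: "real \<Rightarrow> real \<Rightarrow> real" where
  "g' x \<phi> = a' x * sin \<phi> + (1 + b' x)"

lemma cper_a: "cper a" and cper_b: "cper b"
  using pa pb da db by (auto simp: cper_def intro!: continuous_at_imp_continuous_on DERIV_isCont)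

lemma dI_map: "((\<lambda>x. I_map Astar a b x \<phi>) has_real_derivative g' x \<phi>) (at x)"
  unfolding I_map_def g'_def by (auto intro!: derivative_eq_intros da db)

lemma g'_lower: "g' x \<phi> \<ge> 1 - \<kappa>"
proof -
  have "\<bar>a' x * sin \<phi>\<bar> \<le> \<bar>a' x\<bar> * 1" unfolding abs_mult by (intro mult_left_mono) auto
  then show ?thesis using slope[of x] by (auto simp: g'_def)
qed

lemma g'_pos: "g' x \<phi> > 0"
  using g'_lower[of x \<phi>] \<kappa> by linarith

lemma I_map_expanding: "(1 - \<kappa>) * \<bar>x - y\<bar> \<le> \<bar>I_map Astar a b x \<phi> - I_map Astar a b y \<phi>\<bar>"
proof -
  have *: "(1 - \<kappa>) * \<bar>x - y\<bar> \<le> \<bar>I_map Astar a b x \<phi> - I_map Astar a b y \<phi>\<bar>" if xy: "y < x" for x y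
  proof -
    obtain z where z: "I_map Astar a b x \<phi> - I_map Astar a b y \<phi> = (x - y) * g' z \<phi>"
      using MVT2[OF xy, of "\<lambda>x. I_map Astar a b x \<phi>" "\<lambda>x. g' x \<phi>"] dI_map by auto
    have "(x - y) * (1 - \<kappa>) \<le> (x - y) * g' z \<phi>" using xy by (intro mult_left_mono g'_lower) auto
    then show ?thesis using z xy g'_pos[of z \<phi>] by (simp add: mult.commute)
  qed
  consider "y < x" | "x < y" | "x = y" by linarith
  then show ?thesis using *[of y x] *[of x y] by cases (auto simp: abs_minus_commute)
qed

lemma I_map_periodic: "I_map Astar a b (x + 2*pi) \<phi> = I_map Astar a b x \<phi> + 2*pi"
  by (simp add: I_map_def pa pb)

lemma I_map_surj: "\<exists>x. I_map Astar a b x \<phi> = I"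
proof -
  obtain Ba where Ba: "Ba > 0" "\<And>x. norm (a x) \<le> Ba" using cper_bounded[OF cper_a] by metis
  obtain Bb where Bb: "Bb > 0" "\<And>x. norm (b x) \<le> Bb" using cper_bounded[OF cper_b] by metis
  define M where "M = \<bar>Astar\<bar> + Ba + Bb"
  have M: "\<bar>I_map Astar a b x \<phi> - x\<bar> \<le> M" for x
  proof -
    have "\<bar>(Astar + a x) * sin \<phi>\<bar> \<le> \<bar>Astar + a x\<bar> * 1" unfolding abs_mult by (intro mult_left_mono) auto
    moreover have "\<bar>Astar + a x\<bar> \<le> \<bar>Astar\<bar> + Ba" using Ba(2)[of x] by auto
    moreover have "\<bar>b x\<bar> \<le> Bb" using Bb(2)[of x] by simp
    moreover have "\<bar>y + (x + z) - x\<bar> \<le> p + q + r" if "\<bar>y\<bar> \<le> u * 1" "u \<le> p + q" "\<bar>z\<bar> \<le> r" for y u z p q r :: real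
      using that by linarith
    ultimately show ?thesis unfolding I_map_def M_def by blast
  qed
  have "\<exists>x\<ge>I - M. x \<le> I + M \<and> I_map Astar a b x \<phi> = I"
  proof (rule IVT')
    show "I_map Astar a b (I - M) \<phi> \<le> I" "I \<le> I_map Astar a b (I + M) \<phi>"
      using M[of "I - M"] M[of "I + M"] by linarith+
    show "I - M \<le> I + M" using Ba Bb by (simp add: M_def)
    show "continuous_on {I - M..I + M} (\<lambda>x. I_map Astar a b x \<phi>)"
      using dI_map by (intro continuous_at_imp_continuous_on) (auto intro: DERIV_isCont)
  qed
  then show ?thesis by blast
qed

lemma I_map_inj: "I_map Astar a b x \<phi> = I_map Astar a b y \<phi> \<Longrightarrow> x = y"
  using I_map_expanding[of x y \<phi>] \<kappa> by (simp add: mult_le_0_iff)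

lemma I_map_X: "I_map Astar a b (X I \<phi>) \<phi> = I"
  unfolding x_sol_def by (rule theI') (use I_map_surj I_map_inj in metis)

lemma X_I_map: "X (I_map Astar a b x \<phi>) \<phi> = x"
  by (rule I_map_inj[OF I_map_X])

lemma X_periodic: "X (I + 2*pi) \<phi> = X I \<phi> + 2*pi"
  by (rule I_map_inj[of _ \<phi>]) (simp add: I_map_X I_map_periodic)

lemma X_2pi: "X I (2*pi) = X I 0"
  by (rule I_map_inj[of _ 0]) (simp add: I_map_X, use I_map_X[of I "2*pi"] in \<open>simp add: I_map_def\<close>)

text \<open>Continuity of the solution in all parameters at once, including the curve.\<close>

lemma X_close:
  fixes y I J \<phi> :: real
  shows "(1 - \<kappa>) * \<bar>X I \<phi> - y\<bar> \<le> \<bar>I - I_map Astar a b y \<phi>\<bar>"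
  using I_map_expanding[of "X I \<phi>" y \<phi>] by (simp add: I_map_X)

lemma X_continuous: "continuous_on UNIV (\<lambda>(I, \<phi>). X I \<phi>)"
proof -
  have "((\<lambda>(I, \<phi>). X I \<phi>) \<longlongrightarrow> X I0 \<phi>0) (at (I0, \<phi>0))" for I0 \<phi>0
  proof -
    define y where "y = X I0 \<phi>0"
    have "((\<lambda>p. \<bar>fst p - I_map Astar a b y (snd p)\<bar> / (1 - \<kappa>)) \<longlongrightarrow> \<bar>I0 - I_map Astar a b y \<phi>0\<bar> / (1 - \<kappa>)) (at (I0, \<phi>0))"
      unfolding I_map_def using \<kappa> by (auto intro!: tendsto_eq_intros)
    moreover have "\<bar>I0 - I_map Astar a b y \<phi>0\<bar> / (1 - \<kappa>) = 0" by (simp add: y_def I_map_X)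
    ultimately have z: "((\<lambda>p. \<bar>fst p - I_map Astar a b y (snd p)\<bar> / (1 - \<kappa>)) \<longlongrightarrow> 0) (at (I0, \<phi>0))" by simp
    have "((\<lambda>p. X (fst p) (snd p) - y) \<longlongrightarrow> 0) (at (I0, \<phi>0))"
      by (rule Lim_null_comparison[OF _ z])
        (use X_close \<kappa> in \<open>auto intro!: always_eventually simp: field_simps\<close>)
    moreover have "(\<lambda>(I, \<phi>). X I \<phi>) = (\<lambda>p. X (fst p) (snd p))" by auto
    ultimately show ?thesis by (simp add: y_def Lim_null [symmetric])
  qed
  then show ?thesis
    unfolding continuous_on_def by (auto intro: tendsto_within_subset[where S = UNIV])
qed

lemma continuous_X [continuous_intros]:
  "continuous_on S f \<Longrightarrow> continuous_on S h \<Longrightarrow> continuous_on S (\<lambda>x. X (f x) (h x))"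
  using continuous_on_compose2[OF X_continuous, of S "\<lambda>x. (f x, h x)"] by (simp add: continuous_on_Pair)

lemma continuous_cper: "cper f \<Longrightarrow> continuous_on S h \<Longrightarrow> continuous_on S (\<lambda>x. f (h x))"
  using continuous_on_compose2[of UNIV f S h] by (auto simp: cper_def)

lemma continuous_g':
  fixes f h :: "'z::t2_space \<Rightarrow> real"
  shows "continuous_on S f \<Longrightarrow> continuous_on S h \<Longrightarrow> continuous_on S (\<lambda>x. g' (f x) (h x))"
  unfolding g'_def by (intro continuous_intros continuous_cper[OF ca'] continuous_cper[OF cb'])

lemma isCont_X1: "isCont (\<lambda>I. X I \<phi>) I0" and isCont_X2: "isCont (\<lambda>\<phi>. X I \<phi>) \<phi>0"
proof -
  have "continuous_on UNIV (\<lambda>I. X I \<phi>)" "continuous_on UNIV (\<lambda>\<phi>. X I \<phi>)" by (intro continuous_intros)+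
  then show "isCont (\<lambda>I. X I \<phi>) I0" "isCont (\<lambda>\<phi>. X I \<phi>) \<phi>0"
    by (auto simp: continuous_on_eq_continuous_at)
qed

lemma dX_dI: "((\<lambda>I. X I \<phi>) has_real_derivative 1 / g' (X I \<phi>) \<phi>) (at I)"
proof -
  have w: "((\<lambda>x. I_map Astar a b x \<phi> + I * (-1)) has_real_derivative g' (X I \<phi>) \<phi>) (at (X I \<phi>))"
    using dI_map by (auto intro!: derivative_eq_intros)
  have "((\<lambda>I. X I \<phi>) has_real_derivative - (-1 * 1 / g' (X I \<phi>) \<phi>)) (at I)"
    by (rule implicit_derivative[where u = "\<lambda>x. I_map Astar a b x \<phi>" and r = "\<lambda>x. -1" and \<sigma> = "\<lambda>I. I" and C = 0])
      (use w g'_pos[of "X I \<phi>" \<phi>] in \<open>auto simp: I_map_X isCont_X1\<close>)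
  then show ?thesis by simp
qed

lemma dX_d\<phi>: "((\<lambda>\<phi>. X I \<phi>) has_real_derivative - ((Astar + a (X I \<phi>)) * cos \<phi> / g' (X I \<phi>) \<phi>)) (at \<phi>)"
proof (rule implicit_derivative[where u = "\<lambda>x. x + b x" and \<sigma> = sin and C = I])
  show "eventually (\<lambda>s. (X I s + b (X I s)) + (Astar + a (X I s)) * sin s = I) (nhds \<phi>)"
    using I_map_X[of I] by (auto simp: I_map_def algebra_simps intro!: always_eventually)
  show "isCont (\<lambda>x. Astar + a x) (X I \<phi>)" by (intro continuous_intros DERIV_isCont[OF da])
  show "((\<lambda>y. y + b y + sin \<phi> * (Astar + a y)) has_real_derivative g' (X I \<phi>) \<phi>) (at (X I \<phi>))"
    unfolding g'_def by (auto intro!: derivative_eq_intros da db)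
qed (use g'_pos[of "X I \<phi>" \<phi>] in \<open>auto intro!: derivative_eq_intros isCont_X2\<close>)

text \<open>Since \<open>A cos \<phi> \<partial>\<^sub>I x = -\<partial>\<^sub>\<phi> x\<close>, an integration by parts in \<open>\<phi>\<close> removes the derivative of \<open>x\<close> from the
  action map.\<close>

lemma S_map_eq: "S_map Astar (a, b) I = - integral {0..2*pi} (\<lambda>\<phi>. sin \<phi> * X I \<phi>)
    - 1/2 * integral {0..2*pi} (\<lambda>x. Astar + a x)"
proof -
  have D: "((\<lambda>\<phi>. cos \<phi> * X I \<phi>) has_vector_derivative
      (- (sin \<phi> * X I \<phi>) - (cos \<phi>)\<^sup>2 * (Astar + a (X I \<phi>)) * (1 / g' (X I \<phi>) \<phi>))) (at \<phi>)" for \<phi>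
    unfolding has_real_derivative_iff_has_vector_derivative [symmetric]
    by (auto intro!: derivative_eq_intros dX_d\<phi> simp: power2_eq_square)
  have i0: "((\<lambda>\<phi>. - (sin \<phi> * X I \<phi>) - (cos \<phi>)\<^sup>2 * (Astar + a (X I \<phi>)) * (1 / g' (X I \<phi>) \<phi>)) has_integral 0) {0..2*pi}"
    using integral_derivative[OF D, of 0 "2*pi"] X_2pi by simp
  have "continuous_on {0..2*pi} (\<lambda>\<phi>. sin \<phi> * X I \<phi>)" by (intro continuous_intros)
  then have i1: "((\<lambda>\<phi>. sin \<phi> * X I \<phi>) has_integral integral {0..2*pi} (\<lambda>\<phi>. sin \<phi> * X I \<phi>)) {0..2*pi}"
    by (intro integrable_integral integrable_continuous_real)
  have "((\<lambda>\<phi>. (cos \<phi>)\<^sup>2 * (Astar + a (X I \<phi>)) * (1 / g' (X I \<phi>) \<phi>)) has_integral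
      - integral {0..2*pi} (\<lambda>\<phi>. sin \<phi> * X I \<phi>)) {0..2*pi}"
    using has_integral_neg[OF has_integral_add[OF i0 i1]] by simp
  then have "integral {0..2*pi} (\<lambda>\<phi>. (cos \<phi>)\<^sup>2 * (Astar + a (X I \<phi>)) * (1 / g' (X I \<phi>) \<phi>)) =
      - integral {0..2*pi} (\<lambda>\<phi>. sin \<phi> * X I \<phi>)" by (rule integral_unique)
  moreover have "deriv (\<lambda>J. x_sol Astar a b J \<phi>) I = 1 / g' (X I \<phi>) \<phi>" for \<phi>
    by (rule DERIV_imp_deriv[OF dX_dI])
  ultimately show ?thesis by (simp add: S_map_def)
qed

text \<open>The differential of \<open>S_map\<close> in the direction \<open>(\<alpha>, \<beta>)\<close>, obtained from \<open>S_map_eq\<close> by implicit differentiation of \<open>x_sol\<close>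
  with respect to the curve.\<close>

definition T :: "(real \<Rightarrow> real) \<Rightarrow> (real \<Rightarrow> real) \<Rightarrow> real \<Rightarrow> real" where
  "T \<alpha> \<beta> I = integral {0..2*pi} (\<lambda>\<phi>. sin \<phi> * (\<alpha> (X I \<phi>) * sin \<phi> + \<beta> (X I \<phi>)) / g' (X I \<phi>) \<phi>)
     - 1/2 * integral {0..2*pi} \<alpha>"

lemma T_integrand_continuous:
  fixes f h :: "'z::t2_space \<Rightarrow> real"
  assumes "cper \<alpha>" "cper \<beta>" "continuous_on S f" "continuous_on S h"
  shows "continuous_on S (\<lambda>p. sin (h p) * (\<alpha> (X (f p) (h p)) * sin (h p) + \<beta> (X (f p) (h p))) / g' (X (f p) (h p)) (h p))"
  using g'_pos by (intro continuous_intros continuous_cper[OF assms(1)] continuous_cper[OF assms(2)] continuous_g' assms(3,4))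
    (metis less_irrefl)

lemma T_cper:
  assumes "cper \<alpha>" "cper \<beta>"
  shows "cper (T \<alpha> \<beta>)"
proof -
  have "continuous_on UNIV (\<lambda>I. integral (cbox 0 (2*pi)) (\<lambda>\<phi>. sin \<phi> * (\<alpha> (X I \<phi>) * sin \<phi> + \<beta> (X I \<phi>)) / g' (X I \<phi>) \<phi>))"
    by (rule integral_continuous_on_param)
      (use T_integrand_continuous[OF assms continuous_on_fst[OF continuous_on_id] continuous_on_snd[OF continuous_on_id]] in \<open>simp add: case_prod_beta\<close>)
  then have "continuous_on UNIV (T \<alpha> \<beta>)"
    unfolding T_def [abs_def] by (intro continuous_intros) simp
  moreover have "T \<alpha> \<beta> (I + 2*pi) = T \<alpha> \<beta> I" for I
    unfolding T_def X_periodic g'_def using assms ca' cb' by (simp add: cper_def)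
  ultimately show ?thesis by (simp add: cper_def)
qed

lemma integral_sin_exp:
  "integral {0..2*pi} (\<lambda>\<phi>. of_real ((sin \<phi>)\<^sup>2) * ek (-n) (r * sin \<phi>)) = 2 * of_real pi * of_real (besJ' (of_int n * r))"
  "integral {0..2*pi} (\<lambda>\<phi>. of_real (sin \<phi>) * ek (-n) (r * sin \<phi>)) = - 2 * \<i> * of_real pi * of_real (besJ (of_int n * r))"
proof -
  define t where "t = of_int n * r"
  have ekt: "ek (-n) (r * y) = of_real (cos (t * y)) - \<i> * of_real (sin (t * y))" for y
  proof -
    have "ek (-n) (r * y) = exp (- (\<i> * of_real (t * y)))" by (simp add: ek_def t_def mult.assoc)
    then show ?thesis by (simp only: exp_minus_Euler cos_of_real sin_of_real)
  qed
  have odd: "integral {0..2*pi} q = 0" if q: "cper q" "\<And>\<phi>. q (\<phi> + pi) = - q \<phi>" for q :: "real \<Rightarrow> real"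
  proof -
    have "((\<lambda>x. 1 *\<^sub>R q (x + pi)) has_integral integral {0..2*pi} q) {0..2*pi}"
      by (rule has_integral_substitution_period[OF q(1), of "\<lambda>x. x + pi" "\<lambda>_. 1"]) (auto intro!: derivative_eq_intros)
    then have "((\<lambda>x. - q x) has_integral integral {0..2*pi} q) {0..2*pi}" by (simp add: q(2))
    from integral_unique[OF this] show ?thesis by simp
  qed
  have o1: "integral {0..2*pi} (\<lambda>\<phi>. (sin \<phi>)\<^sup>2 * sin (t * sin \<phi>)) = 0"
    by (rule odd) (auto simp: cper_def intro!: continuous_intros)
  have o2: "integral {0..2*pi} (\<lambda>\<phi>. sin \<phi> * cos (t * sin \<phi>)) = 0"
    by (rule odd) (auto simp: cper_def intro!: continuous_intros)
  have split: "integral {0..2*pi} (\<lambda>\<phi>. of_real (w \<phi>) * ek (-n) (r * sin \<phi>)) =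
      of_real (integral {0..2*pi} (\<lambda>\<phi>. w \<phi> * cos (t * sin \<phi>))) - \<i> * of_real (integral {0..2*pi} (\<lambda>\<phi>. w \<phi> * sin (t * sin \<phi>)))"
    if w: "continuous_on {0..2*pi} w" for w
  proof -
    have c: "continuous_on {0..2*pi} (\<lambda>\<phi>. w \<phi> * cos (t * sin \<phi>))" "continuous_on {0..2*pi} (\<lambda>\<phi>. w \<phi> * sin (t * sin \<phi>))"
      by (intro continuous_intros w)+
    have "integral {0..2*pi} (\<lambda>\<phi>. of_real (w \<phi>) * ek (-n) (r * sin \<phi>)) =
      integral {0..2*pi} (\<lambda>\<phi>. of_real (w \<phi> * cos (t * sin \<phi>)) - \<i> * of_real (w \<phi> * sin (t * sin \<phi>)))"
      unfolding ekt by (simp add: algebra_simps)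
    also have "\<dots> = integral {0..2*pi} (\<lambda>\<phi>. complex_of_real (w \<phi> * cos (t * sin \<phi>))) - integral {0..2*pi} (\<lambda>\<phi>. \<i> * of_real (w \<phi> * sin (t * sin \<phi>)))"
      by (intro Henstock_Kurzweil_Integration.integral_diff integrable_continuous_real continuous_intros c)
    finally show ?thesis
      by (simp only: integral_complex_of_real[OF c(1)] integral_complex_of_real[OF c(2)] integral_mult_right)
  qed
  show "integral {0..2*pi} (\<lambda>\<phi>. of_real ((sin \<phi>)\<^sup>2) * ek (-n) (r * sin \<phi>)) = 2 * of_real pi * of_real (besJ' (of_int n * r))"
    using split[of "\<lambda>\<phi>. (sin \<phi>)\<^sup>2"] o1 unfolding t_def [symmetric] besJ'_def
    by (simp add: mult.commute continuous_intros)
  show "integral {0..2*pi} (\<lambda>\<phi>. of_real (sin \<phi>) * ek (-n) (r * sin \<phi>)) = - 2 * \<i> * of_real pi * of_real (besJ (of_int n * r))"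
    using split[of sin] o2 unfolding t_def [symmetric] besJ_def
    by (simp add: mult.commute continuous_intros)
qed

text \<open>One exchanges the integrals over \<open>I\<close> and \<open>\<phi>\<close>, substitutes \<open>I = A(x) sin \<phi> + B(x)\<close> in the inner one, and exchanges the
  integrals again.\<close>

lemma fc_T:
  assumes \<alpha>: "cper \<alpha>" and \<beta>: "cper \<beta>"
  shows "fc (\<lambda>I. of_real (T \<alpha> \<beta> I)) n = (if n = 0 then 0 else
    integral {0..2*pi} (\<lambda>x. (of_real (besJ' (of_int n * (Astar + a x)) * \<alpha> x) - \<i> * of_real (besJ (of_int n * (Astar + a x)) * \<beta> x)) * ek (-n) (x + b x)))"
proof -
  define K where "K I \<phi> = sin \<phi> * (\<alpha> (X I \<phi>) * sin \<phi> + \<beta> (X I \<phi>)) / g' (X I \<phi>) \<phi>" for I \<phi>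
  have cK: "continuous_on S (\<lambda>p. K (f p) (h p))" if "continuous_on S f" "continuous_on S h" for S and f h :: "'z::t2_space \<Rightarrow> real"
    unfolding K_def by (rule T_integrand_continuous[OF \<alpha> \<beta> that])
  define \<Lambda> where "\<Lambda> = integral {0..2*pi} (\<lambda>x. (of_real (besJ' (of_int n * (Astar + a x)) * \<alpha> x) - \<i> * of_real (besJ (of_int n * (Astar + a x)) * \<beta> x)) * ek (-n) (x + b x))"
  define w where "w x \<phi> = sin \<phi> * (\<alpha> x * sin \<phi> + \<beta> x)" for x \<phi>
  have inner: "integral {0..2*pi} (\<lambda>I. of_real (K I \<phi>) * ek (-n) I) = integral {0..2*pi} (\<lambda>x. of_real (w x \<phi>) * ek (-n) (I_map Astar a b x \<phi>))" for \<phi>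
  proof -
    have "K (I + 2*pi) \<phi> = K I \<phi>" for I
      unfolding K_def X_periodic g'_def using \<alpha> \<beta> ca' cb' by (simp add: cper_def)
    then have cp: "cper (\<lambda>I. of_real (K I \<phi>) * ek (-n) I)"
      by (auto simp: cper_def intro!: continuous_intros cK)
    have per: "I_map Astar a b (2*pi) \<phi> = I_map Astar a b 0 \<phi> + 2*pi" using I_map_periodic[of 0 \<phi>] by simp
    have "g' x \<phi> *\<^sub>R (complex_of_real (K (I_map Astar a b x \<phi>) \<phi>) * ek (-n) (I_map Astar a b x \<phi>)) =
      of_real (w x \<phi>) * ek (-n) (I_map Astar a b x \<phi>)" for x
      using g'_pos[of x \<phi>] by (simp add: K_def X_I_map w_def scaleR_conv_of_real)
    with has_integral_substitution_period[OF cp dI_map per]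
    show ?thesis by (simp add: integral_unique)
  qed
  have "integral {0..2*pi} (\<lambda>I. complex_of_real (integral {0..2*pi} (K I)) * ek (-n) I) =
      integral (cbox 0 (2*pi)) (\<lambda>I. integral (cbox 0 (2*pi)) (\<lambda>\<phi>. of_real (K I \<phi>) * ek (-n) I))"
  proof -
    have "complex_of_real (integral {0..2*pi} (K I)) = integral {0..2*pi} (\<lambda>\<phi>. of_real (K I \<phi>))" for I
      by (rule integral_complex_of_real [symmetric]) (intro cK continuous_intros)
    then show ?thesis by simp
  qed
  also have "\<dots> = integral (cbox 0 (2*pi)) (\<lambda>\<phi>. integral (cbox 0 (2*pi)) (\<lambda>I. of_real (K I \<phi>) * ek (-n) I))"
    by (rule integral_swap_continuous) (auto simp: case_prod_beta intro!: continuous_intros cK)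
  also have "\<dots> = integral (cbox 0 (2*pi)) (\<lambda>\<phi>. integral (cbox 0 (2*pi)) (\<lambda>x. of_real (w x \<phi>) * ek (-n) (I_map Astar a b x \<phi>)))"
    using inner by simp
  also have "\<dots> = integral (cbox 0 (2*pi)) (\<lambda>x. integral (cbox 0 (2*pi)) (\<lambda>\<phi>. of_real (w x \<phi>) * ek (-n) (I_map Astar a b x \<phi>)))"
    by (rule integral_swap_continuous)
      (auto simp: case_prod_beta w_def I_map_def intro!: continuous_intros continuous_cper[OF \<alpha>] continuous_cper[OF \<beta>] continuous_cper[OF cper_a] continuous_cper[OF cper_b])
  also have "\<dots> = integral {0..2*pi} (\<lambda>x. 2 * of_real pi * ((of_real (besJ' (of_int n * (Astar + a x)) * \<alpha> x) - \<i> * of_real (besJ (of_int n * (Astar + a x)) * \<beta> x)) * ek (-n) (x + b x)))"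
  proof (simp only: cbox_interval, rule integral_cong)
    fix x
    define r where "r = Astar + a x"
    have e: "of_real (w x \<phi>) * ek (-n) (I_map Astar a b x \<phi>) =
      (of_real (\<alpha> x) * ek (-n) (x + b x)) * (of_real ((sin \<phi>)\<^sup>2) * ek (-n) (r * sin \<phi>)) +
      (of_real (\<beta> x) * ek (-n) (x + b x)) * (of_real (sin \<phi>) * ek (-n) (r * sin \<phi>))" for \<phi>
      unfolding w_def I_map_def r_def [symmetric] ek_add_arg by (simp add: algebra_simps power2_eq_square)
    have "integral {0..2*pi} (\<lambda>\<phi>. of_real (w x \<phi>) * ek (-n) (I_map Astar a b x \<phi>)) =
      (of_real (\<alpha> x) * ek (-n) (x + b x)) * integral {0..2*pi} (\<lambda>\<phi>. of_real ((sin \<phi>)\<^sup>2) * ek (-n) (r * sin \<phi>)) +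
      (of_real (\<beta> x) * ek (-n) (x + b x)) * integral {0..2*pi} (\<lambda>\<phi>. of_real (sin \<phi>) * ek (-n) (r * sin \<phi>))"
      unfolding e
      by (subst Henstock_Kurzweil_Integration.integral_add, (intro integrable_continuous_real continuous_intros)+)
        (simp only: integral_mult_right)
    then show "integral {0..2*pi} (\<lambda>\<phi>. of_real (w x \<phi>) * ek (-n) (I_map Astar a b x \<phi>)) =
      2 * of_real pi * ((of_real (besJ' (of_int n * (Astar + a x)) * \<alpha> x) - \<i> * of_real (besJ (of_int n * (Astar + a x)) * \<beta> x)) * ek (-n) (x + b x))"
      unfolding integral_sin_exp r_def by (simp add: algebra_simps)
  qed
  also have "\<dots> = 2 * of_real pi * \<Lambda>" unfolding \<Lambda>_def by (rule integral_mult_right)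
  finally have main: "integral {0..2*pi} (\<lambda>I. complex_of_real (integral {0..2*pi} (K I)) * ek (-n) I) = 2 * of_real pi * \<Lambda>" .
  define q where "q = 1/2 * integral {0..2*pi} \<alpha>"
  have TK: "T \<alpha> \<beta> I = integral {0..2*pi} (K I) - q" for I
    unfolding T_def K_def q_def ..
  have cI: "cper (\<lambda>I. complex_of_real (integral {0..2*pi} (K I)))"
    using cper_of_real[OF cper_add[OF T_cper[OF \<alpha> \<beta>] cper_const[of q]]] by (simp add: TK)
  have "fc (\<lambda>I. of_real (T \<alpha> \<beta> I)) n = fc (\<lambda>I. complex_of_real (integral {0..2*pi} (K I))) n - fc (\<lambda>I. of_real q) n"
    using fc_diff[OF cI cper_const[of "of_real q"]] by (simp add: TK)
  also have "fc (\<lambda>I. complex_of_real (integral {0..2*pi} (K I))) n = \<Lambda>"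
    unfolding fc_def main by simp
  also have "fc (\<lambda>I. of_real q) n = of_real q * (if n = 0 then 1 else 0)"
    using fc_cmult[of "of_real q" "ek 0" n] by (simp add: fc_ek)
  also have "\<Lambda> - of_real q * (if n = 0 then 1 else 0) = (if n = 0 then 0 else \<Lambda>)"
  proof (cases "n = 0")
    case True
    have "\<Lambda> = integral {0..2*pi} (\<lambda>x. complex_of_real (1/2 * \<alpha> x))"
      unfolding \<Lambda>_def True by simp
    also have "\<dots> = of_real (integral {0..2*pi} (\<lambda>x. 1/2 * \<alpha> x))"
      by (rule integral_complex_of_real) (intro continuous_intros cper_continuous \<alpha>)
    also have "\<dots> = of_real q" unfolding q_def by simp
    finally show ?thesis using True by simp
  qed simp
  finally show ?thesis unfolding \<Lambda>_def .
qed

end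

lemma continuous_quotient:
  fixes pf qf rf sf tf uf :: "real \<times> real \<Rightarrow> real"
  assumes "continuous_on S pf" "continuous_on S qf" "continuous_on S rf" "continuous_on S sf"
    "continuous_on S tf" "continuous_on S uf"
    and "\<And>x. x \<in> S \<Longrightarrow> (rf x + fst x * sf x) * sin (snd x) + (1 + (tf x + fst x * uf x)) \<noteq> 0"
  shows "continuous_on S (\<lambda>x. sin (snd x) * - ((pf x * sin (snd x) + qf x) * 1 /
    ((rf x + fst x * sf x) * sin (snd x) + (1 + (tf x + fst x * uf x)))))"
  by (intro continuous_intros assms ballI) (use assms(7) in blast)+

text \<open>Along the segment \<open>(a + t\<alpha>, b + t\<beta>)\<close> the slope condition persists for small \<open>t\<close>, which gives joint continuity of the
  implicit solution in \<open>t\<close> and \<open>\<phi>\<close> and permits differentiation under the integral.\<close>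

lemma dS_eq_T:
  assumes base: "phase_curve a b a' b' \<kappa>"
    and d\<alpha>: "\<And>x. (\<alpha> has_real_derivative \<alpha>' x) (at x)" and d\<beta>: "\<And>x. (\<beta> has_real_derivative \<beta>' x) (at x)"
    and c': "cper \<alpha>'" "cper \<beta>'" and c: "cper \<alpha>" "cper \<beta>"
  shows "dS Astar (a, b) (\<alpha>, \<beta>) I = phase_curve.T Astar a b a' b' \<alpha> \<beta> I"
proof -
  interpret B: phase_curve Astar a b a' b' \<kappa> by (rule base)
  obtain M1 where M1: "M1 > 0" "\<And>x. norm (\<alpha>' x) \<le> M1" using cper_bounded[OF c'(1)] by metis
  obtain M2 where M2: "M2 > 0" "\<And>x. norm (\<beta>' x) \<le> M2" using cper_bounded[OF c'(2)] by metis
  define \<tau> where "\<tau> = (1 - \<kappa>) / (2 * (M1 + M2))"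
  define \<kappa>1 where "\<kappa>1 = (1 + \<kappa>) / 2"
  have \<tau>: "\<tau> > 0" using B.\<kappa> M1(1) M2(1) by (simp add: \<tau>_def)
  have \<kappa>1: "\<kappa>1 < 1" using B.\<kappa> by (simp add: \<kappa>1_def)
  define U where "U = {-\<tau><..<\<tau>}"
  have U: "0 \<in> U" "convex U" "open U" using \<tau> by (auto simp: U_def)
  define af where "af t x = a x + t * \<alpha> x" for t x
  define bt where "bt t x = b x + t * \<beta> x" for t x
  have pc: "phase_curve (af t) (bt t) (\<lambda>x. a' x + t * \<alpha>' x) (\<lambda>x. b' x + t * \<beta>' x) \<kappa>1" if t: "t \<in> U" for t
  proof
    show "(af t has_real_derivative a' x + t * \<alpha>' x) (at x)" "(bt t has_real_derivative b' x + t * \<beta>' x) (at x)" for x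
      unfolding af_def [abs_def] bt_def [abs_def] by (auto intro!: derivative_eq_intros B.da B.db d\<alpha> d\<beta>)
    show "cper (\<lambda>x. a' x + t * \<alpha>' x)" "cper (\<lambda>x. b' x + t * \<beta>' x)"
      by (intro cper_add cper_mult cper_const B.ca' B.cb' c')+
    show "af t (x + 2*pi) = af t x" "bt t (x + 2*pi) = bt t x" for x
      using c by (simp_all add: af_def bt_def B.pa B.pb cper_def)
    show "\<kappa>1 < 1" by (rule \<kappa>1)
    fix x
    have "\<bar>a' x + t * \<alpha>' x\<bar> \<le> \<bar>a' x\<bar> + \<bar>t\<bar> * \<bar>\<alpha>' x\<bar>" "\<bar>b' x + t * \<beta>' x\<bar> \<le> \<bar>b' x\<bar> + \<bar>t\<bar> * \<bar>\<beta>' x\<bar>"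
      by (auto simp: abs_mult intro: order_trans[OF abs_triangle_ineq])
    moreover have "\<bar>t\<bar> * \<bar>\<alpha>' x\<bar> + \<bar>t\<bar> * \<bar>\<beta>' x\<bar> \<le> (1 - \<kappa>) / 2"
    proof -
      have "\<bar>t\<bar> * (\<bar>\<alpha>' x\<bar> + \<bar>\<beta>' x\<bar>) \<le> \<tau> * (M1 + M2)"
        using t M1(2)[of x] M2(2)[of x] \<tau> by (intro mult_mono add_mono) (auto simp: U_def)
      also have "\<dots> = (1 - \<kappa>) / 2" using M1(1) M2(1) by (simp add: \<tau>_def field_simps)
      finally show ?thesis by (simp add: distrib_left)
    qed
    moreover have "\<bar>a' x\<bar> + \<bar>b' x\<bar> \<le> \<kappa>" by (rule B.slope)
    moreover have "y + z \<le> (1 + \<kappa>) / 2" if "y \<le> p + q" "z \<le> u + v" "q + v \<le> (1 - \<kappa>) / 2" "p + u \<le> \<kappa>"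
      for y z p q u v :: real using that by (simp add: field_simps)
    ultimately show "\<bar>a' x + t * \<alpha>' x\<bar> + \<bar>b' x + t * \<beta>' x\<bar> \<le> \<kappa>1" unfolding \<kappa>1_def by blast
  qed
  define X where "X t \<phi> = x_sol Astar (af t) (bt t) I \<phi>" for t \<phi>
  define g where "g t x \<phi> = (a' x + t * \<alpha>' x) * sin \<phi> + (1 + (b' x + t * \<beta>' x))" for t x \<phi>
  have g: "g t x \<phi> > 0" if "t \<in> U" for t x \<phi>
    using phase_curve.g'_pos[OF pc[OF that], of x \<phi>] by (simp add: g_def phase_curve.g'_def[OF pc[OF that]])
  have X_eq: "I_map Astar (af t) (bt t) (X t \<phi>) \<phi> = I" if "t \<in> U" for t \<phi>
    unfolding X_def by (rule phase_curve.I_map_X[OF pc[OF that]])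
  have lim: "((\<lambda>p. X (fst p) (snd p)) \<longlongrightarrow> X t0 \<phi>0) (at (t0, \<phi>0) within U \<times> UNIV)" if t0: "t0 \<in> U" for t0 \<phi>0
  proof -
    define y where "y = X t0 \<phi>0"
    have "((\<lambda>p. \<bar>I - I_map Astar (af (fst p)) (bt (fst p)) y (snd p)\<bar> / (1 - \<kappa>1)) \<longlongrightarrow>
        \<bar>I - I_map Astar (af t0) (bt t0) y \<phi>0\<bar> / (1 - \<kappa>1)) (at (t0, \<phi>0) within U \<times> UNIV)"
      unfolding I_map_def af_def bt_def using \<kappa>1 by (auto intro!: tendsto_eq_intros)
    moreover have "\<bar>I - I_map Astar (af t0) (bt t0) y \<phi>0\<bar> / (1 - \<kappa>1) = 0" by (simp add: y_def X_eq[OF t0])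
    ultimately have z: "((\<lambda>p. \<bar>I - I_map Astar (af (fst p)) (bt (fst p)) y (snd p)\<bar> / (1 - \<kappa>1)) \<longlongrightarrow> 0) (at (t0, \<phi>0) within U \<times> UNIV)"
      by simp
    have "((\<lambda>p. X (fst p) (snd p) - y) \<longlongrightarrow> 0) (at (t0, \<phi>0) within U \<times> UNIV)"
    proof (rule Lim_null_comparison[OF _ z])
      have "\<bar>X t \<phi> - y\<bar> \<le> \<bar>I - I_map Astar (af t) (bt t) y \<phi>\<bar> / (1 - \<kappa>1)" if "t \<in> U" for t \<phi>
        using phase_curve.X_close[OF pc[OF that], of Astar I \<phi> y] \<kappa>1 by (simp add: X_def field_simps)
      then show "eventually (\<lambda>p. norm (X (fst p) (snd p) - y) \<le> \<bar>I - I_map Astar (af (fst p)) (bt (fst p)) y (snd p)\<bar> / (1 - \<kappa>1)) (at (t0, \<phi>0) within U \<times> UNIV)"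
        by (auto simp: eventually_at_filter intro!: always_eventually)
    qed
    then show ?thesis by (simp add: y_def Lim_null [symmetric])
  qed
  then have cX: "continuous_on (U \<times> UNIV) (\<lambda>p. X (fst p) (snd p))"
    by (auto simp: continuous_on_def)
  have cX': "continuous_on S (\<lambda>p. X (f p) (h p))" if "continuous_on S f" "continuous_on S h" "\<And>p. p \<in> S \<Longrightarrow> f p \<in> U"
    for S and f h :: "'z::t2_space \<Rightarrow> real"
    using continuous_on_compose2[OF cX, of S "\<lambda>p. (f p, h p)"] that by (auto simp: continuous_on_Pair)
  define D where "D t \<phi> = - ((\<alpha> (X t \<phi>) * sin \<phi> + \<beta> (X t \<phi>)) * 1 / g t (X t \<phi>) \<phi>)" for t \<phi>
  have dX: "((\<lambda>t. X t \<phi>) has_real_derivative D t0 \<phi>) (at t0)" if t0: "t0 \<in> U" for t0 \<phi>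
    unfolding D_def
  proof (rule implicit_derivative[where u = "\<lambda>x. I_map Astar a b x \<phi>" and r = "\<lambda>x. \<alpha> x * sin \<phi> + \<beta> x" and \<sigma> = "\<lambda>t. t" and C = I])
    have "I_map Astar a b (X t \<phi>) \<phi> + (\<alpha> (X t \<phi>) * sin \<phi> + \<beta> (X t \<phi>)) * t = I" if "t \<in> U" for t
      using X_eq[OF that, of \<phi>] by (simp add: I_map_def af_def bt_def algebra_simps)
    then show "eventually (\<lambda>t. I_map Astar a b (X t \<phi>) \<phi> + (\<alpha> (X t \<phi>) * sin \<phi> + \<beta> (X t \<phi>)) * t = I) (nhds t0)"
      using eventually_nhds_in_open[OF U(3) t0] by (auto elim: eventually_mono)
    have "continuous_on U (\<lambda>t. X t \<phi>)" by (intro cX' continuous_intros)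
    then show "isCont (\<lambda>t. X t \<phi>) t0" using continuous_on_interior[of U] t0 U(3) by (simp add: interior_open)
    show "isCont (\<lambda>x. \<alpha> x * sin \<phi> + \<beta> x) (X t0 \<phi>)"
      by (intro continuous_intros DERIV_isCont[OF d\<alpha>] DERIV_isCont[OF d\<beta>])
    show "((\<lambda>y. I_map Astar a b y \<phi> + t0 * (\<alpha> y * sin \<phi> + \<beta> y)) has_real_derivative g t0 (X t0 \<phi>) \<phi>) (at (X t0 \<phi>))"
      unfolding I_map_def g_def by (auto intro!: derivative_eq_intros B.da B.db d\<alpha> d\<beta> simp: algebra_simps)
    show "g t0 (X t0 \<phi>) \<phi> \<noteq> 0" using g[OF t0, of "X t0 \<phi>" \<phi>] by simp
  qed (auto intro!: derivative_eq_intros)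
  have "((\<lambda>t. integral (cbox 0 (2*pi)) (\<lambda>\<phi>. sin \<phi> * X t \<phi>)) has_field_derivative
      integral (cbox 0 (2*pi)) (\<lambda>\<phi>. sin \<phi> * D 0 \<phi>)) (at 0 within U)"
  proof (rule leibniz_rule_field_derivative[OF _ _ _ U(1,2)])
    show "((\<lambda>t. sin \<phi> * X t \<phi>) has_field_derivative sin \<phi> * D t \<phi>) (at t within U)" if "t \<in> U" for t \<phi>
      by (intro DERIV_cmult has_field_derivative_at_within[OF dX[OF that]])
    show "(\<lambda>\<phi>. sin \<phi> * X t \<phi>) integrable_on cbox 0 (2*pi)" if "t \<in> U" for t
      by (intro integrable_continuous continuous_intros cX' that)
    have cXU: "continuous_on (U \<times> cbox 0 (2*pi)) (\<lambda>p. X (fst p) (snd p))"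
      by (intro cX' continuous_intros) auto
    have gnz: "\<forall>p\<in>U \<times> cbox 0 (2*pi). (a' (X (fst p) (snd p)) + fst p * \<alpha>' (X (fst p) (snd p))) * sin (snd p) +
        (1 + (b' (X (fst p) (snd p)) + fst p * \<beta>' (X (fst p) (snd p)))) \<noteq> 0"
    proof
      fix p assume "p \<in> U \<times> cbox 0 (2*pi)"
      then have "fst p \<in> U" by auto
      from g[OF this, of "X (fst p) (snd p)" "snd p"]
      show "(a' (X (fst p) (snd p)) + fst p * \<alpha>' (X (fst p) (snd p))) * sin (snd p) +
        (1 + (b' (X (fst p) (snd p)) + fst p * \<beta>' (X (fst p) (snd p)))) \<noteq> 0" unfolding g_def by linarith
    qed
    show "continuous_on (U \<times> cbox 0 (2*pi)) (\<lambda>(t, \<phi>). sin \<phi> * D t \<phi>)"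
      unfolding D_def case_prod_beta g_def
      by (rule continuous_quotient[
        where pf = "\<lambda>p. \<alpha> (X (fst p) (snd p))"
        and qf = "\<lambda>p. \<beta> (X (fst p) (snd p))"
        and rf = "\<lambda>p. a' (X (fst p) (snd p))"
        and sf = "\<lambda>p. \<alpha>' (X (fst p) (snd p))"
        and tf = "\<lambda>p. b' (X (fst p) (snd p))"
        and uf = "\<lambda>p. \<beta>' (X (fst p) (snd p))",
        OF B.continuous_cper[OF c(1) cXU] B.continuous_cper[OF c(2) cXU] B.continuous_cper[OF B.ca' cXU] B.continuous_cper[OF c'(1) cXU] B.continuous_cper[OF B.cb' cXU] B.continuous_cper[OF c'(2) cXU]])
        (rule gnz[rule_format])
  qed
  then have d1: "((\<lambda>t. integral {0..2*pi} (\<lambda>\<phi>. sin \<phi> * X t \<phi>)) has_real_derivative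
      integral {0..2*pi} (\<lambda>\<phi>. sin \<phi> * D 0 \<phi>)) (at 0)"
    unfolding at_within_open[OF U(1,3)] cbox_interval .
  have "integral {0..2*pi} (\<lambda>x. Astar + af t x) = integral {0..2*pi} (\<lambda>x. Astar + a x) + t * integral {0..2*pi} \<alpha>" for t
  proof -
    have "integral {0..2*pi} (\<lambda>x. Astar + af t x) = integral {0..2*pi} (\<lambda>x. (Astar + a x) + t * \<alpha> x)"
      by (simp add: af_def add.assoc)
    also have "\<dots> = integral {0..2*pi} (\<lambda>x. Astar + a x) + integral {0..2*pi} (\<lambda>x. t * \<alpha> x)"
      by (intro Henstock_Kurzweil_Integration.integral_add cper_integrable cper_add cper_mult cper_const B.cper_a c)
    finally show ?thesis by simp
  qed
  then have S: "S_map Astar (lincomb2 1 (a, b) t (\<alpha>, \<beta>)) I = - integral {0..2*pi} (\<lambda>\<phi>. sin \<phi> * X t \<phi>)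
      - 1/2 * (integral {0..2*pi} (\<lambda>x. Astar + a x) + t * integral {0..2*pi} \<alpha>)" if "t \<in> U" for t
    using phase_curve.S_map_eq[OF pc[OF that], of Astar I]
    by (simp add: lincomb2_def lincomb_def X_def af_def [abs_def] bt_def [abs_def])
  have "((\<lambda>t. - integral {0..2*pi} (\<lambda>\<phi>. sin \<phi> * X t \<phi>) - 1/2 * (integral {0..2*pi} (\<lambda>x. Astar + a x) + t * integral {0..2*pi} \<alpha>))
      has_real_derivative - integral {0..2*pi} (\<lambda>\<phi>. sin \<phi> * D 0 \<phi>) - 1/2 * integral {0..2*pi} \<alpha>) (at 0)"
    by (auto intro!: derivative_eq_intros d1)
  then have "((\<lambda>t. S_map Astar (lincomb2 1 (a, b) t (\<alpha>, \<beta>)) I) has_real_derivative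
      - integral {0..2*pi} (\<lambda>\<phi>. sin \<phi> * D 0 \<phi>) - 1/2 * integral {0..2*pi} \<alpha>) (at 0)"
    by (rule has_field_derivative_transform_within_open[OF _ U(3,1)]) (simp add: S)
  then have "dS Astar (a, b) (\<alpha>, \<beta>) I = - integral {0..2*pi} (\<lambda>\<phi>. sin \<phi> * D 0 \<phi>) - 1/2 * integral {0..2*pi} \<alpha>"
    unfolding dS_def by (rule DERIV_imp_deriv)
  also have "- integral {0..2*pi} (\<lambda>\<phi>. sin \<phi> * D 0 \<phi>) = integral {0..2*pi} (\<lambda>\<phi>. - (sin \<phi> * D 0 \<phi>))"
    by simp
  also have "(\<lambda>\<phi>. - (sin \<phi> * D 0 \<phi>)) = (\<lambda>\<phi>. sin \<phi> * (\<alpha> (B.X I \<phi>) * sin \<phi> + \<beta> (B.X I \<phi>)) / B.g' (B.X I \<phi>) \<phi>)"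
    by (simp add: D_def X_def g_def B.g'_def af_def [abs_def] bt_def [abs_def])
  finally show ?thesis unfolding B.T_def .
qed

section \<open>Sobolev norms and modulated waves\<close>

subsection \<open>Sobolev spaces\<close>

lemma sobolev_term_eq: "sobolev_term s u j = (jw s j * cmod (fc (\<lambda>x. of_real (u x)) j))\<^sup>2"
proof -
  have "jap (of_int j) powr (2 * s) = (jw s j)\<^sup>2"
    unfolding jw_def power2_eq_square using jap_ge_1[of "of_int j"] by (simp add: powr_add [symmetric])
  then show ?thesis by (simp add: sobolev_term_def fourier_coeff_eq_fc power_mult_distrib)
qed

lemma Hs_cper: "u \<in> Hs s \<Longrightarrow> cper u"
  by (auto simp: Hs_def cper_def)

lemma Hs_l2le:
  assumes "u \<in> Hs s"
  shows "l2le (jw s) (fc (\<lambda>x. of_real (u x))) (sobolev_norm s u)"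
  unfolding l2le_def
proof safe
  fix F :: "int set" assume F: "finite F"
  have "(\<Sum>j\<in>F. sobolev_term s u j) \<le> (\<Sum>\<^sub>\<infinity>j. sobolev_term s u j)"
  proof (rule finite_sum_le_infsum)
    show "sobolev_term s u summable_on UNIV" using assms by (simp add: Hs_def)
  qed (use F in \<open>auto simp: sobolev_term_eq\<close>)
  then show "L2_set (\<lambda>k. jw s k * cmod (fc (\<lambda>x. of_real (u x)) k)) F \<le> sobolev_norm s u"
    unfolding L2_set_def sobolev_norm_def sobolev_term_eq by (rule real_sqrt_le_mono)
qed

lemma l2le_Hs:
  assumes "cper u" and l: "l2le (jw s) (fc (\<lambda>x. of_real (u x))) M"
  shows "u \<in> Hs s" "sobolev_norm s u \<le> M"
proof -
  have M: "M \<ge> 0" by (rule l2le_nonneg[OF l])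
  have fin: "(\<Sum>j\<in>F. sobolev_term s u j) \<le> M\<^sup>2" if "finite F" for F
  proof -
    have "sqrt (\<Sum>j\<in>F. sobolev_term s u j) \<le> M"
      using l2leD[OF l that] by (simp add: L2_set_def sobolev_term_eq)
    then show ?thesis by (rule sqrt_le_D)
  qed
  have sum: "sobolev_term s u summable_on UNIV"
    by (rule nonneg_bdd_above_summable_on) (use fin in \<open>auto intro!: bdd_aboveI2[where M = "M\<^sup>2"] simp: sobolev_term_eq\<close>)
  then show "u \<in> Hs s" using assms(1) by (simp add: Hs_def cper_def)
  have "(\<Sum>\<^sub>\<infinity>j. sobolev_term s u j) \<le> M\<^sup>2"
    by (rule infsum_le_finite_sums[OF sum]) (use fin in auto)
  then show "sobolev_norm s u \<le> M"
    unfolding sobolev_norm_def using M by (intro real_le_lsqrt)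
qed

lemma l2le_jw_mono: "l2le (jw t) w M \<Longrightarrow> s \<le> t \<Longrightarrow> l2le (jw s) w M"
  using l2le_weaken[of "jw t" w M "jw s" w 1] by (simp add: mult_right_mono jw_mono)

lemma l1le_jw_mono: "l1le (jw t) w M \<Longrightarrow> s \<le> t \<Longrightarrow> l1le (jw s) w M"
  using l1le_weaken[of "jw t" w M "jw s" w 1] by (simp add: mult_right_mono jw_mono)

lemma l1le_jw_imp_1: "l1le (jw s) w M \<Longrightarrow> s \<ge> 0 \<Longrightarrow> l1le (\<lambda>_. 1) w M"
  by (rule l1le_imp_1[OF _ jw_ge_1])

lemma Hs_mono: "u \<in> Hs t \<Longrightarrow> s \<le> t \<Longrightarrow> u \<in> Hs s"
  and sobolev_norm_mono: "u \<in> Hs t \<Longrightarrow> s \<le> t \<Longrightarrow> sobolev_norm s u \<le> sobolev_norm t u"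
  using l2le_Hs[OF Hs_cper l2le_jw_mono[OF Hs_l2le]] by blast+

lemma sobolev_norm_nonneg: "u \<in> Hs s \<Longrightarrow> sobolev_norm s u \<ge> 0"
  by (rule l2le_nonneg[OF Hs_l2le])

text \<open>Cauchy--Schwarz against the square-summable sequence \<open>\<langle>k\<rangle>\<^sup>-\<^sup>1\<close>.\<close>

lemma embedding:
  obtains C where "C > 0" "\<And>s t w M. s + 1 \<le> t \<Longrightarrow> l2le (jw t) w M \<Longrightarrow> l1le (jw s) w (C * M)"
proof -
  obtain D where D: "D \<ge> 0" "\<And>F. finite F \<Longrightarrow> L2_set (jw (-1)) F \<le> D"
    using summable_jw[of 1] by auto
  have "l1le (jw s) w ((D + 1) * M)" if st: "s + 1 \<le> t" and w: "l2le (jw t) w M" for s t w M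
    unfolding l1le_def
  proof safe
    fix F :: "int set" assume F: "finite F"
    have M: "M \<ge> 0" by (rule l2le_nonneg[OF w])
    have "(\<Sum>k\<in>F. jw s k * cmod (w k)) \<le> (\<Sum>k\<in>F. \<bar>jw (-1) k\<bar> * \<bar>jw (s + 1) k * cmod (w k)\<bar>)"
      by (intro sum_mono) (simp add: abs_mult mult.assoc [symmetric] jw_add [symmetric])
    also have "\<dots> \<le> L2_set (jw (-1)) F * L2_set (\<lambda>k. jw (s + 1) k * cmod (w k)) F"
      by (rule L2_set_mult_ineq)
    also have "\<dots> \<le> D * M"
      by (intro mult_mono D F l2leD[OF l2le_jw_mono[OF w st]]) auto
    also have "\<dots> \<le> (D + 1) * M" using M by (intro mult_right_mono) auto
    finally show "(\<Sum>k\<in>F. jw s k * cmod (w k)) \<le> (D + 1) * M" .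
  qed
  then show ?thesis using that[of "D + 1"] D(1) by (simp add: add_nonneg_pos)
qed

lemma real_derivative:
  fixes u :: "real \<Rightarrow> real"
  assumes u: "cper u" and w: "l1le (jw 1) (fc (\<lambda>x. of_real (u x))) M"
  obtains u' where "cper u'" "\<And>x. (u has_real_derivative u' x) (at x)"
    "\<And>k. fc (\<lambda>x. of_real (u' x)) k = \<i> * of_int k * fc (\<lambda>x. of_real (u x)) k"
proof -
  let ?w = "fc (\<lambda>x. complex_of_real (u x))"
  have w': "l1le (\<lambda>_. 1) (\<lambda>k. \<i> * of_int k * ?w k) (1 * M)"
    by (rule l1le_weaken[OF w]) (auto simp: norm_mult jw_1 jap_def intro!: mult_right_mono)
  obtain f where f: "cper f" "\<And>x. ((\<lambda>x. complex_of_real (u x)) has_vector_derivative f x) (at x)"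
    "\<And>k. fc f k = \<i> * of_int k * ?w k"
    by (rule series_derivative[OF cper_of_real[OF u] w']) (rule that, assumption+)
  have Re: "(u has_real_derivative Re (f x)) (at x)" for x
    using bounded_linear.has_vector_derivative[OF bounded_linear_Re f(2)[of x]] by (simp add: has_real_derivative_iff_has_vector_derivative)
  have "((\<lambda>x. 0) has_vector_derivative Im (f x)) (at x)" for x
    using bounded_linear.has_vector_derivative[OF bounded_linear_Im f(2)[of x]] by simp
  then have "Im (f x) = 0" for x
    by (rule vector_derivative_unique_at[OF _ has_vector_derivative_const])
  then have eq: "(\<lambda>x. complex_of_real (Re (f x))) = f" by (auto simp: complex_eq_iff)
  show ?thesis
    by (rule that[of "\<lambda>x. Re (f x)"]) (use cper_Re[OF f(1)] Re f(3) eq in auto)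
qed

lemma l1le_derivative:
  assumes "l1le (jw (s + 1)) w M" "\<And>k. v k = \<i> * of_int k * w k"
  shows "l1le (jw s) v M"
proof -
  have "jw s k * cmod (v k) \<le> 1 * (jw (s + 1) k * cmod (w k))" for k
  proof -
    have "\<bar>real_of_int k\<bar> \<le> jw 1 k" by (simp add: jw_1 jap_def)
    then have "jw s k * \<bar>real_of_int k\<bar> * cmod (w k) \<le> jw s k * jw 1 k * cmod (w k)"
      by (intro mult_right_mono mult_left_mono) auto
    then show ?thesis unfolding assms(2) jw_add by (simp add: norm_mult mult_ac)
  qed
  from l1le_weaken[OF assms(1) this] show ?thesis by simp
qed

subsection \<open>Superpositions of slowly modulated waves along the curve\<close>

lemma summable_quarter: "(\<lambda>l. (1/4::real) ^ l) summable_on UNIV" "finite Z \<Longrightarrow> (\<Sum>l\<in>Z. (1/4::real) ^ l) \<le> 2"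
proof -
  show "(\<lambda>l. (1/4::real) ^ l) summable_on UNIV"
    by (intro summable_on_UNIV_nonneg_real_iff[THEN iffD2]) (auto simp: summable_geometric)
  assume "finite Z"
  then have "(\<Sum>l\<in>Z. (1/4::real) ^ l) \<le> (\<Sum>l. (1/4::real) ^ l)"
    by (intro sum_le_suminf) (auto simp: summable_geometric)
  also have "\<dots> \<le> 2" by (simp add: suminf_geometric)
  finally show "(\<Sum>l\<in>Z. (1/4::real) ^ l) \<le> 2" .
qed

text \<open>Expanding the amplitude of each wave in powers of \<open>a(x)\<close> turns the superposition into
  \<open>\<Sum>\<^sub>l a\<^sup>l (v\<^sub>l \<circ> (id + c))\<close> with Fourier multipliers \<open>v\<^sub>l\<close> of the data, to which the composition theorem applies.
  Powers of \<open>a\<close> are estimated in the rescaled weighted norm.\<close>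

lemma wave_series:
  fixes s Astar :: real
  assumes s: "s > 0" and Astar: "Astar > 0" and m: "m > 0" "real m > s + 1/2"
  obtains C where "C > 0"
    "\<And>a c c' h u Q N Na U1 Us S f.
      \<lbrakk>\<And>x. (c has_real_derivative c' x) (at x); \<And>x. c (x + 2*pi) = c x; cper c';
       l1le (\<lambda>_. 1) (fc (\<lambda>x. of_real (c' x))) (1/16); l1le (jw m) (fc (\<lambda>x. of_real (c' x))) N;
       cper a; l1le (\<lambda>_. 1) (fc (\<lambda>x. of_real (a x))) (Astar/48); l1le (jw s) (fc (\<lambda>x. of_real (a x))) Na;
       \<And>k l. cmod (h k l) \<le> Q * (2/Astar) ^ l; Q \<ge> 0; l1le (\<lambda>_. 1) u U1; l2le (jw s) u Us;
       \<And>k x. (\<lambda>l. h k l * of_real (a x) ^ l) sums S k x;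
       \<And>x. ((\<lambda>k. u k * S k x * ek k (x + c x)) has_sum f x) UNIV\<rbrakk>
      \<Longrightarrow> cper f \<and> (\<forall>x. cmod (f x) \<le> 2 * Q * U1) \<and> l2le (jw s) (fc f) (C * Q * (Us + (1 + N + Na) * U1))"
proof -
  obtain D where D: "D \<ge> 0" "\<And>F. finite F \<Longrightarrow> L2_set (jw (s - real m)) F \<le> D"
    using summable_jw[of "real m - s"] m by auto
  define K where "K = (4 * (real m + 2)) ^ m * D"
  have K: "K \<ge> 0" using D by (simp add: K_def)
  define L where "L = (s + 2) powr s * (1 + 16 / Astar) + 4 * 8 powr s + 6 * K"
  have L: "L > 0" "4 * 8 powr s \<le> L" using K Astar s by (auto simp: L_def intro!: add_nonneg_pos add_pos_nonneg mult_pos_pos divide_pos_pos)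
  define C where "C = 2 * 2 powr s * L"
  have C: "C > 0" using L by (simp add: C_def)
  show ?thesis
  proof (rule that[OF C])
    fix a c c' :: "real \<Rightarrow> real" and h :: "int \<Rightarrow> nat \<Rightarrow> complex" and u Q N Na U1 Us S f
    assume dc: "\<And>x. (c has_real_derivative c' x) (at x)" "\<And>x. c (x + 2*pi) = c x" and cc': "cper c'"
       "l1le (\<lambda>_. 1) (fc (\<lambda>x. of_real (c' x))) (1/16)" "l1le (jw m) (fc (\<lambda>x. of_real (c' x))) N"
     and a: "cper a" "l1le (\<lambda>_. 1) (fc (\<lambda>x. of_real (a x))) (Astar/48)" "l1le (jw s) (fc (\<lambda>x. of_real (a x))) Na"
     and h: "\<And>k l. cmod (h k l) \<le> Q * (2/Astar) ^ l" and Q: "Q \<ge> 0"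
     and u: "l1le (\<lambda>_. 1) u U1" "l2le (jw s) u Us"
     and S: "\<And>k x. (\<lambda>l. h k l * of_real (a x) ^ l) sums S k x"
     and f: "\<And>x. ((\<lambda>k. u k * S k x * ek k (x + c x)) has_sum f x) UNIV"
    have U1: "U1 \<ge> 0" and Us: "Us \<ge> 0" and Na: "Na \<ge> 0" and N: "N \<ge> 0"
      using l1le_nonneg[OF u(1)] l2le_nonneg[OF u(2)] l1le_nonneg[OF a(3)] l1le_nonneg[OF cc'(3)] by auto
    define ac where "ac x = complex_of_real (a x)" for x
    have cac: "cper ac" unfolding ac_def [abs_def] by (rule cper_of_real[OF a(1)])
    note a' = a(2,3)[folded ac_def]
    have sup_a: "cmod (ac x) \<le> Astar/48" for x by (rule fourier_inversion(2)[OF cac a'(1)])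
    have ab: "cmod (ac x) \<le> Astar/8" for x using sup_a[of x] Astar by linarith
    have abl: "Q * (2/Astar) ^ l * cmod (ac x) ^ l \<le> Q * (1/4) ^ l" for l x
    proof -
      have "2/Astar * cmod (ac x) \<le> 1/4" using ab[of x] Astar by (simp add: field_simps)
      then have "(2/Astar * cmod (ac x)) ^ l \<le> (1/4) ^ l" using Astar by (intro power_mono) auto
      from mult_left_mono[OF this Q] show ?thesis by (simp only: power_mult_distrib mult.assoc)
    qed
    \<comment> \<open>the coefficients of the expansion\<close>
    define v where "v l x = (\<Sum>\<^sub>\<infinity>k. u k * h k l * ek k (x + c x))" for l x
    have uh: "l1le (\<lambda>_. 1) (\<lambda>k. u k * h k l) (Q * (2/Astar) ^ l * U1)"
      "l2le (jw s) (\<lambda>k. u k * h k l) (Q * (2/Astar) ^ l * Us)" for l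
    proof -
      have "cmod (u k) * cmod (h k l) \<le> Q * (2/Astar) ^ l * cmod (u k)" for k
        using mult_right_mono[OF h[of k l], of "cmod (u k)"] by (simp add: mult.commute)
      then show "l1le (\<lambda>_. 1) (\<lambda>k. u k * h k l) (Q * (2/Astar) ^ l * U1)"
        using Q Astar by (intro l1le_weaken[OF u(1)]) (auto simp: norm_mult)
      have "jw s k * cmod (u k * h k l) \<le> Q * (2/Astar) ^ l * (jw s k * cmod (u k))" for k
        using mult_left_mono[OF \<open>cmod (u k) * cmod (h k l) \<le> Q * (2/Astar) ^ l * cmod (u k)\<close> jw_nonneg[of s k]]
        by (simp add: norm_mult mult_ac)
      then show "l2le (jw s) (\<lambda>k. u k * h k l) (Q * (2/Astar) ^ l * Us)"
        using Q Astar by (intro l2le_weaken[OF u(2)]) auto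
    qed
    have vs: "((\<lambda>k. u k * h k l * ek k (x + c x)) has_sum v l x) UNIV" for l x
      unfolding v_def
      by (rule has_sum_infsum[OF abs_summable_summable]) (use l1le_1_summable(1)[OF uh(1)] in \<open>simp add: norm_mult\<close>)
    have vsup: "cmod (v l x) \<le> Q * (2/Astar) ^ l * U1" for l x
      by (rule has_sum_norm_le[OF vs]) (use l1leD[OF uh(1)] in \<open>simp add: norm_mult\<close>)
    have cont_c: "continuous_on UNIV c"
      using dc(1) by (intro continuous_at_imp_continuous_on) (auto intro: DERIV_isCont)
    have cv: "cper (v l)" for l
    proof (rule cper_series[OF _ _ l1le_1_summable(1)[OF uh(1)[of l]] vs])
      show "cper (\<lambda>x. u k * h k l * ek k (x + c x))" for k
        by (intro cper_mult cper_const cper_compose[OF cper_ek] continuous_intros cont_c) (simp add: dc(2))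
    qed (simp add: norm_mult)
    define R where "R = 4 * 8 powr s * Us + K * (1 + 16 * N / 3) * U1"
    have vl2: "l2le (jw s) (fc (v l)) (Q * (2/Astar) ^ l * R)" for l
      using l2le_compose[OF dc cc' _ D(2) m(1) uh vs, of l] s
      by (simp add: R_def K_def algebra_simps)
    have vl2': "l2le (\<lambda>_. 1) (fc (v l)) (Q * (2/Astar) ^ l * U1)" for l
      by (rule l2le_of_bounded[OF cv vsup])
    \<comment> \<open>interchange of the two summations\<close>
    have sum2: "((\<lambda>l. ac x ^ l * v l x) has_sum f x) UNIV" for x
    proof -
      define F where "F = (\<lambda>(k, l). u k * h k l * ac x ^ l * ek k (x + c x))"
      have "(\<lambda>p. cmod (F p)) summable_on (UNIV \<times> UNIV)"
      proof (rule Infinite_Sum.abs_summable_on_comparison_test'[where g = "\<lambda>(k, l). cmod (u k) * Q * (1/4) ^ l"])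
        show "(\<lambda>(k, l). cmod (u k) * Q * (1/4) ^ l) summable_on (UNIV \<times> (UNIV :: nat set))"
        proof (rule summable_on_SigmaI)
          show "((\<lambda>l. case (k, l) of (k, l) \<Rightarrow> cmod (u k) * Q * (1/4) ^ l) has_sum (cmod (u k) * Q * infsum (\<lambda>l. (1/4::real) ^ l) UNIV)) UNIV" for k
            unfolding prod.case by (intro has_sum_cmult_right has_sum_infsum summable_quarter)
          have "(\<lambda>k. cmod (u k) * (Q * infsum (\<lambda>l. (1/4::real) ^ l) UNIV)) summable_on UNIV"
            by (intro summable_on_cmult_left l1le_1_summable(1)[OF u(1)])
          then show "(\<lambda>k. cmod (u k) * Q * infsum (\<lambda>l. (1/4::real) ^ l) UNIV) summable_on UNIV" by (simp add: mult.assoc)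
          show "0 \<le> (case (k, l) of (k, l) \<Rightarrow> cmod (u k) * Q * (1/4) ^ l)" for k and l :: nat using Q by simp
        qed
        fix p assume "p \<in> (UNIV :: int set) \<times> (UNIV :: nat set)"
        obtain k l where p: "p = (k, l)" by (cases p)
        have "cmod (h k l) * cmod (ac x) ^ l \<le> Q * (1/4) ^ l"
          using mult_right_mono[OF h[of k l], of "cmod (ac x) ^ l"] abl[of l x] by simp
        from mult_left_mono[OF this, of "cmod (u k)"]
        show "cmod (F p) \<le> (case p of (k, l) \<Rightarrow> cmod (u k) * Q * (1/4) ^ l)"
          by (simp add: F_def p norm_mult norm_power mult.assoc)
      qed
      then have tot: "(F has_sum infsum F (UNIV \<times> UNIV)) (UNIV \<times> UNIV)"
        by (intro has_sum_infsum) (rule abs_summable_summable)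
      have Sk: "((\<lambda>l. h k l * ac x ^ l) has_sum S k x) UNIV" for k
      proof (rule norm_summable_imp_has_sum)
        show "summable (\<lambda>l. norm (h k l * ac x ^ l))"
        proof (rule summable_comparison_test[OF _ summable_mult[OF summable_geometric]])
          show "\<exists>M. \<forall>l\<ge>M. norm (norm (h k l * ac x ^ l)) \<le> Q * (1/4) ^ l"
          proof (intro exI allI impI)
            fix l
            show "norm (norm (h k l * ac x ^ l)) \<le> Q * (1/4) ^ l"
              using mult_right_mono[OF h[of k l], of "cmod (ac x) ^ l"] abl[of l x] by (simp add: norm_mult norm_power)
          qed
        qed simp
        show "(\<lambda>l. h k l * ac x ^ l) sums S k x" using S[of k x] by (simp add: ac_def)
      qed
      have "((\<lambda>k. u k * S k x * ek k (x + c x)) has_sum infsum F (UNIV \<times> UNIV)) UNIV"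
      proof (rule has_sum_SigmaD[OF tot])
        fix k
        have "((\<lambda>l. (u k * ek k (x + c x)) * (h k l * ac x ^ l)) has_sum (u k * ek k (x + c x)) * S k x) UNIV"
          by (rule has_sum_cmult_right[OF Sk])
        then show "((\<lambda>l. F (k, l)) has_sum u k * S k x * ek k (x + c x)) UNIV"
          by (simp add: F_def mult_ac)
      qed
      then have "infsum F (UNIV \<times> UNIV) = f x" using f[of x] by (rule has_sum_unique)
      with tot have "(F has_sum f x) (UNIV \<times> UNIV)" by simp
      then have "((\<lambda>(l, k). F (k, l)) has_sum f x) (UNIV \<times> UNIV)"
        using has_sum_reindex_bij_witness[of "UNIV \<times> UNIV" prod.swap prod.swap "UNIV \<times> UNIV" "\<lambda>(l, k). F (k, l)" F "f x"]
        by (auto simp: case_prod_beta)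
      then show ?thesis
      proof (rule has_sum_SigmaD)
        fix l
        show "((\<lambda>k. (case (l, k) of (l, k) \<Rightarrow> F (k, l))) has_sum ac x ^ l * v l x) UNIV"
          using has_sum_cmult_right[OF vs, of "ac x ^ l" l x] by (simp add: F_def mult_ac)
      qed
    qed
    \<comment> \<open>powers of \<open>a\<close>\<close>
    obtain \<theta> where \<theta>: "0 < \<theta>" "\<theta> \<le> 1" "((s + 2) * \<theta>) powr s * Na \<le> Astar/16"
      "\<theta> powr (-s) = (s + 2) powr s * (1 + Na / (Astar/16))"
      using weight_choice[OF s, of "Astar/16" Na] Astar Na by auto
    have "l1le (gw \<theta> s) (fc ac) (Astar/8)"
      unfolding l1le_def
    proof safe
      fix F :: "int set" assume F: "finite F"
      let ?q = "((s + 2) * \<theta>) powr s"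
      have "(\<Sum>k\<in>F. gw \<theta> s k * cmod (fc ac k)) \<le> (\<Sum>k\<in>F. 3 * (1 * cmod (fc ac k)) + ?q * (jw s k * cmod (fc ac k)))"
      proof (rule sum_mono)
        fix k
        show "gw \<theta> s k * cmod (fc ac k) \<le> 3 * (1 * cmod (fc ac k)) + ?q * (jw s k * cmod (fc ac k))"
          using mult_right_mono[OF gw_le_jw[of \<theta> s k], of "cmod (fc ac k)"] \<theta> s by (simp add: algebra_simps)
      qed
      also have "\<dots> = 3 * (\<Sum>k\<in>F. 1 * cmod (fc ac k)) + ?q * (\<Sum>k\<in>F. jw s k * cmod (fc ac k))"
        by (simp add: sum.distrib sum_distrib_left)
      also have "\<dots> \<le> 3 * (Astar/48) + ?q * Na"
        by (intro add_mono mult_left_mono l1leD[OF a'(1) F] l1leD[OF a'(2) F]) auto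
      also have "\<dots> \<le> Astar/8" using \<theta>(3) by simp
      finally show "(\<Sum>k\<in>F. gw \<theta> s k * cmod (fc ac k)) \<le> Astar/8" .
    qed
    then have pw: "l1le (gw \<theta> s) (fc (\<lambda>x. ac x ^ l)) ((Astar/8) ^ l)" for l
      using \<theta> s by (intro l1le_power cac gw_ge_1 gw_submult) auto
    have pw0: "l1le (\<lambda>_. 1) (fc (\<lambda>x. ac x ^ l)) ((Astar/8) ^ l)" for l
      by (rule l1le_imp_1[OF pw gw_ge_1]) (use \<theta> s in auto)
    have pws: "l1le (jw s) (fc (\<lambda>x. ac x ^ l)) (\<theta> powr (-s) * (Astar/8) ^ l)" for l
    proof (rule l1le_weaken[OF pw])
      fix k
      show "jw s k * cmod (fc (\<lambda>x. ac x ^ l) k) \<le> \<theta> powr (-s) * (gw \<theta> s k * cmod (fc (\<lambda>x. ac x ^ l) k))"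
        using mult_right_mono[OF jw_le_gw[OF \<theta>(1,2), of s k], of "cmod (fc (\<lambda>x. ac x ^ l) k)"] s by (simp add: mult.assoc)
    qed simp
    define Z where "Z = 2 powr s * (\<theta> powr (-s) * U1 + R)"
    have R0: "R \<ge> 0" using K N U1 Us by (simp add: R_def)
    have Z0: "Z \<ge> 0" using R0 U1 by (simp add: Z_def)
    have prod: "l2le (jw s) (fc (\<lambda>x. ac x ^ l * v l x)) (Q * Z * (1/4) ^ l)" for l
    proof -
      have e: "(Astar/8) ^ l * (2/Astar) ^ l = (1/4) ^ l"
        using Astar by (simp add: power_mult_distrib [symmetric])
      have "2 powr s * (\<theta> powr (-s) * (Astar/8) ^ l * (Q * (2/Astar) ^ l * U1) + (Astar/8) ^ l * (Q * (2/Astar) ^ l * R)) =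
        2 powr s * (\<theta> powr (-s) * U1 + R) * Q * ((Astar/8) ^ l * (2/Astar) ^ l)" by (simp add: algebra_simps)
      also have "\<dots> = Q * Z * (1/4) ^ l" unfolding e Z_def by (simp add: mult_ac)
      finally show ?thesis
        using l2le_mult[OF cper_power[OF cac] pws[of l] pw0[of l] _ cv vl2[of l] vl2'[of l]] s by (simp only: order.strict_implies_order)
    qed
    have ct: "cper (\<lambda>x. ac x ^ l * v l x)" for l by (intro cper_mult cper_power cac cv)
    have tb: "cmod (ac x ^ l * v l x) \<le> Q * U1 * (1/4) ^ l" for l x
    proof -
      have "cmod (ac x) ^ l * cmod (v l x) \<le> cmod (ac x) ^ l * (Q * (2/Astar) ^ l * U1)"
        by (intro mult_left_mono vsup) auto
      also have "\<dots> = Q * (2/Astar) ^ l * cmod (ac x) ^ l * U1" by (simp add: mult_ac)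
      also have "\<dots> \<le> Q * (1/4) ^ l * U1" by (intro mult_right_mono abl U1)
      finally show ?thesis by (simp add: norm_mult norm_power mult_ac)
    qed
    have ts: "(\<lambda>l. Q * U1 * (1/4) ^ l) summable_on UNIV" by (intro summable_on_cmult_right summable_quarter)
    have "cper f" by (rule cper_series[OF ct tb ts sum2])
    moreover have "cmod (f x) \<le> 2 * Q * U1" for x
    proof (rule has_sum_norm_le[OF sum2])
      fix Y :: "nat set" assume Y: "finite Y"
      have "(\<Sum>l\<in>Y. cmod (ac x ^ l * v l x)) \<le> (\<Sum>l\<in>Y. Q * U1 * (1/4) ^ l)" by (intro sum_mono tb)
      also have "\<dots> = Q * U1 * (\<Sum>l\<in>Y. (1/4) ^ l)" by (simp add: sum_distrib_left)
      also have "\<dots> \<le> Q * U1 * 2" using Q U1 by (intro mult_left_mono summable_quarter(2) Y) auto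
      finally show "(\<Sum>l\<in>Y. cmod (ac x ^ l * v l x)) \<le> 2 * Q * U1" by simp
    qed
    moreover have "l2le (jw s) (fc f) (C * Q * (Us + (1 + N + Na) * U1))"
      unfolding l2le_def
    proof safe
      fix F :: "int set" assume F: "finite F"
      have "L2_set (\<lambda>k. jw s k * cmod (fc f k)) F \<le> Q * Z * 2"
      proof (rule L2_set_series[OF F jw_nonneg fc_series[OF ct tb ts sum2]])
        show "L2_set (\<lambda>n. jw s n * cmod (fc (\<lambda>x. ac x ^ l * v l x) n)) F \<le> Q * Z * (1/4) ^ l" for l
          by (rule l2leD[OF prod F])
        fix Y :: "nat set" assume Y: "finite Y"
        show "(\<Sum>l\<in>Y. Q * Z * (1/4) ^ l) \<le> Q * Z * 2"
          unfolding sum_distrib_left [symmetric] using Q Z0 by (intro mult_left_mono summable_quarter(2) Y) auto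
      qed
      also have "Z \<le> 2 powr s * (L * (Us + (1 + N + Na) * U1))"
      proof -
        define p where "p = (s + 2) powr s"
        have p: "p \<ge> 0" by (simp add: p_def)
        have "\<theta> powr (-s) * U1 + R = p * U1 + p * (16 / Astar) * (Na * U1) + 4 * 8 powr s * Us + K * U1 + K * (16/3) * (N * U1)"
          unfolding \<theta>(4) R_def p_def [symmetric] by (simp add: field_simps)
        also have "\<dots> \<le> L * U1 + L * (Na * U1) + L * Us + 0 + L * (N * U1)"
        proof -
          have l1: "p * U1 + K * U1 \<le> L * U1"
            unfolding distrib_right [symmetric] using p K Astar U1
            by (intro mult_right_mono) (auto simp: L_def p_def [symmetric] algebra_simps)
          have l2: "p * (16 / Astar) * (Na * U1) \<le> L * (Na * U1)"
            using p K Astar Na U1 by (intro mult_right_mono) (auto simp: L_def p_def [symmetric] algebra_simps)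
          have l3: "K * (16/3) * (N * U1) \<le> L * (N * U1)"
            using p K Astar N U1 by (intro mult_right_mono) (auto simp: L_def p_def [symmetric] algebra_simps)
          have l4: "4 * 8 powr s * Us \<le> L * Us" using L(2) Us by (intro mult_right_mono)
          from l1 l2 l3 l4 show ?thesis by linarith
        qed
        also have "\<dots> = L * (Us + (1 + N + Na) * U1)" by (simp add: algebra_simps)
        finally show ?thesis unfolding Z_def by (intro mult_left_mono) auto
      qed
      then have "Q * Z * 2 \<le> Q * (2 powr s * (L * (Us + (1 + N + Na) * U1))) * 2"
        using Q by (intro mult_right_mono mult_left_mono) auto
      also have "\<dots> = C * Q * (Us + (1 + N + Na) * U1)" by (simp add: C_def mult_ac)
      finally show "L2_set (\<lambda>k. jw s k * cmod (fc f k)) F \<le> C * Q * (Us + (1 + N + Na) * U1)" by simp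
    qed
    ultimately show "cper f \<and> (\<forall>x. cmod (f x) \<le> 2 * Q * U1) \<and> l2le (jw s) (fc f) (C * Q * (Us + (1 + N + Na) * U1))"
      by blast
  qed
qed

section \<open>The exact right inverse\<close>

lemma besJ_odd: "besJ (- t) = - besJ t" and besJ'_even: "besJ' (- t) = besJ' t"
  by (simp_all add: besJ_def besJ'_def)

text \<open>\<open>cw\<close> is the constant value of \<open>t\<close> times the Wronskian of \<open>hank\<close> and \<open>besJ\<close>.\<close>

locale small_curve = phase_curve Astar a b a' b' \<kappa> for Astar a b a' b' \<kappa> +
  fixes cw :: complex
  assumes Astar: "Astar > 0" and small: "\<And>x. \<bar>a x\<bar> < Astar / 2"
    and cw: "cw \<noteq> 0" and wronskian_cw: "\<And>t. t > 0 \<Longrightarrow> of_real t * (hank t * of_real (besJ' t) - of_real (besJ t) * hank' t) = cw"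
begin

definition A :: "real \<Rightarrow> real" where "A x = Astar + a x"
definition B :: "real \<Rightarrow> real" where "B x = x + b x"
definition B' :: "real \<Rightarrow> real" where "B' x = 1 + b' x"

text \<open>Waves are superposed for positive frequencies only; taking real parts in the end supplies the negative ones.\<close>

definition W :: "(real \<Rightarrow> real) \<Rightarrow> int \<Rightarrow> complex" where
  "W \<gamma> k = (if k \<ge> 1 then of_int k * fc (\<lambda>x. of_real (\<gamma> x)) k / (of_real pi * cw) else 0)"

definition EH :: "int \<Rightarrow> real \<Rightarrow> complex" where
  "EH k x = hank (of_int k * A x) * ek k (B x)"

definition EH1 :: "int \<Rightarrow> real \<Rightarrow> complex" where
  "EH1 k x = of_int k * hank' (of_int k * A x) * ek k (B x)"

text \<open>\<open>P\<close> is a solution of the wave equation along the curve, \<open>PA\<close> and \<open>PB\<close> are its partial derivatives.\<close>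

definition P :: "(real \<Rightarrow> real) \<Rightarrow> real \<Rightarrow> complex" where
  "P \<gamma> x = (\<Sum>\<^sub>\<infinity>k. W \<gamma> k * EH k x)"

definition PA :: "(real \<Rightarrow> real) \<Rightarrow> real \<Rightarrow> complex" where
  "PA \<gamma> x = (\<Sum>\<^sub>\<infinity>k. W \<gamma> k * EH1 k x)"

definition PB :: "(real \<Rightarrow> real) \<Rightarrow> real \<Rightarrow> complex" where
  "PB \<gamma> x = (\<Sum>\<^sub>\<infinity>k. W \<gamma> k * (\<i> * of_int k * EH k x))"

definition q0 :: "(real \<Rightarrow> real) \<Rightarrow> real \<Rightarrow> complex" where
  "q0 \<gamma> x = of_real (A x) * (of_real (B' x) * PA \<gamma> x + of_real (a' x) * PB \<gamma> x)"

text \<open>The multiple \<open>mu\<close> of the solution \<open>A\<close> is chosen such that \<open>q\<close> has mean zero and hence a periodic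
  antiderivative.\<close>

definition mu :: "(real \<Rightarrow> real) \<Rightarrow> complex" where
  "mu \<gamma> = integral {0..2*pi} (q0 \<gamma>) / of_real (integral {0..2*pi} (\<lambda>x. A x * B' x))"

definition Pt :: "(real \<Rightarrow> real) \<Rightarrow> real \<Rightarrow> complex" where
  "Pt \<gamma> x = P \<gamma> x - of_real (A x) * mu \<gamma>"

definition q :: "(real \<Rightarrow> real) \<Rightarrow> real \<Rightarrow> complex" where
  "q \<gamma> x = q0 \<gamma> x - of_real (A x) * (of_real (B' x) * mu \<gamma>)"

definition Q :: "(real \<Rightarrow> real) \<Rightarrow> real \<Rightarrow> complex" where
  "Q \<gamma> = antid (q \<gamma>)"

text \<open>The direction with which a mode is paired after the flux of \<open>Pt\<close> has been integrated by parts.\<close>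

definition h1 :: "(real \<Rightarrow> real) \<Rightarrow> real \<Rightarrow> complex" where
  "h1 \<gamma> x = of_real (A x) * (of_real (B' x) * Pt \<gamma> x) + of_real (a' x) * Q \<gamma> x"

definition h2 :: "(real \<Rightarrow> real) \<Rightarrow> real \<Rightarrow> complex" where
  "h2 \<gamma> x = of_real (A x) * (of_real (a' x) * Pt \<gamma> x) + of_real (B' x) * Q \<gamma> x"

definition R :: "(real \<Rightarrow> real) \<Rightarrow> (real \<Rightarrow> real) \<times> (real \<Rightarrow> real)" where
  "R \<gamma> = (\<lambda>x. Re (h1 \<gamma> x), \<lambda>x. Re (h2 \<gamma> x))"

lemma A_lower: "A x \<ge> Astar / 2" and A_pos: "A x > 0"
  using small[of x] Astar by (auto simp: A_def abs_less_iff)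

lemma dA: "(A has_real_derivative a' x) (at x)" and dB: "(B has_real_derivative B' x) (at x)"
  unfolding A_def [abs_def] B_def [abs_def] B'_def by (auto intro!: derivative_eq_intros da db)

lemma cper_A: "cper A" and cper_B': "cper B'"
  unfolding A_def [abs_def] B'_def [abs_def] by (intro cper_add cper_const cper_a cb')+

lemma A_2pi: "A (2*pi) = A 0" and B_2pi: "B (2*pi) = B 0 + 2*pi"
  using pa[of 0] pb[of 0] by (simp_all add: A_def B_def)

lemma cper_compose_B: "cper f \<Longrightarrow> cper (\<lambda>x. f (B x))"
  unfolding B_def
  by (rule cper_compose[OF _ continuous_on_add[OF continuous_on_id cper_continuous[OF cper_b]]]) (simp_all add: pb)

lemma cper_compose_A: "(\<And>r. r > 0 \<Longrightarrow> isCont f r) \<Longrightarrow> cper (\<lambda>x. f (A x))"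
  unfolding cper_def
proof (intro conjI allI)
  assume f: "\<And>r. r > 0 \<Longrightarrow> isCont f r"
  show "continuous_on UNIV (\<lambda>x. f (A x))"
    using isCont_o2[OF DERIV_isCont[OF dA] f[OF A_pos]] by (auto intro: continuous_at_imp_continuous_on)
  show "f (A (x + 2*pi)) = f (A x)" for x by (simp add: A_def pa)
qed

lemma cper_EH: "k \<ge> 1 \<Longrightarrow> cper (EH k)" and cper_EH1: "k \<ge> 1 \<Longrightarrow> cper (EH1 k)"
proof -
  assume k: "k \<ge> 1"
  have kr: "real_of_int k * r > 0" if "r > 0" for r using k that by simp
  have "isCont (\<lambda>r. hank (of_int k * r)) r" "isCont (\<lambda>r. hank' (of_int k * r)) r" if "r > 0" for r
    using isCont_o2[where f = "\<lambda>r. of_int k * r" and a = r, OF _ has_vector_derivative_continuous[OF H_derivatives(1)[OF kr[OF that]]]]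
      isCont_o2[where f = "\<lambda>r. of_int k * r" and a = r, OF _ has_vector_derivative_continuous[OF H_derivatives(2)[OF kr[OF that]]]]
    by simp_all
  then show "cper (EH k)" "cper (EH1 k)"
    unfolding EH_def [abs_def] EH1_def [abs_def]
    by (intro cper_mult cper_const cper_compose_A cper_compose_B cper_ek; simp)+
qed

lemma cper_J:
  "cper (\<lambda>x. complex_of_real (besJ (of_int k * A x)))" "cper (\<lambda>x. complex_of_real (besJ' (of_int k * A x)))"
proof -
  have "isCont (\<lambda>r. besJ (of_int k * r)) r" "isCont (\<lambda>r. besJ' (of_int k * r)) r" for r
    using isCont_o2[where f = "\<lambda>r. of_int k * r" and a = r, OF _ DERIV_isCont[OF besJ_derivative]]
      isCont_o2[where f = "\<lambda>r. of_int k * r" and a = r, OF _ DERIV_isCont[OF besJ'_derivative]] by simp_all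
  then have "cper (\<lambda>x. besJ (of_int k * A x))" "cper (\<lambda>x. besJ' (of_int k * A x))"
    using cper_compose_A[of "\<lambda>r. besJ (of_int k * r)"] cper_compose_A[of "\<lambda>r. besJ' (of_int k * r)"] by simp_all
  then show "cper (\<lambda>x. complex_of_real (besJ (of_int k * A x)))" "cper (\<lambda>x. complex_of_real (besJ' (of_int k * A x)))"
    by - (rule cper_of_real, assumption)+
qed

lemma integral_AB'_pos: "integral {0..2*pi} (\<lambda>x. A x * B' x) \<ge> (1 - \<kappa>) * Astar * pi"
proof -
  have "(\<lambda>x. A x * B' x) integrable_on {0..2*pi}" by (intro cper_integrable cper_mult cper_A cper_B')
  moreover have "Astar / 2 * (1 - \<kappa>) \<le> A x * B' x" for x
    using A_lower[of x] slope[of x] Astar \<kappa> by (intro mult_mono) (auto simp: B'_def)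
  ultimately have "integral {0..2*pi} (\<lambda>x. Astar / 2 * (1 - \<kappa>)) \<le> integral {0..2*pi} (\<lambda>x. A x * B' x)"
    by (intro integral_le) auto
  moreover have "integral {0..2*pi} (\<lambda>x. Astar / 2 * (1 - \<kappa>)) = (1 - \<kappa>) * Astar * pi" by simp
  ultimately show ?thesis by linarith
qed

lemma term_bounds:
  obtains C where "C \<ge> 0" "\<And>\<gamma> k x. cmod (W \<gamma> k * EH k x) \<le> C * (jw (3/2) k * cmod (fc (\<lambda>x. of_real (\<gamma> x)) k))"
    "\<And>\<gamma> k x. cmod (W \<gamma> k * EH1 k x) \<le> C * (jw (3/2) k * cmod (fc (\<lambda>x. of_real (\<gamma> x)) k))"
    "\<And>\<gamma> k x. cmod (W \<gamma> k * (\<i> * of_int k * EH k x)) \<le> C * (jw (3/2) k * cmod (fc (\<lambda>x. of_real (\<gamma> x)) k))"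
proof -
  obtain Ce where Ce: "Ce > 0" "\<And>z. \<bar>Im z\<bar> \<le> Re z \<Longrightarrow> cmod z \<ge> Astar/2 \<Longrightarrow> cmod (eta0 z) \<le> Ce / sqrt (cmod z)"
    "\<And>z. \<bar>Im z\<bar> \<le> Re z \<Longrightarrow> cmod z \<ge> Astar/2 \<Longrightarrow> cmod (eta1 z) \<le> Ce / sqrt (cmod z)"
    using eta_bounds[of "Astar/2"] Astar by (metis half_gt_zero)
  define L where "L = Ce / sqrt (Astar/2)"
  have L: "L > 0" using Ce Astar by (simp add: L_def)
  define C where "C = L / (pi * cmod cw)"
  have C: "C \<ge> 0" using L by (simp add: C_def)
  have H: "cmod (hank (of_int k * A x)) \<le> L / sqrt k" "cmod (hank' (of_int k * A x)) \<le> L / sqrt k" if k: "k \<ge> 1" for k x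
  proof -
    define t where "t = of_int k * A x"
    have t: "t \<ge> of_int k * (Astar/2)" unfolding t_def using k A_lower[of x] by (intro mult_left_mono) auto
    have k2: "of_int k * (Astar/2) \<ge> Astar/2" using k Astar by simp
    have tp: "t > 0" using t k2 Astar by linarith
    have le: "Ce / sqrt t \<le> L / sqrt k"
    proof -
      have "sqrt (of_int k * (Astar/2)) \<le> sqrt t" using t by simp
      moreover have "0 < sqrt (of_int k * (Astar/2))" using k Astar by simp
      ultimately have "Ce / sqrt t \<le> Ce / sqrt (of_int k * (Astar/2))" using Ce(1) by (intro frac_le) auto
      moreover have "Ce / sqrt (of_int k * (Astar/2)) = L / sqrt k"
        by (simp only: L_def real_sqrt_mult divide_divide_eq_left mult.commute)
      ultimately show ?thesis by simp
    qed
    have "cmod (eta0 (of_real t)) \<le> Ce / sqrt t" "cmod (eta1 (of_real t)) \<le> Ce / sqrt t"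
      using Ce(2)[of "of_real t"] Ce(3)[of "of_real t"] t k2 tp by auto
    then show "cmod (hank (of_int k * A x)) \<le> L / sqrt k" "cmod (hank' (of_int k * A x)) \<le> L / sqrt k"
      using le unfolding t_def [symmetric] hank_def hank'_def by (auto simp: norm_mult)
  qed
  have key: "cmod (W \<gamma> k) * of_int k * (L / sqrt k) \<le> C * (jw (3/2) k * cmod (fc (\<lambda>x. of_real (\<gamma> x)) k))" if k: "k \<ge> 1" for \<gamma> k
  proof -
    have "jw (3/2) k = real_of_int k powr (3/2)" using k by (simp add: jw_def jap_def)
    also have "\<dots> = real_of_int k powr 1 * real_of_int k powr (1/2)"
      by (subst powr_add [symmetric]) simp
    also have "\<dots> = k * sqrt k" using k by (simp add: powr_half_sqrt)
    finally have j: "jw (3/2) k = k * sqrt k" .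
    have "cmod (W \<gamma> k) * of_int k * (L / sqrt k) = cmod (W \<gamma> k) * L * (of_int k / sqrt k)" by simp
    also have "\<dots> = cmod (W \<gamma> k) * L * sqrt k" using k by (simp add: real_div_sqrt)
    also have "\<dots> = C * (jw (3/2) k * cmod (fc (\<lambda>x. of_real (\<gamma> x)) k))"
      using k unfolding j by (simp add: W_def norm_mult norm_divide C_def field_simps)
    finally show ?thesis by simp
  qed
  have main: "cmod (W \<gamma> k) * (cmod z) \<le> C * (jw (3/2) k * cmod (fc (\<lambda>x. of_real (\<gamma> x)) k))"
    if z: "k \<ge> 1 \<Longrightarrow> cmod z \<le> of_int k * (L / sqrt k)" for \<gamma> k z
  proof (cases "k \<ge> 1")
    case True
    have "cmod (W \<gamma> k) * cmod z \<le> cmod (W \<gamma> k) * (of_int k * (L / sqrt k))"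
      by (intro mult_left_mono z True) auto
    then show ?thesis using key[OF True, of \<gamma>] by (simp add: mult.assoc)
  next
    case False
    then show ?thesis using C by (simp add: W_def)
  qed
  have one: "L / sqrt k \<le> of_int k * (L / sqrt k)" if "k \<ge> 1" for k :: int
    using mult_right_mono[of 1 "real_of_int k" "L / sqrt k"] that L by simp
  show ?thesis
  proof (rule that[OF C])
    fix \<gamma> k x
    show "cmod (W \<gamma> k * EH k x) \<le> C * (jw (3/2) k * cmod (fc (\<lambda>x. of_real (\<gamma> x)) k))"
      unfolding norm_mult by (rule main) (use H(1)[of k x] one[of k] in \<open>auto simp: EH_def norm_mult\<close>)
    show "cmod (W \<gamma> k * EH1 k x) \<le> C * (jw (3/2) k * cmod (fc (\<lambda>x. of_real (\<gamma> x)) k))"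
      unfolding norm_mult by (rule main) (use mult_left_mono[OF H(2)[of k x], of "of_int k"] in \<open>simp add: EH1_def norm_mult\<close>)
    show "cmod (W \<gamma> k * (\<i> * of_int k * EH k x)) \<le> C * (jw (3/2) k * cmod (fc (\<lambda>x. of_real (\<gamma> x)) k))"
      unfolding norm_mult[of "W \<gamma> k"] by (rule main) (use mult_left_mono[OF H(1)[of k x], of "of_int k"] in \<open>simp add: EH_def norm_mult\<close>)
  qed
qed

text \<open>The regularity of \<open>\<gamma>\<close> for which the series for \<open>P\<close>, \<open>PA\<close> and \<open>PB\<close> converge absolutely: the weight \<open>k\<^sup>2 \<cdot> k^(-1/2)\<close> of
  the coefficients in \<open>PA\<close> and \<open>PB\<close> is the largest one.\<close>

definition data :: "(real \<Rightarrow> real) \<Rightarrow> bool" where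
  "data \<gamma> \<longleftrightarrow> cper \<gamma> \<and> (\<exists>M. l1le (jw (3/2)) (fc (\<lambda>x. of_real (\<gamma> x))) M)"

lemma series_sums:
  assumes "data \<gamma>"
  shows "((\<lambda>k. W \<gamma> k * EH k x) has_sum P \<gamma> x) UNIV" "((\<lambda>k. W \<gamma> k * EH1 k x) has_sum PA \<gamma> x) UNIV"
    "((\<lambda>k. W \<gamma> k * (\<i> * of_int k * EH k x)) has_sum PB \<gamma> x) UNIV"
    "cper (P \<gamma>)" "cper (PA \<gamma>)" "cper (PB \<gamma>)"
proof -
  obtain M where M: "l1le (jw (3/2)) (fc (\<lambda>x. of_real (\<gamma> x))) M" using assms by (auto simp: data_def)
  obtain C where C: "C \<ge> 0" "\<And>k x. cmod (W \<gamma> k * EH k x) \<le> C * (jw (3/2) k * cmod (fc (\<lambda>x. of_real (\<gamma> x)) k))"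
    "\<And>k x. cmod (W \<gamma> k * EH1 k x) \<le> C * (jw (3/2) k * cmod (fc (\<lambda>x. of_real (\<gamma> x)) k))"
    "\<And>k x. cmod (W \<gamma> k * (\<i> * of_int k * EH k x)) \<le> C * (jw (3/2) k * cmod (fc (\<lambda>x. of_real (\<gamma> x)) k))"
    using term_bounds by metis
  have s: "(\<lambda>k. C * (jw (3/2) k * cmod (fc (\<lambda>x. of_real (\<gamma> x)) k))) summable_on UNIV"
    by (intro summable_on_cmult_right l1le_summable(1)[OF M]) simp
  have hs: "(f has_sum infsum f UNIV) UNIV"
    if "\<And>k. cmod (f k) \<le> C * (jw (3/2) k * cmod (fc (\<lambda>x. of_real (\<gamma> x)) k))" for f :: "int \<Rightarrow> complex"
    by (rule has_sum_infsum[OF abs_summable_summable[OF Infinite_Sum.abs_summable_on_comparison_test'[OF s]]]) (rule that)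
  show 1: "((\<lambda>k. W \<gamma> k * EH k x) has_sum P \<gamma> x) UNIV" "((\<lambda>k. W \<gamma> k * EH1 k x) has_sum PA \<gamma> x) UNIV"
    "((\<lambda>k. W \<gamma> k * (\<i> * of_int k * EH k x)) has_sum PB \<gamma> x) UNIV" for x
    unfolding P_def PA_def PB_def by (rule hs[OF C(2)] hs[OF C(3)] hs[OF C(4)])+
  have "cper (\<lambda>x. W \<gamma> k * EH k x) \<and> cper (\<lambda>x. W \<gamma> k * EH1 k x) \<and> cper (\<lambda>x. W \<gamma> k * (\<i> * of_int k * EH k x))" for k
  proof (cases "k \<ge> 1")
    case True
    then show ?thesis by (intro conjI cper_mult cper_const cper_EH cper_EH1)
  next
    case False
    then show ?thesis by (simp add: W_def)
  qed
  then have c: "cper (\<lambda>x. W \<gamma> k * EH k x)" "cper (\<lambda>x. W \<gamma> k * EH1 k x)" "cper (\<lambda>x. W \<gamma> k * (\<i> * of_int k * EH k x))" for k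
    by blast+
  show "cper (P \<gamma>)" "cper (PA \<gamma>)" "cper (PB \<gamma>)"
    by (rule cper_series[OF c(1) C(2) s 1(1)] cper_series[OF c(2) C(3) s 1(2)] cper_series[OF c(3) C(4) s 1(3)])+
qed

lemma cper_parts:
  assumes "data \<gamma>"
  shows "cper (q0 \<gamma>)" "cper (q \<gamma>)" "integral {0..2*pi} (q \<gamma>) = 0"
    "\<And>x. (Q \<gamma> has_vector_derivative q \<gamma> x) (at x)" "cper (Q \<gamma>)" "cper (Pt \<gamma>)" "cper (h1 \<gamma>)" "cper (h2 \<gamma>)"
proof -
  note P = series_sums(4-6)[OF assms]
  show q0: "cper (q0 \<gamma>)" unfolding q0_def [abs_def] by (intro cper_mult cper_add cper_of_real cper_A cper_B' ca' P)
  have cAB: "cper (\<lambda>x. complex_of_real (A x) * (of_real (B' x) * mu \<gamma>))"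
    by (intro cper_mult cper_of_real cper_A cper_B' cper_const)
  show q: "cper (q \<gamma>)" unfolding q_def [abs_def] by (intro cper_diff q0 cAB)
  have "integral {0..2*pi} (\<lambda>x. complex_of_real (A x) * (of_real (B' x) * mu \<gamma>)) = of_real (integral {0..2*pi} (\<lambda>x. A x * B' x)) * mu \<gamma>"
  proof -
    have "integral {0..2*pi} (\<lambda>x. complex_of_real (A x) * (of_real (B' x) * mu \<gamma>)) = integral {0..2*pi} (\<lambda>x. complex_of_real (A x * B' x) * mu \<gamma>)"
      by (simp add: mult.assoc)
    then show ?thesis
      by (simp only: integral_mult_left integral_complex_of_real[OF cper_continuous[OF cper_mult[OF cper_A cper_B']]])
  qed
  moreover have "integral {0..2*pi} (\<lambda>x. A x * B' x) \<noteq> 0"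
  proof -
    have "0 < (1 - \<kappa>) * Astar * pi" using \<kappa> Astar by simp
    then show ?thesis using integral_AB'_pos by linarith
  qed
  ultimately show 0: "integral {0..2*pi} (q \<gamma>) = 0"
    using Henstock_Kurzweil_Integration.integral_diff[OF cper_integrable[OF q0] cper_integrable[OF cAB], of 0 "2*pi"]
    by (simp add: q_def [abs_def] mu_def)
  show dQ: "(Q \<gamma> has_vector_derivative q \<gamma> x) (at x)" for x
    unfolding Q_def by (rule antid_derivative[OF cper_continuous[OF q]])
  show Q: "cper (Q \<gamma>)" by (rule periodic_antiderivative[OF q 0 dQ])
  show Pt: "cper (Pt \<gamma>)" unfolding Pt_def [abs_def]
    by (intro cper_diff cper_mult cper_of_real cper_A cper_const P)
  show "cper (h1 \<gamma>)" "cper (h2 \<gamma>)" unfolding h1_def [abs_def] h2_def [abs_def]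
    by (intro cper_add cper_mult cper_of_real cper_A cper_B' ca' Pt Q)+
qed

text \<open>Pairing of the constructed direction with the mode \<open>k\<close>. Integration by parts turns the pairing into the flux
  of \<open>P - mu A\<close> against the mode, and the flux of \<open>P\<close> consists of a single Wronskian.\<close>

lemma pairing:
  assumes \<gamma>: "data \<gamma>" and k: "k \<noteq> 0"
  shows "integral {0..2*pi} (\<lambda>x. (of_real (besJ' (of_int k * A x)) * h1 \<gamma> x - \<i> * of_real (besJ (of_int k * A x)) * h2 \<gamma> x) * ek (-k) (B x))
    = (if k \<ge> 1 then 2 * fc (\<lambda>x. of_real (\<gamma> x)) k else 0)"
proof -
  define V where "V x = of_real (besJ (of_int k * A x)) * ek (-k) (B x)" for x
  define VA where "VA x = of_int k * of_real (besJ' (of_int k * A x)) * ek (-k) (B x)" for x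
  have cJ: "cper (\<lambda>x. complex_of_real (besJ (of_int k * A x)))" "cper (\<lambda>x. complex_of_real (besJ' (of_int k * A x)))"
    by (rule cper_J)+
  have cV: "cper V" "cper VA" unfolding V_def [abs_def] VA_def [abs_def]
    by (intro cper_mult cper_const cJ cper_compose_B cper_ek)+
  note c = cV cper_of_real[OF cper_A] cper_of_real[OF cper_B'] cper_of_real[OF ca'] series_sums(4-6)[OF \<gamma>] cper_parts(1,2,5,6)[OF \<gamma>]
  have dV: "(V has_vector_derivative (VA x * of_real (a' x) + (- \<i> * of_int k * V x) * of_real (B' x))) (at x)" for x
  proof -
    have "((\<lambda>x. of_int k * A x) has_vector_derivative of_int k * a' x) (at x)"
      unfolding has_real_derivative_iff_has_vector_derivative [symmetric] by (intro DERIV_cmult dA)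
    from vector_diff_chain_at[OF this J_vector_derivatives(1)]
    have "((\<lambda>x. of_real (besJ (of_int k * A x)) :: complex) has_vector_derivative of_int k * of_real (a' x) * of_real (besJ' (of_int k * A x))) (at x)"
      by (simp add: o_def scaleR_conv_of_real)
    from has_vector_derivative_mult[OF this ek_has_vector_derivative[OF dB, of "-k"]]
    show ?thesis unfolding V_def [abs_def] VA_def by (simp add: algebra_simps)
  qed
  define I where "I x = of_real (A x) * ((P \<gamma> x * VA x - V x * PA \<gamma> x) * of_real (B' x) +
      (P \<gamma> x * (- \<i> * of_int k * V x) - V x * PB \<gamma> x) * of_real (a' x))" for x
  define I0 where "I0 x = of_real (A x) * ((of_real (A x) * VA x - V x) * of_real (B' x) +
      of_real (A x) * (- \<i> * of_int k * V x) * of_real (a' x))" for x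
  have I0: "(I0 has_integral 0) {0..2*pi}"
    unfolding I0_def [abs_def] V_def VA_def by (rule flux_zero_mode[OF dA A_pos A_2pi dB B_2pi k])
  \<comment> \<open>the flux of \<open>P\<close>, mode by mode\<close>
  have eqI: "integral {0..2*pi} I = 2 * of_real pi * cw * W \<gamma> k"
  proof -
    define g where "g j x = of_real (A x) * (((W \<gamma> j * EH j x) * VA x - V x * (W \<gamma> j * EH1 j x)) * of_real (B' x) +
      ((W \<gamma> j * EH j x) * (- \<i> * of_int k * V x) - V x * (W \<gamma> j * (\<i> * of_int j * EH j x))) * of_real (a' x))" for j x
    have gI: "integral {0..2*pi} (g j) = W \<gamma> j * (if j = k then 2 * of_real pi * cw else 0)" for j
    proof (cases "j \<ge> 1")
      case True
      define i where "i = nat j"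
      have i: "i \<ge> 1" "int i = j" "real_of_int j = real i" "complex_of_int j = of_nat i" using True by (auto simp: i_def)
      have "g j x = W \<gamma> j * (of_real (A x) * ((hank (real i * A x) * ek (int i) (B x) * VA x - V x * (of_nat i * hank' (real i * A x) * ek (int i) (B x))) * of_real (B' x) +
        (hank (real i * A x) * ek (int i) (B x) * (- \<i> * of_int k * V x) - V x * (\<i> * of_nat i * (hank (real i * A x) * ek (int i) (B x)))) * of_real (a' x)))" for x
        unfolding g_def EH_def EH1_def i(2) [symmetric] of_int_of_nat_eq by (simp add: algebra_simps)
      moreover have "((\<lambda>x. of_real (A x) * ((hank (real i * A x) * ek (int i) (B x) * VA x - V x * (of_nat i * hank' (real i * A x) * ek (int i) (B x))) * of_real (B' x) +
        (hank (real i * A x) * ek (int i) (B x) * (- \<i> * of_int k * V x) - V x * (\<i> * of_nat i * (hank (real i * A x) * ek (int i) (B x)))) * of_real (a' x)))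
        has_integral (if int i = k then 2 * of_real pi * cw else 0)) {0..2*pi}"
        unfolding V_def VA_def by (rule flux_mode[OF dA A_pos A_2pi dB B_2pi k i(1) wronskian_cw])
      from has_integral_mult_right[OF this, of "W \<gamma> j"] have
        "((\<lambda>x. W \<gamma> j * (of_real (A x) * ((hank (real i * A x) * ek (int i) (B x) * VA x - V x * (of_nat i * hank' (real i * A x) * ek (int i) (B x))) * of_real (B' x) +
        (hank (real i * A x) * ek (int i) (B x) * (- \<i> * of_int k * V x) - V x * (\<i> * of_nat i * (hank (real i * A x) * ek (int i) (B x)))) * of_real (a' x))))
        has_integral W \<gamma> j * (if int i = k then 2 * of_real pi * cw else 0)) {0..2*pi}" .
      ultimately have "(g j has_integral W \<gamma> j * (if int i = k then 2 * of_real pi * cw else 0)) {0..2*pi}"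
        by presburger
      then show ?thesis unfolding i(2) by (rule integral_unique)
    next
      case False
      then have "g j = (\<lambda>x. 0)" "W \<gamma> j = 0" by (auto simp: g_def W_def)
      then show ?thesis by simp
    qed
    obtain M where M: "l1le (jw (3/2)) (fc (\<lambda>x. of_real (\<gamma> x))) M" using \<gamma> by (auto simp: data_def)
    obtain C where C: "C \<ge> 0" "\<And>k x. cmod (W \<gamma> k * EH k x) \<le> C * (jw (3/2) k * cmod (fc (\<lambda>x. of_real (\<gamma> x)) k))"
      "\<And>k x. cmod (W \<gamma> k * EH1 k x) \<le> C * (jw (3/2) k * cmod (fc (\<lambda>x. of_real (\<gamma> x)) k))"
      "\<And>k x. cmod (W \<gamma> k * (\<i> * of_int k * EH k x)) \<le> C * (jw (3/2) k * cmod (fc (\<lambda>x. of_real (\<gamma> x)) k))"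
      using term_bounds by metis
    define e where "e j = C * (jw (3/2) j * cmod (fc (\<lambda>x. of_real (\<gamma> x)) j))" for j
    have e: "e j \<ge> 0" for j using C(1) by (simp add: e_def)
    \<comment> \<open>the integrand is a combination, with bounded coefficients, of the three summands\<close>
    define c1 where "c1 x = of_real (A x) * (VA x * of_real (B' x) + (- \<i> * of_int k * V x) * of_real (a' x))" for x
    define c2 where "c2 x = - (of_real (A x) * (V x * of_real (B' x)))" for x
    define c3 where "c3 x = - (of_real (A x) * (V x * of_real (a' x)))" for x
    have cc: "cper c1" "cper (\<lambda>x. of_real (A x) * (V x * of_real (B' x)))" "cper (\<lambda>x. of_real (A x) * (V x * of_real (a' x)))"
      unfolding c1_def [abs_def] by (intro cper_add cper_mult cper_const c)+
    obtain D1 where D1: "D1 > 0" "\<And>x. cmod (c1 x) \<le> D1" using cper_bounded[OF cc(1)] by metis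
    obtain D2 where D2: "D2 > 0" "\<And>x. cmod (of_real (A x) * (V x * of_real (B' x))) \<le> D2" using cper_bounded[OF cc(2)] by metis
    obtain D3 where D3: "D3 > 0" "\<And>x. cmod (of_real (A x) * (V x * of_real (a' x))) \<le> D3" using cper_bounded[OF cc(3)] by metis
    have g_eq: "g j x = (W \<gamma> j * EH j x) * c1 x + (W \<gamma> j * EH1 j x) * c2 x + (W \<gamma> j * (\<i> * of_int j * EH j x)) * c3 x" for j x
      by (simp add: g_def c1_def c2_def c3_def algebra_simps)
    have cg: "cper (g j)" for j
    proof (cases "j \<ge> 1")
      case True
      then show ?thesis unfolding g_def [abs_def]
        by (intro cper_add cper_diff cper_mult cper_const c cper_EH cper_EH1)
    next
      case False
      then have "g j = (\<lambda>x. 0)" by (auto simp: g_def W_def)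
      then show ?thesis by simp
    qed
    have gb: "cmod (g j x) \<le> (D1 + D2 + D3) * e j" for j x
    proof -
      have "cmod (g j x) \<le> cmod (W \<gamma> j * EH j x) * cmod (c1 x) + cmod (W \<gamma> j * EH1 j x) * cmod (c2 x) + cmod (W \<gamma> j * (\<i> * of_int j * EH j x)) * cmod (c3 x)"
        unfolding g_eq norm_mult [symmetric] by (intro order_trans[OF norm_triangle_ineq] add_mono norm_triangle_ineq order_refl)
      also have "\<dots> \<le> e j * D1 + e j * D2 + e j * D3"
        using C(2-4) D1(2) D2(2) D3(2) e unfolding e_def c2_def c3_def norm_minus_cancel
        by (intro add_mono mult_mono) auto
      finally show ?thesis by (simp add: algebra_simps)
    qed
    have gs: "(\<lambda>j. (D1 + D2 + D3) * e j) summable_on UNIV"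
      unfolding e_def by (intro summable_on_cmult_right l1le_summable(1)[OF M]) simp
    have gh: "((\<lambda>j. g j x) has_sum I x) UNIV" for x
    proof -
      have "I x = P \<gamma> x * c1 x + PA \<gamma> x * c2 x + PB \<gamma> x * c3 x"
        by (simp add: I_def c1_def c2_def c3_def algebra_simps)
      then show ?thesis unfolding g_eq
        by (auto intro!: has_sum_add has_sum_cmult_left series_sums[OF \<gamma>])
    qed
    have "((\<lambda>j. W \<gamma> j * (if j = k then 2 * of_real pi * cw else 0)) has_sum integral {0..2*pi} I) UNIV"
      using integral_series[OF cg gb gs gh] unfolding gI .
    moreover have "((\<lambda>j. W \<gamma> j * (if j = k then 2 * of_real pi * cw else 0)) has_sum (W \<gamma> k * (2 * of_real pi * cw))) UNIV"
      by (rule has_sum_finite_neutralI[of "{k}"]) auto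
    ultimately have "integral {0..2*pi} I = W \<gamma> k * (2 * of_real pi * cw)" by (rule has_sum_unique)
    then show ?thesis by (simp add: mult_ac)
  qed
  have cI: "cper I" unfolding I_def [abs_def] by (intro cper_mult cper_add cper_diff cper_const c)
  have I: "(I has_integral 2 * of_real pi * cw * W \<gamma> k) {0..2*pi}"
    using integrable_integral[OF cper_integrable[OF cI], of 0 "2*pi"] unfolding eqI .
  \<comment> \<open>integration by parts\<close>
  have "((\<lambda>x. Q \<gamma> x * V x) has_vector_derivative (Q \<gamma> x * (VA x * of_real (a' x) + (- \<i> * of_int k * V x) * of_real (B' x)) + q \<gamma> x * V x)) (at x)" for x
    by (intro has_vector_derivative_mult dV cper_parts(4)[OF \<gamma>])
  from integral_derivative[OF this, of 0 "2*pi"]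
  have ibp: "((\<lambda>x. Q \<gamma> x * (VA x * of_real (a' x) + (- \<i> * of_int k * V x) * of_real (B' x)) + q \<gamma> x * V x) has_integral 0) {0..2*pi}"
    using cper_at_2pi[OF cper_mult[OF c(11) c(1)]] by simp
  have "((\<lambda>x. (I x - mu \<gamma> * I0 x) + (Q \<gamma> x * (VA x * of_real (a' x) + (- \<i> * of_int k * V x) * of_real (B' x)) + q \<gamma> x * V x))
      has_integral ((2 * of_real pi * cw * W \<gamma> k - mu \<gamma> * 0) + 0)) {0..2*pi}"
    by (intro has_integral_add has_integral_diff I has_integral_mult_right[OF I0] ibp)
  moreover have "(I x - mu \<gamma> * I0 x) + (Q \<gamma> x * (VA x * of_real (a' x) + (- \<i> * of_int k * V x) * of_real (B' x)) + q \<gamma> x * V x)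
      = of_int k * ((of_real (besJ' (of_int k * A x)) * h1 \<gamma> x - \<i> * of_real (besJ (of_int k * A x)) * h2 \<gamma> x) * ek (-k) (B x))" for x
    unfolding I_def I0_def h1_def h2_def q_def q0_def Pt_def V_def VA_def by (simp add: algebra_simps)
  ultimately have "((\<lambda>x. of_int k * ((of_real (besJ' (of_int k * A x)) * h1 \<gamma> x - \<i> * of_real (besJ (of_int k * A x)) * h2 \<gamma> x) * ek (-k) (B x)))
      has_integral (2 * of_real pi * cw * W \<gamma> k)) {0..2*pi}" by simp
  then have "of_int k * integral {0..2*pi} (\<lambda>x. (of_real (besJ' (of_int k * A x)) * h1 \<gamma> x - \<i> * of_real (besJ (of_int k * A x)) * h2 \<gamma> x) * ek (-k) (B x))
      = 2 * of_real pi * cw * W \<gamma> k" by (simp only: integral_mult_right [symmetric] integral_unique)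
  also have "\<dots> = of_int k * (if k \<ge> 1 then 2 * fc (\<lambda>x. of_real (\<gamma> x)) k else 0)"
    using cw by (simp add: W_def)
  finally show ?thesis using k by simp
qed

text \<open>The pairings of the complex direction are \<open>2\<gamma>\<^sub>k\<close> for \<open>k \<ge> 1\<close> and \<open>0\<close> for \<open>k < 0\<close>. Those of its real part are the
  averages of the pairing at \<open>k\<close> and the conjugate of the pairing at \<open>-k\<close>, that is \<open>\<gamma>\<^sub>k\<close> for every \<open>k \<noteq> 0\<close>, as \<open>\<gamma>\<close> is real.\<close>

theorem dS_R:
  assumes \<gamma>: "data \<gamma>" "integral {0..2*pi} \<gamma> = 0"
    and d1: "\<And>x. ((\<lambda>x. Re (h1 \<gamma> x)) has_real_derivative d1 x) (at x)" "cper d1"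
    and d2: "\<And>x. ((\<lambda>x. Re (h2 \<gamma> x)) has_real_derivative d2 x) (at x)" "cper d2"
  shows "dS Astar (a, b) (R \<gamma>) = \<gamma>"
proof
  fix I0
  define \<alpha> where "\<alpha> x = Re (h1 \<gamma> x)" for x
  define \<beta> where "\<beta> x = Re (h2 \<gamma> x)" for x
  have c: "cper \<alpha>" "cper \<beta>" unfolding \<alpha>_def [abs_def] \<beta>_def [abs_def] by (intro cper_Re cper_parts \<gamma>)+
  have c\<gamma>: "cper \<gamma>" using \<gamma>(1) by (simp add: data_def)
  define L where "L n = integral {0..2*pi} (\<lambda>x. (of_real (besJ' (of_int n * A x)) * h1 \<gamma> x - \<i> * of_real (besJ (of_int n * A x)) * h2 \<gamma> x) * ek (-n) (B x))" for n
  have cJ: "cper (\<lambda>x. complex_of_real (besJ (of_int n * A x)))" "cper (\<lambda>x. complex_of_real (besJ' (of_int n * A x)))" for n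
    by (rule cper_J)+
  have cL: "cper (\<lambda>x. (of_real (besJ' (of_int n * A x)) * h1 \<gamma> x - \<i> * of_real (besJ (of_int n * A x)) * h2 \<gamma> x) * ek (-n) (B x))" for n
    by (intro cper_mult cper_diff cper_const cJ cper_parts(7,8)[OF \<gamma>(1)] cper_compose_B cper_ek)
  have fcT: "fc (\<lambda>I. of_real (T \<alpha> \<beta> I)) n = fc (\<lambda>x. of_real (\<gamma> x)) n" for n
  proof (cases "n = 0")
    case True
    have "fc (\<lambda>x. complex_of_real (\<gamma> x)) 0 = 0"
      using integral_complex_of_real[OF cper_continuous[OF c\<gamma>], of 0 "2*pi"] \<gamma>(2) by (simp add: fc_def)
    then show ?thesis using fc_T[OF c, of n] True by simp
  next
    case False
    define y where "y n x = (of_real (besJ' (of_int n * A x)) * h1 \<gamma> x - \<i> * of_real (besJ (of_int n * A x)) * h2 \<gamma> x) * ek (-n) (B x)" for n x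
    have cy: "cper (y n)" for n unfolding y_def [abs_def] by (rule cL)
    have eqy: "(of_real (besJ' (of_int n * (Astar + a x)) * \<alpha> x) - \<i> * of_real (besJ (of_int n * (Astar + a x)) * \<beta> x)) * ek (-n) (x + b x)
      = (1/2) * (y n x + cnj (y (-n) x))" for x
    proof -
      have Re: "complex_of_real (\<alpha> x) = (h1 \<gamma> x + cnj (h1 \<gamma> x)) / 2" "complex_of_real (\<beta> x) = (h2 \<gamma> x + cnj (h2 \<gamma> x)) / 2"
        by (simp_all add: \<alpha>_def \<beta>_def complex_add_cnj)
      define j0 where "j0 = complex_of_real (besJ (of_int n * A x))"
      define j1 where "j1 = complex_of_real (besJ' (of_int n * A x))"
      have j: "complex_of_real (besJ (of_int (-n) * A x)) = - j0" "complex_of_real (besJ' (of_int (-n) * A x)) = j1"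
        "cnj j0 = j0" "cnj j1 = j1"
        by (simp_all add: j0_def j1_def besJ_odd besJ'_even)
      show ?thesis
        unfolding y_def A_def [symmetric] B_def [symmetric] of_real_mult Re j(1,2) j0_def [symmetric] j1_def [symmetric]
        by (simp add: j(3,4) cnj_ek field_simps)
    qed
    have "fc (\<lambda>I. of_real (T \<alpha> \<beta> I)) n = integral {0..2*pi} (\<lambda>x. (1/2) * (y n x + cnj (y (-n) x)))"
      by (simp only: fc_T[OF c] eqy if_not_P[OF False])
    also have "\<dots> = (1/2) * (integral {0..2*pi} (y n) + integral {0..2*pi} (\<lambda>x. cnj (y (-n) x)))"
      by (simp only: integral_mult_right Henstock_Kurzweil_Integration.integral_add[OF cper_integrable[OF cy] cper_integrable[OF cper_cnj[OF cy]]])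
    also have "integral {0..2*pi} (\<lambda>x. cnj (y (-n) x)) = cnj (integral {0..2*pi} (y (-n)))"
      by (rule Henstock_Kurzweil_Integration.integral_cnj [symmetric])
    finally have "fc (\<lambda>I. of_real (T \<alpha> \<beta> I)) n = (1/2) * (L n + cnj (L (-n)))"
      unfolding L_def y_def [abs_def] .
    also have "\<dots> = fc (\<lambda>x. of_real (\<gamma> x)) n"
    proof -
      have "fc (\<lambda>x. complex_of_real (\<gamma> x)) (-m) = cnj (fc (\<lambda>x. of_real (\<gamma> x)) m)" for m
        using fc_cnj[of "\<lambda>x. complex_of_real (\<gamma> x)" "-m"] by simp
      from this[of n] have e: "cnj (fc (\<lambda>x. complex_of_real (\<gamma> x)) (-n)) = fc (\<lambda>x. of_real (\<gamma> x)) n" by simp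
      show ?thesis using pairing[OF \<gamma>(1), of n] pairing[OF \<gamma>(1), of "-n"] False
        unfolding L_def [symmetric] by (cases "n \<ge> 1") (auto simp: e)
    qed
    finally show ?thesis .
  qed
  have "complex_of_real (T \<alpha> \<beta> I0) = of_real (\<gamma> I0)"
    by (rule fc_unique[OF cper_of_real[OF T_cper[OF c]] cper_of_real[OF c\<gamma>] fcT])
  then have "T \<alpha> \<beta> I0 = \<gamma> I0" by (simp only: of_real_eq_iff)
  moreover have "dS Astar (a, b) (\<alpha>, \<beta>) I0 = T \<alpha> \<beta> I0"
    by (rule dS_eq_T[OF phase_curve_axioms _ _ d1(2) d2(2) c]) (use d1(1) d2(1) in \<open>auto simp: \<alpha>_def [abs_def] \<beta>_def [abs_def]\<close>)
  ultimately show "dS Astar (a, b) (R \<gamma>) I0 = \<gamma> I0"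
    by (simp add: R_def \<alpha>_def [abs_def] \<beta>_def [abs_def])
qed

end

subsection \<open>Linearity\<close>

lemma antid_linear:
  fixes f g :: "real \<Rightarrow> complex"
  assumes "cper f" "cper g"
  shows "antid (\<lambda>x. c * f x + d * g x) x = c * antid f x + d * antid g x"
proof -
  have "integral {u..v} (\<lambda>x. c * f x + d * g x) = c * integral {u..v} f + d * integral {u..v} g" for u v
    by (intro integral_unique has_integral_add has_integral_mult_right integrable_integral cper_integrable assms)
  then show ?thesis by (simp add: antid_def algebra_simps)
qed

context small_curve
begin

lemma R_linear:
  assumes \<gamma>: "data \<gamma>" and \<eta>: "data \<eta>"
  shows "R (lincomb c \<gamma> d \<eta>) = lincomb2 c (R \<gamma>) d (R \<eta>)"
proof -
  let ?c = "complex_of_real c" and ?d = "complex_of_real d"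
  define \<zeta> where "\<zeta> = lincomb c \<gamma> d \<eta>"
  have cp: "cper (\<lambda>x. complex_of_real (\<gamma> x))" "cper (\<lambda>x. complex_of_real (\<eta> x))"
    using \<gamma> \<eta> by (auto simp: data_def cper_of_real)
  have "fc (\<lambda>x. of_real (\<zeta> x)) k = ?c * fc (\<lambda>x. of_real (\<gamma> x)) k + ?d * fc (\<lambda>x. of_real (\<eta> x)) k" for k
    unfolding \<zeta>_def lincomb_def of_real_add of_real_mult fc_cmult [symmetric]
    by (rule fc_add) (intro cper_mult cper_const cp)+
  then have W: "W \<zeta> k = ?c * W \<gamma> k + ?d * W \<eta> k" for k
    using cw by (simp add: W_def field_simps)
  have lin: "infsum (\<lambda>k. W \<zeta> k * E k) UNIV = ?c * u + ?d * v"
    if "((\<lambda>k. W \<gamma> k * E k) has_sum u) UNIV" "((\<lambda>k. W \<eta> k * E k) has_sum v) UNIV" for E u v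
  proof (rule infsumI)
    show "((\<lambda>k. W \<zeta> k * E k) has_sum (?c * u + ?d * v)) UNIV"
      using has_sum_add[OF has_sum_cmult_right[OF that(1), of ?c] has_sum_cmult_right[OF that(2), of ?d]]
      by (simp add: W distrib_right mult.assoc)
  qed
  have P: "P \<zeta> x = ?c * P \<gamma> x + ?d * P \<eta> x" and PA: "PA \<zeta> x = ?c * PA \<gamma> x + ?d * PA \<eta> x"
    and PB: "PB \<zeta> x = ?c * PB \<gamma> x + ?d * PB \<eta> x" for x
    using lin[OF series_sums(1)[OF \<gamma>] series_sums(1)[OF \<eta>], of x]
      lin[OF series_sums(2)[OF \<gamma>] series_sums(2)[OF \<eta>], of x]
      lin[OF series_sums(3)[OF \<gamma>] series_sums(3)[OF \<eta>], of x]
    unfolding P_def PA_def PB_def .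
  have q0: "q0 \<zeta> x = ?c * q0 \<gamma> x + ?d * q0 \<eta> x" for x
    unfolding q0_def PA PB by (simp add: algebra_simps)
  have "integral {0..2*pi} (q0 \<zeta>) = ?c * integral {0..2*pi} (q0 \<gamma>) + ?d * integral {0..2*pi} (q0 \<eta>)"
    unfolding q0 [abs_def]
    by (intro integral_unique has_integral_add has_integral_mult_right integrable_integral cper_integrable cper_parts(1) \<gamma> \<eta>)
  then have mu: "mu \<zeta> = ?c * mu \<gamma> + ?d * mu \<eta>"
    by (simp add: mu_def add_divide_distrib)
  have "q \<zeta> = (\<lambda>x. ?c * q \<gamma> x + ?d * q \<eta> x)"
    unfolding q_def q0 mu by (simp add: algebra_simps fun_eq_iff)
  then have Q: "Q \<zeta> x = ?c * Q \<gamma> x + ?d * Q \<eta> x" for x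
    unfolding Q_def by (simp only: antid_linear[OF cper_parts(2)[OF \<gamma>] cper_parts(2)[OF \<eta>]])
  have Pt: "Pt \<zeta> x = ?c * Pt \<gamma> x + ?d * Pt \<eta> x" for x
    unfolding Pt_def P mu by (simp add: algebra_simps)
  have "h1 \<zeta> x = ?c * h1 \<gamma> x + ?d * h1 \<eta> x" "h2 \<zeta> x = ?c * h2 \<gamma> x + ?d * h2 \<eta> x" for x
    unfolding h1_def h2_def Pt Q by (simp_all add: algebra_simps)
  then have "R \<zeta> = lincomb2 c (R \<gamma>) d (R \<eta>)"
    unfolding R_def lincomb2_def by (simp add: lincomb_def)
  then show ?thesis unfolding \<zeta>_def .
qed

end

section \<open>Tame estimates for the inverse\<close>

subsection \<open>Tame vectors and scalars\<close>

text \<open>\<open>G\<close> and \<open>\<Theta>\<close> stand for the low norm of \<open>\<gamma>\<close> and for the right-hand side of the estimate, and \<open>\<Lambda>\<close> for one plus the high norm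
  of \<open>(a, b)\<close>. With \<open>\<Lambda> G \<le> \<Theta>\<close> the class of tame vectors is closed under multiplication by scalars.\<close>

definition tame :: "real \<Rightarrow> real \<Rightarrow> real \<Rightarrow> (real \<Rightarrow> complex) \<Rightarrow> real \<Rightarrow> bool" where
  "tame s G \<Theta> v C \<longleftrightarrow> cper v \<and> (\<forall>x. cmod (v x) \<le> C * G) \<and> l2le (jw s) (fc v) (C * \<Theta>)"

definition scalar :: "real \<Rightarrow> real \<Rightarrow> (real \<Rightarrow> real) \<Rightarrow> real \<Rightarrow> bool" where
  "scalar s \<Lambda> f F \<longleftrightarrow> cper f \<and> l1le (\<lambda>_. 1) (fc (\<lambda>x. of_real (f x))) F \<and> l1le (jw s) (fc (\<lambda>x. of_real (f x))) (F * \<Lambda>)"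

lemma tame_mono:
  assumes "tame s G \<Theta> v C" "C \<le> D" "0 \<le> G" "0 \<le> \<Theta>"
  shows "tame s G \<Theta> v D"
  using assms unfolding tame_def
  by (meson l2le_mono mult_right_mono order_trans)

lemma tame_mult:
  assumes f: "scalar s \<Lambda> f F" and v: "tame s G \<Theta> v C"
    and s: "s \<ge> 0" and G: "G \<ge> 0" and C: "C \<ge> 0" and \<Lambda>: "\<Lambda> * G \<le> \<Theta>" and \<Theta>: "\<Theta> \<ge> 0"
  shows "tame s G \<Theta> (\<lambda>x. of_real (f x) * v x) (2 * 2 powr s * F * C)"
proof -
  have F: "F \<ge> 0" using f l1le_nonneg by (auto simp: scalar_def)
  have cf: "cper (\<lambda>x. complex_of_real (f x))" using f by (simp add: scalar_def cper_of_real)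
  have v': "cper v" "\<And>x. cmod (v x) \<le> C * G" "l2le (jw s) (fc v) (C * \<Theta>)" using v by (auto simp: tame_def)
  have f': "l1le (\<lambda>_. 1) (fc (\<lambda>x. of_real (f x))) F" "l1le (jw s) (fc (\<lambda>x. of_real (f x))) (F * \<Lambda>)"
    using f by (auto simp: scalar_def)
  have p: "1 \<le> 2 * 2 powr s" using s ge_one_powr_ge_zero[of 2 s] by linarith
  have "cmod (of_real (f x) * v x) \<le> 2 * 2 powr s * F * C * G" for x
  proof -
    have "cmod (of_real (f x) * v x) \<le> F * (C * G)"
      unfolding norm_mult by (intro mult_mono fourier_inversion(2)[OF cf f'(1)] v' F) auto
    also have "\<dots> \<le> (2 * 2 powr s) * (F * (C * G))"
      using mult_right_mono[OF p, of "F * (C * G)"] F C G by simp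
    finally show ?thesis by (simp add: mult_ac)
  qed
  moreover have "l2le (jw s) (fc (\<lambda>x. of_real (f x) * v x)) (2 powr s * (F * \<Lambda> * (C * G) + F * (C * \<Theta>)))"
    by (rule l2le_mult[OF cf f'(2,1) s v'(1,3) l2le_of_bounded[OF v'(1,2)]])
  then have "l2le (jw s) (fc (\<lambda>x. of_real (f x) * v x)) (2 * 2 powr s * F * C * \<Theta>)"
  proof (rule l2le_mono)
    have "F * \<Lambda> * (C * G) = F * C * (\<Lambda> * G)" by simp
    also have "\<dots> \<le> F * C * \<Theta>" using F C by (intro mult_left_mono \<Lambda>) auto
    finally have "F * \<Lambda> * (C * G) \<le> F * (C * \<Theta>)" by (simp only: mult.assoc)
    then have "F * \<Lambda> * (C * G) + F * (C * \<Theta>) \<le> 2 * (F * C * \<Theta>)" by (simp only: mult.assoc)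
    then have "2 powr s * (F * \<Lambda> * (C * G) + F * (C * \<Theta>)) \<le> 2 powr s * (2 * (F * C * \<Theta>))"
      by (intro mult_left_mono) auto
    then show "2 powr s * (F * \<Lambda> * (C * G) + F * (C * \<Theta>)) \<le> 2 * 2 powr s * F * C * \<Theta>" by (simp add: mult_ac)
  qed
  ultimately show ?thesis using cper_mult[OF cf v'(1)] by (simp add: tame_def)
qed

lemma tame_add:
  assumes "tame s G \<Theta> v C" "tame s G \<Theta> w D"
  shows "tame s G \<Theta> (\<lambda>x. v x + w x) (C + D)"
  unfolding tame_def
proof (intro conjI allI)
  have v: "cper v" "\<And>x. cmod (v x) \<le> C * G" "l2le (jw s) (fc v) (C * \<Theta>)" using assms(1) by (auto simp: tame_def)
  have w: "cper w" "\<And>x. cmod (w x) \<le> D * G" "l2le (jw s) (fc w) (D * \<Theta>)" using assms(2) by (auto simp: tame_def)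
  show "cper (\<lambda>x. v x + w x)" by (intro cper_add v w)
  show "cmod (v x + w x) \<le> (C + D) * G" for x
    using norm_triangle_ineq[of "v x" "w x"] v(2)[of x] w(2)[of x] by (simp add: distrib_right)
  show "l2le (jw s) (fc (\<lambda>x. v x + w x)) ((C + D) * \<Theta>)"
    unfolding distrib_right
    by (rule l2le_add[OF v(3) w(3)]) (auto simp: fc_add[OF v(1) w(1)] norm_triangle_ineq)
qed

lemma tame_diff:
  assumes "tame s G \<Theta> v C" "tame s G \<Theta> w D"
  shows "tame s G \<Theta> (\<lambda>x. v x - w x) (C + D)"
proof -
  have "fc (\<lambda>x. - w x) k = - fc w k" for k using fc_cmult[of "-1" w k] by simp
  moreover have "cper (\<lambda>x. - w x)" using assms(2) cper_mult[OF cper_const[of "-1"], of w] by (simp add: tame_def)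
  ultimately have "tame s G \<Theta> (\<lambda>x. - w x) D" using assms(2) by (auto simp: tame_def l2le_def)
  from tame_add[OF assms(1) this] show ?thesis by simp
qed

lemma tame_const:
  assumes "cmod z \<le> C * G" "G \<le> \<Theta>" "C \<ge> 0"
  shows "tame s G \<Theta> (\<lambda>x. z) C"
  unfolding tame_def
proof (intro conjI allI)
  have "l2le (jw s) (fc (\<lambda>x. z)) (cmod z)"
    unfolding l2le_def
  proof safe
    fix F :: "int set" assume F: "finite F"
    have e: "fc (\<lambda>x. z) k = z * (if k = 0 then 1 else 0)" for k
      using fc_cmult[of z "ek 0" k] by (simp add: fc_ek)
    have "(\<Sum>k\<in>F. (jw s k * cmod (fc (\<lambda>x. z) k))\<^sup>2) = (\<Sum>k\<in>F. if k = 0 then (cmod z)\<^sup>2 else 0)"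
      by (intro sum.cong refl) (auto simp: e norm_mult jw_def jap_def)
    also have "\<dots> \<le> (cmod z)\<^sup>2" using F by (simp add: sum.delta)
    finally show "L2_set (\<lambda>k. jw s k * cmod (fc (\<lambda>x. z) k)) F \<le> cmod z"
      unfolding L2_set_def by (intro real_le_lsqrt) auto
  qed
  moreover have "cmod z \<le> C * \<Theta>" using assms mult_left_mono[OF assms(2,3)] by linarith
  ultimately show "l2le (jw s) (fc (\<lambda>x. z)) (C * \<Theta>)" by (rule l2le_mono)
qed (use assms in auto)

text \<open>The mean of \<open>Q\<close>, which its derivative does not see, is controlled by the supremum of \<open>Q\<close> over one period and hence by the
  low norm; the factor 8 is \<open>7 + 1\<close> with \<open>2\<pi> \<le> 7\<close>.\<close>

lemma tame_antiderivative:
  assumes q: "tame (s - 1) G \<Theta> q C" and Q: "cper Q" "\<And>x. (Q has_vector_derivative q x) (at x)" "Q 0 = 0"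
    and G: "0 \<le> G" "G \<le> \<Theta>" and C: "C \<ge> 0"
  shows "tame s G \<Theta> Q (8 * C)"
  unfolding tame_def
proof (intro conjI allI)
  have q': "cper q" "\<And>x. cmod (q x) \<le> C * G" "l2le (jw (s - 1)) (fc q) (C * \<Theta>)" using q by (auto simp: tame_def)
  have CG: "C * G \<ge> 0" using C G by simp
  have b0: "cmod (Q x) \<le> 7 * (C * G)" if x: "x \<in> {0..2*pi}" for x
  proof -
    have i: "(q has_integral (Q x - Q 0)) {0..x}" by (rule integral_derivative[OF Q(2)]) (use x in auto)
    have "norm (integral {0..x} q) \<le> C * G * (x - 0)"
      by (rule integral_bound) (use x q' in \<open>auto intro: cper_continuous\<close>)
    also have "\<dots> \<le> C * G * 7" using x CG pi_less_4 pi_approx by (intro mult_left_mono) auto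
    finally show ?thesis using integral_unique[OF i] Q(3) by (simp add: mult.commute)
  qed
  have b: "cmod (Q x) \<le> 7 * (C * G)" for x
  proof -
    define n where "n = \<lfloor>x / (2*pi)\<rfloor>"
    have "of_int n \<le> x / (2*pi)" "x / (2*pi) < of_int n + 1" unfolding n_def by linarith+
    then have "x - 2 * pi * of_int n \<in> {0..2*pi}" using pi_gt_zero by (auto simp: field_simps)
    from b0[OF this] show ?thesis
      using cper_shift_int[of Q "x - 2 * pi * of_int n" n] Q(1) by (simp add: cper_def)
  qed
  show "cper Q" by (rule Q(1))
  show "cmod (Q x) \<le> 8 * C * G" for x using b[of x] CG by linarith
  have "l2le (jw s) (\<lambda>k. if k = 0 then fc Q 0 else 0) (7 * (C * G))"
    unfolding l2le_def
  proof safe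
    fix F :: "int set" assume F: "finite F"
    have "(\<Sum>k\<in>F. (jw s k * cmod (if k = 0 then fc Q 0 else 0))\<^sup>2) = (\<Sum>k\<in>F. if k = 0 then (cmod (fc Q 0))\<^sup>2 else 0)"
      by (intro sum.cong refl) (auto simp: jw_def jap_def)
    also have "\<dots> \<le> (cmod (fc Q 0))\<^sup>2" using F by (simp add: sum.delta)
    also have "\<dots> \<le> (7 * (C * G))\<^sup>2" by (intro power_mono norm_fc_le Q b) auto
    finally show "L2_set (\<lambda>k. jw s k * cmod (if k = 0 then fc Q 0 else 0)) F \<le> 7 * (C * G)"
      unfolding L2_set_def using CG by (intro real_le_lsqrt) auto
  qed
  moreover have "l2le (jw s) (\<lambda>k. if k = 0 then 0 else fc Q k) (1 * (C * \<Theta>))"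
  proof (rule l2le_weaken[OF q'(3)])
    fix k
    show "jw s k * cmod (if k = 0 then 0 else fc Q k) \<le> 1 * (jw (s - 1) k * cmod (fc q k))"
    proof (cases "k = 0")
      case False
      have "fc q k = \<i> * of_int k * fc Q k" by (rule fc_derivative[OF Q(1) q'(1) Q(2)])
      moreover have "jw s k = jw (s - 1) k * \<bar>of_int k\<bar>"
        using jw_add[of "s - 1" 1 k] False by (simp add: jw_1 jap_def max_def)
      ultimately show ?thesis using False by (simp add: norm_mult)
    qed simp
  qed auto
  ultimately have "l2le (jw s) (fc Q) (7 * (C * G) + 1 * (C * \<Theta>))"
    by (rule l2le_add) auto
  then show "l2le (jw s) (fc Q) (8 * C * \<Theta>)"
  proof (rule l2le_mono)
    have "C * G \<le> C * \<Theta>" using G C by (intro mult_left_mono) auto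
    then show "7 * (C * G) + 1 * (C * \<Theta>) \<le> 8 * C * \<Theta>" by simp
  qed
qed

lemma tame_Re:
  assumes "tame s G \<Theta> v C" "C \<ge> 0" "\<Theta> \<ge> 0"
  shows "l2le (jw s) (fc (\<lambda>x. of_real (Re (v x)))) (C * \<Theta>)"
proof -
  have v: "cper v" "l2le (jw s) (fc v) (C * \<Theta>)" using assms by (auto simp: tame_def)
  have eq: "(\<lambda>x. complex_of_real (Re (v x))) = (\<lambda>x. (1/2) * (v x + cnj (v x)))"
    by (auto simp: complex_add_cnj)
  have fceq: "fc (\<lambda>x. complex_of_real (Re (v x))) k = (1/2) * (fc v k + cnj (fc v (-k)))" for k
    unfolding eq fc_cmult by (simp add: fc_add[OF v(1) cper_cnj[OF v(1)]] fc_cnj)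
  have refl: "l2le (jw s) (\<lambda>k. (1/2) * cnj (fc v (-k))) (1/2 * (C * \<Theta>))"
    unfolding l2le_def
  proof safe
    fix F :: "int set" assume F: "finite F"
    have "L2_set (\<lambda>k. jw s k * cmod ((1/2) * cnj (fc v (-k)))) F = 1/2 * L2_set (\<lambda>k. jw s k * cmod (fc v (-k))) F"
      by (subst L2_set_right_distrib) (auto simp: norm_mult norm_divide mult_ac)
    also have "L2_set (\<lambda>k. jw s k * cmod (fc v (-k))) F = L2_set (\<lambda>k. jw s k * cmod (fc v k)) (uminus ` F)"
      unfolding L2_set_def by (subst sum.reindex) (auto simp: jw_def jap_def)
    also have "1/2 * \<dots> \<le> 1/2 * (C * \<Theta>)" using F by (intro mult_left_mono l2leD[OF v(2)]) auto
    finally show "L2_set (\<lambda>k. jw s k * cmod ((1/2) * cnj (fc v (-k)))) F \<le> 1/2 * (C * \<Theta>)" .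
  qed
  have half: "l2le (jw s) (\<lambda>k. (1/2) * fc v k) (1/2 * (C * \<Theta>))"
    by (rule l2le_weaken[OF v(2)]) (auto simp: norm_mult norm_divide)
  have "l2le (jw s) (fc (\<lambda>x. complex_of_real (Re (v x)))) (1/2 * (C * \<Theta>) + 1/2 * (C * \<Theta>))"
  proof (rule l2le_add[OF half refl])
    show "cmod (fc (\<lambda>x. complex_of_real (Re (v x))) k) \<le> cmod (1/2 * fc v k) + cmod (1/2 * cnj (fc v (-k)))" for k
      unfolding fceq distrib_left by (rule norm_triangle_ineq)
  qed auto
  then show ?thesis by simp
qed

subsection \<open>Waves modulated by the Hankel amplitudes\<close>

text \<open>The first two bounds make \<open>x \<mapsto> x + a(x) + b(x)\<close> a diffeomorphism and bound its low norms
  by constants; the third one keeps \<open>a\<close> inside the disc of convergence of the amplitudes.\<close>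

definition near_flat :: "real \<Rightarrow> (real \<Rightarrow> real) \<Rightarrow> (real \<Rightarrow> real) \<Rightarrow> (real \<Rightarrow> real) \<Rightarrow> (real \<Rightarrow> real) \<Rightarrow> bool" where
  "near_flat Astar a b a' b' \<longleftrightarrow>
    (\<forall>x. (a has_real_derivative a' x) (at x)) \<and> (\<forall>x. (b has_real_derivative b' x) (at x)) \<and>
    cper a \<and> cper b \<and> cper a' \<and> cper b' \<and>
    (\<forall>k. fc (\<lambda>x. of_real (a' x)) k = \<i> * of_int k * fc (\<lambda>x. of_real (a x)) k) \<and>
    (\<forall>k. fc (\<lambda>x. of_real (b' x)) k = \<i> * of_int k * fc (\<lambda>x. of_real (b x)) k) \<and>
    l1le (jw 1) (fc (\<lambda>x. of_real (a x))) (1/32) \<and> l1le (jw 1) (fc (\<lambda>x. of_real (b x))) (1/32) \<and>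
    l1le (jw 1) (fc (\<lambda>x. of_real (a x))) (Astar/48)"

text \<open>The constant may depend on the level \<open>s\<close>, on \<open>e\<close>, on \<open>Astar\<close> and on the amplitude \<open>\<eta>\<close>, but not on the curve or the data. The
  weights \<open>w\<close> may be of order \<open>e + 1/2\<close> because the amplitude gains \<open>1/2\<close>.\<close>

definition wave_bound :: "real \<Rightarrow> real \<Rightarrow> real \<Rightarrow> (complex \<Rightarrow> complex) \<Rightarrow> real \<Rightarrow> bool" where
  "wave_bound Astar s e \<eta> C \<longleftrightarrow> C > 0 \<and> (\<forall>a b a' b' \<gamma> w f G \<Gamma> \<Theta> p. near_flat Astar a b a' b' \<longrightarrow>
    l2le (jw (s + 7/2)) (fc (\<lambda>x. of_real (a x))) p \<longrightarrow> l2le (jw (s + 7/2)) (fc (\<lambda>x. of_real (b x))) p \<longrightarrow>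
    l2le (jw 3) \<gamma> G \<longrightarrow> l2le (jw (s + e)) \<gamma> \<Gamma> \<longrightarrow> \<Gamma> \<le> \<Theta> \<longrightarrow> (1 + p) * G \<le> \<Theta> \<longrightarrow>
    (\<forall>k. cmod (w k) \<le> (if k \<ge> 1 then real_of_int k powr (e + 1/2) * cmod (\<gamma> k) else 0)) \<longrightarrow>
    (\<forall>x. ((\<lambda>k. w k * (\<eta> (of_real (of_int k * (Astar + a x))) * exp (\<i> * of_real (of_int k * (Astar + a x)))) * ek k (x + b x))
      has_sum f x) UNIV) \<longrightarrow>
    tame s G \<Theta> f C)"

lemma wave_boundD:
  assumes "wave_bound Astar s e \<eta> C" "near_flat Astar a b a' b'"
    "l2le (jw (s + 7/2)) (fc (\<lambda>x. of_real (a x))) p" "l2le (jw (s + 7/2)) (fc (\<lambda>x. of_real (b x))) p"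
    "l2le (jw 3) \<gamma> G" "l2le (jw (s + e)) \<gamma> \<Gamma>" "\<Gamma> \<le> \<Theta>" "(1 + p) * G \<le> \<Theta>"
    "\<And>k. cmod (w k) \<le> (if k \<ge> 1 then real_of_int k powr (e + 1/2) * cmod (\<gamma> k) else 0)"
    "\<And>x. ((\<lambda>k. w k * (\<eta> (of_real (of_int k * (Astar + a x))) * exp (\<i> * of_real (of_int k * (Astar + a x)))) * ek k (x + b x))
      has_sum f x) UNIV"
  shows "tame s G \<Theta> f C"
  using assms(1)[unfolded wave_bound_def, THEN conjunct2, THEN spec, THEN spec, THEN spec, THEN spec, THEN spec, THEN spec,
    THEN spec, THEN spec, THEN spec, THEN spec, THEN spec, THEN mp, THEN mp, THEN mp, THEN mp, THEN mp, THEN mp, THEN mp,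
    THEN mp, THEN mp, OF assms(2-8)] assms(9,10) by blast

text \<open>Since \<open>H(kA) e\<^sub>k(B) = e\<^sub>k(Astar) \<eta>(kA) e\<^sub>k(x + a + b)\<close>, the phase is that of a composition with \<open>id + a + b\<close>. The number
  \<open>m\<close> of integrations by parts lies in \<open>(s + 1/2, s + 3/2]\<close>, and the absolutely convergent norm of order \<open>m\<close> of
  \<open>a' + b'\<close> is bounded by the norm of order \<open>s + 7/2\<close> of \<open>(a, b)\<close>.\<close>

lemma ex_wave_bound:
  fixes s Astar e :: real
  assumes s: "s > 0" and e: "0 \<le> e" "e \<le> 2" and Astar: "Astar > 0" and hol: "\<eta> holomorphic_on rhp"
    and Ce: "\<And>z. \<bar>Im z\<bar> \<le> Re z \<Longrightarrow> cmod z \<ge> Astar/2 \<Longrightarrow> cmod (\<eta> z) \<le> Ce / sqrt (cmod z)" "Ce > 0"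
    and CE: "C0 > 0" "\<And>s t w M. s + 1 \<le> t \<Longrightarrow> l2le (jw t) w M \<Longrightarrow> l1le (jw s) w (C0 * M)"
  shows "\<exists>C. wave_bound Astar s e \<eta> C"
proof -
  define m where "m = nat \<lfloor>s + 1/2\<rfloor> + 1"
  have m: "m > 0" "real m > s + 1/2" "real m \<le> s + 3/2"
    using s by (auto simp: m_def of_nat_nat) linarith+
  obtain Cw where Cw: "Cw > 0"
    "\<And>a c c' h u Q N Na U1 Us S f.
      \<lbrakk>\<And>x. (c has_real_derivative c' x) (at x); \<And>x. c (x + 2*pi) = c x; cper c';
       l1le (\<lambda>_. 1) (fc (\<lambda>x. of_real (c' x))) (1/16); l1le (jw m) (fc (\<lambda>x. of_real (c' x))) N;
       cper a; l1le (\<lambda>_. 1) (fc (\<lambda>x. of_real (a x))) (Astar/48); l1le (jw s) (fc (\<lambda>x. of_real (a x))) Na;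
       \<And>k l. cmod (h k l) \<le> Q * (2/Astar) ^ l; Q \<ge> 0; l1le (\<lambda>_. 1) u U1; l2le (jw s) u Us;
       \<And>k x. (\<lambda>l. h k l * of_real (a x) ^ l) sums S k x;
       \<And>x. ((\<lambda>k. u k * S k x * ek k (x + c x)) has_sum f x) UNIV\<rbrakk>
      \<Longrightarrow> cper f \<and> (\<forall>x. cmod (f x) \<le> 2 * Q * U1) \<and> l2le (jw s) (fc f) (Cw * Q * (Us + (1 + N + Na) * U1))"
    using wave_series[OF s Astar m(1,2)] by blast
  obtain hn :: "nat \<Rightarrow> nat \<Rightarrow> complex" where hn:
    "\<And>k l. k \<ge> 1 \<Longrightarrow> cmod (hn k l) \<le> Ce / sqrt (Astar/2) / sqrt (real k) * (2/Astar) ^ l"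
    "\<And>k y. k \<ge> 1 \<Longrightarrow> \<bar>y\<bar> < Astar/2 \<Longrightarrow> (\<lambda>l. hn k l * of_real y ^ l) sums \<eta> (of_real (real k * (Astar + y)))"
    using amplitude_expansion[OF Astar hol Ce] by blast
  define Q where "Q = Ce / sqrt (Astar/2)"
  have Q: "Q > 0" using Ce(2) Astar by (simp add: Q_def)
  define h where "h k l = (if k \<ge> 1 then of_real (sqrt (of_int k)) * hn (nat k) l else 0)" for k :: int and l
  have h: "cmod (h k l) \<le> Q * (2/Astar) ^ l" for k l
  proof (cases "k \<ge> 1")
    case True
    have "cmod (hn (nat k) l) \<le> Q / sqrt (of_int k) * (2/Astar) ^ l"
      using hn(1)[of "nat k" l] True by (simp add: Q_def)
    from mult_left_mono[OF this, of "sqrt (of_int k)"] show ?thesis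
      using True by (simp add: h_def norm_mult)
  next
    case False
    then show ?thesis using Q Astar by (simp add: h_def)
  qed
  define C where "C = 2 * Q * C0 + Cw * Q * (1 + (1 + 3 * C0) * C0)"
  have C: "C > 0" using Q Cw(1) CE(1) by (auto simp: C_def intro!: add_pos_pos mult_pos_pos)
  have "wave_bound Astar s e \<eta> C"
    unfolding wave_bound_def
  proof (intro conjI allI impI C)
    fix a b a' b' :: "real \<Rightarrow> real" and \<gamma> w :: "int \<Rightarrow> complex" and f and G \<Gamma> \<Theta> p
    assume nf: "near_flat Astar a b a' b'"
      and ap: "l2le (jw (s + 7/2)) (fc (\<lambda>x. of_real (a x))) p" and bp: "l2le (jw (s + 7/2)) (fc (\<lambda>x. of_real (b x))) p"
      and \<gamma>: "l2le (jw 3) \<gamma> G" "l2le (jw (s + e)) \<gamma> \<Gamma>" and \<Theta>: "\<Gamma> \<le> \<Theta>" "(1 + p) * G \<le> \<Theta>"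
      and "\<forall>k. cmod (w k) \<le> (if k \<ge> 1 then real_of_int k powr (e + 1/2) * cmod (\<gamma> k) else 0)"
        "\<forall>x. ((\<lambda>k. w k * (\<eta> (of_real (of_int k * (Astar + a x))) * exp (\<i> * of_real (of_int k * (Astar + a x)))) * ek k (x + b x)) has_sum f x) UNIV"
    then have w: "cmod (w k) \<le> (if k \<ge> 1 then real_of_int k powr (e + 1/2) * cmod (\<gamma> k) else 0)"
      and f: "((\<lambda>k. w k * (\<eta> (of_real (of_int k * (Astar + a x))) * exp (\<i> * of_real (of_int k * (Astar + a x)))) * ek k (x + b x)) has_sum f x) UNIV" for k x
      by blast+
    have da: "(a has_real_derivative a' x) (at x)" and db: "(b has_real_derivative b' x) (at x)"
      and fa': "fc (\<lambda>x. of_real (a' x)) k = \<i> * of_int k * fc (\<lambda>x. of_real (a x)) k"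
      and fb': "fc (\<lambda>x. of_real (b' x)) k = \<i> * of_int k * fc (\<lambda>x. of_real (b x)) k" for x k
      using nf by (simp_all add: near_flat_def)
    have ca: "cper a" and cb: "cper b" and ca': "cper a'" and cb': "cper b'"
      and a1: "l1le (jw 1) (fc (\<lambda>x. of_real (a x))) (1/32)" and b1: "l1le (jw 1) (fc (\<lambda>x. of_real (b x))) (1/32)"
      and aA: "l1le (jw 1) (fc (\<lambda>x. of_real (a x))) (Astar/48)"
      using nf by (simp_all add: near_flat_def)
    have pa: "a (x + 2*pi) = a x" and pb: "b (x + 2*pi) = b x" for x using ca cb by (simp_all add: cper_def)
    have G: "G \<ge> 0" and p: "p \<ge> 0" using l2le_nonneg[OF \<gamma>(1)] l2le_nonneg[OF ap] by auto
    define c where "c x = a x + b x" for x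
    define c' where "c' x = a' x + b' x" for x
    have fcc': "fc (\<lambda>x. of_real (c' x)) k = fc (\<lambda>x. of_real (a' x)) k + fc (\<lambda>x. of_real (b' x)) k" for k
      unfolding c'_def of_real_add by (rule fc_add) (intro cper_of_real ca' cb')+
    have sum: "l1le \<omega> (fc (\<lambda>x. of_real (c' x))) (X + Y)"
      if "l1le \<omega> (fc (\<lambda>x. of_real (a' x))) X" "l1le \<omega> (fc (\<lambda>x. of_real (b' x))) Y" "\<And>k. \<omega> k \<ge> 0" for \<omega> X Y
      unfolding l1le_def
    proof safe
      fix F :: "int set" assume F: "finite F"
      have "(\<Sum>k\<in>F. \<omega> k * cmod (fc (\<lambda>x. of_real (c' x)) k)) \<le>
        (\<Sum>k\<in>F. \<omega> k * cmod (fc (\<lambda>x. of_real (a' x)) k) + \<omega> k * cmod (fc (\<lambda>x. of_real (b' x)) k))"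
        unfolding fcc' distrib_left [symmetric] by (intro sum_mono mult_left_mono norm_triangle_ineq that)
      also have "\<dots> \<le> X + Y" unfolding sum.distrib by (intro add_mono l1leD[OF that(1) F] l1leD[OF that(2) F])
      finally show "(\<Sum>k\<in>F. \<omega> k * cmod (fc (\<lambda>x. of_real (c' x)) k)) \<le> X + Y" .
    qed
    have c1: "l1le (\<lambda>_. 1) (fc (\<lambda>x. of_real (c' x))) (1/16)"
    proof -
      have "l1le (jw 0) (fc (\<lambda>x. of_real (a' x))) (1/32)" "l1le (jw 0) (fc (\<lambda>x. of_real (b' x))) (1/32)"
        by (rule l1le_derivative[OF _ fa'], simp add: a1) (rule l1le_derivative[OF _ fb'], simp add: b1)
      from sum[OF this] have "l1le (jw 0) (fc (\<lambda>x. of_real (c' x))) (1/16)" by simp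
      then show ?thesis by (rule l1le_jw_imp_1) simp
    qed
    have cm: "l1le (jw m) (fc (\<lambda>x. of_real (c' x))) (C0 * p + C0 * p)"
    proof (rule sum)
      have "real m + 1 + 1 \<le> s + 7/2" using m by simp
      then show "l1le (jw m) (fc (\<lambda>x. of_real (a' x))) (C0 * p)" "l1le (jw m) (fc (\<lambda>x. of_real (b' x))) (C0 * p)"
        by (intro l1le_derivative[OF CE(2)[OF _ ap] fa'] l1le_derivative[OF CE(2)[OF _ bp] fb']; assumption)+
    qed simp
    have a0: "l1le (\<lambda>_. 1) (fc (\<lambda>x. of_real (a x))) (Astar/48)" by (rule l1le_jw_imp_1[OF aA]) simp
    have as: "l1le (jw s) (fc (\<lambda>x. of_real (a x))) (C0 * p)" by (rule CE(2)[OF _ ap]) simp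
    have asmall: "\<bar>a x\<bar> < Astar/2" for x
      using fourier_inversion(2)[OF cper_of_real[OF ca] a0, of x] Astar by simp
    define u where "u k = w k * ek k Astar / of_real (sqrt (of_int k))" for k
    have ub: "cmod (u k) \<le> jw e k * cmod (\<gamma> k)" for k
    proof (cases "k \<ge> 1")
      case True
      have kp: "real_of_int k > 0" using True by simp
      have "cmod (u k) = cmod (w k) / sqrt (of_int k)" using True by (simp add: u_def norm_mult norm_divide)
      also have "\<dots> \<le> real_of_int k powr (e + 1/2) * cmod (\<gamma> k) / sqrt (of_int k)"
        using w[of k] True by (intro divide_right_mono) auto
      also have "\<dots> = jw e k * cmod (\<gamma> k)"
        using True kp by (simp add: jw_def jap_def powr_add powr_half_sqrt)
      finally show ?thesis .
    next
      case False
      then have "w k = 0" using w[of k] by simp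
      then show ?thesis by (simp add: u_def)
    qed
    have u1: "l1le (\<lambda>_. 1) u (C0 * G)"
    proof -
      have "l1le (jw e) \<gamma> (C0 * G)" by (rule CE(2)[OF _ \<gamma>(1)]) (use e in simp)
      from l1le_weaken[OF this, of "\<lambda>_. 1" u 1] ub show ?thesis by simp
    qed
    have us: "l2le (jw s) u \<Gamma>"
    proof -
      have "jw s k * cmod (u k) \<le> 1 * (jw (s + e) k * cmod (\<gamma> k))" for k
        using mult_left_mono[OF ub jw_nonneg[of s k]] by (simp add: jw_add mult.assoc)
      from l2le_weaken[OF \<gamma>(2) this] show ?thesis by simp
    qed
    define S where "S k x = (if k \<ge> 1 then of_real (sqrt (of_int k)) * \<eta> (of_real (of_int k * (Astar + a x))) else 0)" for k :: int and x
    have hS: "(\<lambda>l. h k l * of_real (a x) ^ l) sums S k x" for k x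
    proof (cases "k \<ge> 1")
      case True
      have "(\<lambda>l. hn (nat k) l * of_real (a x) ^ l) sums \<eta> (of_real (real (nat k) * (Astar + a x)))"
        by (rule hn(2)) (use True asmall in auto)
      from sums_mult[OF this, of "of_real (sqrt (of_int k))"] show ?thesis
        using True by (simp add: h_def S_def mult.assoc)
    next
      case False
      then show ?thesis by (simp add: h_def S_def)
    qed
    have eqt: "u k * S k x * ek k (x + c x) = w k * (\<eta> (of_real (of_int k * (Astar + a x))) * exp (\<i> * of_real (of_int k * (Astar + a x)))) * ek k (x + b x)" for k x
    proof (cases "k \<ge> 1")
      case True
      have "exp (\<i> * of_real (of_int k * (Astar + a x))) = ek k Astar * ek k (a x)"
        unfolding ek_add_arg [symmetric] by (simp add: ek_def mult_ac)
      moreover have "ek k (x + c x) = ek k (a x) * ek k (x + b x)"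
        unfolding ek_add_arg [symmetric] by (simp add: c_def add_ac)
      moreover have "complex_of_real (sqrt (of_int k)) \<noteq> 0" using True by simp
      ultimately show ?thesis using True by (simp add: u_def S_def)
    next
      case False
      then have "w k = 0" using w[of k] by simp
      then show ?thesis by (simp add: u_def)
    qed
    have dc: "(c has_real_derivative c' x) (at x)" for x
      unfolding c_def [abs_def] c'_def by (intro DERIV_add da db)
    have pc: "c (x + 2*pi) = c x" for x by (simp add: c_def pa pb)
    have cc': "cper c'" unfolding c'_def [abs_def] by (intro cper_add ca' cb')
    have fs: "((\<lambda>k. u k * S k x * ek k (x + c x)) has_sum f x) UNIV" for x unfolding eqt by (rule f)
    have *: "cper f \<and> (\<forall>x. cmod (f x) \<le> 2 * Q * (C0 * G)) \<and> l2le (jw s) (fc f) (Cw * Q * (\<Gamma> + (1 + (C0 * p + C0 * p) + C0 * p) * (C0 * G)))"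
      by (rule Cw(2)[where h = h and u = u and S = S and a = a and c = c and c' = c', OF dc pc cc' c1 cm ca a0 as h _ u1 us hS fs])
        (use Q in auto)
    have Th: "\<Theta> \<ge> 0"
    proof -
      have "0 \<le> (1 + p) * G" using p G by simp
      then show ?thesis using \<Theta>(2) by linarith
    qed
    show "tame s G \<Theta> f C"
      unfolding tame_def
    proof (intro conjI allI)
      show "cper f" using * by blast
      fix x
      have "cmod (f x) \<le> 2 * Q * C0 * G" using * by (simp add: mult.assoc)
      also have "\<dots> \<le> C * G" using Q Cw(1) CE(1) G by (intro mult_right_mono) (auto simp: C_def)
      finally show "cmod (f x) \<le> C * G" .
    next
      have "(1 + (C0 * p + C0 * p) + C0 * p) * (C0 * G) \<le> (1 + 3 * C0) * C0 * ((1 + p) * G)"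
      proof -
        have "1 + (C0 * p + C0 * p) + C0 * p \<le> (1 + 3 * C0) * (1 + p)" using CE(1) p by (simp add: algebra_simps)
        from mult_right_mono[OF this, of "C0 * G"] CE(1) G show ?thesis by (simp add: mult_ac)
      qed
      also have "\<dots> \<le> (1 + 3 * C0) * C0 * \<Theta>" using CE(1) by (intro mult_left_mono \<Theta>) auto
      finally have "Cw * Q * (\<Gamma> + (1 + (C0 * p + C0 * p) + C0 * p) * (C0 * G)) \<le> Cw * Q * (\<Theta> + (1 + 3 * C0) * C0 * \<Theta>)"
        using Cw(1) Q \<Theta>(1) by (intro mult_left_mono add_mono) auto
      also have "\<dots> = Cw * Q * (1 + (1 + 3 * C0) * C0) * \<Theta>" by (simp add: algebra_simps)
      also have "\<dots> \<le> C * \<Theta>" using Q CE(1) Th by (intro mult_right_mono) (auto simp: C_def)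
      finally show "l2le (jw s) (fc f) (C * \<Theta>)" using * l2le_mono by blast
    qed
  qed
  then show ?thesis ..
qed

subsection \<open>From the waves to the inverse\<close>

context small_curve
begin

text \<open>The waves \<open>PA\<close> and \<open>PB\<close> are estimated at the level \<open>s - 1\<close>; passing from \<open>q\<close> to its antiderivative \<open>Q\<close> restores the level
  \<open>s\<close>. The constant \<open>mu\<close> is bounded by the low norm, because the denominator in its definition stays away from \<open>0\<close>.\<close>

lemma h_tame:
  fixes s F K \<Lambda> G \<Theta> :: real
  defines "k \<equiv> 2 * 2 powr s * F"
  defines "K1 \<equiv> k * (k * K + k * K)"
  defines "K2 \<equiv> 2 * K1 / ((1 - \<kappa>) * Astar)"
  defines "K3 \<equiv> k * (k * (K + k * K2)) + k * (8 * (K1 + k * (k * K2)))"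
  assumes \<gamma>: "data \<gamma>" and s: "s \<ge> 1" and K: "K \<ge> 0" and G: "0 \<le> G" "G \<le> \<Theta>" "\<Lambda> * G \<le> \<Theta>"
    and waves: "tame s G \<Theta> (P \<gamma>) K" "tame (s - 1) G \<Theta> (PA \<gamma>) K" "tame (s - 1) G \<Theta> (PB \<gamma>) K"
    and coeffs: "scalar s \<Lambda> A F" "scalar s \<Lambda> a' F" "scalar s \<Lambda> B' F"
  shows "tame s G \<Theta> (h1 \<gamma>) K3" "tame s G \<Theta> (h2 \<gamma>) K3" "K3 \<ge> 0"
proof -
  have F: "F \<ge> 0" using coeffs(1) l1le_nonneg by (auto simp: scalar_def)
  have \<Theta>: "\<Theta> \<ge> 0" using G by linarith
  have k: "k \<ge> 0" using F by (simp add: k_def)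
  have K1: "K1 \<ge> 0" using k K by (simp add: K1_def)
  have K2: "K2 \<ge> 0" using K1 Astar \<kappa> by (simp add: K2_def)
  show "K3 \<ge> 0" using k K K1 K2 by (simp add: K3_def)
  have mult: "tame t G \<Theta> (\<lambda>x. of_real (f x) * v x) (k * C)"
    if f: "scalar s \<Lambda> f F" and v: "tame t G \<Theta> v C" and t: "0 \<le> t" "t \<le> s" and C: "C \<ge> 0" for t f v C
  proof -
    have "scalar t \<Lambda> f F" using f l1le_jw_mono[OF _ t(2)] by (auto simp: scalar_def)
    from tame_mult[OF this v t(1) G(1) C G(3) \<Theta>]
    have "tame t G \<Theta> (\<lambda>x. of_real (f x) * v x) (2 * 2 powr t * F * C)" .
    moreover have "2 * 2 powr t * F * C \<le> k * C"
      unfolding k_def using t F C by (intro mult_right_mono) auto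
    ultimately show ?thesis using G(1) \<Theta> by (rule tame_mono)
  qed
  have s1: "0 \<le> s - 1" "s - 1 \<le> s" "0 \<le> s" "s \<le> s" using s by auto
  have q0: "tame (s - 1) G \<Theta> (q0 \<gamma>) K1"
    unfolding q0_def [abs_def] K1_def
    by (intro mult tame_add coeffs waves s1 K add_nonneg_nonneg mult_nonneg_nonneg k)
  have mu: "cmod (mu \<gamma>) \<le> K2 * G"
  proof -
    have "cmod (integral {0..2*pi} (q0 \<gamma>)) \<le> K1 * G * (2*pi - 0)"
      by (rule integral_bound) (use q0 in \<open>auto simp: tame_def intro: cper_continuous\<close>)
    moreover have "0 < (1 - \<kappa>) * Astar * pi" using \<kappa> Astar by simp
    ultimately have "cmod (mu \<gamma>) \<le> K1 * G * (2*pi) / ((1 - \<kappa>) * Astar * pi)"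
      using integral_AB'_pos K1 G unfolding mu_def norm_divide norm_of_real by (intro frac_le) auto
    also have "\<dots> = K2 * G" by (simp add: K2_def)
    finally show ?thesis .
  qed
  have q: "tame (s - 1) G \<Theta> (q \<gamma>) (K1 + k * (k * K2))"
    unfolding q_def [abs_def]
    by (intro tame_diff q0 mult tame_const mu G coeffs s1 K2 mult_nonneg_nonneg k)
  have Q: "tame s G \<Theta> (Q \<gamma>) (8 * (K1 + k * (k * K2)))"
    by (rule tame_antiderivative[OF q cper_parts(5,4)[OF \<gamma>] _ G(1,2)]) (use K1 K2 k in \<open>simp_all add: Q_def\<close>)
  have Pt: "tame s G \<Theta> (Pt \<gamma>) (K + k * K2)"
    unfolding Pt_def [abs_def] by (intro tame_diff waves mult tame_const mu G coeffs s1 K2)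
  show "tame s G \<Theta> (h1 \<gamma>) K3" "tame s G \<Theta> (h2 \<gamma>) K3"
    unfolding h1_def [abs_def] h2_def [abs_def] K3_def
    by (intro tame_add mult coeffs Pt Q s1 mult_nonneg_nonneg add_nonneg_nonneg k K K1 K2; simp)+
qed

end

subsection \<open>The estimate of the inverse\<close>

lemma l2le_divide:
  assumes "l2le (jw s) w M" shows "l2le (jw s) (\<lambda>k. w k / c) (M / cmod c)"
proof -
  have "l2le (jw s) (\<lambda>k. w k / c) (1 / cmod c * M)"
    by (rule l2le_weaken[OF assms]) (auto simp: norm_divide)
  then show ?thesis by simp
qed

lemma l1le_shift:
  assumes "cper f" "l1le (jw s) (fc f) M"
  shows "l1le (jw s) (fc (\<lambda>x. c + f x)) (cmod c + M)"
  unfolding l1le_def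
proof safe
  fix F :: "int set" assume F: "finite F"
  have "(\<Sum>k\<in>F. jw s k * cmod (fc (\<lambda>x. c + f x) k)) \<le> (\<Sum>k\<in>F. jw s k * cmod (fc (\<lambda>x. c) k) + jw s k * cmod (fc f k))"
    unfolding fc_add[OF cper_const assms(1)] distrib_left [symmetric]
    by (intro sum_mono mult_left_mono norm_triangle_ineq) simp
  also have "\<dots> \<le> cmod c + M"
    unfolding sum.distrib by (intro add_mono l1leD[OF l1le_const F] l1leD[OF assms(2) F]) (simp add: jw_def jap_def)
  finally show "(\<Sum>k\<in>F. jw s k * cmod (fc (\<lambda>x. c + f x) k)) \<le> cmod c + M" .
qed

lemma near_flat_derivatives:
  assumes nf: "near_flat Astar a b a' b'"
  shows "l1le (jw 0) (fc (\<lambda>x. of_real (a' x))) (1/32)" "l1le (jw 0) (fc (\<lambda>x. of_real (b' x))) (1/32)"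
proof -
  have f: "fc (\<lambda>x. of_real (a' x)) j = \<i> * of_int j * fc (\<lambda>x. of_real (a x)) j"
    "fc (\<lambda>x. of_real (b' x)) j = \<i> * of_int j * fc (\<lambda>x. of_real (b x)) j" for j
    using nf by (simp_all add: near_flat_def)
  have l: "l1le (jw (0 + 1)) (fc (\<lambda>x. of_real (a x))) (1/32)" "l1le (jw (0 + 1)) (fc (\<lambda>x. of_real (b x))) (1/32)"
    using nf by (simp_all add: near_flat_def)
  show "l1le (jw 0) (fc (\<lambda>x. of_real (a' x))) (1/32)" by (rule l1le_derivative[OF l(1) f(1)])
  show "l1le (jw 0) (fc (\<lambda>x. of_real (b' x))) (1/32)" by (rule l1le_derivative[OF l(2) f(2)])
qed

lemma near_flat_small_curve:
  assumes nf: "near_flat Astar a b a' b'" and Astar: "Astar > 0" and cw: "cw \<noteq> 0"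
    "\<And>t. t > 0 \<Longrightarrow> of_real t * (hank t * of_real (besJ' t) - of_real (besJ t) * hank' t) = cw"
  shows "small_curve Astar a b a' b' (1/2) cw"
proof unfold_locales
  have c: "cper a" "cper b" "cper a'" "cper b'" using nf by (simp_all add: near_flat_def)
  have "l1le (\<lambda>_. 1) (fc (\<lambda>x. of_real (a' x))) (1/32)" "l1le (\<lambda>_. 1) (fc (\<lambda>x. of_real (b' x))) (1/32)"
    using near_flat_derivatives[OF nf] by (auto elim: l1le_jw_imp_1)
  from fourier_inversion(2)[OF cper_of_real[OF c(3)] this(1)] fourier_inversion(2)[OF cper_of_real[OF c(4)] this(2)]
  have ba: "\<bar>a' x\<bar> \<le> 1/32" and bb: "\<bar>b' x\<bar> \<le> 1/32" for x by simp_all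
  show "\<bar>a' x\<bar> + \<bar>b' x\<bar> \<le> 1/2" for x using ba[of x] bb[of x] by linarith
  have "l1le (\<lambda>_. 1) (fc (\<lambda>x. of_real (a x))) (Astar/48)"
    by (rule l1le_jw_imp_1[of 1]) (use nf in \<open>simp_all add: near_flat_def\<close>)
  from fourier_inversion(2)[OF cper_of_real[OF c(1)] this] have aa: "\<bar>a x\<bar> \<le> Astar/48" for x by simp
  show "\<bar>a x\<bar> < Astar / 2" for x using aa[of x] Astar by simp
  show "a (x + 2*pi) = a x" "b (x + 2*pi) = b x" for x using c by (auto simp: cper_def)
qed (use nf Astar cw in \<open>auto simp: near_flat_def\<close>)

text \<open>All constants are fixed before the curve and the data; the right-hand side of the estimate plays the role of \<open>\<Theta>\<close>.
  It dominates \<open>(1 + p) G\<close>, since the norm of \<open>\<gamma>\<close> of order 3 is at most that of order \<open>s + 1/2\<close>.\<close>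

lemma inverse_estimate:
  fixes s Astar :: real and cw :: complex
  assumes s: "s \<ge> 5/2" and Astar: "Astar > 0"
    and cw: "cw \<noteq> 0" "\<And>t. t > 0 \<Longrightarrow> of_real t * (hank t * of_real (besJ' t) - of_real (besJ t) * hank' t) = cw"
  shows "\<exists>C>0. \<forall>a b a' b' \<gamma>. near_flat Astar a b a' b' \<longrightarrow> a \<in> Hs (s + 7/2) \<longrightarrow> b \<in> Hs (s + 7/2) \<longrightarrow> \<gamma> \<in> Hs (s + 1/2) \<longrightarrow>
    small_curve.R Astar a b a' b' cw \<gamma> \<in> Hs s \<times> Hs s \<and>
    sobolev_norm2 s (small_curve.R Astar a b a' b' cw \<gamma>)
      \<le> C * sobolev_norm (s + 1/2) \<gamma> + C * sobolev_norm2 (s + 7/2) (a, b) * sobolev_norm 3 \<gamma>"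
proof -
  obtain C0 where C0: "C0 > 0" "\<And>s t w M. s + 1 \<le> t \<Longrightarrow> l2le (jw t) w M \<Longrightarrow> l1le (jw s) w (C0 * M)"
    by (rule embedding) (rule that, assumption+)
  obtain Ce where Ce: "Ce > 0" "\<And>z. \<bar>Im z\<bar> \<le> Re z \<Longrightarrow> cmod z \<ge> Astar/2 \<Longrightarrow> cmod (eta0 z) \<le> Ce / sqrt (cmod z)"
    "\<And>z. \<bar>Im z\<bar> \<le> Re z \<Longrightarrow> cmod z \<ge> Astar/2 \<Longrightarrow> cmod (eta1 z) \<le> Ce / sqrt (cmod z)"
    using eta_bounds[of "Astar/2"] Astar by (metis half_gt_zero)
  \<comment> \<open>a derivative of the waves is taken in the space one order below, where \<open>\<gamma>\<close> has the same surplus of regularity\<close>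
  obtain KP where KP: "wave_bound Astar s (1/2) eta0 KP"
    using ex_wave_bound[of s "1/2" Astar eta0 Ce C0] s Astar eta_holomorphic Ce C0 by auto
  obtain KA where KA: "wave_bound Astar (s - 1) (3/2) eta1 KA"
    using ex_wave_bound[of "s - 1" "3/2" Astar eta1 Ce C0] s Astar eta_holomorphic Ce C0 by auto
  obtain KB where KB: "wave_bound Astar (s - 1) (3/2) eta0 KB"
    using ex_wave_bound[of "s - 1" "3/2" Astar eta0 Ce C0] s Astar eta_holomorphic Ce C0 by auto
  define K where "K = KP + KA + KB"
  have pos: "KP > 0" "KA > 0" "KB > 0" using KP KA KB by (simp_all add: wave_bound_def)
  have K: "KP \<le> K" "KA \<le> K" "KB \<le> K" "K \<ge> 0" using pos by (simp_all add: K_def)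
  define F where "F = 2 * Astar + 2 + C0"
  define k where "k = 2 * 2 powr s * F"
  define K1 where "K1 = k * (k * K + k * K)"
  define K2 where "K2 = 2 * K1 / ((1 - 1/2) * Astar)"
  define K3 where "K3 = k * (k * (K + k * K2)) + k * (8 * (K1 + k * (k * K2)))"
  define N where "N = cmod (of_real pi * cw)"
  have N: "N > 0" using cw by (simp add: N_def)
  define C where "C = 2 * \<bar>K3\<bar> / N + 1"
  have C: "C > 0" using N by (simp add: C_def add_nonneg_pos)
  show ?thesis
  proof (intro exI[of _ C] conjI allI impI C)
    fix a b a' b' \<gamma>
    assume nf: "near_flat Astar a b a' b'" and ab: "a \<in> Hs (s + 7/2)" "b \<in> Hs (s + 7/2)" and \<gamma>: "\<gamma> \<in> Hs (s + 1/2)"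
    interpret small_curve Astar a b a' b' "1/2" cw by (rule near_flat_small_curve[OF nf Astar cw])
    define p where "p = sobolev_norm2 (s + 7/2) (a, b)"
    have ap: "l2le (jw (s + 7/2)) (fc (\<lambda>x. of_real (a x))) p" and bp: "l2le (jw (s + 7/2)) (fc (\<lambda>x. of_real (b x))) p"
      by (rule l2le_mono[OF Hs_l2le[OF ab(1)]], simp add: p_def sobolev_norm2_def)
        (rule l2le_mono[OF Hs_l2le[OF ab(2)]], simp add: p_def sobolev_norm2_def)
    have p: "p \<ge> 0" using l2le_nonneg[OF ap] .
    define y where "y j = fc (\<lambda>x. of_real (\<gamma> x)) j / (of_real pi * cw)" for j
    define G where "G = sobolev_norm 3 \<gamma> / N"
    define \<Gamma> where "\<Gamma> = sobolev_norm (s + 1/2) \<gamma> / N"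
    define \<Theta> where "\<Theta> = \<Gamma> + p * G"
    have \<gamma>3: "\<gamma> \<in> Hs 3" by (rule Hs_mono[OF \<gamma>]) (use s in simp)
    have y: "l2le (jw 3) y G" "l2le (jw (s + 1/2)) y \<Gamma>"
      unfolding y_def [abs_def] G_def \<Gamma>_def N_def by (intro l2le_divide Hs_l2le \<gamma>3 \<gamma>)+
    have G: "G \<ge> 0" and \<Gamma>: "\<Gamma> \<ge> 0" using y l2le_nonneg by auto
    have G\<Gamma>: "G \<le> \<Gamma>" unfolding G_def \<Gamma>_def using N sobolev_norm_mono[OF \<gamma>, of 3] s by (intro divide_right_mono) auto
    have pG: "p * G \<ge> 0" using p G by simp
    have \<Theta>: "G \<le> \<Theta>" "\<Gamma> \<le> \<Theta>" "(1 + p) * G \<le> \<Theta>" "0 \<le> \<Theta>"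
      using G\<Gamma> pG \<Gamma> by (simp_all add: \<Theta>_def distrib_right)
    have dat: "data \<gamma>"
      using Hs_cper[OF \<gamma>] C0(2)[OF _ Hs_l2le[OF \<gamma>3], of "3/2"] by (auto simp: data_def)
    have W: "W \<gamma> j = (if j \<ge> 1 then of_int j * y j else 0)" for j by (simp add: W_def y_def)
    have ap1: "l2le (jw (s - 1 + 7/2)) (fc (\<lambda>x. of_real (a x))) p" and bp1: "l2le (jw (s - 1 + 7/2)) (fc (\<lambda>x. of_real (b x))) p"
      by (rule l2le_jw_mono[OF ap], simp) (rule l2le_jw_mono[OF bp], simp)
    have y1: "l2le (jw (s - 1 + 3/2)) y \<Gamma>" by (rule l2le_jw_mono[OF y(2)]) simp
    have P: "tame s G \<Theta> (P \<gamma>) KP"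
    proof (rule wave_boundD[OF KP nf ap bp y \<Theta>(2,3)])
      show "cmod (W \<gamma> j) \<le> (if j \<ge> 1 then real_of_int j powr (1/2 + 1/2) * cmod (y j) else 0)" for j
        by (simp add: W norm_mult)
      show "((\<lambda>j. W \<gamma> j * (eta0 (of_real (of_int j * (Astar + a x))) * exp (\<i> * of_real (of_int j * (Astar + a x)))) * ek j (x + b x))
        has_sum P \<gamma> x) UNIV" for x
        using series_sums(1)[OF dat, of x] by (simp add: EH_def hank_def A_def B_def mult_ac)
    qed
    have PA: "tame (s - 1) G \<Theta> (PA \<gamma>) KA"
    proof (rule wave_boundD[OF KA nf ap1 bp1 y(1) y1 \<Theta>(2,3), where w = "\<lambda>j. of_int j * W \<gamma> j"])
      show "cmod (of_int j * W \<gamma> j) \<le> (if j \<ge> 1 then real_of_int j powr (3/2 + 1/2) * cmod (y j) else 0)" for j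
        by (simp add: W norm_mult power2_eq_square)
      show "((\<lambda>j. of_int j * W \<gamma> j * (eta1 (of_real (of_int j * (Astar + a x))) * exp (\<i> * of_real (of_int j * (Astar + a x)))) * ek j (x + b x))
        has_sum PA \<gamma> x) UNIV" for x
        using series_sums(2)[OF dat, of x] by (simp add: EH1_def hank'_def A_def B_def mult_ac)
    qed
    have PB: "tame (s - 1) G \<Theta> (PB \<gamma>) KB"
    proof (rule wave_boundD[OF KB nf ap1 bp1 y(1) y1 \<Theta>(2,3), where w = "\<lambda>j. \<i> * of_int j * W \<gamma> j"])
      show "cmod (\<i> * of_int j * W \<gamma> j) \<le> (if j \<ge> 1 then real_of_int j powr (3/2 + 1/2) * cmod (y j) else 0)" for j
        by (simp add: W norm_mult power2_eq_square)
      show "((\<lambda>j. \<i> * of_int j * W \<gamma> j * (eta0 (of_real (of_int j * (Astar + a x))) * exp (\<i> * of_real (of_int j * (Astar + a x)))) * ek j (x + b x))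
        has_sum PB \<gamma> x) UNIV" for x
        using series_sums(3)[OF dat, of x] by (simp add: EH_def hank_def A_def B_def mult_ac)
    qed
    have fa': "fc (\<lambda>x. of_real (a' x)) j = \<i> * of_int j * fc (\<lambda>x. of_real (a x)) j"
      and fb': "fc (\<lambda>x. of_real (b' x)) j = \<i> * of_int j * fc (\<lambda>x. of_real (b x)) j" for j
      using nf by (simp_all add: near_flat_def)
    have low: "l1le (jw 0) (fc (\<lambda>x. of_real (a x))) (Astar/48)" "l1le (jw 0) (fc (\<lambda>x. of_real (a' x))) (1/32)"
      "l1le (jw 0) (fc (\<lambda>x. of_real (b' x))) (1/32)"
      using nf near_flat_derivatives[OF nf] l1le_jw_mono[of 1 "fc (\<lambda>x. of_real (a x))" "Astar/48" 0] by (simp_all add: near_flat_def)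
    have high: "l1le (jw s) (fc (\<lambda>x. of_real (a x))) (C0 * p)" "l1le (jw s) (fc (\<lambda>x. of_real (a' x))) (C0 * p)"
      "l1le (jw s) (fc (\<lambda>x. of_real (b' x))) (C0 * p)"
      using C0(2)[OF _ ap, of s] l1le_derivative[of s, OF C0(2)[OF _ ap, of "s + 1"] fa']
        l1le_derivative[of s, OF C0(2)[OF _ bp, of "s + 1"] fb'] by simp_all
    have F1: "Astar + Astar/48 \<le> F" "1/32 \<le> F" "1 + 1/32 \<le> F" using Astar C0(1) by (simp_all add: F_def)
    have "C0 * p \<le> F * p" "Astar \<le> F" "1 \<le> F" using Astar C0(1) p by (auto simp: F_def intro!: mult_right_mono)
    then have F2: "Astar + C0 * p \<le> F * (1 + p)" "C0 * p \<le> F * (1 + p)" "1 + C0 * p \<le> F * (1 + p)"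
      by (simp_all add: distrib_left)
    have cab: "cper (\<lambda>x. complex_of_real (a x))" "cper (\<lambda>x. complex_of_real (b' x))"
      by (rule cper_of_real, (rule cper_a cb'))+
    have sA: "scalar s (1 + p) A F"
      using l1le_mono[OF l1le_shift[OF cab(1) low(1), of "of_real Astar"]] l1le_mono[OF l1le_shift[OF cab(1) high(1), of "of_real Astar"]]
        F1(1) F2(1) Astar cper_A l1le_jw_imp_1[of 0]
      by (simp add: scalar_def A_def)
    have sa': "scalar s (1 + p) a' F"
      using l1le_mono[OF low(2) F1(2)] l1le_mono[OF high(2) F2(2)] ca' l1le_jw_imp_1[of 0] by (simp add: scalar_def)
    have sB': "scalar s (1 + p) B' F"
      using l1le_mono[OF l1le_shift[OF cab(2) low(3), of 1]] l1le_mono[OF l1le_shift[OF cab(2) high(3), of 1]]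
        F1(3) F2(3) cper_B' l1le_jw_imp_1[of 0]
      by (simp add: scalar_def B'_def)
    have "s \<ge> 1" using s by simp
    note h = h_tame[OF dat this K(4) G \<Theta>(1,3) tame_mono[OF P K(1) G \<Theta>(4)] tame_mono[OF PA K(2) G \<Theta>(4)]
      tame_mono[OF PB K(3) G \<Theta>(4)] sA sa' sB', folded k_def, folded K1_def, folded K2_def, folded K3_def]
    have l: "l2le (jw s) (fc (\<lambda>x. of_real (Re (h1 \<gamma> x)))) (K3 * \<Theta>)" "l2le (jw s) (fc (\<lambda>x. of_real (Re (h2 \<gamma> x)))) (K3 * \<Theta>)"
      by (rule tame_Re[OF h(1,3) \<Theta>(4)] tame_Re[OF h(2,3) \<Theta>(4)])+
    have c: "cper (\<lambda>x. Re (h1 \<gamma> x))" "cper (\<lambda>x. Re (h2 \<gamma> x))"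
      by (intro cper_Re cper_parts(7,8)[OF dat])+
    show "R \<gamma> \<in> Hs s \<times> Hs s" using l2le_Hs(1)[OF c(1) l(1)] l2le_Hs(1)[OF c(2) l(2)] by (simp add: R_def)
    have n: "0 \<le> sobolev_norm s (fst (R \<gamma>))" "sobolev_norm s (fst (R \<gamma>)) \<le> K3 * \<Theta>"
      "0 \<le> sobolev_norm s (snd (R \<gamma>))" "sobolev_norm s (snd (R \<gamma>)) \<le> K3 * \<Theta>"
      using l2le_Hs[OF c(1) l(1)] l2le_Hs[OF c(2) l(2)] sobolev_norm_nonneg by (simp_all add: R_def)
    have "sobolev_norm2 s (R \<gamma>) \<le> sobolev_norm s (fst (R \<gamma>)) + sobolev_norm s (snd (R \<gamma>))"
      unfolding sobolev_norm2_def by (rule sqrt_sum_squares_le_sum[OF n(1,3)])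
    also have "\<dots> \<le> 2 * K3 * \<Theta>" using n by simp
    also have "\<dots> = 2 * \<bar>K3\<bar> / N * (sobolev_norm (s + 1/2) \<gamma> + p * sobolev_norm 3 \<gamma>)"
      using h(3) by (simp add: \<Theta>_def \<Gamma>_def G_def add_divide_distrib [symmetric])
    also have "\<dots> \<le> C * (sobolev_norm (s + 1/2) \<gamma> + p * sobolev_norm 3 \<gamma>)"
      using p sobolev_norm_nonneg[OF \<gamma>] sobolev_norm_nonneg[OF \<gamma>3] by (intro mult_right_mono) (auto simp: C_def)
    finally show "sobolev_norm2 s (R \<gamma>) \<le> C * sobolev_norm (s + 1/2) \<gamma> + C * sobolev_norm2 (s + 7/2) (a, b) * sobolev_norm 3 \<gamma>"
      by (simp add: p_def distrib_left mult.assoc)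
  qed
qed

theorem theorem1p3:
  fixes Astar :: real
  assumes "Astar > 0"
  shows "\<exists>\<delta>>0. \<exists>C :: real \<Rightarrow> real. (\<forall>s\<ge>5/2. C s > 0) \<and>
    (\<forall>p \<in> Hs 6 \<times> Hs 6. sobolev_norm2 6 p < \<delta> \<longrightarrow>
      (\<exists>R :: (real \<Rightarrow> real) \<Rightarrow> (real \<Rightarrow> real) \<times> (real \<Rightarrow> real).
         (\<forall>\<gamma> \<in> Hs0 3. \<forall>\<eta> \<in> Hs0 3. \<forall>c d. R (lincomb c \<gamma> d \<eta>) = lincomb2 c (R \<gamma>) d (R \<eta>)) \<and>
         (\<forall>\<gamma> \<in> Hs0 3. R \<gamma> \<in> Hs (5/2) \<times> Hs (5/2) \<and> dS Astar p (R \<gamma>) = \<gamma>) \<and>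
         (\<forall>s\<ge>5/2. p \<in> Hs (s + 7/2) \<times> Hs (s + 7/2) \<longrightarrow>
            (\<forall>\<gamma> \<in> Hs0 (s + 1/2).
               R \<gamma> \<in> Hs s \<times> Hs s \<and>
               sobolev_norm2 s (R \<gamma>)
                 \<le> C s * sobolev_norm (s + 1/2) \<gamma>
                   + C s * sobolev_norm2 (s + 7/2) p * sobolev_norm 3 \<gamma>))))"
proof -
  obtain cw where cw: "cw \<noteq> 0" "\<And>t. t > 0 \<Longrightarrow> of_real t * (hank t * of_real (besJ' t) - of_real (besJ t) * hank' t) = cw"
    by (rule wronskian) (rule that, assumption+)
  obtain C0 where C0: "C0 > 0" "\<And>s t w M. s + 1 \<le> t \<Longrightarrow> l2le (jw t) w M \<Longrightarrow> l1le (jw s) w (C0 * M)"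
    by (rule embedding) (rule that, assumption+)
  have "\<forall>s\<in>{5/2..}. \<exists>C>0. \<forall>a b a' b' \<gamma>. near_flat Astar a b a' b' \<longrightarrow> a \<in> Hs (s + 7/2) \<longrightarrow> b \<in> Hs (s + 7/2) \<longrightarrow> \<gamma> \<in> Hs (s + 1/2) \<longrightarrow>
    small_curve.R Astar a b a' b' cw \<gamma> \<in> Hs s \<times> Hs s \<and>
    sobolev_norm2 s (small_curve.R Astar a b a' b' cw \<gamma>)
      \<le> C * sobolev_norm (s + 1/2) \<gamma> + C * sobolev_norm2 (s + 7/2) (a, b) * sobolev_norm 3 \<gamma>"
    by (intro ballI inverse_estimate assms cw) auto
  from bchoice[OF this] obtain C where C: "\<forall>s\<in>{5/2..}. C s > 0 \<and> (\<forall>a b a' b' \<gamma>. near_flat Astar a b a' b' \<longrightarrow>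
    a \<in> Hs (s + 7/2) \<longrightarrow> b \<in> Hs (s + 7/2) \<longrightarrow> \<gamma> \<in> Hs (s + 1/2) \<longrightarrow>
    small_curve.R Astar a b a' b' cw \<gamma> \<in> Hs s \<times> Hs s \<and>
    sobolev_norm2 s (small_curve.R Astar a b a' b' cw \<gamma>)
      \<le> C s * sobolev_norm (s + 1/2) \<gamma> + C s * sobolev_norm2 (s + 7/2) (a, b) * sobolev_norm 3 \<gamma>)" ..
  define \<delta> where "\<delta> = min (1/32) (Astar/48) / C0"
  have \<delta>: "\<delta> > 0" using assms C0(1) by (simp add: \<delta>_def)
  show ?thesis
  proof (intro exI[of _ \<delta>] conjI \<delta> exI[of _ C] allI ballI impI)
    show "C s > 0" if "5/2 \<le> s" for s using C that by auto
    fix p :: "(real \<Rightarrow> real) \<times> (real \<Rightarrow> real)"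
    assume p6: "p \<in> Hs 6 \<times> Hs 6" and small: "sobolev_norm2 6 p < \<delta>"
    obtain a b where p: "p = (a, b)" by fastforce
    have ab: "a \<in> Hs 6" "b \<in> Hs 6" using p6 p by auto
    have c: "cper a" "cper b" using ab by (auto intro: Hs_cper)
    have bound: "l1le (jw 1) (fc (\<lambda>x. of_real (u x))) (min (1/32) (Astar/48))" if u: "u \<in> Hs 6" "sobolev_norm 6 u \<le> sobolev_norm2 6 p" for u
    proof (rule l1le_mono[OF C0(2)[OF _ Hs_l2le[OF u(1)]]])
      show "C0 * sobolev_norm 6 u \<le> min (1/32) (Astar/48)"
        using mult_left_mono[of "sobolev_norm 6 u" \<delta> C0] u(2) small C0(1) by (simp add: \<delta>_def)
    qed simp
    have a1: "l1le (jw 1) (fc (\<lambda>x. of_real (a x))) (min (1/32) (Astar/48))"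
      and b1: "l1le (jw 1) (fc (\<lambda>x. of_real (b x))) (min (1/32) (Astar/48))"
      by (rule bound[OF ab(1)] bound[OF ab(2)]; simp add: p sobolev_norm2_def)+
    obtain a' where a': "cper a'" "\<And>x. (a has_real_derivative a' x) (at x)"
      "\<And>k. fc (\<lambda>x. of_real (a' x)) k = \<i> * of_int k * fc (\<lambda>x. of_real (a x)) k"
      by (rule real_derivative[OF c(1) a1]) (rule that, assumption+)
    obtain b' where b': "cper b'" "\<And>x. (b has_real_derivative b' x) (at x)"
      "\<And>k. fc (\<lambda>x. of_real (b' x)) k = \<i> * of_int k * fc (\<lambda>x. of_real (b x)) k"
      by (rule real_derivative[OF c(2) b1]) (rule that, assumption+)
    have nf: "near_flat Astar a b a' b'"
      unfolding near_flat_def using a' b' c l1le_mono[OF a1] l1le_mono[OF b1] by auto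
    interpret small_curve Astar a b a' b' "1/2" cw by (rule near_flat_small_curve[OF nf assms cw])
    \<comment> \<open>with \<open>s = 5/2\<close> this also covers the mapping property of \<open>R\<close>, as \<open>5/2 + 7/2 = 6\<close> and \<open>5/2 + 1/2 = 3\<close>\<close>
    have est: "R \<gamma> \<in> Hs s \<times> Hs s \<and> sobolev_norm2 s (R \<gamma>)
        \<le> C s * sobolev_norm (s + 1/2) \<gamma> + C s * sobolev_norm2 (s + 7/2) p * sobolev_norm 3 \<gamma>"
      if "5/2 \<le> s" "p \<in> Hs (s + 7/2) \<times> Hs (s + 7/2)" "\<gamma> \<in> Hs (s + 1/2)" for s \<gamma>
      using C nf that unfolding p by auto
    have mem: "R \<gamma> \<in> Hs (5/2) \<times> Hs (5/2)" if "\<gamma> \<in> Hs 3" for \<gamma>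
      using est[of "5/2" \<gamma>] p6 that by simp
    have dat: "data \<gamma>" if "\<gamma> \<in> Hs 3" for \<gamma>
      using Hs_cper[OF that] C0(2)[OF _ Hs_l2le[OF that], of "3/2"] by (auto simp: data_def)
    have deriv: "\<exists>d. cper d \<and> (\<forall>x. (u has_real_derivative d x) (at x))" if "u \<in> Hs (5/2)" for u
    proof -
      have "l1le (jw 1) (fc (\<lambda>x. of_real (u x))) (C0 * sobolev_norm (5/2) u)"
        by (rule C0(2)[OF _ Hs_l2le[OF that]]) simp
      then show ?thesis by (rule real_derivative[OF Hs_cper[OF that]]) blast
    qed
    have inv: "dS Astar p (R \<gamma>) = \<gamma>" if \<gamma>: "\<gamma> \<in> Hs0 3" for \<gamma>
    proof -
      have \<gamma>': "\<gamma> \<in> Hs 3" "integral {0..2*pi} \<gamma> = 0" using \<gamma> by (auto simp: Hs0_def)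
      have "(\<lambda>x. Re (h1 \<gamma> x)) \<in> Hs (5/2)" "(\<lambda>x. Re (h2 \<gamma> x)) \<in> Hs (5/2)" using mem[OF \<gamma>'(1)] by (auto simp: R_def)
      from deriv[OF this(1)] deriv[OF this(2)] obtain d1 d2 where
        d1: "cper d1" "\<And>x. ((\<lambda>x. Re (h1 \<gamma> x)) has_real_derivative d1 x) (at x)" and
        d2: "cper d2" "\<And>x. ((\<lambda>x. Re (h2 \<gamma> x)) has_real_derivative d2 x) (at x)"
        by blast
      show ?thesis unfolding p by (rule dS_R[OF dat[OF \<gamma>'(1)] \<gamma>'(2) d1(2,1) d2(2,1)])
    qed
    show "\<exists>R. (\<forall>\<gamma> \<in> Hs0 3. \<forall>\<eta> \<in> Hs0 3. \<forall>c d. R (lincomb c \<gamma> d \<eta>) = lincomb2 c (R \<gamma>) d (R \<eta>)) \<and>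
         (\<forall>\<gamma> \<in> Hs0 3. R \<gamma> \<in> Hs (5/2) \<times> Hs (5/2) \<and> dS Astar p (R \<gamma>) = \<gamma>) \<and>
         (\<forall>s\<ge>5/2. p \<in> Hs (s + 7/2) \<times> Hs (s + 7/2) \<longrightarrow>
            (\<forall>\<gamma> \<in> Hs0 (s + 1/2).
               R \<gamma> \<in> Hs s \<times> Hs s \<and>
               sobolev_norm2 s (R \<gamma>)
                 \<le> C s * sobolev_norm (s + 1/2) \<gamma>
                   + C s * sobolev_norm2 (s + 7/2) p * sobolev_norm 3 \<gamma>))"
      by (rule exI[of _ R]) (use R_linear dat mem inv est in \<open>auto simp: Hs0_def\<close>)
  qed
qed

end
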